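(* Let $\Lambda$ be an artin algebra. Let $\mathcal R$ be the full subcategory of $\Lambda\text{-mod}$ consisting of reflexive $\Lambda$-modules, let $\mathcal Y:={}^{\perp_1}(\Lambda\oplus K_1)$, and let $\mathcal W:={}^{\perp_1}(\Lambda\oplus L_{-1})$. Then $\mho$ and $\Omega$ induce mutually quasi-inverse equivalences $$\mho:\mathcal R/\mathcal P\rightleftarrows \mathcal Y/\mathcal P:\Omega \qquad\text{and}\qquad \mho:\mathcal Y/\mathcal P\rightleftarrows\mathcal W/\mathcal P:\Omega .$$
   Context: $\Lambda$ is an artin algebra over a commutative artin ring $R$. "Module" means finitely generated left $\Lambda$-module; their category is $\Lambda\text{-mod}$. $D$ is the canonical duality between $\Lambda\text{-mod}$ and $\Lambda^{\mathrm{op}}\text{-mod}$. $\mathcal P$ is the full subcategory of projective modules. $\Omega M$ is the kernel of a projective cover $P\to M$. A left $\mathcal P$-approximation of $M$ is a morphism $f:M\to Q$ with $Q\in\mathcal P$ such that every morphism from $M$ to a projective module factors through $f$; it is minimal if every $t:Q\to Q$ with $tf=f$ is an automorphism. Every $M$ has a minimal left $\mathcal P$-approximation $f:M\to Q$, and $\mho M:=\operatorname{Coker} f$. Both $\Omega$ and $\mho$ are regarded as functors on the stable category $\Lambda\text{-}\underline{\mathrm{mod}}=\Lambda\text{-mod}/\mathcal P$ (the additive quotient by the ideal of morphisms factoring through projective modules). For a full subcategory $\mathcal C\supseteq\mathcal P$ of $\Lambda\text{-mod}$, $\mathcal C/\mathcal P$ is the corresponding full subcategory of $\Lambda\text{-}\underline{\mathrm{mod}}$.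 A module $M$ is reflexive if it is $2$-torsionfree, i.e. $\operatorname{Ext}^i_{\Lambda^{\mathrm{op}}}(\operatorname{Tr}M,\Lambda)=0$ for $i=1,2$, where $\operatorname{Tr}$ is the Auslander transpose. $K_1$ is the first syzygy $\Omega(D(\Lambda_\Lambda))$, i.e. the kernel of a projective cover $P_0\to D(\Lambda_\Lambda)$ of left modules. $L_{-1}$ is the first cosyzygy of ${}_\Lambda\Lambda$, i.e. the cokernel of an injective envelope ${}_\Lambda\Lambda\to I_0$. For a module $X$, ${}^{\perp_1}X$ is the full subcategory $\{Z\in\Lambda\text{-mod}\mid \operatorname{Ext}^1_\Lambda(Z,X)=0\}$. *)

theory Defs
  imports "HOL-Algebra.Module" "HOL-Algebra.Ideal"
begin

section \<open>Left modules over a possibly noncommutative ring\<close>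

text \<open>The locale \<open>module\<close> of HOL-Algebra requires a commutative ring of scalars. We keep
  its record type and drop commutativity. The fields \<open>mult\<close> and \<open>one\<close> of the record carry
  no information when the record is used as a module.\<close>

locale left_module = A?: ring A + M?: abelian_group M
    for A :: "('a, 'x) ring_scheme" (structure) and M :: "('a, 'm, 'z) module_scheme" (structure) +
  assumes smult_closed [simp, intro]:
      "\<lbrakk>a \<in> carrier A; x \<in> carrier M\<rbrakk> \<Longrightarrow> a \<odot>\<^bsub>M\<^esub> x \<in> carrier M"
    and smult_l_distr:
      "\<lbrakk>a \<in> carrier A; b \<in> carrier A; x \<in> carrier M\<rbrakk> \<Longrightarrow>
        (a \<oplus>\<^bsub>A\<^esub> b) \<odot>\<^bsub>M\<^esub> x = a \<odot>\<^bsub>M\<^esub> x \<oplus>\<^bsub>M\<^esub> b \<odot>\<^bsub>M\<^esub> x"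
    and smult_r_distr:
      "\<lbrakk>a \<in> carrier A; x \<in> carrier M; y \<in> carrier M\<rbrakk> \<Longrightarrow>
        a \<odot>\<^bsub>M\<^esub> (x \<oplus>\<^bsub>M\<^esub> y) = a \<odot>\<^bsub>M\<^esub> x \<oplus>\<^bsub>M\<^esub> a \<odot>\<^bsub>M\<^esub> y"
    and smult_assoc:
      "\<lbrakk>a \<in> carrier A; b \<in> carrier A; x \<in> carrier M\<rbrakk> \<Longrightarrow>
        (a \<otimes>\<^bsub>A\<^esub> b) \<odot>\<^bsub>M\<^esub> x = a \<odot>\<^bsub>M\<^esub> (b \<odot>\<^bsub>M\<^esub> x)"
    and smult_one [simp]:
      "x \<in> carrier M \<Longrightarrow> \<one>\<^bsub>A\<^esub> \<odot>\<^bsub>M\<^esub> x = x"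

definition finitely_generated :: "('a, 'x) ring_scheme \<Rightarrow> ('a, 'm) module \<Rightarrow> bool" where
  "finitely_generated A M \<longleftrightarrow>
     (\<exists>S. finite S \<and> S \<subseteq> carrier M \<and> (\<forall>N. submodule N A M \<and> S \<subseteq> N \<longrightarrow> N = carrier M))"

text \<open>Module homomorphisms are extensional functions, so that equality of functions is equality
  of morphisms.\<close>

definition lhom ::
    "('a, 'x) ring_scheme \<Rightarrow> ('a, 'm) module \<Rightarrow> ('a, 'n) module \<Rightarrow> ('m \<Rightarrow> 'n) set" where
  "lhom A M N = {f \<in> carrier M \<rightarrow>\<^sub>E carrier N.
     (\<forall>x\<in>carrier M. \<forall>y\<in>carrier M. f (x \<oplus>\<^bsub>M\<^esub> y) = f x \<oplus>\<^bsub>N\<^esub> f y) \<and>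
     (\<forall>a\<in>carrier A. \<forall>x\<in>carrier M. f (a \<odot>\<^bsub>M\<^esub> x) = a \<odot>\<^bsub>N\<^esub> f x)}"

text \<open>A module on \<open>n\<close> generators is a quotient of the free module of rank \<open>n\<close>, whose elements
  are functions \<open>nat \<Rightarrow> 'a\<close>; the elements of the quotient are sets of such functions. So up to
  isomorphism every finitely generated module over a ring with elements in \<open>'a\<close> has a carrier
  of type \<open>'a univ\<close> (proved as \<open>fg_modules_dense\<close> below), and the modules on this type form a
  model of the category of all finitely generated left modules.\<close>

type_synonym 'a univ = "(nat \<Rightarrow> 'a) set"
type_synonym 'a umod = "('a, 'a univ) module"

definition fg_modules :: "('a, 'x) ring_scheme \<Rightarrow> 'a umod set" where
  "fg_modules A = {M. left_module A M \<and> finitely_generated A M}"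

lemma (in left_module) smult_r_null:
  assumes "a \<in> carrier A" shows "a \<odot>\<^bsub>M\<^esub> \<zero>\<^bsub>M\<^esub> = \<zero>\<^bsub>M\<^esub>"
proof -
  have "a \<odot>\<^bsub>M\<^esub> \<zero>\<^bsub>M\<^esub> \<oplus>\<^bsub>M\<^esub> a \<odot>\<^bsub>M\<^esub> \<zero>\<^bsub>M\<^esub> = a \<odot>\<^bsub>M\<^esub> \<zero>\<^bsub>M\<^esub>"
    using smult_r_distr[of a "\<zero>\<^bsub>M\<^esub>" "\<zero>\<^bsub>M\<^esub>"] assms by simp
  then show ?thesis using assms by (metis M.add.l_cancel_one' M.zero_closed smult_closed)
qed

lemma (in left_module) smult_l_null:
  assumes "x \<in> carrier M" shows "\<zero>\<^bsub>A\<^esub> \<odot>\<^bsub>M\<^esub> x = \<zero>\<^bsub>M\<^esub>"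
proof -
  have "\<zero>\<^bsub>A\<^esub> \<odot>\<^bsub>M\<^esub> x \<oplus>\<^bsub>M\<^esub> \<zero>\<^bsub>A\<^esub> \<odot>\<^bsub>M\<^esub> x = \<zero>\<^bsub>A\<^esub> \<odot>\<^bsub>M\<^esub> x"
    using smult_l_distr[of "\<zero>\<^bsub>A\<^esub>" "\<zero>\<^bsub>A\<^esub>" x] assms by simp
  then show ?thesis using assms by (metis A.zero_closed M.add.l_cancel_one' smult_closed)
qed

lemma (in left_module) smult_l_minus:
  assumes "a \<in> carrier A" "x \<in> carrier M"
  shows "(\<ominus>\<^bsub>A\<^esub> a) \<odot>\<^bsub>M\<^esub> x = \<ominus>\<^bsub>M\<^esub> (a \<odot>\<^bsub>M\<^esub> x)"
proof -
  have "(\<ominus>\<^bsub>A\<^esub> a) \<odot>\<^bsub>M\<^esub> x \<oplus>\<^bsub>M\<^esub> a \<odot>\<^bsub>M\<^esub> x = \<zero>\<^bsub>M\<^esub>"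
    using smult_l_distr[of "\<ominus>\<^bsub>A\<^esub> a" a x] assms by (simp add: A.l_neg smult_l_null)
  then show ?thesis using assms by (metis A.a_inv_closed M.minus_equality smult_closed)
qed

lemma (in left_module) submodule_criterion:
  assumes sub: "U \<subseteq> carrier M" and zero: "\<zero>\<^bsub>M\<^esub> \<in> U"
    and add: "\<And>x y. x \<in> U \<Longrightarrow> y \<in> U \<Longrightarrow> x \<oplus>\<^bsub>M\<^esub> y \<in> U"
    and sm: "\<And>a x. a \<in> carrier A \<Longrightarrow> x \<in> U \<Longrightarrow> a \<odot>\<^bsub>M\<^esub> x \<in> U"
  shows "submodule U A M"
proof (intro submodule.intro submodule_axioms.intro subgroup.intro)
  fix x assume x: "x \<in> U"
  then have "\<ominus>\<^bsub>M\<^esub> x = (\<ominus>\<^bsub>A\<^esub> \<one>\<^bsub>A\<^esub>) \<odot>\<^bsub>M\<^esub> x"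
    using sub by (subst smult_l_minus) auto
  also have "\<dots> \<in> U" by (rule sm[OF _ x]) simp
  finally show "inv\<^bsub>add_monoid M\<^esub> x \<in> U" by (simp only: a_inv_def)
qed (simp_all add: sub zero add sm)

lemma transport_module:
  fixes A :: "('a, 'x) ring_scheme" and M :: "('a, 'm) module" and j :: "'m \<Rightarrow> 'n"
  assumes M: "left_module A M" and fg: "finitely_generated A M" and j: "inj_on j (carrier M)"
  shows "\<exists>N :: ('a, 'n) module. left_module A N \<and> finitely_generated A N \<and>
    (\<exists>f\<in>lhom A M N. bij_betw f (carrier M) (carrier N))"
proof -
  interpret left_module A M by fact
  define i where "i = the_inv_into (carrier M) j"
  have ij [simp]: "i (j x) = x" if "x \<in> carrier M" for x
    using that j by (simp add: i_def the_inv_into_f_f)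
  define N :: "('a, 'n) module" where "N = \<lparr>carrier = j ` carrier M, mult = undefined,
    one = undefined, zero = j \<zero>\<^bsub>M\<^esub>, add = (\<lambda>x y. j (i x \<oplus>\<^bsub>M\<^esub> i y)),
    smult = (\<lambda>a x. j (a \<odot>\<^bsub>M\<^esub> i x))\<rparr>"
  have Ns [simp]: "carrier N = j ` carrier M" "\<zero>\<^bsub>N\<^esub> = j \<zero>\<^bsub>M\<^esub>"
    "x \<oplus>\<^bsub>N\<^esub> y = j (i x \<oplus>\<^bsub>M\<^esub> i y)" "a \<odot>\<^bsub>N\<^esub> x = j (a \<odot>\<^bsub>M\<^esub> i x)" for x y a
    by (simp_all add: N_def)
  have N_ab: "abelian_group N"
  proof (rule abelian_groupI)
    fix x assume "x \<in> carrier N"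
    then obtain u where "u \<in> carrier M" "x = j u" by auto
    then show "\<exists>y\<in>carrier N. y \<oplus>\<^bsub>N\<^esub> x = \<zero>\<^bsub>N\<^esub>"
      by (intro bexI[of _ "j (\<ominus>\<^bsub>M\<^esub> u)"]) (simp_all add: M.l_neg)
  next
    fix x y assume "x \<in> carrier N" "y \<in> carrier N"
    then show "x \<oplus>\<^bsub>N\<^esub> y \<in> carrier N" by (simp, elim imageE, simp)
  next
    fix x y assume "x \<in> carrier N" "y \<in> carrier N"
    then show "x \<oplus>\<^bsub>N\<^esub> y = y \<oplus>\<^bsub>N\<^esub> x" by (simp, elim imageE, simp add: M.a_comm)
  next
    fix x y z assume "x \<in> carrier N" "y \<in> carrier N" "z \<in> carrier N"
    then show "x \<oplus>\<^bsub>N\<^esub> y \<oplus>\<^bsub>N\<^esub> z = x \<oplus>\<^bsub>N\<^esub> (y \<oplus>\<^bsub>N\<^esub> z)"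
      by (simp, elim imageE, simp add: M.a_assoc)
  next
    fix x assume "x \<in> carrier N"
    then show "\<zero>\<^bsub>N\<^esub> \<oplus>\<^bsub>N\<^esub> x = x" by (simp, elim imageE, simp)
  qed simp
  have N_mod: "left_module A N"
  proof (rule left_module.intro[OF A.ring_axioms N_ab], rule left_module_axioms.intro)
    fix a x assume "a \<in> carrier A" "x \<in> carrier N"
    then show "a \<odot>\<^bsub>N\<^esub> x \<in> carrier N" by (simp only: Ns, elim imageE, simp only: ij  M.a_closed smult_closed A.a_closed A.m_closed A.one_closed imageI)
  next
    fix a b x assume "a \<in> carrier A" "b \<in> carrier A" "x \<in> carrier N"
    then show "(a \<oplus>\<^bsub>A\<^esub> b) \<odot>\<^bsub>N\<^esub> x = a \<odot>\<^bsub>N\<^esub> x \<oplus>\<^bsub>N\<^esub> b \<odot>\<^bsub>N\<^esub> x" by (simp only: Ns, elim imageE, simp only: ij smult_l_distr M.a_closed smult_closed A.a_closed A.m_closed A.one_closed imageI)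
  next
    fix a x y assume "a \<in> carrier A" "x \<in> carrier N" "y \<in> carrier N"
    then show "a \<odot>\<^bsub>N\<^esub> (x \<oplus>\<^bsub>N\<^esub> y) = a \<odot>\<^bsub>N\<^esub> x \<oplus>\<^bsub>N\<^esub> a \<odot>\<^bsub>N\<^esub> y" by (simp only: Ns, elim imageE, simp only: ij smult_r_distr M.a_closed smult_closed A.a_closed A.m_closed A.one_closed imageI)
  next
    fix a b x assume "a \<in> carrier A" "b \<in> carrier A" "x \<in> carrier N"
    then show "(a \<otimes>\<^bsub>A\<^esub> b) \<odot>\<^bsub>N\<^esub> x = a \<odot>\<^bsub>N\<^esub> (b \<odot>\<^bsub>N\<^esub> x)" by (simp only: Ns, elim imageE, simp only: ij smult_assoc M.a_closed smult_closed A.a_closed A.m_closed A.one_closed imageI)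
  next
    fix x assume "x \<in> carrier N"
    then show "\<one>\<^bsub>A\<^esub> \<odot>\<^bsub>N\<^esub> x = x" by (simp only: Ns, elim imageE, simp only: ij smult_one M.a_closed smult_closed A.a_closed A.m_closed A.one_closed imageI)
  qed
  obtain S where S: "finite S" "S \<subseteq> carrier M"
    and gen: "\<And>T. submodule T A M \<Longrightarrow> S \<subseteq> T \<Longrightarrow> T = carrier M"
    using fg unfolding finitely_generated_def by (elim exE conjE) simp
  have "finitely_generated A N" unfolding finitely_generated_def
  proof (intro exI[of _ "j ` S"] conjI allI impI)
    fix T assume T: "submodule T A N \<and> j ` S \<subseteq> T"
    then have sT: "submodule T A N" and jS: "j ` S \<subseteq> T" by simp_all
    note Tg = submodule.axioms(1)[OF sT]
    have Tc: "T \<subseteq> j ` carrier M" using subgroup.subset[OF Tg] by simp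
    define U where "U = {x \<in> carrier M. j x \<in> T}"
    have add: "x \<oplus>\<^bsub>M\<^esub> y \<in> U" if "x \<in> U" "y \<in> U" for x y
      using that subgroup.m_closed[OF Tg, of "j x" "j y"] by (simp add: U_def)
    have sm: "a \<odot>\<^bsub>M\<^esub> x \<in> U" if "a \<in> carrier A" "x \<in> U" for a x
      using that submodule.smult_closed[OF sT, of a "j x"] by (simp add: U_def)
    have zero: "\<zero>\<^bsub>M\<^esub> \<in> U" using subgroup.one_closed[OF Tg] by (simp add: U_def)
    have "submodule U A M"
      by (rule submodule_criterion) (use zero add sm in \<open>simp_all add: U_def\<close>)
    moreover have "S \<subseteq> U" using S jS by (auto simp: U_def)
    ultimately have "U = carrier M" by (rule gen)
    then show "T = carrier N" using Tc by (auto simp: U_def)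
  qed (use S in \<open>simp_all add: image_mono\<close>)
  moreover have "restrict j (carrier M) \<in> lhom A M N"
    by (simp add: lhom_def)
  moreover have "bij_betw (restrict j (carrier M)) (carrier M) (carrier N)"
    using j by (simp add: bij_betw_def)
  ultimately show ?thesis
    by (intro exI[of _ N] conjI N_mod bexI[of _ "restrict j (carrier M)"])
qed

lemma fg_modules_dense:
  fixes A :: "('a, 'x) ring_scheme" and M :: "('a, 'm) module"
  assumes M: "left_module A M" and fg: "finitely_generated A M"
  shows "\<exists>N\<in>fg_modules A. \<exists>f\<in>lhom A M N. bij_betw f (carrier M) (carrier N)"
proof -
  interpret left_module A M by fact
  obtain S where S: "finite S" "S \<subseteq> carrier M"
    and gen: "\<And>T. submodule T A M \<Longrightarrow> S \<subseteq> T \<Longrightarrow> T = carrier M"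
    using fg unfolding finitely_generated_def by (elim exE conjE) simp
  obtain s where s: "bij_betw s {0..<card S} S"
    using ex_bij_betw_nat_finite[OF S(1)] by blast
  define n where "n = card S"
  have sc [simp]: "s k \<in> carrier M" if "k < n" for k
    using s S that by (auto simp: bij_betw_def n_def)
  define comb where "comb c = finsum M (\<lambda>k. c k \<odot>\<^bsub>M\<^esub> s k) {..<n}" for c :: "nat \<Rightarrow> 'a"
  define j where "j m = {c. (\<forall>k<n. c k \<in> carrier A) \<and> comb c = m}" for m
  define T where "T = {m \<in> carrier M. j m \<noteq> {}}"
  have cl [simp]: "comb c \<in> carrier M" if "\<forall>k<n. c k \<in> carrier A" for c
    unfolding comb_def by (rule M.finsum_closed) (use that in auto)
  have T_comb: "T = {comb c | c. \<forall>k<n. c k \<in> carrier A}"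
    by (auto simp: T_def j_def)
  have add: "x \<oplus>\<^bsub>M\<^esub> y \<in> T" if xy: "x \<in> T" "y \<in> T" for x y
  proof -
    obtain c d where cd: "\<forall>k<n. c k \<in> carrier A" "x = comb c" "\<forall>k<n. d k \<in> carrier A" "y = comb d"
      using xy unfolding T_comb by blast
    have "x \<oplus>\<^bsub>M\<^esub> y = finsum M (\<lambda>k. c k \<odot>\<^bsub>M\<^esub> s k \<oplus>\<^bsub>M\<^esub> d k \<odot>\<^bsub>M\<^esub> s k) {..<n}"
      unfolding cd comb_def by (rule M.finsum_addf[symmetric]) (use cd in auto)
    also have "\<dots> = comb (\<lambda>k. c k \<oplus>\<^bsub>A\<^esub> d k)"
      unfolding comb_def by (rule M.finsum_cong') (use cd in \<open>auto simp: smult_l_distr\<close>)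
    finally show ?thesis using cd unfolding T_comb by auto
  qed
  have sm: "a \<odot>\<^bsub>M\<^esub> x \<in> T" if a: "a \<in> carrier A" and x: "x \<in> T" for a x
  proof -
    obtain c where c: "\<forall>k<n. c k \<in> carrier A" "x = comb c"
      using x unfolding T_comb by blast
    have "a \<odot>\<^bsub>M\<^esub> finsum M (\<lambda>k. c k \<odot>\<^bsub>M\<^esub> s k) {..<l}
        = finsum M (\<lambda>k. (a \<otimes>\<^bsub>A\<^esub> c k) \<odot>\<^bsub>M\<^esub> s k) {..<l}" if "l \<le> n" for l
      using that
    proof (induction l)
      case 0
      then show ?case using a by (simp add: smult_r_null)
    next
      case (Suc l)
      have fc: "finsum M (\<lambda>k. c k \<odot>\<^bsub>M\<^esub> s k) {..<l} \<in> carrier M"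
        by (rule M.finsum_closed) (use Suc c in auto)
      have e1: "finsum M (\<lambda>k. c k \<odot>\<^bsub>M\<^esub> s k) {..<Suc l}
          = c l \<odot>\<^bsub>M\<^esub> s l \<oplus>\<^bsub>M\<^esub> finsum M (\<lambda>k. c k \<odot>\<^bsub>M\<^esub> s k) {..<l}"
        unfolding lessThan_Suc by (rule M.finsum_insert) (use Suc c in auto)
      have e2: "finsum M (\<lambda>k. (a \<otimes>\<^bsub>A\<^esub> c k) \<odot>\<^bsub>M\<^esub> s k) {..<Suc l}
          = (a \<otimes>\<^bsub>A\<^esub> c l) \<odot>\<^bsub>M\<^esub> s l \<oplus>\<^bsub>M\<^esub> finsum M (\<lambda>k. (a \<otimes>\<^bsub>A\<^esub> c k) \<odot>\<^bsub>M\<^esub> s k) {..<l}"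
        unfolding lessThan_Suc by (rule M.finsum_insert) (use Suc c a in auto)
      have "c l \<odot>\<^bsub>M\<^esub> s l \<in> carrier M" using Suc c by auto
      then show ?case using e1 e2 fc Suc c a by (simp add: smult_r_distr smult_assoc)
    qed
    from this[of n] have "a \<odot>\<^bsub>M\<^esub> x = comb (\<lambda>k. a \<otimes>\<^bsub>A\<^esub> c k)"
      using c by (simp add: comb_def)
    then show ?thesis using a c unfolding T_comb by auto
  qed
  have unit: "s k \<in> T" if k: "k < n" for k
  proof -
    define c where "c = (\<lambda>l. if l = k then \<one>\<^bsub>A\<^esub> else \<zero>\<^bsub>A\<^esub>)"
    have "comb c = finsum M (\<lambda>l. if k = l then s l else \<zero>\<^bsub>M\<^esub>) {..<n}"
      unfolding comb_def c_def
      by (rule M.finsum_cong') (auto simp: smult_l_null)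
    also have "\<dots> = s k"
      by (rule M.finsum_singleton) (use k in auto)
    finally have "s k = comb c" ..
    then show ?thesis unfolding T_comb by (auto simp: c_def)
  qed
  have zero: "\<zero>\<^bsub>M\<^esub> \<in> T"
  proof -
    have "comb (\<lambda>_. \<zero>\<^bsub>A\<^esub>) = finsum M (\<lambda>_. \<zero>\<^bsub>M\<^esub>) {..<n}"
      unfolding comb_def by (rule M.finsum_cong') (auto simp: smult_l_null)
    then have "\<zero>\<^bsub>M\<^esub> = comb (\<lambda>_. \<zero>\<^bsub>A\<^esub>)" by simp
    then show ?thesis unfolding T_comb by auto
  qed
  have "submodule T A M"
    by (rule submodule_criterion) (use zero add sm in \<open>auto simp: T_def\<close>)
  moreover have "S \<subseteq> T"
    using s unit unfolding bij_betw_def n_def by (metis atLeastLessThan_iff imageE subsetI)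
  ultimately have "T = carrier M" by (rule gen)
  then have ne: "j x \<noteq> {}" if "x \<in> carrier M" for x
    using that by (auto simp: T_def)
  have "inj_on j (carrier M)"
  proof (rule inj_onI)
    fix x y assume "x \<in> carrier M" "j x = j y"
    then obtain c where "c \<in> j x" "c \<in> j y" using ne by blast
    then show "x = y" by (simp add: j_def)
  qed
  from transport_module[OF M fg this] show ?thesis
    unfolding fg_modules_def by blast
qed

definition regular :: "('a, 'x) ring_scheme \<Rightarrow> ('a, 'a) module" where
  "regular A = \<lparr>carrier = carrier A, mult = undefined, one = undefined,
     zero = \<zero>\<^bsub>A\<^esub>, add = (\<oplus>\<^bsub>A\<^esub>), smult = (\<otimes>\<^bsub>A\<^esub>)\<rparr>"

definition opp :: "('a, 'x) ring_scheme \<Rightarrow> ('a, 'x) ring_scheme" where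
  "opp A = A\<lparr>mult := \<lambda>x y. y \<otimes>\<^bsub>A\<^esub> x\<rparr>"

definition submod :: "('a, 'm) module \<Rightarrow> 'm set \<Rightarrow> ('a, 'm) module" where
  "submod M N = M\<lparr>carrier := N\<rparr>"

text \<open>In the quotient, \<open>a \<odot> X\<close> is the union of the cosets of \<open>a \<odot> x\<close> for \<open>x \<in> X\<close>, all of which
  coincide.\<close>

definition quot_mod :: "('a, 'm) module \<Rightarrow> 'm set \<Rightarrow> ('a, 'm set) module" where
  "quot_mod M N = \<lparr>carrier = a_rcosets\<^bsub>M\<^esub> N, mult = undefined, one = undefined,
     zero = N, add = (<+>\<^bsub>M\<^esub>), smult = (\<lambda>a X. \<Union>x\<in>X. N +>\<^bsub>M\<^esub> (a \<odot>\<^bsub>M\<^esub> x))\<rparr>"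

definition dsum :: "('a, 'm) module \<Rightarrow> ('a, 'n) module \<Rightarrow> ('a, 'm \<times> 'n) module" where
  "dsum M N = \<lparr>carrier = carrier M \<times> carrier N, mult = undefined, one = undefined,
     zero = (\<zero>\<^bsub>M\<^esub>, \<zero>\<^bsub>N\<^esub>),
     add = (\<lambda>(x, y) (x', y'). (x \<oplus>\<^bsub>M\<^esub> x', y \<oplus>\<^bsub>N\<^esub> y')),
     smult = (\<lambda>a (x, y). (a \<odot>\<^bsub>M\<^esub> x, a \<odot>\<^bsub>N\<^esub> y))\<rparr>"


section \<open>Artin algebras\<close>

definition artinian :: "('r, 'x) ring_scheme \<Rightarrow> bool" where
  "artinian R \<longleftrightarrow> (\<forall>I :: nat \<Rightarrow> 'r set.
     (\<forall>n. ideal (I n) R \<and> I (Suc n) \<subseteq> I n) \<longrightarrow> (\<exists>m. \<forall>n\<ge>m. I n = I m))"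

text \<open>One record holds both the ring structure of the algebra and its \<open>R\<close>-module structure.
  The locale \<open>algebra\<close> of HOL-Algebra is not used because it requires commutativity.\<close>

definition artin_algebra :: "'r ring \<Rightarrow> ('r, 'a) module \<Rightarrow> bool" where
  "artin_algebra R A \<longleftrightarrow> cring R \<and> artinian R \<and> ring A \<and> module R A \<and>
     (\<forall>r\<in>carrier R. \<forall>x\<in>carrier A. \<forall>y\<in>carrier A.
        (r \<odot>\<^bsub>A\<^esub> x) \<otimes>\<^bsub>A\<^esub> y = r \<odot>\<^bsub>A\<^esub> (x \<otimes>\<^bsub>A\<^esub> y) \<and> x \<otimes>\<^bsub>A\<^esub> (r \<odot>\<^bsub>A\<^esub> y) = r \<odot>\<^bsub>A\<^esub> (x \<otimes>\<^bsub>A\<^esub> y)) \<and>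
     finitely_generated R A"


section \<open>Projective covers, injective envelopes, approximations\<close>

definition proj_modules :: "('a, 'x) ring_scheme \<Rightarrow> 'a umod set" where
  "proj_modules A = {P \<in> fg_modules A. \<forall>X\<in>fg_modules A. \<forall>Y\<in>fg_modules A.
     \<forall>g\<in>lhom A X Y. \<forall>f\<in>lhom A P Y. g ` carrier X = carrier Y \<longrightarrow>
       (\<exists>h\<in>lhom A P X. \<forall>x\<in>carrier P. g (h x) = f x)}"

definition inj_modules :: "('a, 'x) ring_scheme \<Rightarrow> 'a umod set" where
  "inj_modules A = {I \<in> fg_modules A. \<forall>X\<in>fg_modules A. \<forall>Y\<in>fg_modules A.
     \<forall>g\<in>lhom A X Y. \<forall>f\<in>lhom A X I. inj_on g (carrier X) \<longrightarrow>
       (\<exists>h\<in>lhom A Y I. \<forall>x\<in>carrier X. h (g x) = f x)}"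

definition projective_cover ::
    "('a, 'x) ring_scheme \<Rightarrow> ('a, 'm) module \<Rightarrow> 'a umod \<Rightarrow> ('a univ \<Rightarrow> 'm) \<Rightarrow> bool" where
  "projective_cover A M P p \<longleftrightarrow> P \<in> proj_modules A \<and> p \<in> lhom A P M \<and>
     p ` carrier P = carrier M \<and>
     (\<forall>N. submodule N A P \<and> p ` N = carrier M \<longrightarrow> N = carrier P)"

definition injective_envelope ::
    "('a, 'x) ring_scheme \<Rightarrow> ('a, 'm) module \<Rightarrow> 'a umod \<Rightarrow> ('m \<Rightarrow> 'a univ) \<Rightarrow> bool" where
  "injective_envelope A M I j \<longleftrightarrow> I \<in> inj_modules A \<and> j \<in> lhom A M I \<and>
     inj_on j (carrier M) \<and>
     (\<forall>N. submodule N A I \<and> N \<inter> j ` carrier M = {\<zero>\<^bsub>I\<^esub>} \<longrightarrow> N = {\<zero>\<^bsub>I\<^esub>})"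

definition left_proj_approx ::
    "('a, 'x) ring_scheme \<Rightarrow> 'a umod \<Rightarrow> 'a umod \<Rightarrow> ('a univ \<Rightarrow> 'a univ) \<Rightarrow> bool" where
  "left_proj_approx A M Q f \<longleftrightarrow> Q \<in> proj_modules A \<and> f \<in> lhom A M Q \<and>
     (\<forall>Q'\<in>proj_modules A. \<forall>g\<in>lhom A M Q'.
        \<exists>h\<in>lhom A Q Q'. \<forall>x\<in>carrier M. g x = h (f x))"

definition minimal_left_proj_approx ::
    "('a, 'x) ring_scheme \<Rightarrow> 'a umod \<Rightarrow> 'a umod \<Rightarrow> ('a univ \<Rightarrow> 'a univ) \<Rightarrow> bool" where
  "minimal_left_proj_approx A M Q f \<longleftrightarrow> left_proj_approx A M Q f \<and>
     (\<forall>t\<in>lhom A Q Q. (\<forall>x\<in>carrier M. t (f x) = f x) \<longrightarrow> bij_betw t (carrier Q) (carrier Q))"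

text \<open>Up to isomorphism \<open>C\<close> is \<open>quot_mod Q (f ` carrier M)\<close>; the quotient itself has a carrier of
  a larger type, so that it is not literally an object of \<open>fg_modules A\<close>.\<close>

definition is_cokernel ::
    "('a, 'x) ring_scheme \<Rightarrow> 'a umod \<Rightarrow> 'a umod \<Rightarrow> ('a univ \<Rightarrow> 'a univ) \<Rightarrow>
     'a umod \<Rightarrow> ('a univ \<Rightarrow> 'a univ) \<Rightarrow> bool" where
  "is_cokernel A M Q f C q \<longleftrightarrow> C \<in> fg_modules A \<and> q \<in> lhom A Q C \<and>
     q ` carrier Q = carrier C \<and> a_kernel Q C q = f ` carrier M"


section \<open>Ext, transpose, duality\<close>

definition projective_resolution ::
    "('a, 'x) ring_scheme \<Rightarrow> ('a, 'm) module \<Rightarrow> (nat \<Rightarrow> 'a umod) \<Rightarrow>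
     (nat \<Rightarrow> 'a univ \<Rightarrow> 'a univ) \<Rightarrow> ('a univ \<Rightarrow> 'm) \<Rightarrow> bool" where
  "projective_resolution A M P d e \<longleftrightarrow>
     (\<forall>n. P n \<in> proj_modules A) \<and> (\<forall>n. d n \<in> lhom A (P (Suc n)) (P n)) \<and>
     e \<in> lhom A (P 0) M \<and> e ` carrier (P 0) = carrier M \<and>
     a_kernel (P 0) M e = d 0 ` carrier (P 1) \<and>
     (\<forall>n. a_kernel (P (Suc n)) (P n) (d n) = d (Suc n) ` carrier (P (Suc (Suc n))))"

definition hom_group ::
    "('a, 'x) ring_scheme \<Rightarrow> ('a, 'm) module \<Rightarrow> ('a, 'n) module \<Rightarrow> ('m \<Rightarrow> 'n) monoid" where
  "hom_group A M N = \<lparr>carrier = lhom A M N,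
     mult = (\<lambda>f g. \<lambda>x\<in>carrier M. f x \<oplus>\<^bsub>N\<^esub> g x), one = (\<lambda>x\<in>carrier M. \<zero>\<^bsub>N\<^esub>)\<rparr>"

definition cocycles ::
    "('a, 'x) ring_scheme \<Rightarrow> (nat \<Rightarrow> 'a umod) \<Rightarrow> (nat \<Rightarrow> 'a univ \<Rightarrow> 'a univ) \<Rightarrow>
     nat \<Rightarrow> ('a, 'n) module \<Rightarrow> ('a univ \<Rightarrow> 'n) set" where
  "cocycles A P d n X =
     {f \<in> lhom A (P n) X. \<forall>y\<in>carrier (P (Suc n)). f (d n y) = \<zero>\<^bsub>X\<^esub>}"

definition coboundaries ::
    "('a, 'x) ring_scheme \<Rightarrow> (nat \<Rightarrow> 'a umod) \<Rightarrow> (nat \<Rightarrow> 'a univ \<Rightarrow> 'a univ) \<Rightarrow>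
     nat \<Rightarrow> ('a, 'n) module \<Rightarrow> ('a univ \<Rightarrow> 'n) set" where
  "coboundaries A P d n X = (case n of
       0 \<Rightarrow> {\<lambda>x\<in>carrier (P 0). \<zero>\<^bsub>X\<^esub>}
     | Suc m \<Rightarrow> {compose (carrier (P (Suc m))) g (d m) | g. g \<in> lhom A (P m) X})"

text \<open>The cohomology group in degree \<open>n\<close> of \<open>Hom(P, X)\<close> for a chosen projective resolution \<open>P\<close>
  of \<open>M\<close>.\<close>

definition Ext ::
    "('a, 'x) ring_scheme \<Rightarrow> nat \<Rightarrow> ('a, 'm) module \<Rightarrow> ('a, 'n) module \<Rightarrow>
     ('a univ \<Rightarrow> 'n) set monoid" where
  "Ext A n M X =
     (let (P, d, e) = (SOME (P, d, e). projective_resolution A M P d e)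
      in (hom_group A (P n) X)\<lparr>carrier := cocycles A P d n X\<rparr> Mod coboundaries A P d n X)"

definition Ext_zero ::
    "('a, 'x) ring_scheme \<Rightarrow> nat \<Rightarrow> ('a, 'm) module \<Rightarrow> ('a, 'n) module \<Rightarrow> bool" where
  "Ext_zero A n M X \<longleftrightarrow> carrier (Ext A n M X) = {\<one>\<^bsub>Ext A n M X\<^esub>}"

definition perp1 :: "('a, 'x) ring_scheme \<Rightarrow> ('a, 'n) module \<Rightarrow> 'a umod set" where
  "perp1 A X = {Z \<in> fg_modules A. Ext_zero A 1 Z X}"

definition minimal_presentation ::
    "('a, 'x) ring_scheme \<Rightarrow> 'a umod \<Rightarrow> 'a umod \<Rightarrow> 'a umod \<Rightarrow>
     ('a univ \<Rightarrow> 'a univ) \<Rightarrow> ('a univ \<Rightarrow> 'a univ) \<Rightarrow> bool" where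
  "minimal_presentation A M P1 P0 p1 p0 \<longleftrightarrow> projective_cover A M P0 p0 \<and>
     projective_cover A (submod P0 (a_kernel P0 M p0)) P1 p1"

text \<open>\<open>Hom(M, A)\<close> is a right \<open>A\<close>-module by \<open>(\<phi> a) x = \<phi> x \<otimes> a\<close>, that is, a left \<open>opp A\<close>-module.\<close>

definition star :: "('a, 'x) ring_scheme \<Rightarrow> ('a, 'm) module \<Rightarrow> ('a, 'm \<Rightarrow> 'a) module" where
  "star A M = \<lparr>carrier = lhom A M (regular A), mult = undefined, one = undefined,
     zero = (\<lambda>x\<in>carrier M. \<zero>\<^bsub>A\<^esub>),
     add = (\<lambda>\<phi> \<psi>. \<lambda>x\<in>carrier M. \<phi> x \<oplus>\<^bsub>A\<^esub> \<psi> x),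
     smult = (\<lambda>a \<phi>. \<lambda>x\<in>carrier M. \<phi> x \<otimes>\<^bsub>A\<^esub> a)\<rparr>"

definition Tr ::
    "('a, 'x) ring_scheme \<Rightarrow> 'a umod \<Rightarrow> ('a, ('a univ \<Rightarrow> 'a) set) module" where
  "Tr A M =
     (let (P1, P0, p1, p0) = (SOME (P1, P0, p1, p0). minimal_presentation A M P1 P0 p1 p0)
      in quot_mod (star A P1) ((\<lambda>\<phi>. compose (carrier P1) \<phi> p1) ` carrier (star A P0)))"

definition reflexive_modules :: "('a, 'x) ring_scheme \<Rightarrow> 'a umod set" where
  "reflexive_modules A =
     {M \<in> fg_modules A. \<forall>i\<in>{1, 2}. Ext_zero (opp A) i (Tr A M) (regular (opp A))}"

definition jacobson_radical :: "'r ring \<Rightarrow> 'r set" where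
  "jacobson_radical R = carrier R \<inter> \<Inter>{I. maximalideal I R}"

text \<open>The canonical duality is \<open>D = Hom(-, J)\<close> over \<open>R\<close>, with \<open>J\<close> an injective envelope of the
  \<open>R\<close>-module \<open>R / rad R\<close>.\<close>

definition dualizing_module :: "'r ring \<Rightarrow> 'r umod \<Rightarrow> bool" where
  "dualizing_module R J \<longleftrightarrow>
     (\<exists>j. injective_envelope R (quot_mod (regular R) (jacobson_radical R)) J j)"

text \<open>For a left \<open>A\<close>-module \<open>M\<close>, this is the left \<open>opp A\<close>-module \<open>D M\<close>. The scalar
  \<open>r \<in> R\<close> acts on \<open>M\<close> as \<open>r \<odot> \<one> \<in> A\<close>.\<close>

definition dual ::
    "'r ring \<Rightarrow> ('r, 'j) module \<Rightarrow> ('r, 'a) module \<Rightarrow> ('a, 'm) module \<Rightarrow> ('a, 'm \<Rightarrow> 'j) module" where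
  "dual R J A M = \<lparr>carrier = {\<phi> \<in> carrier M \<rightarrow>\<^sub>E carrier J.
       (\<forall>x\<in>carrier M. \<forall>y\<in>carrier M. \<phi> (x \<oplus>\<^bsub>M\<^esub> y) = \<phi> x \<oplus>\<^bsub>J\<^esub> \<phi> y) \<and>
       (\<forall>r\<in>carrier R. \<forall>x\<in>carrier M. \<phi> ((r \<odot>\<^bsub>A\<^esub> \<one>\<^bsub>A\<^esub>) \<odot>\<^bsub>M\<^esub> x) = r \<odot>\<^bsub>J\<^esub> \<phi> x)},
     mult = undefined, one = undefined,
     zero = (\<lambda>x\<in>carrier M. \<zero>\<^bsub>J\<^esub>),
     add = (\<lambda>\<phi> \<psi>. \<lambda>x\<in>carrier M. \<phi> x \<oplus>\<^bsub>J\<^esub> \<psi> x),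
     smult = (\<lambda>a \<phi>. \<lambda>x\<in>carrier M. \<phi> (a \<odot>\<^bsub>M\<^esub> x))\<rparr>"

text \<open>\<open>regular (opp A)\<close> is \<open>A\<close> as a right module over itself, so this is a left \<open>A\<close>-module.\<close>

definition dual_regular ::
    "'r ring \<Rightarrow> ('r, 'j) module \<Rightarrow> ('r, 'a) module \<Rightarrow> ('a, 'a \<Rightarrow> 'j) module" where
  "dual_regular R J A = dual R J (opp A) (regular (opp A))"


section \<open>Categories and equivalences\<close>

text \<open>Hom-sets are not required to be disjoint, so composition takes the three objects involved
  as arguments: \<open>Comp C X Y Z g f\<close> is \<open>g \<circ> f\<close> for \<open>f : X \<rightarrow> Y\<close> and \<open>g : Y \<rightarrow> Z\<close>.\<close>

record ('o, 'm) cat =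
  Ob :: "'o set"
  Arr :: "'o \<Rightarrow> 'o \<Rightarrow> 'm set"
  Ident :: "'o \<Rightarrow> 'm"
  Comp :: "'o \<Rightarrow> 'o \<Rightarrow> 'o \<Rightarrow> 'm \<Rightarrow> 'm \<Rightarrow> 'm"

definition is_category :: "('o, 'm) cat \<Rightarrow> bool" where
  "is_category C \<longleftrightarrow>
     (\<forall>X\<in>Ob C. Ident C X \<in> Arr C X X) \<and>
     (\<forall>X\<in>Ob C. \<forall>Y\<in>Ob C. \<forall>Z\<in>Ob C. \<forall>f\<in>Arr C X Y. \<forall>g\<in>Arr C Y Z. Comp C X Y Z g f \<in> Arr C X Z) \<and>
     (\<forall>X\<in>Ob C. \<forall>Y\<in>Ob C. \<forall>f\<in>Arr C X Y.
        Comp C X X Y f (Ident C X) = f \<and> Comp C X Y Y (Ident C Y) f = f) \<and>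
     (\<forall>W\<in>Ob C. \<forall>X\<in>Ob C. \<forall>Y\<in>Ob C. \<forall>Z\<in>Ob C. \<forall>f\<in>Arr C W X. \<forall>g\<in>Arr C X Y. \<forall>h\<in>Arr C Y Z.
        Comp C W X Z (Comp C X Y Z h g) f = Comp C W Y Z h (Comp C W X Y g f))"

definition full_subcat :: "('o, 'm) cat \<Rightarrow> 'o set \<Rightarrow> ('o, 'm) cat" where
  "full_subcat C S = C\<lparr>Ob := Ob C \<inter> S\<rparr>"

record ('o, 'm, 'p, 'n) fnctr =
  on_ob :: "'o \<Rightarrow> 'p"
  on_arr :: "'o \<Rightarrow> 'o \<Rightarrow> 'm \<Rightarrow> 'n"

definition is_functor :: "('o, 'm) cat \<Rightarrow> ('p, 'n) cat \<Rightarrow> ('o, 'm, 'p, 'n) fnctr \<Rightarrow> bool" where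
  "is_functor C D F \<longleftrightarrow> is_category C \<and> is_category D \<and>
     (\<forall>X\<in>Ob C. on_ob F X \<in> Ob D) \<and>
     (\<forall>X\<in>Ob C. \<forall>Y\<in>Ob C. \<forall>f\<in>Arr C X Y. on_arr F X Y f \<in> Arr D (on_ob F X) (on_ob F Y)) \<and>
     (\<forall>X\<in>Ob C. on_arr F X X (Ident C X) = Ident D (on_ob F X)) \<and>
     (\<forall>X\<in>Ob C. \<forall>Y\<in>Ob C. \<forall>Z\<in>Ob C. \<forall>f\<in>Arr C X Y. \<forall>g\<in>Arr C Y Z.
        on_arr F X Z (Comp C X Y Z g f) =
          Comp D (on_ob F X) (on_ob F Y) (on_ob F Z) (on_arr F Y Z g) (on_arr F X Y f))"

definition id_functor :: "('o, 'm, 'o, 'm) fnctr" where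
  "id_functor = \<lparr>on_ob = \<lambda>X. X, on_arr = \<lambda>X Y f. f\<rparr>"

definition comp_functor ::
    "('p, 'n, 'q, 'k) fnctr \<Rightarrow> ('o, 'm, 'p, 'n) fnctr \<Rightarrow> ('o, 'm, 'q, 'k) fnctr" where
  "comp_functor G F = \<lparr>on_ob = \<lambda>X. on_ob G (on_ob F X),
     on_arr = \<lambda>X Y f. on_arr G (on_ob F X) (on_ob F Y) (on_arr F X Y f)\<rparr>"

definition is_isomorphism :: "('o, 'm) cat \<Rightarrow> 'o \<Rightarrow> 'o \<Rightarrow> 'm \<Rightarrow> bool" where
  "is_isomorphism C X Y f \<longleftrightarrow> f \<in> Arr C X Y \<and>
     (\<exists>g\<in>Arr C Y X. Comp C X Y X g f = Ident C X \<and> Comp C Y X Y f g = Ident C Y)"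

definition naturally_isomorphic ::
    "('o, 'm) cat \<Rightarrow> ('p, 'n) cat \<Rightarrow> ('o, 'm, 'p, 'n) fnctr \<Rightarrow> ('o, 'm, 'p, 'n) fnctr \<Rightarrow> bool" where
  "naturally_isomorphic C D F G \<longleftrightarrow> (\<exists>\<eta>.
     (\<forall>X\<in>Ob C. is_isomorphism D (on_ob F X) (on_ob G X) (\<eta> X)) \<and>
     (\<forall>X\<in>Ob C. \<forall>Y\<in>Ob C. \<forall>f\<in>Arr C X Y.
        Comp D (on_ob F X) (on_ob F Y) (on_ob G Y) (\<eta> Y) (on_arr F X Y f) =
        Comp D (on_ob F X) (on_ob G X) (on_ob G Y) (on_arr G X Y f) (\<eta> X)))"

definition quasi_inverse_equivalences ::
    "('o, 'm) cat \<Rightarrow> ('p, 'n) cat \<Rightarrow> ('o, 'm, 'p, 'n) fnctr \<Rightarrow> ('p, 'n, 'o, 'm) fnctr \<Rightarrow> bool" where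
  "quasi_inverse_equivalences C D F G \<longleftrightarrow> is_functor C D F \<and> is_functor D C G \<and>
     naturally_isomorphic C C id_functor (comp_functor G F) \<and>
     naturally_isomorphic D D (comp_functor F G) id_functor"


section \<open>The stable category and the functors on it\<close>

definition stable_rel ::
    "('a, 'x) ring_scheme \<Rightarrow> 'a umod \<Rightarrow> 'a umod \<Rightarrow>
     (('a univ \<Rightarrow> 'a univ) \<times> ('a univ \<Rightarrow> 'a univ)) set" where
  "stable_rel A M N = {(f, g). f \<in> lhom A M N \<and> g \<in> lhom A M N \<and>
     (\<exists>P\<in>proj_modules A. \<exists>u\<in>lhom A M P. \<exists>v\<in>lhom A P N.
        \<forall>x\<in>carrier M. f x \<ominus>\<^bsub>N\<^esub> g x = v (u x))}"

abbreviation stable_class ::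
    "('a, 'x) ring_scheme \<Rightarrow> 'a umod \<Rightarrow> 'a umod \<Rightarrow> ('a univ \<Rightarrow> 'a univ) \<Rightarrow>
     ('a univ \<Rightarrow> 'a univ) set" where
  "stable_class A M N f \<equiv> stable_rel A M N `` {f}"

text \<open>Operations on classes are written as the union of the resulting classes over all
  representatives; by well-definedness this is a union of equal sets.\<close>

definition stable_cat ::
    "('a, 'x) ring_scheme \<Rightarrow> ('a umod, ('a univ \<Rightarrow> 'a univ) set) cat" where
  "stable_cat A = \<lparr>Ob = fg_modules A,
     Arr = \<lambda>M N. lhom A M N // stable_rel A M N,
     Ident = \<lambda>M. stable_class A M M (\<lambda>x\<in>carrier M. x),
     Comp = \<lambda>L M N G F. \<Union>g\<in>G. \<Union>f\<in>F. stable_class A L N (compose (carrier L) g f)\<rparr>"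

type_synonym 'a stable_endofunctor =
  "('a umod, ('a univ \<Rightarrow> 'a univ) set, 'a umod, ('a univ \<Rightarrow> 'a univ) set) fnctr"

definition projective_covers ::
    "('a, 'x) ring_scheme \<Rightarrow> ('a umod \<Rightarrow> 'a umod) \<Rightarrow> ('a umod \<Rightarrow> 'a univ \<Rightarrow> 'a univ) \<Rightarrow> bool" where
  "projective_covers A P p \<longleftrightarrow> (\<forall>M\<in>fg_modules A. projective_cover A M (P M) (p M))"

text \<open>The morphism \<open>h\<close> below is the restriction to the kernels of a lift \<open>t\<close> of \<open>f : M \<rightarrow> N\<close> to the
  projective covers.\<close>

definition Syz ::
    "('a, 'x) ring_scheme \<Rightarrow> ('a umod \<Rightarrow> 'a umod) \<Rightarrow> ('a umod \<Rightarrow> 'a univ \<Rightarrow> 'a univ) \<Rightarrow>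
     'a stable_endofunctor" where
  "Syz A P p = (let \<Omega> = (\<lambda>M. submod (P M) (a_kernel (P M) M (p M))) in
     \<lparr>on_ob = \<Omega>,
      on_arr = \<lambda>M N F. \<Union>{stable_class A (\<Omega> M) (\<Omega> N) h | h.
        \<exists>f\<in>F. \<exists>t\<in>lhom A (P M) (P N). (\<forall>x\<in>carrier (P M). p N (t x) = f (p M x)) \<and>
          h = restrict t (carrier (\<Omega> M))}\<rparr>)"

definition minimal_approximations ::
    "('a, 'x) ring_scheme \<Rightarrow> ('a umod \<Rightarrow> 'a umod) \<Rightarrow> ('a umod \<Rightarrow> 'a univ \<Rightarrow> 'a univ) \<Rightarrow>
     ('a umod \<Rightarrow> 'a umod) \<Rightarrow> ('a umod \<Rightarrow> 'a univ \<Rightarrow> 'a univ) \<Rightarrow> bool" where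
  "minimal_approximations A Q e C q \<longleftrightarrow> (\<forall>M\<in>fg_modules A.
     minimal_left_proj_approx A M (Q M) (e M) \<and> is_cokernel A M (Q M) (e M) (C M) (q M))"

text \<open>The morphism \<open>h\<close> below is induced on the cokernels by an extension \<open>t\<close> of \<open>f : M \<rightarrow> N\<close> to
  the approximations.\<close>

definition Agemo ::
    "('a, 'x) ring_scheme \<Rightarrow> ('a umod \<Rightarrow> 'a umod) \<Rightarrow> ('a umod \<Rightarrow> 'a univ \<Rightarrow> 'a univ) \<Rightarrow>
     ('a umod \<Rightarrow> 'a umod) \<Rightarrow> ('a umod \<Rightarrow> 'a univ \<Rightarrow> 'a univ) \<Rightarrow> 'a stable_endofunctor" where
  "Agemo A Q e C q =
     \<lparr>on_ob = C,
      on_arr = \<lambda>M N F. \<Union>{stable_class A (C M) (C N) h | h. h \<in> lhom A (C M) (C N) \<and>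
        (\<exists>f\<in>F. \<exists>t\<in>lhom A (Q M) (Q N). (\<forall>x\<in>carrier M. t (e M x) = e N (f x)) \<and>
          (\<forall>y\<in>carrier (Q M). h (q M y) = q N (t y)))}\<rparr>"

end

theory Submission
  imports Defs
begin

text \<open>For exact sequences \<open>0 \<rightarrow> K \<rightarrow> P \<rightarrow> C \<rightarrow> 0\<close> with \<open>P\<close> projective and \<open>K \<rightarrow> P\<close> a left
  \<open>\<P>\<close>-approximation, completing morphisms at one end to morphisms of sequences gives bijections between
  the stable morphisms at the two ends. Hence \<open>\<mho>\<close> and \<open>\<Omega>\<close> are quasi-inverse between the torsionless
  modules and the modules \<open>Z\<close> with \<open>Ext\<^sup>1(Z, \<Lambda>) = 0\<close>, and both equivalences are restrictions of this one:
  \<open>M\<close> is reflexive iff \<open>M\<close> and \<open>\<mho> M\<close> are torsionless;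
  \<open>Z \<in> \<Y>\<close> iff \<open>Ext\<^sup>1(Z, \<Lambda>) = 0\<close> and \<open>Z\<close> is torsionless, since given the former
  \<open>Ext\<^sup>1(Z, K\<^sub>1)\<close> is the obstruction to factoring maps \<open>Z \<rightarrow> D\<Lambda>\<close> through \<open>P\<^sub>0\<close>, and \<open>D\<Lambda>\<close> is an injective
  cogenerator; \<open>Z \<in> \<W>\<close> iff \<open>Ext\<^sup>1(Z, \<Lambda>) = Ext\<^sup>1(\<Omega> Z, \<Lambda>) = 0\<close>, by dimension shift along
  \<open>0 \<rightarrow> \<Lambda> \<rightarrow> I\<^sub>0 \<rightarrow> L\<^sub>-\<^sub>1 \<rightarrow> 0\<close>.\<close>

section \<open>Homomorphisms of left modules\<close>

text \<open>Reflexivity meets the sequences through duality. If 0 -> M -> P -> C -> 0 has an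
  approximation M -> P as its first map, then P* -> M* is onto, so M** sits inside P** = P; it
  consists of the elements whose image in C is killed by all functionals. Hence M -> M** is onto
  exactly if C is torsionless. That injectivity and surjectivity of this map amount to vanishing of
  Ext^1 and Ext^2 on Tr M is read off the dual of a projective presentation. Two features of the
  setting shape the rest. The lifting properties in \<open>proj_modules\<close> and
  \<open>inj_modules\<close> quantify over one carrier type, whereas \<Lambda>, its dual, quotients
  and modules of functionals live on others; so projectivity is expressed by dual bases and
  injectivity is moved through isomorphic copies. And \<open>Ext\<close> is computed from a chosen
  resolution of which only exactness is known; so its vanishing is replaced by an extension property
  that any one short exact sequence can test. For syzygies to stay finitely generated \<Lambda> has
  to be noetherian, which must be derived from descending chains in R.\<close>

lemma left_module_ring: "left_module A M \<Longrightarrow> ring A"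
  and left_module_abelian_group: "left_module A M \<Longrightarrow> abelian_group M"
  by (auto simp: left_module_def)

lemmas left_module_zero_closed =
  abelian_monoid.zero_closed[OF abelian_group.axioms(1)[OF left_module_abelian_group]]
lemmas left_module_add_closed =
  abelian_monoid.a_closed[OF abelian_group.axioms(1)[OF left_module_abelian_group]]
lemmas left_module_neg_closed = abelian_group.a_inv_closed[OF left_module_abelian_group]

lemma lhomI:
  assumes "f \<in> extensional (carrier M)" "\<And>x. x \<in> carrier M \<Longrightarrow> f x \<in> carrier N"
    and "\<And>x y. x \<in> carrier M \<Longrightarrow> y \<in> carrier M \<Longrightarrow> f (x \<oplus>\<^bsub>M\<^esub> y) = f x \<oplus>\<^bsub>N\<^esub> f y"
    and "\<And>a x. a \<in> carrier A \<Longrightarrow> x \<in> carrier M \<Longrightarrow> f (a \<odot>\<^bsub>M\<^esub> x) = a \<odot>\<^bsub>N\<^esub> f x"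
  shows "f \<in> lhom A M N"
  using assms by (auto simp: lhom_def PiE_def)

lemma lhom_restrictI:
  assumes M: "left_module A M" and "\<And>x. x \<in> carrier M \<Longrightarrow> f x \<in> carrier N"
    and "\<And>x y. x \<in> carrier M \<Longrightarrow> y \<in> carrier M \<Longrightarrow> f (x \<oplus>\<^bsub>M\<^esub> y) = f x \<oplus>\<^bsub>N\<^esub> f y"
    and "\<And>a x. a \<in> carrier A \<Longrightarrow> x \<in> carrier M \<Longrightarrow> f (a \<odot>\<^bsub>M\<^esub> x) = a \<odot>\<^bsub>N\<^esub> f x"
  shows "(\<lambda>x\<in>carrier M. f x) \<in> lhom A M N"
  using assms(2-) left_module_add_closed[OF M] left_module.smult_closed[OF M]
  by (intro lhomI) simp_all

lemma lhom_closed: "f \<in> lhom A M N \<Longrightarrow> x \<in> carrier M \<Longrightarrow> f x \<in> carrier N"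
  and lhom_add: "f \<in> lhom A M N \<Longrightarrow> x \<in> carrier M \<Longrightarrow> y \<in> carrier M \<Longrightarrow>
    f (x \<oplus>\<^bsub>M\<^esub> y) = f x \<oplus>\<^bsub>N\<^esub> f y"
  and lhom_smult: "f \<in> lhom A M N \<Longrightarrow> a \<in> carrier A \<Longrightarrow> x \<in> carrier M \<Longrightarrow>
    f (a \<odot>\<^bsub>M\<^esub> x) = a \<odot>\<^bsub>N\<^esub> f x"
  and lhom_extensional: "f \<in> lhom A M N \<Longrightarrow> f \<in> extensional (carrier M)"
  by (auto simp: lhom_def PiE_def)

lemma lhom_eqI:
  assumes "f \<in> lhom A M N" "g \<in> lhom A M N'" "\<And>x. x \<in> carrier M \<Longrightarrow> f x = g x"
  shows "f = g"
  using assms lhom_extensional by (metis extensionalityI)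

lemma lhom_zero:
  assumes "left_module A M" "left_module A N" "f \<in> lhom A M N"
  shows "f \<zero>\<^bsub>M\<^esub> = \<zero>\<^bsub>N\<^esub>"
proof -
  interpret M: abelian_group M using assms(1) by (rule left_module_abelian_group)
  interpret N: abelian_group N using assms(2) by (rule left_module_abelian_group)
  have "f \<zero>\<^bsub>M\<^esub> \<oplus>\<^bsub>N\<^esub> f \<zero>\<^bsub>M\<^esub> = f \<zero>\<^bsub>M\<^esub>"
    using lhom_add[OF assms(3), of "\<zero>\<^bsub>M\<^esub>" "\<zero>\<^bsub>M\<^esub>"] by simp
  then show ?thesis using lhom_closed[OF assms(3) M.zero_closed] N.add.l_cancel_one' by metis
qed

lemma lhom_neg:
  assumes "left_module A M" "left_module A N" "f \<in> lhom A M N" "x \<in> carrier M"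
  shows "f (\<ominus>\<^bsub>M\<^esub> x) = \<ominus>\<^bsub>N\<^esub> f x"
proof -
  interpret M: abelian_group M using assms(1) by (rule left_module_abelian_group)
  interpret N: abelian_group N using assms(2) by (rule left_module_abelian_group)
  have "f (\<ominus>\<^bsub>M\<^esub> x) \<oplus>\<^bsub>N\<^esub> f x = \<zero>\<^bsub>N\<^esub>"
    using lhom_add[OF assms(3), of "\<ominus>\<^bsub>M\<^esub> x" x] assms by (simp add: M.l_neg lhom_zero[of A])
  then show ?thesis using assms lhom_closed by (metis M.a_inv_closed N.minus_equality)
qed

lemma lhom_minus:
  assumes "left_module A M" "left_module A N" "f \<in> lhom A M N" "x \<in> carrier M" "y \<in> carrier M"
  shows "f (x \<ominus>\<^bsub>M\<^esub> y) = f x \<ominus>\<^bsub>N\<^esub> f y"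
  using assms by (simp add: a_minus_def lhom_add lhom_neg left_module_neg_closed)

lemma lhom_compose:
  assumes "left_module A M" "f \<in> lhom A M N" "g \<in> lhom A N L"
  shows "compose (carrier M) g f \<in> lhom A M L"
  unfolding compose_def
  by (rule lhom_restrictI) (use assms in \<open>auto simp: lhom_closed lhom_add lhom_smult\<close>)

lemma lhom_id: "left_module A M \<Longrightarrow> (\<lambda>x\<in>carrier M. x) \<in> lhom A M M"
  by (rule lhom_restrictI) auto

lemma lhom_zero_map:
  assumes M: "left_module A M" and N: "left_module A N"
  shows "(\<lambda>x\<in>carrier M. \<zero>\<^bsub>N\<^esub>) \<in> lhom A M N"
proof -
  interpret N: abelian_group N using N by (rule left_module_abelian_group)
  show ?thesis by (rule lhom_restrictI[OF M]) (simp_all add: left_module.smult_r_null[OF N])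
qed

lemma left_module_smult_minus:
  assumes N: "left_module A N" and "a \<in> carrier A" "x \<in> carrier N" "y \<in> carrier N"
  shows "a \<odot>\<^bsub>N\<^esub> (x \<ominus>\<^bsub>N\<^esub> y) = a \<odot>\<^bsub>N\<^esub> x \<ominus>\<^bsub>N\<^esub> a \<odot>\<^bsub>N\<^esub> y"
proof -
  interpret NG: abelian_group N by (rule left_module_abelian_group[OF N])
  interpret N: left_module A N by fact
  have "a \<odot>\<^bsub>N\<^esub> (\<ominus>\<^bsub>N\<^esub> y) \<oplus>\<^bsub>N\<^esub> a \<odot>\<^bsub>N\<^esub> y = \<zero>\<^bsub>N\<^esub>"
    using N.smult_r_distr[of a "\<ominus>\<^bsub>N\<^esub> y" y] assms by (simp add: NG.l_neg N.smult_r_null)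
  then have "a \<odot>\<^bsub>N\<^esub> (\<ominus>\<^bsub>N\<^esub> y) = \<ominus>\<^bsub>N\<^esub> (a \<odot>\<^bsub>N\<^esub> y)"
    using assms by (metis NG.a_inv_closed NG.minus_equality N.smult_closed)
  then show ?thesis using assms by (simp add: a_minus_def N.smult_r_distr)
qed

lemma lhom_sub:
  assumes M: "left_module A M" and N: "left_module A N" and f: "f \<in> lhom A M N" and g: "g \<in> lhom A M N"
  shows "(\<lambda>x\<in>carrier M. f x \<ominus>\<^bsub>N\<^esub> g x) \<in> lhom A M N"
proof -
  interpret N: abelian_group N using N by (rule left_module_abelian_group)
  show ?thesis
  proof (rule lhom_restrictI[OF M])
    fix x y assume "x \<in> carrier M" "y \<in> carrier M"
    then show "f (x \<oplus>\<^bsub>M\<^esub> y) \<ominus>\<^bsub>N\<^esub> g (x \<oplus>\<^bsub>M\<^esub> y) = f x \<ominus>\<^bsub>N\<^esub> g x \<oplus>\<^bsub>N\<^esub> (f y \<ominus>\<^bsub>N\<^esub> g y)"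
      using f g by (simp add: lhom_add lhom_closed a_minus_def N.minus_add N.a_ac)
  qed (use f g in \<open>auto simp: lhom_closed lhom_smult left_module_smult_minus[OF N]\<close>)
qed

lemma lhom_sum:
  assumes M: "left_module A M" and N: "left_module A N" and f: "f \<in> lhom A M N" and g: "g \<in> lhom A M N"
  shows "(\<lambda>x\<in>carrier M. f x \<oplus>\<^bsub>N\<^esub> g x) \<in> lhom A M N"
proof -
  interpret N: abelian_group N using N by (rule left_module_abelian_group)
  show ?thesis
  proof (rule lhom_restrictI[OF M])
    fix x y assume "x \<in> carrier M" "y \<in> carrier M"
    then show "f (x \<oplus>\<^bsub>M\<^esub> y) \<oplus>\<^bsub>N\<^esub> g (x \<oplus>\<^bsub>M\<^esub> y) = f x \<oplus>\<^bsub>N\<^esub> g x \<oplus>\<^bsub>N\<^esub> (f y \<oplus>\<^bsub>N\<^esub> g y)"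
      using f g by (simp add: lhom_add lhom_closed N.a_ac)
  qed (use f g in \<open>auto simp: lhom_closed lhom_smult left_module.smult_r_distr[OF N]\<close>)
qed

lemma (in abelian_group) minus_add_cancel [simp]:
  "x \<in> carrier G \<Longrightarrow> y \<in> carrier G \<Longrightarrow> x \<ominus> y \<oplus> y = x"
  by (simp add: a_minus_def a_assoc l_neg)

lemma (in abelian_group) minus_self [simp]: "x \<in> carrier G \<Longrightarrow> x \<ominus> x = \<zero>"
  by (simp add: a_minus_def r_neg)

lemma (in abelian_group) minus_eq_zero_iff:
  assumes "x \<in> carrier G" "y \<in> carrier G"
  shows "x \<ominus> y = \<zero> \<longleftrightarrow> x = y"
  using minus_add_cancel[OF assms] assms by (metis l_zero minus_self)

lemma (in abelian_group) minus_zero [simp]: "x \<in> carrier G \<Longrightarrow> x \<ominus> \<zero> = x"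
  by (simp add: a_minus_def)

lemma (in abelian_group) minus_minus_minus [simp]:
  "x \<in> carrier G \<Longrightarrow> y \<in> carrier G \<Longrightarrow> x \<ominus> (x \<ominus> y) = y"
  by (simp add: a_minus_def minus_add a_assoc[symmetric] r_neg)

lemma lhom_inj_on_iff:
  assumes "left_module A M" "left_module A N" "f \<in> lhom A M N"
  shows "inj_on f (carrier M) \<longleftrightarrow> (\<forall>x\<in>carrier M. f x = \<zero>\<^bsub>N\<^esub> \<longrightarrow> x = \<zero>\<^bsub>M\<^esub>)"
proof -
  interpret M: abelian_group M using assms(1) by (rule left_module_abelian_group)
  interpret N: abelian_group N using assms(2) by (rule left_module_abelian_group)
  show ?thesis
  proof (intro iffI ballI impI inj_onI)
    fix x assume "inj_on f (carrier M)" "x \<in> carrier M" "f x = \<zero>\<^bsub>N\<^esub>"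
    then show "x = \<zero>\<^bsub>M\<^esub>" using lhom_zero[OF assms] by (metis M.zero_closed inj_onD)
  next
    fix x y assume *: "\<forall>x\<in>carrier M. f x = \<zero>\<^bsub>N\<^esub> \<longrightarrow> x = \<zero>\<^bsub>M\<^esub>"
      and xy: "x \<in> carrier M" "y \<in> carrier M" "f x = f y"
    then have "f (x \<ominus>\<^bsub>M\<^esub> y) = \<zero>\<^bsub>N\<^esub>" using assms by (simp add: lhom_minus[of A] lhom_closed)
    then show "x = y" using * xy by (metis M.minus_closed M.minus_eq_zero_iff)
  qed
qed

lemma in_a_kernel_iff: "x \<in> a_kernel M N f \<longleftrightarrow> x \<in> carrier M \<and> f x = \<zero>\<^bsub>N\<^esub>"
  by (simp add: a_kernel_def')

text \<open>Two preimages of the same element differ by an element of the kernel, so f takes the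
  same value on both. The carriers of P, C and X are of independent types, so the lemma serves for
  quotient modules and modules of functionals alike.\<close>

lemma lhom_factor:
  assumes P: "left_module A P" and C: "left_module A C" and X: "left_module A X"
    and p: "p \<in> lhom A P C" "p ` carrier P = carrier C" and f: "f \<in> lhom A P X"
    and ker: "\<And>x. x \<in> carrier P \<Longrightarrow> p x = \<zero>\<^bsub>C\<^esub> \<Longrightarrow> f x = \<zero>\<^bsub>X\<^esub>"
  shows "\<exists>h\<in>lhom A C X. \<forall>x\<in>carrier P. h (p x) = f x"
proof -
  interpret PG: abelian_group P using P by (rule left_module_abelian_group)
  interpret P: left_module A P by fact
  interpret CG: abelian_group C using C by (rule left_module_abelian_group)
  interpret XG: abelian_group X using X by (rule left_module_abelian_group)
  have eq: "f x = f y" if "x \<in> carrier P" "y \<in> carrier P" "p x = p y" for x y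
  proof -
    have "p (x \<ominus>\<^bsub>P\<^esub> y) = \<zero>\<^bsub>C\<^esub>" using that p by (simp add: lhom_minus[OF P C] lhom_closed)
    then have "f (x \<ominus>\<^bsub>P\<^esub> y) = \<zero>\<^bsub>X\<^esub>" using that ker by simp
    then show ?thesis using that f
      by (simp add: lhom_minus[OF P X] lhom_closed XG.minus_eq_zero_iff)
  qed
  \<comment> \<open>A set-theoretic section of p. It need not be additive; \<open>eq\<close> repairs
    this once f is applied.\<close>
  define s where "s c = (SOME x. x \<in> carrier P \<and> p x = c)" for c
  have s: "s c \<in> carrier P" "p (s c) = c" if "c \<in> carrier C" for c
  proof -
    have "\<exists>x. x \<in> carrier P \<and> p x = c" using that p(2) by (metis imageE)
    from someI_ex[OF this] show "s c \<in> carrier P" "p (s c) = c" by (simp_all add: s_def)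
  qed
  have "(\<lambda>c\<in>carrier C. f (s c)) \<in> lhom A C X"
  proof (rule lhom_restrictI[OF C])
    fix c d assume cd: "c \<in> carrier C" "d \<in> carrier C"
    have "f (s (c \<oplus>\<^bsub>C\<^esub> d)) = f (s c \<oplus>\<^bsub>P\<^esub> s d)"
      by (rule eq) (use cd s lhom_add[OF p(1)] in simp_all)
    then show "f (s (c \<oplus>\<^bsub>C\<^esub> d)) = f (s c) \<oplus>\<^bsub>X\<^esub> f (s d)" using cd s f by (simp add: lhom_add)
  next
    fix a c assume ac: "a \<in> carrier A" "c \<in> carrier C"
    have "f (s (a \<odot>\<^bsub>C\<^esub> c)) = f (a \<odot>\<^bsub>P\<^esub> s c)"
      by (rule eq) (use ac s left_module.smult_closed[OF C] lhom_smult[OF p(1)] in simp_all)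
    then show "f (s (a \<odot>\<^bsub>C\<^esub> c)) = a \<odot>\<^bsub>X\<^esub> f (s c)" using ac s f by (simp add: lhom_smult)
  qed (use s f in \<open>auto simp: lhom_closed\<close>)
  moreover have "f (s (p x)) = f x" if "x \<in> carrier P" for x
    by (rule eq) (simp_all add: that s lhom_closed[OF p(1)])
  ultimately show ?thesis using p(1) by (intro bexI[of _ "\<lambda>c\<in>carrier C. f (s c)"]) (auto simp: lhom_closed)
qed

text \<open>The counterpart of \<open>lhom_factor\<close> for injections: pointwise preimages under
  i form a linear map because i is injective and linear.\<close>

lemma lhom_corestrict:
  assumes K: "left_module A K" and P: "left_module A P" and X: "left_module A X"
    and i: "i \<in> lhom A K P" "inj_on i (carrier K)" and f: "f \<in> lhom A X P"
    and im: "\<And>x. x \<in> carrier X \<Longrightarrow> f x \<in> i ` carrier K"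
  shows "\<exists>h\<in>lhom A X K. \<forall>x\<in>carrier X. i (h x) = f x"
proof -
  define h where "h = (\<lambda>x\<in>carrier X. the_inv_into (carrier K) i (f x))"
  have h: "h x \<in> carrier K" "i (h x) = f x" if "x \<in> carrier X" for x
    using im[OF that] i that by (auto simp: h_def the_inv_into_f_f)
  have eq: "y = z" if "y \<in> carrier K" "z \<in> carrier K" "i y = i z" for y z
    by (rule inj_onD[OF i(2)]) (simp_all add: that)
  note cl = left_module_add_closed[OF X] left_module.smult_closed[OF X]
    left_module_add_closed[OF K] left_module.smult_closed[OF K]
  have "h \<in> lhom A X K"
  proof (rule lhomI)
    fix x y assume xy: "x \<in> carrier X" "y \<in> carrier X"
    show "h (x \<oplus>\<^bsub>X\<^esub> y) = h x \<oplus>\<^bsub>K\<^esub> h y"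
      by (rule eq) (use xy cl h i f in \<open>auto simp: lhom_add\<close>)
  next
    fix a x assume xy: "a \<in> carrier A" "x \<in> carrier X"
    show "h (a \<odot>\<^bsub>X\<^esub> x) = a \<odot>\<^bsub>K\<^esub> h x"
      by (rule eq) (use xy cl h i f in \<open>auto simp: lhom_smult\<close>)
  qed (use h in \<open>auto simp: h_def\<close>)
  then show ?thesis using h by blast
qed

lemma lhom_inverse:
  assumes M: "left_module A M" and N: "left_module A N" and f: "f \<in> lhom A M N"
    and bij: "bij_betw f (carrier M) (carrier N)"
  shows "\<exists>g\<in>lhom A N M. (\<forall>x\<in>carrier M. g (f x) = x) \<and> (\<forall>y\<in>carrier N. f (g y) = y)"
proof -
  have "inj_on f (carrier M)" "f ` carrier M = carrier N" using bij by (auto simp: bij_betw_def)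
  then obtain g where g: "g \<in> lhom A N M" "\<And>y. y \<in> carrier N \<Longrightarrow> f (g y) = y"
    using lhom_corestrict[OF M N N f _ lhom_id[OF N]] by auto
  moreover have "g (f x) = x" if "x \<in> carrier M" for x
    by (rule inj_onD[OF bij_betw_imp_inj_on[OF bij]])
      (simp_all add: that g(2) lhom_closed[OF f] lhom_closed[OF g(1)])
  ultimately show ?thesis by blast
qed


section \<open>Finite sums and dual bases\<close>

lemma lhom_finsum:
  assumes M: "left_module A M" and N: "left_module A N" and f: "f \<in> lhom A M N"
    and I: "finite I" "g \<in> I \<rightarrow> carrier M"
  shows "f (finsum M g I) = finsum N (\<lambda>i. f (g i)) I"
proof -
  interpret M: abelian_group M using M by (rule left_module_abelian_group)
  interpret N: abelian_group N using N by (rule left_module_abelian_group)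
  show ?thesis using I
  proof (induction I rule: finite_induct)
    case empty
    then show ?case using lhom_zero[OF M N f] by simp
  next
    case (insert i I)
    then have "(\<lambda>i. f (g i)) \<in> I \<rightarrow> carrier N" "f (g i) \<in> carrier N"
      using lhom_closed[OF f] by auto
    then show ?case using insert lhom_add[OF f] by (simp add: Pi_def)
  qed
qed

lemma (in left_module) smult_finsum:
  assumes a: "a \<in> carrier A" and I: "finite I" "g \<in> I \<rightarrow> carrier M"
  shows "a \<odot>\<^bsub>M\<^esub> finsum M g I = finsum M (\<lambda>i. a \<odot>\<^bsub>M\<^esub> g i) I"
  using I
proof (induction I rule: finite_induct)
  case empty
  then show ?case using a by (simp add: smult_r_null)
next
  case (insert i I)
  then have "(\<lambda>i. a \<odot>\<^bsub>M\<^esub> g i) \<in> I \<rightarrow> carrier M" using a by auto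
  then show ?case using insert a by (simp add: Pi_def smult_r_distr)
qed

lemma regular_simps [simp]:
  "carrier (regular A) = carrier A" "\<zero>\<^bsub>regular A\<^esub> = \<zero>\<^bsub>A\<^esub>"
  "x \<oplus>\<^bsub>regular A\<^esub> y = x \<oplus>\<^bsub>A\<^esub> y" "a \<odot>\<^bsub>regular A\<^esub> x = a \<otimes>\<^bsub>A\<^esub> x"
  by (simp_all add: regular_def)

lemma left_module_regular:
  assumes "ring A"
  shows "left_module A (regular A)"
proof -
  interpret ring A by fact
  have "abelian_group (regular A)"
  proof (rule abelian_groupI)
    fix x assume "x \<in> carrier (regular A)"
    then show "\<exists>y\<in>carrier (regular A). y \<oplus>\<^bsub>regular A\<^esub> x = \<zero>\<^bsub>regular A\<^esub>"
      by (intro bexI[of _ "\<ominus>\<^bsub>A\<^esub> x"]) (auto simp: l_neg)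
  qed (auto simp: a_ac)
  then show ?thesis
    by (intro left_module.intro left_module_axioms.intro ring_axioms)
      (auto simp: l_distr r_distr m_assoc)
qed

definition dual_basis ::
    "('a, 'x) ring_scheme \<Rightarrow> ('a, 'm) module \<Rightarrow> nat \<Rightarrow> (nat \<Rightarrow> 'm) \<Rightarrow> (nat \<Rightarrow> 'm \<Rightarrow> 'a) \<Rightarrow> bool" where
  "dual_basis A P n x \<phi> \<longleftrightarrow> left_module A P \<and>
     (\<forall>i<n. x i \<in> carrier P \<and> \<phi> i \<in> lhom A P (regular A)) \<and>
     (\<forall>y\<in>carrier P. y = finsum P (\<lambda>i. \<phi> i y \<odot>\<^bsub>P\<^esub> x i) {..<n})"

text \<open>Unlike \<open>proj_modules\<close>, this notion of a finitely generated projective module does not depend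
  on the type of the elements.\<close>

definition has_dual_basis :: "('a, 'x) ring_scheme \<Rightarrow> ('a, 'm) module \<Rightarrow> bool" where
  "has_dual_basis A P \<longleftrightarrow> (\<exists>n x \<phi>. dual_basis A P n x \<phi>)"

lemma has_dual_basis_module: "has_dual_basis A P \<Longrightarrow> left_module A P"
  by (auto simp: has_dual_basis_def dual_basis_def)

text \<open>The common source of explicit maps: lifts, extensions and maps out of free modules are
  all of this form. The functionals need not belong to a dual basis, which
  \<open>extends_dual_basis\<close> exploits.\<close>

lemma lhom_combination:
  assumes P: "left_module A P" and X: "left_module A X"
    and \<phi>: "\<And>i. i < n \<Longrightarrow> \<phi> i \<in> lhom A P (regular A)" and z: "\<And>i. i < n \<Longrightarrow> z i \<in> carrier X"
  shows "(\<lambda>y\<in>carrier P. finsum X (\<lambda>i. \<phi> i y \<odot>\<^bsub>X\<^esub> z i) {..<n::nat}) \<in> lhom A P X"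
proof -
  interpret P: left_module A P by fact
  interpret XG: abelian_group X using X by (rule left_module_abelian_group)
  interpret X: left_module A X by fact
  have c: "\<phi> i y \<in> carrier A" if "i < n" "y \<in> carrier P" for i y
    using lhom_closed[OF \<phi>[OF that(1)] that(2)] by simp
  show ?thesis
  proof (rule lhom_restrictI[OF P])
    fix x assume x: "x \<in> carrier P"
    show "finsum X (\<lambda>i. \<phi> i x \<odot>\<^bsub>X\<^esub> z i) {..<n} \<in> carrier X"
      by (rule XG.finsum_closed) (use c x z in auto)
  next
    fix x y assume xy: "x \<in> carrier P" "y \<in> carrier P"
    have "finsum X (\<lambda>i. \<phi> i (x \<oplus>\<^bsub>P\<^esub> y) \<odot>\<^bsub>X\<^esub> z i) {..<n}
        = finsum X (\<lambda>i. \<phi> i x \<odot>\<^bsub>X\<^esub> z i \<oplus>\<^bsub>X\<^esub> \<phi> i y \<odot>\<^bsub>X\<^esub> z i) {..<n}"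
      by (rule XG.finsum_cong') (use c xy z lhom_add[OF \<phi>] in \<open>auto simp: X.smult_l_distr\<close>)
    also have "\<dots> = finsum X (\<lambda>i. \<phi> i x \<odot>\<^bsub>X\<^esub> z i) {..<n} \<oplus>\<^bsub>X\<^esub> finsum X (\<lambda>i. \<phi> i y \<odot>\<^bsub>X\<^esub> z i) {..<n}"
      by (rule XG.finsum_addf) (use c xy z in auto)
    finally show "finsum X (\<lambda>i. \<phi> i (x \<oplus>\<^bsub>P\<^esub> y) \<odot>\<^bsub>X\<^esub> z i) {..<n} = \<dots>" .
  next
    fix a y assume ay: "a \<in> carrier A" "y \<in> carrier P"
    have "a \<odot>\<^bsub>X\<^esub> finsum X (\<lambda>i. \<phi> i y \<odot>\<^bsub>X\<^esub> z i) {..<n}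
        = finsum X (\<lambda>i. a \<odot>\<^bsub>X\<^esub> (\<phi> i y \<odot>\<^bsub>X\<^esub> z i)) {..<n}"
      by (rule X.smult_finsum) (use c ay z in auto)
    also have "\<dots> = finsum X (\<lambda>i. \<phi> i (a \<odot>\<^bsub>P\<^esub> y) \<odot>\<^bsub>X\<^esub> z i) {..<n}"
      by (rule XG.finsum_cong') (use c ay z lhom_smult[OF \<phi>] in \<open>auto simp: X.smult_assoc\<close>)
    finally show "finsum X (\<lambda>i. \<phi> i (a \<odot>\<^bsub>P\<^esub> y) \<odot>\<^bsub>X\<^esub> z i) {..<n} =
      a \<odot>\<^bsub>X\<^esub> finsum X (\<lambda>i. \<phi> i y \<odot>\<^bsub>X\<^esub> z i) {..<n}" ..
  qed
qed

lemma lhom_dual_basis_expand: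
  assumes b: "dual_basis A P n x \<phi>" and X: "left_module A X" and f: "f \<in> lhom A P X"
    and y: "y \<in> carrier P"
  shows "f y = finsum X (\<lambda>i. \<phi> i y \<odot>\<^bsub>X\<^esub> f (x i)) {..<n}"
proof -
  have P: "left_module A P" and x: "\<And>i. i < n \<Longrightarrow> x i \<in> carrier P"
    and \<phi>: "\<And>i. i < n \<Longrightarrow> \<phi> i \<in> lhom A P (regular A)"
    and e: "y = finsum P (\<lambda>i. \<phi> i y \<odot>\<^bsub>P\<^esub> x i) {..<n}"
    using b y by (auto simp: dual_basis_def)
  interpret P: left_module A P by fact
  interpret XG: abelian_group X using X by (rule left_module_abelian_group)
  interpret X: left_module A X by fact
  have c: "\<phi> i y \<in> carrier A" if "i < n" for i
    using lhom_closed[OF \<phi>[OF that(1)] y] by simp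
  have "f y = f (finsum P (\<lambda>i. \<phi> i y \<odot>\<^bsub>P\<^esub> x i) {..<n})" using e by simp
  also have "\<dots> = finsum X (\<lambda>i. f (\<phi> i y \<odot>\<^bsub>P\<^esub> x i)) {..<n}"
    by (rule lhom_finsum[OF P X f]) (use c x in auto)
  also have "\<dots> = finsum X (\<lambda>i. \<phi> i y \<odot>\<^bsub>X\<^esub> f (x i)) {..<n}"
    by (rule XG.finsum_cong') (use c x lhom_smult[OF f] lhom_closed[OF f] in auto)
  finally show ?thesis .
qed

text \<open>Preimages of the finitely many f (x i) suffice, since the functionals of the dual basis
  combine them into a linear map. In contrast to the definition of \<open>proj_modules\<close>, X
  and Y may have any carrier types.\<close>

lemma dual_basis_lift:
  assumes P: "has_dual_basis A P" and X: "left_module A X" and Y: "left_module A Y"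
    and g: "g \<in> lhom A X Y" "g ` carrier X = carrier Y" and f: "f \<in> lhom A P Y"
  shows "\<exists>h\<in>lhom A P X. \<forall>x\<in>carrier P. g (h x) = f x"
proof -
  obtain n x \<phi> where b: "dual_basis A P n x \<phi>" using P by (auto simp: has_dual_basis_def)
  have PM: "left_module A P" and x: "\<And>i. i < n \<Longrightarrow> x i \<in> carrier P"
    and \<phi>: "\<And>i. i < n \<Longrightarrow> \<phi> i \<in> lhom A P (regular A)"
    using b by (auto simp: dual_basis_def)
  interpret X: left_module A X by fact
  interpret YG: abelian_group Y using Y by (rule left_module_abelian_group)
  interpret Y: left_module A Y by fact
  have "\<forall>i. \<exists>z. i < n \<longrightarrow> z \<in> carrier X \<and> g z = f (x i)"
    using g(2) lhom_closed[OF f x] by (metis imageE)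
  then obtain z where z: "\<And>i. i < n \<Longrightarrow> z i \<in> carrier X" "\<And>i. i < n \<Longrightarrow> g (z i) = f (x i)" by metis
  define h where "h = (\<lambda>y\<in>carrier P. finsum X (\<lambda>i. \<phi> i y \<odot>\<^bsub>X\<^esub> z i) {..<n})"
  have "h \<in> lhom A P X" unfolding h_def by (rule lhom_combination[OF PM X \<phi> z(1)])
  moreover have "g (h y) = f y" if y: "y \<in> carrier P" for y
  proof -
    have c: "\<phi> i y \<in> carrier A" if "i < n" for i
      using lhom_closed[OF \<phi>[OF that(1)] y] by simp
    have "g (h y) = finsum Y (\<lambda>i. g (\<phi> i y \<odot>\<^bsub>X\<^esub> z i)) {..<n}"
      unfolding h_def using y by simp (rule lhom_finsum[OF X Y g(1)], use c z in auto)
    also have "\<dots> = finsum Y (\<lambda>i. \<phi> i y \<odot>\<^bsub>Y\<^esub> f (x i)) {..<n}"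
      by (rule YG.finsum_cong') (use c x z lhom_smult[OF g(1)] lhom_closed[OF f] in auto)
    also have "\<dots> = f y" by (rule lhom_dual_basis_expand[OF b Y f y, symmetric])
    finally show ?thesis .
  qed
  ultimately show ?thesis by blast
qed

text \<open>The generators are pushed along r and the functionals are pulled back along s.\<close>

lemma has_dual_basis_retract:
  assumes F: "has_dual_basis A F" and P: "left_module A P" and r: "r \<in> lhom A F P" and s: "s \<in> lhom A P F"
    and rs: "\<And>x. x \<in> carrier P \<Longrightarrow> r (s x) = x"
  shows "has_dual_basis A P"
proof -
  obtain n x \<phi> where b: "dual_basis A F n x \<phi>" using F by (auto simp: has_dual_basis_def)
  have x: "\<And>i. i < n \<Longrightarrow> x i \<in> carrier F"
    and \<phi>: "\<And>i. i < n \<Longrightarrow> \<phi> i \<in> lhom A F (regular A)"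
    using b by (auto simp: dual_basis_def)
  interpret P: abelian_group P using P by (rule left_module_abelian_group)
  have "dual_basis A P n (\<lambda>i. r (x i)) (\<lambda>i. compose (carrier P) (\<phi> i) s)"
    unfolding dual_basis_def
  proof (intro conjI allI impI ballI P)
    fix y assume y: "y \<in> carrier P"
    have "y = r (s y)" using rs y by simp
    also have "\<dots> = finsum P (\<lambda>i. \<phi> i (s y) \<odot>\<^bsub>P\<^esub> r (x i)) {..<n}"
      by (rule lhom_dual_basis_expand[OF b P r]) (rule lhom_closed[OF s y])
    finally show "y = finsum P (\<lambda>i. compose (carrier P) (\<phi> i) s y \<odot>\<^bsub>P\<^esub> r (x i)) {..<n}"
      using y by (simp add: compose_eq)
  qed (simp_all add: lhom_closed[OF r x] lhom_compose[OF P s \<phi>])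
  then show ?thesis by (auto simp: has_dual_basis_def)
qed

lemma has_dual_basis_regular:
  assumes "ring A"
  shows "has_dual_basis A (regular A)"
proof -
  interpret ring A by fact
  have L: "left_module A (regular A)" by (rule left_module_regular) fact
  interpret L: abelian_group "regular A" using L by (rule left_module_abelian_group)
  \<comment> \<open>One generator suffices: x is x times 1, with the identity as coefficient
    functional.\<close>
  have "dual_basis A (regular A) (Suc 0) (\<lambda>_. \<one>\<^bsub>A\<^esub>) (\<lambda>_. \<lambda>x\<in>carrier A. x)"
    unfolding dual_basis_def using L lhom_id[OF L] by (simp add: lessThan_Suc)
  then show ?thesis by (auto simp: has_dual_basis_def)
qed

section \<open>Free modules of finite rank\<close>

definition free_module :: "('a, 'x) ring_scheme \<Rightarrow> nat \<Rightarrow> ('a, nat \<Rightarrow> 'a) module" where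
  "free_module A n = \<lparr>carrier = {..<n} \<rightarrow>\<^sub>E carrier A, mult = undefined, one = undefined,
     zero = (\<lambda>i\<in>{..<n}. \<zero>\<^bsub>A\<^esub>), add = (\<lambda>c d. \<lambda>i\<in>{..<n}. c i \<oplus>\<^bsub>A\<^esub> d i),
     smult = (\<lambda>a c. \<lambda>i\<in>{..<n}. a \<otimes>\<^bsub>A\<^esub> c i)\<rparr>"

lemma free_module_simps:
  "carrier (free_module A n) = {..<n} \<rightarrow>\<^sub>E carrier A"
  "\<zero>\<^bsub>free_module A n\<^esub> = (\<lambda>i\<in>{..<n}. \<zero>\<^bsub>A\<^esub>)"
  "c \<oplus>\<^bsub>free_module A n\<^esub> d = (\<lambda>i\<in>{..<n}. c i \<oplus>\<^bsub>A\<^esub> d i)"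
  "a \<odot>\<^bsub>free_module A n\<^esub> c = (\<lambda>i\<in>{..<n}. a \<otimes>\<^bsub>A\<^esub> c i)"
  by (simp_all add: free_module_def)

lemma free_module_eqI:
  assumes "c \<in> carrier (free_module A n)" "d \<in> carrier (free_module A n)" "\<And>i. i < n \<Longrightarrow> c i = d i"
  shows "c = d"
  using assms unfolding free_module_simps by (intro PiE_ext[of c "{..<n}" "\<lambda>_. carrier A" d]) simp_all

lemma free_module_nth: "c \<in> carrier (free_module A n) \<Longrightarrow> i < n \<Longrightarrow> c i \<in> carrier A"
  unfolding free_module_simps by (erule PiE_mem) simp

lemma restrict_in_free_module: "(\<And>i. i < n \<Longrightarrow> c i \<in> carrier A) \<Longrightarrow> (\<lambda>i\<in>{..<n}. c i) \<in> carrier (free_module A n)"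
  unfolding free_module_simps restrict_PiE_iff by simp

lemma left_module_free_module:
  assumes "ring A"
  shows "left_module A (free_module A n)"
proof -
  interpret ring A by fact
  note nth = free_module_nth[of _ A n]
  have ac: "c \<oplus>\<^bsub>free_module A n\<^esub> d \<in> carrier (free_module A n)"
    if "c \<in> carrier (free_module A n)" "d \<in> carrier (free_module A n)" for c d
    unfolding free_module_simps(3) by (rule restrict_in_free_module) (simp add: nth that)
  have sc: "a \<odot>\<^bsub>free_module A n\<^esub> d \<in> carrier (free_module A n)"
    if "a \<in> carrier A" "d \<in> carrier (free_module A n)" for a d
    unfolding free_module_simps(4) by (rule restrict_in_free_module) (simp add: nth that)
  have zc: "\<zero>\<^bsub>free_module A n\<^esub> \<in> carrier (free_module A n)"
    unfolding free_module_simps(2) by (rule restrict_in_free_module) simp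
  have "abelian_group (free_module A n)"
  proof (rule abelian_groupI)
    fix x assume x: "x \<in> carrier (free_module A n)"
    let ?y = "\<lambda>i\<in>{..<n}. \<ominus>\<^bsub>A\<^esub> x i"
    have y: "?y \<in> carrier (free_module A n)"
      by (rule restrict_in_free_module) (simp add: nth x)
    have "?y \<oplus>\<^bsub>free_module A n\<^esub> x = \<zero>\<^bsub>free_module A n\<^esub>"
      by (rule free_module_eqI[OF ac[OF y x] zc]) (simp add: free_module_simps(2-4) nth x l_neg)
    from this y show "\<exists>y\<in>carrier (free_module A n). y \<oplus>\<^bsub>free_module A n\<^esub> x = \<zero>\<^bsub>free_module A n\<^esub>"
      by (rule bexI)
  next
    fix x y z assume "x \<in> carrier (free_module A n)" "y \<in> carrier (free_module A n)"
      "z \<in> carrier (free_module A n)"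
    then show "x \<oplus>\<^bsub>free_module A n\<^esub> y \<oplus>\<^bsub>free_module A n\<^esub> z =
        x \<oplus>\<^bsub>free_module A n\<^esub> (y \<oplus>\<^bsub>free_module A n\<^esub> z)"
      by (intro free_module_eqI[of _ A n] ac) (simp_all add: free_module_simps(2-4) nth a_ac)
  next
    fix x y assume "x \<in> carrier (free_module A n)" "y \<in> carrier (free_module A n)"
    then show "x \<oplus>\<^bsub>free_module A n\<^esub> y = y \<oplus>\<^bsub>free_module A n\<^esub> x"
      by (intro free_module_eqI[of _ A n] ac) (simp_all add: free_module_simps(2-4) nth a_ac)
  next
    fix x assume "x \<in> carrier (free_module A n)"
    then show "\<zero>\<^bsub>free_module A n\<^esub> \<oplus>\<^bsub>free_module A n\<^esub> x = x"
      by (intro free_module_eqI[of _ A n] ac zc) (simp_all add: free_module_simps(2-4) nth)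
  qed (simp_all only: ac zc)
  then show ?thesis
  proof (intro left_module.intro left_module_axioms.intro ring_axioms sc)
    fix a b x assume *: "a \<in> carrier A" "b \<in> carrier A" "x \<in> carrier (free_module A n)"
    show "(a \<oplus>\<^bsub>A\<^esub> b) \<odot>\<^bsub>free_module A n\<^esub> x =
        a \<odot>\<^bsub>free_module A n\<^esub> x \<oplus>\<^bsub>free_module A n\<^esub> b \<odot>\<^bsub>free_module A n\<^esub> x"
      by (rule free_module_eqI[OF sc ac[OF sc sc]])
        (use * in \<open>simp_all add: free_module_simps(2-4) nth l_distr\<close>)
    show "(a \<otimes>\<^bsub>A\<^esub> b) \<odot>\<^bsub>free_module A n\<^esub> x =
        a \<odot>\<^bsub>free_module A n\<^esub> (b \<odot>\<^bsub>free_module A n\<^esub> x)"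
      by (rule free_module_eqI[OF sc sc[OF _ sc]])
        (use * in \<open>simp_all add: free_module_simps(2-4) nth m_assoc\<close>)
  next
    fix a x y assume *: "a \<in> carrier A" "x \<in> carrier (free_module A n)" "y \<in> carrier (free_module A n)"
    show "a \<odot>\<^bsub>free_module A n\<^esub> (x \<oplus>\<^bsub>free_module A n\<^esub> y) =
        a \<odot>\<^bsub>free_module A n\<^esub> x \<oplus>\<^bsub>free_module A n\<^esub> a \<odot>\<^bsub>free_module A n\<^esub> y"
      by (rule free_module_eqI[OF sc[OF _ ac] ac[OF sc sc]])
        (use * in \<open>simp_all add: free_module_simps(2-4) nth r_distr\<close>)
  next
    fix x assume "x \<in> carrier (free_module A n)"
    then show "\<one>\<^bsub>A\<^esub> \<odot>\<^bsub>free_module A n\<^esub> x = x"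
      by (intro free_module_eqI[of _ A n] sc) (simp_all add: free_module_simps(2-4) nth)
  qed
qed

lemma finsum_free_module:
  assumes "ring A" and g: "\<And>k. k < m \<Longrightarrow> g k \<in> carrier (free_module A n)" and i: "i < n"
  shows "finsum (free_module A n) g {..<m::nat} i = finsum A (\<lambda>k. g k i) {..<m}"
  using g
proof (induction m)
  case 0
  interpret ring A by fact
  interpret F: abelian_group "free_module A n"
    using left_module_free_module[OF assms(1)] by (rule left_module_abelian_group)
  show ?case using i by (simp add: free_module_simps(2))
next
  case (Suc m)
  interpret ring A by fact
  interpret F: abelian_group "free_module A n"
    using left_module_free_module[OF assms(1)] by (rule left_module_abelian_group)
  have "finsum (free_module A n) g {..<Suc m} i = (g m \<oplus>\<^bsub>free_module A n\<^esub> finsum (free_module A n) g {..<m}) i"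
    using Suc.prems by (simp add: lessThan_Suc Pi_def)
  also have "\<dots> = g m i \<oplus>\<^bsub>A\<^esub> finsum A (\<lambda>k. g k i) {..<m}"
    using Suc i by (simp add: free_module_simps(3))
  also have "\<dots> = finsum A (\<lambda>k. g k i) {..<Suc m}"
    using free_module_nth[OF Suc.prems i] by (simp add: lessThan_Suc Pi_def)
  finally show ?case .
qed

lemma has_dual_basis_free_module:
  assumes "ring A"
  shows "\<exists>x. dual_basis A (free_module A n) n x (\<lambda>i. \<lambda>c\<in>carrier (free_module A n). c i)"
proof -
  interpret ring A by fact
  have F: "left_module A (free_module A n)" by (rule left_module_free_module) fact
  define x where "x k = (\<lambda>i\<in>{..<n}. if i = k then \<one>\<^bsub>A\<^esub> else \<zero>\<^bsub>A\<^esub>)" for k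
  have x: "x k \<in> carrier (free_module A n)" for k unfolding x_def by (rule restrict_in_free_module) simp
  interpret F: abelian_group "free_module A n" using F by (rule left_module_abelian_group)
  have "dual_basis A (free_module A n) n x (\<lambda>i. \<lambda>c\<in>carrier (free_module A n). c i)"
    unfolding dual_basis_def
  proof (intro conjI allI impI ballI F x)
    fix i assume "i < n"
    then show "(\<lambda>c\<in>carrier (free_module A n). c i) \<in> lhom A (free_module A n) (regular A)"
      by (intro lhom_restrictI[OF F]) (simp_all add: free_module_simps(2-4) free_module_nth)
  next
    fix y assume y: "y \<in> carrier (free_module A n)"
    let ?s = "finsum (free_module A n) (\<lambda>k. y k \<odot>\<^bsub>free_module A n\<^esub> x k) {..<n}"
    have c: "y k \<odot>\<^bsub>free_module A n\<^esub> x k \<in> carrier (free_module A n)" if "k < n" for k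
      by (rule left_module.smult_closed[OF F free_module_nth[OF y that] x])
    have "?s i = y i" if i: "i < n" for i
    proof -
      have "?s i = finsum A (\<lambda>k. (y k \<odot>\<^bsub>free_module A n\<^esub> x k) i) {..<n}"
        by (rule finsum_free_module[OF assms c i])
      also have "\<dots> = finsum A (\<lambda>k. if i = k then y k else \<zero>\<^bsub>A\<^esub>) {..<n}"
        by (rule finsum_cong') (use i in \<open>auto simp: free_module_simps(2-4) x_def free_module_nth[OF y]\<close>)
      also have "\<dots> = y i"
        by (rule finsum_singleton) (use i in \<open>auto simp: free_module_nth[OF y]\<close>)
      finally show ?thesis .
    qed
    moreover have "?s \<in> carrier (free_module A n)"
      by (rule F.finsum_closed) (use c in auto)
    ultimately have "y = ?s" by (intro free_module_eqI[OF y]) (simp_all only:)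
    then show "y = finsum (free_module A n) (\<lambda>i. (\<lambda>c\<in>carrier (free_module A n). c i) y \<odot>\<^bsub>free_module A n\<^esub> x i) {..<n}"
      using y by simp
  qed
  then show ?thesis by blast
qed

section \<open>Submodules and finite generation\<close>

lemma submoduleD:
  assumes "submodule N A M"
  shows submodule_subset: "N \<subseteq> carrier M" and submodule_zero: "\<zero>\<^bsub>M\<^esub> \<in> N"
    and submodule_add: "x \<in> N \<Longrightarrow> y \<in> N \<Longrightarrow> x \<oplus>\<^bsub>M\<^esub> y \<in> N"
    and submodule_smult: "a \<in> carrier A \<Longrightarrow> x \<in> N \<Longrightarrow> a \<odot>\<^bsub>M\<^esub> x \<in> N"
    and submodule_neg: "x \<in> N \<Longrightarrow> \<ominus>\<^bsub>M\<^esub> x \<in> N"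
proof -
  note g = submodule.axioms(1)[OF assms]
  show "N \<subseteq> carrier M" using subgroup.subset[OF g] by simp
  show "\<zero>\<^bsub>M\<^esub> \<in> N" using subgroup.one_closed[OF g] by simp
  show "x \<in> N \<Longrightarrow> y \<in> N \<Longrightarrow> x \<oplus>\<^bsub>M\<^esub> y \<in> N" using subgroup.m_closed[OF g] by simp
  show "x \<in> N \<Longrightarrow> \<ominus>\<^bsub>M\<^esub> x \<in> N" using subgroup.m_inv_closed[OF g] by (simp add: a_inv_def)
  show "a \<in> carrier A \<Longrightarrow> x \<in> N \<Longrightarrow> a \<odot>\<^bsub>M\<^esub> x \<in> N" by (rule submodule.smult_closed[OF assms])
qed

lemma submod_simps [simp]:
  "carrier (submod M N) = N" "\<zero>\<^bsub>submod M N\<^esub> = \<zero>\<^bsub>M\<^esub>"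
  "x \<oplus>\<^bsub>submod M N\<^esub> y = x \<oplus>\<^bsub>M\<^esub> y" "a \<odot>\<^bsub>submod M N\<^esub> x = a \<odot>\<^bsub>M\<^esub> x"
  by (simp_all add: submod_def)

lemma left_module_submod:
  assumes M: "left_module A M" and N: "submodule N A M"
  shows "left_module A (submod M N)"
proof -
  interpret MG: abelian_group M using M by (rule left_module_abelian_group)
  interpret M: left_module A M by fact
  note [simp] = submodule_zero[OF N] submodule_add[OF N] submodule_smult[OF N] submodule_neg[OF N]
  have c: "x \<in> N \<Longrightarrow> x \<in> carrier M" for x using submodule_subset[OF N] by blast
  have "abelian_group (submod M N)"
  proof (rule abelian_groupI)
    fix x assume "x \<in> carrier (submod M N)"
    then show "\<exists>y\<in>carrier (submod M N). y \<oplus>\<^bsub>submod M N\<^esub> x = \<zero>\<^bsub>submod M N\<^esub>"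
      by (intro bexI[of _ "\<ominus>\<^bsub>M\<^esub> x"]) (simp_all add: MG.l_neg c)
  qed (simp_all add: MG.a_ac c)
  then show ?thesis
    by (intro left_module.intro left_module_axioms.intro left_module_ring[OF M])
      (simp_all add: c M.smult_l_distr M.smult_r_distr M.smult_assoc)
qed

lemma lhom_submod_incl:
  assumes M: "left_module A M" and N: "submodule N A M"
  shows "(\<lambda>x\<in>N. x) \<in> lhom A (submod M N) M"
proof -
  have "(\<lambda>x\<in>carrier (submod M N). x) \<in> lhom A (submod M N) M"
    by (rule lhom_restrictI[OF left_module_submod[OF M N]]) (use submodule_subset[OF N] in auto)
  then show ?thesis by simp
qed

lemma submodule_image:
  assumes M: "left_module A M" and N: "left_module A N" and f: "f \<in> lhom A M N"
  shows "submodule (f ` carrier M) A N"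
proof (rule left_module.submodule_criterion[OF N])
  show "\<zero>\<^bsub>N\<^esub> \<in> f ` carrier M"
    by (rule image_eqI[of _ f, OF lhom_zero[OF M N f, symmetric] left_module_zero_closed[OF M]])
  fix x y assume "x \<in> f ` carrier M" "y \<in> f ` carrier M"
  then obtain u v where uv: "u \<in> carrier M" "v \<in> carrier M" "x = f u" "y = f v" by blast
  then show "x \<oplus>\<^bsub>N\<^esub> y \<in> f ` carrier M"
    by (intro image_eqI[of _ f, OF _ left_module_add_closed[OF M uv(1,2)]]) (simp add: lhom_add[OF f])
next
  fix a x assume a: "a \<in> carrier A" and "x \<in> f ` carrier M"
  then obtain u where u: "u \<in> carrier M" "x = f u" by blast
  then show "a \<odot>\<^bsub>N\<^esub> x \<in> f ` carrier M"
    by (intro image_eqI[of _ f, OF _ left_module.smult_closed[OF M a u(1)]]) (simp add: lhom_smult[OF f a])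
qed (use lhom_closed[OF f] in blast)

lemma submodule_vimage:
  assumes M: "left_module A M" and N: "left_module A N" and f: "f \<in> lhom A M N" and U: "submodule U A N"
  shows "submodule {x \<in> carrier M. f x \<in> U} A M"
proof (rule left_module.submodule_criterion[OF M])
  show "\<zero>\<^bsub>M\<^esub> \<in> {x \<in> carrier M. f x \<in> U}"
    using lhom_zero[OF M N f] left_module_zero_closed[OF M] submodule_zero[OF U] by simp
next
  fix x y assume "x \<in> {x \<in> carrier M. f x \<in> U}" "y \<in> {x \<in> carrier M. f x \<in> U}"
  then show "x \<oplus>\<^bsub>M\<^esub> y \<in> {x \<in> carrier M. f x \<in> U}"
    using lhom_add[OF f] left_module_add_closed[OF M] submodule_add[OF U] by simp
next
  fix a x assume "a \<in> carrier A" "x \<in> {x \<in> carrier M. f x \<in> U}"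
  then show "a \<odot>\<^bsub>M\<^esub> x \<in> {x \<in> carrier M. f x \<in> U}"
    using lhom_smult[OF f] left_module.smult_closed[OF M] submodule_smult[OF U] by simp
qed simp

lemma submodule_zero_set:
  assumes M: "left_module A M"
  shows "submodule {\<zero>\<^bsub>M\<^esub>} A M"
proof -
  interpret M: abelian_group M using M by (rule left_module_abelian_group)
  show ?thesis
    by (rule left_module.submodule_criterion[OF M]) (simp_all add: left_module.smult_r_null[OF M])
qed

lemma submodule_kernel:
  assumes M: "left_module A M" and N: "left_module A N" and f: "f \<in> lhom A M N"
  shows "submodule (a_kernel M N f) A M"
  using submodule_vimage[OF M N f submodule_zero_set[OF N]] by (simp add: a_kernel_def')

lemma submodule_finsum:
  assumes M: "left_module A M" and U: "submodule U A M" and I: "finite I" "\<And>i. i \<in> I \<Longrightarrow> g i \<in> U"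
  shows "finsum M g I \<in> U"
proof -
  interpret M: abelian_group M using M by (rule left_module_abelian_group)
  show ?thesis using I
  proof (induction I rule: finite_induct)
    case (insert i I)
    then have "g \<in> I \<rightarrow> carrier M" "g i \<in> carrier M" using submodule_subset[OF U] by auto
    then show ?case using insert submodule_add[OF U] by simp
  qed (simp add: submodule_zero[OF U])
qed

lemma finitely_generated_image:
  assumes M: "left_module A M" and N: "left_module A N" and f: "f \<in> lhom A M N"
    and surj: "f ` carrier M = carrier N" and fg: "finitely_generated A M"
  shows "finitely_generated A N"
proof -
  obtain S where S: "finite S" "S \<subseteq> carrier M"
    and gen: "\<And>T. submodule T A M \<Longrightarrow> S \<subseteq> T \<Longrightarrow> T = carrier M"
    using fg unfolding finitely_generated_def by (elim exE conjE) simp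
  show ?thesis unfolding finitely_generated_def
  proof (intro exI[of _ "f ` S"] conjI allI impI)
    fix T assume T: "submodule T A N \<and> f ` S \<subseteq> T"
    then have sT: "submodule T A N" and fS: "f ` S \<subseteq> T" by auto
    have "{x \<in> carrier M. f x \<in> T} = carrier M"
      by (rule gen[OF submodule_vimage[OF M N f sT]]) (use S fS in blast)
    then have "f ` carrier M \<subseteq> T" by blast
    then show "T = carrier N" using submodule_subset[OF sT] unfolding surj by (rule equalityI[rotated])
  next
    show "f ` S \<subseteq> carrier N" using S(2) unfolding surj[symmetric] by (rule image_mono)
  qed (rule finite_imageI[OF S(1)])
qed

lemma dual_basis_finitely_generated:
  assumes "has_dual_basis A P"
  shows "finitely_generated A P"
proof -
  obtain n x \<phi> where b: "dual_basis A P n x \<phi>" using assms by (auto simp: has_dual_basis_def)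
  have P: "left_module A P" and x: "\<And>i. i < n \<Longrightarrow> x i \<in> carrier P"
    and \<phi>: "\<And>i. i < n \<Longrightarrow> \<phi> i \<in> lhom A P (regular A)"
    and e: "\<And>y. y \<in> carrier P \<Longrightarrow> y = finsum P (\<lambda>i. \<phi> i y \<odot>\<^bsub>P\<^esub> x i) {..<n}"
    using b by (auto simp: dual_basis_def)
  show ?thesis unfolding finitely_generated_def
  proof (intro exI[of _ "x ` {..<n}"] conjI allI impI)
    fix T assume T: "submodule T A P \<and> x ` {..<n} \<subseteq> T"
    have "y \<in> T" if "y \<in> carrier P" for y
    proof -
      have xT: "x i \<in> T" if "i < n" for i using T that by auto
      have "finsum P (\<lambda>i. \<phi> i y \<odot>\<^bsub>P\<^esub> x i) {..<n} \<in> T"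
        using T lhom_closed[OF \<phi> that] xT
        by (intro submodule_finsum[OF P] submodule_smult[of T A P]) simp_all
      then show ?thesis by (subst e[OF that])
    qed
    then show "T = carrier P" using T submodule_subset by blast
  qed (use x in auto)
qed

text \<open>The unit vectors are sent to the chosen generators, and an image is a submodule, so it
  is everything.\<close>

lemma finitely_generated_free_surjection:
  assumes M: "left_module A M" and fg: "finitely_generated A M"
  shows "\<exists>n. \<exists>f\<in>lhom A (free_module A n) M. f ` carrier (free_module A n) = carrier M"
proof -
  interpret MG: abelian_group M using M by (rule left_module_abelian_group)
  interpret M: left_module A M by fact
  obtain S where S: "finite S" "S \<subseteq> carrier M"
    and gen: "\<And>T. submodule T A M \<Longrightarrow> S \<subseteq> T \<Longrightarrow> T = carrier M"
    using fg unfolding finitely_generated_def by (elim exE conjE) simp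
  obtain z where z: "bij_betw z {0..<card S} S"
    using ex_bij_betw_nat_finite[OF S(1)] by blast
  define n where "n = card S"
  have zc: "z i \<in> carrier M" if "i < n" for i
    using that z S by (auto simp: n_def bij_betw_def)
  note F = left_module_free_module[OF left_module_ring[OF M], of n]
  have ev: "(\<lambda>c\<in>carrier (free_module A n). c i) \<in> lhom A (free_module A n) (regular A)" if "i < n" for i
    using has_dual_basis_free_module[OF left_module_ring[OF M], of n] that by (auto simp: dual_basis_def)
  define f where "f = (\<lambda>y\<in>carrier (free_module A n). finsum M (\<lambda>i. (\<lambda>c\<in>carrier (free_module A n). c i) y \<odot>\<^bsub>M\<^esub> z i) {..<n})"
  have f: "f \<in> lhom A (free_module A n) M"
    unfolding f_def by (rule lhom_combination[OF F M ev zc])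
  have "z k \<in> f ` carrier (free_module A n)" if k: "k < n" for k
  proof
    let ?c = "\<lambda>i\<in>{..<n}. if i = k then \<one>\<^bsub>A\<^esub> else \<zero>\<^bsub>A\<^esub>"
    show c: "?c \<in> carrier (free_module A n)"
      by (rule restrict_in_free_module) simp
    have "f ?c = finsum M (\<lambda>i. ?c i \<odot>\<^bsub>M\<^esub> z i) {..<n}"
      unfolding f_def using c by simp
    also have "\<dots> = finsum M (\<lambda>i. if k = i then z i else \<zero>\<^bsub>M\<^esub>) {..<n}"
      by (rule MG.finsum_cong') (use zc in \<open>auto simp: M.smult_l_null\<close>)
    also have "\<dots> = z k" by (rule MG.finsum_singleton) (use zc k in auto)
    finally show "z k = f ?c" ..
  qed
  then have "S \<subseteq> f ` carrier (free_module A n)"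
    unfolding bij_betw_imp_surj_on[OF z, folded n_def, symmetric] by (simp add: image_subset_iff)
  then have "f ` carrier (free_module A n) = carrier M"
    by (rule gen[OF submodule_image[OF F M f]])
  with f show ?thesis by blast
qed

text \<open>The bridge from arbitrary carrier types to the one type of \<open>fg_modules\<close>;
  the two-sided inverse carries maps in both directions.\<close>

lemma fg_module_copy:
  fixes M :: "('a, 'm) module"
  assumes M: "left_module A M" and fg: "finitely_generated A M"
  obtains N f g where "N \<in> fg_modules A" "f \<in> lhom A M N" "g \<in> lhom A N M"
    "\<And>x. x \<in> carrier M \<Longrightarrow> g (f x) = x" "\<And>y. y \<in> carrier N \<Longrightarrow> f (g y) = y"
proof -
  obtain N f where N: "N \<in> fg_modules A" and f: "f \<in> lhom A M N" "bij_betw f (carrier M) (carrier N)"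
    using fg_modules_dense[OF assms] by blast
  then have "left_module A N" by (simp add: fg_modules_def)
  then obtain g where g: "g \<in> lhom A N M" "\<forall>x\<in>carrier M. g (f x) = x" "\<forall>y\<in>carrier N. f (g y) = y"
    using lhom_inverse[OF M _ f] by blast
  show ?thesis by (rule that[OF N f(1) g(1) bspec[OF g(2)] bspec[OF g(3)]])
qed

section \<open>Projective modules and dual bases\<close>

lemma fg_modulesD: "M \<in> fg_modules A \<Longrightarrow> left_module A M" "M \<in> fg_modules A \<Longrightarrow> finitely_generated A M"
  by (auto simp: fg_modules_def)

lemma proj_modules_lift:
  assumes "P \<in> proj_modules A" "X \<in> fg_modules A" "Y \<in> fg_modules A"
    and "g \<in> lhom A X Y" "f \<in> lhom A P Y" "g ` carrier X = carrier Y"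
  shows "\<exists>h\<in>lhom A P X. \<forall>x\<in>carrier P. g (h x) = f x"
  using assms unfolding proj_modules_def by simp

text \<open>A projective module is a retract of a free one, where unit vectors and coordinates form
  a dual basis. The elements of the free module have type \<open>nat \<Rightarrow> 'a\<close>, so
  the lifting property of P is applied to a copy G of it.\<close>

lemma proj_modules_iff:
  fixes P :: "'a umod"
  shows "P \<in> proj_modules A \<longleftrightarrow> has_dual_basis A P"
proof
  assume P: "has_dual_basis A P"
  have "P \<in> fg_modules A"
    unfolding fg_modules_def using P by (simp add: has_dual_basis_module dual_basis_finitely_generated)
  then show "P \<in> proj_modules A"
    unfolding proj_modules_def
    by (intro CollectI conjI ballI impI dual_basis_lift[OF P fg_modulesD(1) fg_modulesD(1)]) simp_all
next
  assume P: "P \<in> proj_modules A"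
  then have PM: "left_module A P" and fg: "finitely_generated A P" and Pf: "P \<in> fg_modules A"
    by (auto simp: proj_modules_def fg_modules_def)
  obtain n f where f: "f \<in> lhom A (free_module A n) P" "f ` carrier (free_module A n) = carrier P"
    using finitely_generated_free_surjection[OF PM fg] by blast
  let ?F = "free_module A n"
  have F: "has_dual_basis A ?F"
    using has_dual_basis_free_module[OF left_module_ring[OF PM]] unfolding has_dual_basis_def by blast
  note FM = has_dual_basis_module[OF F]
  obtain G a b where G: "G \<in> fg_modules A" and a: "a \<in> lhom A ?F G" and b: "b \<in> lhom A G ?F"
    and ba: "\<And>x. x \<in> carrier ?F \<Longrightarrow> b (a x) = x"
    by (rule fg_module_copy[OF FM dual_basis_finitely_generated[OF F]]) (rule that)
  let ?g = "compose (carrier G) f b"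
  have g: "?g \<in> lhom A G P" by (rule lhom_compose[OF fg_modulesD(1)[OF G] b f(1)])
  have "b ` carrier G = carrier ?F"
    using image_eqI[of _ b, OF ba[symmetric] lhom_closed[OF a]] lhom_closed[OF b] by auto
  then have "?g ` carrier G = carrier P"
    using f(2) by (simp add: compose_def image_image[symmetric])
  then obtain h where h: "h \<in> lhom A P G" "\<forall>x\<in>carrier P. ?g (h x) = (\<lambda>x\<in>carrier P. x) x"
    using proj_modules_lift[OF P G Pf g lhom_id[OF PM]] by blast
  show "has_dual_basis A P"
  proof (rule has_dual_basis_retract[OF F PM f(1) lhom_compose[OF PM h(1) b]])
    fix x assume "x \<in> carrier P"
    then show "f (compose (carrier P) b h x) = x"
      using h lhom_closed[OF h(1)] by (auto simp: compose_eq)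
  qed
qed

text \<open>The free module is replaced by a copy G, because it does not have the carrier type of
  \<open>proj_modules\<close>; M itself may have any type.\<close>

lemma projective_surjection:
  fixes M :: "('a, 'm) module"
  assumes M: "left_module A M" and fg: "finitely_generated A M"
  shows "\<exists>P\<in>proj_modules A. \<exists>f\<in>lhom A P M. f ` carrier P = carrier M"
proof -
  obtain n f where f: "f \<in> lhom A (free_module A n) M" "f ` carrier (free_module A n) = carrier M"
    using finitely_generated_free_surjection[OF M fg] by blast
  let ?F = "free_module A n"
  have F: "has_dual_basis A ?F"
    using has_dual_basis_free_module[OF left_module_ring[OF M]] unfolding has_dual_basis_def by blast
  note FM = has_dual_basis_module[OF F]
  obtain G a b where G: "G \<in> fg_modules A" and a: "a \<in> lhom A ?F G" and b: "b \<in> lhom A G ?F"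
    and ba: "\<And>x. x \<in> carrier ?F \<Longrightarrow> b (a x) = x" and ab: "\<And>x. x \<in> carrier G \<Longrightarrow> a (b x) = x"
    by (rule fg_module_copy[OF FM dual_basis_finitely_generated[OF F]]) (rule that)
  note GM = fg_modulesD(1)[OF G]
  have "has_dual_basis A G" by (rule has_dual_basis_retract[OF F GM a b]) (rule ab)
  moreover have "compose (carrier G) f b ` carrier G = carrier M"
  proof -
    have "b ` carrier G = carrier ?F"
      using image_eqI[of _ b, OF ba[symmetric] lhom_closed[OF a]] lhom_closed[OF b] by auto
    moreover have "compose (carrier G) f b ` carrier G = f ` b ` carrier G"
      by (simp add: compose_def image_image)
    ultimately show ?thesis using f(2) by simp
  qed
  ultimately show ?thesis using lhom_compose[OF GM b f(1)]
    by (intro bexI[of _ "compose (carrier G) f b"] bexI[of _ G]) (simp_all add: proj_modules_iff)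
qed


section \<open>Short exact sequences with projective middle term\<close>

text \<open>The three carrier types are independent because the terms range over modules on
  \<open>'a univ\<close>, modules of functionals over the opposite ring, and quotients of
  these.\<close>

record ('a, 'k, 'p, 'c) seq =
  sub :: "('a, 'k) module"
  emb :: "'k \<Rightarrow> 'p"
  mid :: "('a, 'p) module"
  epi :: "'p \<Rightarrow> 'c"
  quo :: "('a, 'c) module"

definition proj_seq :: "('a, 'x) ring_scheme \<Rightarrow> ('a, 'k, 'p, 'c) seq \<Rightarrow> bool" where
  "proj_seq A s \<longleftrightarrow> left_module A (sub s) \<and> has_dual_basis A (mid s) \<and> left_module A (quo s) \<and>
     emb s \<in> lhom A (sub s) (mid s) \<and> inj_on (emb s) (carrier (sub s)) \<and>
     epi s \<in> lhom A (mid s) (quo s) \<and> epi s ` carrier (mid s) = carrier (quo s) \<and>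
     a_kernel (mid s) (quo s) (epi s) = emb s ` carrier (sub s)"

lemma proj_seqD:
  assumes "proj_seq A s"
  shows "left_module A (sub s)" "has_dual_basis A (mid s)" "left_module A (mid s)" "left_module A (quo s)"
    "emb s \<in> lhom A (sub s) (mid s)" "inj_on (emb s) (carrier (sub s))"
    "epi s \<in> lhom A (mid s) (quo s)" "epi s ` carrier (mid s) = carrier (quo s)"
    "\<And>x. x \<in> carrier (mid s) \<Longrightarrow> epi s x = \<zero>\<^bsub>quo s\<^esub> \<longleftrightarrow> x \<in> emb s ` carrier (sub s)"
    "\<And>x. x \<in> carrier (sub s) \<Longrightarrow> epi s (emb s x) = \<zero>\<^bsub>quo s\<^esub>"
    "\<And>x. x \<in> carrier (sub s) \<Longrightarrow> emb s x \<in> carrier (mid s)"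
    "\<And>x. x \<in> carrier (mid s) \<Longrightarrow> epi s x \<in> carrier (quo s)"
proof -
  show "left_module A (sub s)" "has_dual_basis A (mid s)" "left_module A (quo s)"
    and e: "emb s \<in> lhom A (sub s) (mid s)" and "inj_on (emb s) (carrier (sub s))"
    and p: "epi s \<in> lhom A (mid s) (quo s)" "epi s ` carrier (mid s) = carrier (quo s)"
    using assms unfolding proj_seq_def by simp_all
  show "left_module A (mid s)" using assms unfolding proj_seq_def by (simp add: has_dual_basis_module)
  show "epi s x \<in> carrier (quo s)" if "x \<in> carrier (mid s)" for x using that p(1) by (rule lhom_closed[rotated])
  show c: "emb s x \<in> carrier (mid s)" if "x \<in> carrier (sub s)" for x using that e by (rule lhom_closed[rotated])
  have k: "a_kernel (mid s) (quo s) (epi s) = emb s ` carrier (sub s)"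
    using assms unfolding proj_seq_def by simp
  show i: "epi s x = \<zero>\<^bsub>quo s\<^esub> \<longleftrightarrow> x \<in> emb s ` carrier (sub s)" if "x \<in> carrier (mid s)" for x
    unfolding k[symmetric] in_a_kernel_iff using that by simp
  show "epi s (emb s x) = \<zero>\<^bsub>quo s\<^esub>" if "x \<in> carrier (sub s)" for x
    using i[OF c[OF that]] that by simp
qed

lemma proj_seq_lift_sub:
  assumes s: "proj_seq A s" and X: "left_module A X" and f: "f \<in> lhom A X (mid s)"
    and z: "\<And>x. x \<in> carrier X \<Longrightarrow> epi s (f x) = \<zero>\<^bsub>quo s\<^esub>"
  shows "\<exists>h\<in>lhom A X (sub s). \<forall>x\<in>carrier X. emb s (h x) = f x"
  by (rule lhom_corestrict[OF proj_seqD(1,3)[OF s] X proj_seqD(5,6)[OF s] f])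
    (simp add: z proj_seqD(9)[OF s lhom_closed[OF f], symmetric])

lemma proj_seq_factor_quo:
  assumes s: "proj_seq A s" and X: "left_module A X" and f: "f \<in> lhom A (mid s) X"
    and z: "\<And>x. x \<in> carrier (sub s) \<Longrightarrow> f (emb s x) = \<zero>\<^bsub>X\<^esub>"
  shows "\<exists>h\<in>lhom A (quo s) X. \<forall>x\<in>carrier (mid s). h (epi s x) = f x"
  by (rule lhom_factor[OF proj_seqD(3,4)[OF s] X proj_seqD(7,8)[OF s] f])
    (use z proj_seqD(9)[OF s] in blast)

definition kernel_seq ::
    "('a, 'p) module \<Rightarrow> ('a, 'c) module \<Rightarrow> ('p \<Rightarrow> 'c) \<Rightarrow> ('a, 'p, 'p, 'c) seq" where
  "kernel_seq P C p = (let K = a_kernel P C p in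
     \<lparr>sub = submod P K, emb = (\<lambda>x\<in>K. x), mid = P, epi = p, quo = C\<rparr>)"

lemma kernel_seq_simps [simp]:
  "sub (kernel_seq P C p) = submod P (a_kernel P C p)"
  "x \<in> a_kernel P C p \<Longrightarrow> emb (kernel_seq P C p) x = x"
  "mid (kernel_seq P C p) = P" "epi (kernel_seq P C p) = p" "quo (kernel_seq P C p) = C"
  by (simp_all add: kernel_seq_def Let_def)

lemma proj_seq_kernel_seq:
  assumes P: "has_dual_basis A P" and C: "left_module A C" and p: "p \<in> lhom A P C"
    and surj: "p ` carrier P = carrier C"
  shows "proj_seq A (kernel_seq P C p)"
  unfolding proj_seq_def kernel_seq_def Let_def
  using submodule_kernel[OF has_dual_basis_module[OF P] C p] assms
  by (simp add: left_module_submod lhom_submod_incl has_dual_basis_module inj_on_def)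

text \<open>For a \<open>proj_seq\<close> the middle term is projective, so the long exact sequence
  identifies this property with Ext^1(quo s, X) = 0; \<open>Ext_zero_1_iff\<close> proves the
  equivalence for \<open>Ext\<close>.\<close>

definition extends :: "('a, 'x) ring_scheme \<Rightarrow> ('a, 'k, 'p, 'c) seq \<Rightarrow> ('a, 'n) module \<Rightarrow> bool" where
  "extends A s X \<longleftrightarrow> (\<forall>g\<in>lhom A (sub s) X. \<exists>G\<in>lhom A (mid s) X. \<forall>x\<in>carrier (sub s). G (emb s x) = g x)"

text \<open>Each coordinate functional of g is extended to the middle term, and the extensions are
  recombined with the generators of X. So extending functionals is enough to make
  \<open>emb s\<close> a left approximation by projectives.\<close>

lemma extends_dual_basis:
  assumes s: "proj_seq A s" and e: "extends A s (regular A)" and X: "has_dual_basis A X"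
  shows "extends A s X"
  unfolding extends_def
proof
  fix g assume g: "g \<in> lhom A (sub s) X"
  obtain n x \<phi> where b: "dual_basis A X n x \<phi>" using X by (auto simp: has_dual_basis_def)
  have XM: "left_module A X" and x: "\<And>i. i < n \<Longrightarrow> x i \<in> carrier X"
    and \<phi>: "\<And>i. i < n \<Longrightarrow> \<phi> i \<in> lhom A X (regular A)"
    and ex: "\<And>y. y \<in> carrier X \<Longrightarrow> y = finsum X (\<lambda>i. \<phi> i y \<odot>\<^bsub>X\<^esub> x i) {..<n}"
    using b by (auto simp: dual_basis_def)
  interpret X: left_module A X by fact
  have "\<exists>G. G \<in> lhom A (mid s) (regular A) \<and> (\<forall>y\<in>carrier (sub s). G (emb s y) = \<phi> i (g y))"
    if i: "i < n" for i
  proof -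
    obtain G where "G \<in> lhom A (mid s) (regular A)"
      "\<forall>y\<in>carrier (sub s). G (emb s y) = compose (carrier (sub s)) (\<phi> i) g y"
      using e lhom_compose[OF proj_seqD(1)[OF s] g \<phi>[OF i]] unfolding extends_def by blast
    then show ?thesis by (auto simp: compose_eq)
  qed
  then have "\<forall>i. \<exists>G. i < n \<longrightarrow> G \<in> lhom A (mid s) (regular A) \<and> (\<forall>y\<in>carrier (sub s). G (emb s y) = \<phi> i (g y))"
    by blast
  from choice[OF this] obtain G where G: "\<And>i. i < n \<Longrightarrow> G i \<in> lhom A (mid s) (regular A)"
    "\<And>i y. i < n \<Longrightarrow> y \<in> carrier (sub s) \<Longrightarrow> G i (emb s y) = \<phi> i (g y)" by blast
  let ?H = "\<lambda>y\<in>carrier (mid s). finsum X (\<lambda>i. G i y \<odot>\<^bsub>X\<^esub> x i) {..<n}"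
  have "?H \<in> lhom A (mid s) X" by (rule lhom_combination[OF proj_seqD(3)[OF s] XM G(1) x])
  moreover have "?H (emb s y) = g y" if y: "y \<in> carrier (sub s)" for y
  proof -
    have "?H (emb s y) = finsum X (\<lambda>i. G i (emb s y) \<odot>\<^bsub>X\<^esub> x i) {..<n}"
      using proj_seqD(11)[OF s y] by simp
    also have "\<dots> = finsum X (\<lambda>i. \<phi> i (g y) \<odot>\<^bsub>X\<^esub> x i) {..<n}"
      by (rule abelian_monoid.finsum_cong'[OF abelian_group.axioms(1)[OF left_module_abelian_group[OF XM]]])
        (use y G x lhom_closed[OF \<phi> lhom_closed[OF g y]] in auto)
    also have "\<dots> = g y" by (rule ex[OF lhom_closed[OF g y], symmetric])
    finally show ?thesis .
  qed
  ultimately show "\<exists>G\<in>lhom A (mid s) X. \<forall>x\<in>carrier (sub s). G (emb s x) = g x" by blast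
qed

section \<open>Morphisms of short exact sequences\<close>

definition seq_mor ::
    "('a, 'x) ring_scheme \<Rightarrow> ('a, 'k, 'p, 'c) seq \<Rightarrow> ('a, 'l, 'q, 'd) seq \<Rightarrow>
     ('k \<Rightarrow> 'l) \<Rightarrow> ('p \<Rightarrow> 'q) \<Rightarrow> ('c \<Rightarrow> 'd) \<Rightarrow> bool" where
  "seq_mor A s s' u t h \<longleftrightarrow> u \<in> lhom A (sub s) (sub s') \<and> t \<in> lhom A (mid s) (mid s') \<and>
     h \<in> lhom A (quo s) (quo s') \<and> (\<forall>x\<in>carrier (sub s). t (emb s x) = emb s' (u x)) \<and>
     (\<forall>x\<in>carrier (mid s). h (epi s x) = epi s' (t x))"

lemma seq_mor_from_lift:
  assumes s: "proj_seq A s" and s': "proj_seq A s'" and h: "h \<in> lhom A (quo s) (quo s')"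
    and t: "t \<in> lhom A (mid s) (mid s')" "\<forall>x\<in>carrier (mid s). h (epi s x) = epi s' (t x)"
  shows "\<exists>u. seq_mor A s s' u t h"
proof -
  have "\<exists>u\<in>lhom A (sub s) (sub s'). \<forall>x\<in>carrier (sub s). emb s' (u x) = compose (carrier (sub s)) t (emb s) x"
  proof (rule proj_seq_lift_sub[OF s' proj_seqD(1)[OF s] lhom_compose[OF proj_seqD(1,5)[OF s] t(1)]])
    fix x assume x: "x \<in> carrier (sub s)"
    then have "epi s' (t (emb s x)) = h \<zero>\<^bsub>quo s\<^esub>" using t(2) proj_seqD(10,11)[OF s x] by metis
    then show "epi s' (compose (carrier (sub s)) t (emb s) x) = \<zero>\<^bsub>quo s'\<^esub>"
      using x lhom_zero[OF proj_seqD(4)[OF s] proj_seqD(4)[OF s'] h] by (simp add: compose_eq)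
  qed
  then show ?thesis using h t unfolding seq_mor_def by (auto simp: compose_eq)
qed

text \<open>The map t is a lift, available because \<open>mid s\<close> is projective; exactness
  then yields u.\<close>

lemma seq_mor_from_quo:
  assumes s: "proj_seq A s" and s': "proj_seq A s'" and h: "h \<in> lhom A (quo s) (quo s')"
  shows "\<exists>u t. seq_mor A s s' u t h"
proof -
  obtain t where t: "t \<in> lhom A (mid s) (mid s')"
    "\<forall>x\<in>carrier (mid s). epi s' (t x) = compose (carrier (mid s)) h (epi s) x"
    using dual_basis_lift[OF proj_seqD(2)[OF s] proj_seqD(3,4,7,8)[OF s']
          lhom_compose[OF proj_seqD(3,7)[OF s] h]] by blast
  have "\<exists>u. seq_mor A s s' u t h"
    by (rule seq_mor_from_lift[OF s s' h t(1)]) (simp add: t(2) compose_eq)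
  then show ?thesis by blast
qed

lemma seq_mor_from_extension:
  assumes s: "proj_seq A s" and s': "proj_seq A s'" and u: "u \<in> lhom A (sub s) (sub s')"
    and t: "t \<in> lhom A (mid s) (mid s')" "\<forall>x\<in>carrier (sub s). t (emb s x) = emb s' (u x)"
  shows "\<exists>h. seq_mor A s s' u t h"
proof -
  have "\<exists>h\<in>lhom A (quo s) (quo s'). \<forall>x\<in>carrier (mid s). h (epi s x) = compose (carrier (mid s)) (epi s') t x"
  proof (rule proj_seq_factor_quo[OF s proj_seqD(4)[OF s'] lhom_compose[OF proj_seqD(3)[OF s] t(1) proj_seqD(7)[OF s']]])
    fix x assume x: "x \<in> carrier (sub s)"
    then show "compose (carrier (mid s)) (epi s') t (emb s x) = \<zero>\<^bsub>quo s'\<^esub>"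
      using t(2) proj_seqD(11)[OF s x] proj_seqD(10)[OF s' lhom_closed[OF u x]] by (simp add: compose_eq)
  qed
  then show ?thesis using u t unfolding seq_mor_def by (auto simp: compose_eq)
qed

text \<open>Here a map has to be extended rather than lifted. This works because
  \<open>emb s\<close> is an approximation and \<open>mid s'\<close> is projective.\<close>

lemma seq_mor_from_sub:
  assumes s: "proj_seq A s" and e: "extends A s (regular A)" and s': "proj_seq A s'"
    and u: "u \<in> lhom A (sub s) (sub s')"
  shows "\<exists>t h. seq_mor A s s' u t h"
proof -
  have "extends A s (mid s')" by (rule extends_dual_basis[OF s e proj_seqD(2)[OF s']])
  then obtain t where t: "t \<in> lhom A (mid s) (mid s')"
    "\<forall>x\<in>carrier (sub s). t (emb s x) = compose (carrier (sub s)) (emb s') u x"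
    using lhom_compose[OF proj_seqD(1)[OF s] u proj_seqD(5)[OF s']] unfolding extends_def by blast
  have "\<exists>h. seq_mor A s s' u t h"
    by (rule seq_mor_from_extension[OF s s' u t(1)]) (simp add: t(2) compose_eq)
  then show ?thesis by blast
qed

lemma seq_mor_id:
  assumes s: "proj_seq A s"
  shows "seq_mor A s s (\<lambda>x\<in>carrier (sub s). x) (\<lambda>x\<in>carrier (mid s). x) (\<lambda>x\<in>carrier (quo s). x)"
  using proj_seqD[OF s] by (simp add: seq_mor_def lhom_id)

lemma seq_mor_compose:
  assumes s: "proj_seq A s" and m: "seq_mor A s s' u t h" and m': "seq_mor A s' s'' u' t' h'"
  shows "seq_mor A s s'' (compose (carrier (sub s)) u' u) (compose (carrier (mid s)) t' t)
    (compose (carrier (quo s)) h' h)"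
proof -
  note D = proj_seqD[OF s]
  have u: "u \<in> lhom A (sub s) (sub s')" "u' \<in> lhom A (sub s') (sub s'')"
    and t: "t \<in> lhom A (mid s) (mid s')" "t' \<in> lhom A (mid s') (mid s'')"
    and h: "h \<in> lhom A (quo s) (quo s')" "h' \<in> lhom A (quo s') (quo s'')"
    and tu: "\<And>x. x \<in> carrier (sub s) \<Longrightarrow> t (emb s x) = emb s' (u x)"
      "\<And>x. x \<in> carrier (sub s') \<Longrightarrow> t' (emb s' x) = emb s'' (u' x)"
    and ht: "\<And>x. x \<in> carrier (mid s) \<Longrightarrow> h (epi s x) = epi s' (t x)"
      "\<And>x. x \<in> carrier (mid s') \<Longrightarrow> h' (epi s' x) = epi s'' (t' x)"
    using m m' by (auto simp: seq_mor_def)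
  show ?thesis unfolding seq_mor_def
    by (intro conjI ballI lhom_compose[OF D(1) u] lhom_compose[OF D(3) t] lhom_compose[OF D(4) h])
      (simp_all add: compose_eq D(11,12) tu ht lhom_closed[OF u(1)] lhom_closed[OF t(1)])
qed

lemma seq_mor_minus:
  assumes s: "proj_seq A s" and s': "proj_seq A s'" and m: "seq_mor A s s' u t h" and m': "seq_mor A s s' u' t' h'"
  shows "seq_mor A s s' (\<lambda>x\<in>carrier (sub s). u x \<ominus>\<^bsub>sub s'\<^esub> u' x)
    (\<lambda>x\<in>carrier (mid s). t x \<ominus>\<^bsub>mid s'\<^esub> t' x) (\<lambda>x\<in>carrier (quo s). h x \<ominus>\<^bsub>quo s'\<^esub> h' x)"
proof -
  note D = proj_seqD[OF s] and D' = proj_seqD[OF s']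
  have u: "u \<in> lhom A (sub s) (sub s')" "u' \<in> lhom A (sub s) (sub s')"
    and t: "t \<in> lhom A (mid s) (mid s')" "t' \<in> lhom A (mid s) (mid s')"
    and h: "h \<in> lhom A (quo s) (quo s')" "h' \<in> lhom A (quo s) (quo s')"
    and tu: "\<And>x. x \<in> carrier (sub s) \<Longrightarrow> t (emb s x) = emb s' (u x)"
      "\<And>x. x \<in> carrier (sub s) \<Longrightarrow> t' (emb s x) = emb s' (u' x)"
    and ht: "\<And>x. x \<in> carrier (mid s) \<Longrightarrow> h (epi s x) = epi s' (t x)"
      "\<And>x. x \<in> carrier (mid s) \<Longrightarrow> h' (epi s x) = epi s' (t' x)"
    using m m' by (auto simp: seq_mor_def)
  show ?thesis unfolding seq_mor_def
  proof (intro conjI ballI)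
    show "(\<lambda>x\<in>carrier (sub s). u x \<ominus>\<^bsub>sub s'\<^esub> u' x) \<in> lhom A (sub s) (sub s')"
      by (rule lhom_sub[OF D(1) D'(1) u])
    show "(\<lambda>x\<in>carrier (mid s). t x \<ominus>\<^bsub>mid s'\<^esub> t' x) \<in> lhom A (mid s) (mid s')"
      by (rule lhom_sub[OF D(3) D'(3) t])
    show "(\<lambda>x\<in>carrier (quo s). h x \<ominus>\<^bsub>quo s'\<^esub> h' x) \<in> lhom A (quo s) (quo s')"
      by (rule lhom_sub[OF D(4) D'(4) h])
  qed (simp_all add: D(11,12) tu ht lhom_minus[OF D'(1,3,5)] lhom_minus[OF D'(3,4,7)]
      lhom_closed[OF u(1)] lhom_closed[OF u(2)] lhom_closed[OF t(1)] lhom_closed[OF t(2)])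
qed

text \<open>Since V is projective, w lifts to a map l into \<open>mid s'\<close>. The difference of
  t and l v epi is killed by \<open>epi s'\<close>, so it defines a map g from \<open>mid s\<close>
  to \<open>sub s'\<close>. On \<open>sub s\<close> the correction disappears, because epi after emb
  is zero, and g restricts to u.\<close>

lemma seq_mor_sub_factors:
  assumes s: "proj_seq A s" and s': "proj_seq A s'" and m: "seq_mor A s s' u t h"
    and V: "has_dual_basis A V" and v: "v \<in> lhom A (quo s) V" and w: "w \<in> lhom A V (quo s')"
    and h: "\<And>x. x \<in> carrier (quo s) \<Longrightarrow> h x = w (v x)"
  shows "\<exists>g\<in>lhom A (mid s) (sub s'). \<forall>x\<in>carrier (sub s). u x = g (emb s x)"
proof -
  have t: "t \<in> lhom A (mid s) (mid s')" and u: "u \<in> lhom A (sub s) (sub s')"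
    and tu: "\<And>x. x \<in> carrier (sub s) \<Longrightarrow> t (emb s x) = emb s' (u x)"
    and ht: "\<And>x. x \<in> carrier (mid s) \<Longrightarrow> h (epi s x) = epi s' (t x)"
    using m by (auto simp: seq_mor_def)
  note D = proj_seqD[OF s] and D' = proj_seqD[OF s']
  interpret mG: abelian_group "mid s'" by (rule left_module_abelian_group[OF D'(3)])
  interpret qG: abelian_group "quo s'" by (rule left_module_abelian_group[OF D'(4)])
  obtain l where l: "l \<in> lhom A V (mid s')" "\<And>x. x \<in> carrier V \<Longrightarrow> epi s' (l x) = w x"
    using dual_basis_lift[OF V D'(3,4,7,8) w] by blast
  let ?k = "compose (carrier (quo s)) l v"
  let ?r = "\<lambda>x\<in>carrier (mid s). t x \<ominus>\<^bsub>mid s'\<^esub> compose (carrier (mid s)) ?k (epi s) x"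
  have k: "?k \<in> lhom A (quo s) (mid s')" by (rule lhom_compose[OF D(4) v l(1)])
  have kp: "compose (carrier (mid s)) ?k (epi s) \<in> lhom A (mid s) (mid s')"
    by (rule lhom_compose[OF D(3,7) k])
  have r: "?r \<in> lhom A (mid s) (mid s')"
    by (rule lhom_sub[OF D(3) D'(3) t kp])
  have "\<exists>g\<in>lhom A (mid s) (sub s'). \<forall>x\<in>carrier (mid s). emb s' (g x) = ?r x"
  proof (rule proj_seq_lift_sub[OF s' D(3) r])
    fix x assume x: "x \<in> carrier (mid s)"
    have "epi s' (?r x) = epi s' (t x) \<ominus>\<^bsub>quo s'\<^esub> epi s' (?k (epi s x))"
      using x by (simp add: compose_eq[of x] lhom_minus[OF D'(3,4,7)] lhom_closed[OF t] lhom_closed[OF k] D(12))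
    also have "epi s' (?k (epi s x)) = h (epi s x)"
      using x D(12) by (simp add: compose_eq l(2) lhom_closed[OF v] h)
    also have "epi s' (t x) \<ominus>\<^bsub>quo s'\<^esub> h (epi s x) = \<zero>\<^bsub>quo s'\<^esub>"
      using x by (simp add: ht lhom_closed[OF t] D'(12))
    finally show "epi s' (?r x) = \<zero>\<^bsub>quo s'\<^esub>" .
  qed
  then obtain g where g: "g \<in> lhom A (mid s) (sub s')" "\<And>x. x \<in> carrier (mid s) \<Longrightarrow> emb s' (g x) = ?r x"
    by blast
  have "u x = g (emb s x)" if x: "x \<in> carrier (sub s)" for x
  proof -
    have "?r (emb s x) = emb s' (u x) \<ominus>\<^bsub>mid s'\<^esub> ?k \<zero>\<^bsub>quo s\<^esub>"
      using x D(10,11) tu by (simp add: compose_eq[of "emb s x"])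
    also have "\<dots> = emb s' (u x)"
      using x lhom_zero[OF D(4) D'(3) k] D'(11) lhom_closed[OF u x] by simp
    finally have "emb s' (g (emb s x)) = emb s' (u x)" using g(2) D(11) x by simp
    then show ?thesis
      using inj_onD[OF D'(6)] lhom_closed[OF g(1) D(11)] lhom_closed[OF u] x by metis
  qed
  with g(1) show ?thesis by blast
qed

text \<open>The dual argument: v extends over \<open>mid s\<close> to a map l because s is an
  approximation sequence. The difference of t and emb w l vanishes on \<open>sub s\<close> and
  descends to g; after \<open>epi s'\<close> the correction is zero, so g lifts h.\<close>

lemma seq_mor_quo_factors:
  assumes s: "proj_seq A s" and e: "extends A s (regular A)" and s': "proj_seq A s'"
    and m: "seq_mor A s s' u t h"
    and V: "has_dual_basis A V" and v: "v \<in> lhom A (sub s) V" and w: "w \<in> lhom A V (sub s')"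
    and u: "\<And>x. x \<in> carrier (sub s) \<Longrightarrow> u x = w (v x)"
  shows "\<exists>g\<in>lhom A (quo s) (mid s'). \<forall>x\<in>carrier (quo s). h x = epi s' (g x)"
proof -
  have t: "t \<in> lhom A (mid s) (mid s')" and h: "h \<in> lhom A (quo s) (quo s')"
    and tu: "\<And>x. x \<in> carrier (sub s) \<Longrightarrow> t (emb s x) = emb s' (u x)"
    and ht: "\<And>x. x \<in> carrier (mid s) \<Longrightarrow> h (epi s x) = epi s' (t x)"
    using m by (auto simp: seq_mor_def)
  note D = proj_seqD[OF s] and D' = proj_seqD[OF s']
  interpret mG: abelian_group "mid s'" by (rule left_module_abelian_group[OF D'(3)])
  interpret qG: abelian_group "quo s'" by (rule left_module_abelian_group[OF D'(4)])
  have "extends A s V" by (rule extends_dual_basis[OF s e V])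
  then obtain l where l: "l \<in> lhom A (mid s) V" "\<And>x. x \<in> carrier (sub s) \<Longrightarrow> l (emb s x) = v x"
    using v unfolding extends_def by blast
  let ?k = "compose (carrier (mid s)) w l"
  let ?ik = "compose (carrier (mid s)) (emb s') ?k"
  let ?r = "\<lambda>x\<in>carrier (mid s). t x \<ominus>\<^bsub>mid s'\<^esub> ?ik x"
  have k: "?k \<in> lhom A (mid s) (sub s')" by (rule lhom_compose[OF D(3) l(1) w])
  have ik: "?ik \<in> lhom A (mid s) (mid s')" by (rule lhom_compose[OF D(3) k D'(5)])
  have r: "?r \<in> lhom A (mid s) (mid s')" by (rule lhom_sub[OF D(3) D'(3) t ik])
  have "\<exists>g\<in>lhom A (quo s) (mid s'). \<forall>x\<in>carrier (mid s). g (epi s x) = ?r x"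
  proof (rule proj_seq_factor_quo[OF s D'(3) r])
    fix x assume x: "x \<in> carrier (sub s)"
    have "?ik (emb s x) = emb s' (u x)" using x D(11) l(2) u by (simp add: compose_eq)
    moreover have "emb s' (u x) \<in> carrier (mid s')" using lhom_closed[OF t D(11)[OF x]] tu[OF x] by simp
    ultimately show "?r (emb s x) = \<zero>\<^bsub>mid s'\<^esub>" using D(11)[OF x] tu[OF x] by simp
  qed
  then obtain g where g: "g \<in> lhom A (quo s) (mid s')" "\<And>x. x \<in> carrier (mid s) \<Longrightarrow> g (epi s x) = ?r x"
    by blast
  have "h y = epi s' (g y)" if "y \<in> carrier (quo s)" for y
  proof -
    obtain x where x: "x \<in> carrier (mid s)" "y = epi s x" using D(8) \<open>y \<in> carrier (quo s)\<close> by blast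
    have "epi s' (?r x) = epi s' (t x) \<ominus>\<^bsub>quo s'\<^esub> epi s' (?ik x)"
      using x by (simp add: lhom_minus[OF D'(3,4,7)] lhom_closed[OF t] lhom_closed[OF ik])
    also have "epi s' (?ik x) = \<zero>\<^bsub>quo s'\<^esub>"
      using D'(10)[OF lhom_closed[OF k x(1)]] x by (simp add: compose_eq[of x])
    finally have "epi s' (?r x) = epi s' (t x)" using D'(12) lhom_closed[OF t] x by simp
    then show ?thesis using x g(2) ht by simp
  qed
  with g(1) show ?thesis by blast
qed

section \<open>Independence of the extension property from the sequence\<close>

lemma surj_imageE:
  assumes "f ` X = Y" "y \<in> Y"
  obtains x where "x \<in> X" "y = f x"
  using assms by blast

text \<open>The identity of \<open>quo s\<close> factors through \<open>quo s'\<close> up to a map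
  through a projective. Hence u' u differs from the identity of \<open>sub s\<close> by a map g emb
  that extends over \<open>mid s\<close>. To extend f, one extends f u' over \<open>mid s'\<close>,
  pulls it back along t, and subtracts f g.\<close>

lemma extends_transfer:
  fixes s :: "('a, 'k, 'p, 'c) seq" and s' :: "('a, 'l, 'q, 'd) seq" and X :: "('a, 'n) module"
  assumes s: "proj_seq A s" and s': "proj_seq A s'" and X: "left_module A X"
    and a: "a \<in> lhom A (quo s) (quo s')" and b: "b \<in> lhom A (quo s') (quo s)"
    and V: "has_dual_basis A V" and v: "v \<in> lhom A (quo s) V" and w: "w \<in> lhom A V (quo s)"
    and ba: "\<And>x. x \<in> carrier (quo s) \<Longrightarrow> b (a x) \<ominus>\<^bsub>quo s\<^esub> x = w (v x)"
    and e: "extends A s' X"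
  shows "extends A s X"
proof -
  note D = proj_seqD[OF s] and D' = proj_seqD[OF s']
  interpret XG: abelian_group X by (rule left_module_abelian_group[OF X])
  obtain u t where m: "seq_mor A s s' u t a" using seq_mor_from_quo[OF s s' a] by blast
  obtain u' t' where m': "seq_mor A s' s u' t' b" using seq_mor_from_quo[OF s' s b] by blast
  have u: "u \<in> lhom A (sub s) (sub s')" and u': "u' \<in> lhom A (sub s') (sub s)"
    and t: "t \<in> lhom A (mid s) (mid s')"
    and tu: "\<And>x. x \<in> carrier (sub s) \<Longrightarrow> t (emb s x) = emb s' (u x)"
    using m m' by (auto simp: seq_mor_def)
  note md = seq_mor_minus[OF s s seq_mor_compose[OF s m m'] seq_mor_id[OF s]]
  obtain g where g: "g \<in> lhom A (mid s) (sub s)"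
    "\<And>x. x \<in> carrier (sub s) \<Longrightarrow> (\<lambda>x\<in>carrier (sub s). compose (carrier (sub s)) u' u x \<ominus>\<^bsub>sub s\<^esub>
      (\<lambda>x\<in>carrier (sub s). x) x) x = g (emb s x)"
    using seq_mor_sub_factors[OF s s md V v w] ba by (auto simp: compose_eq)
  have g': "g (emb s x) = u' (u x) \<ominus>\<^bsub>sub s\<^esub> x" if "x \<in> carrier (sub s)" for x
    using g(2)[OF that] that by (simp add: compose_eq)
  show ?thesis unfolding extends_def
  proof
    fix f assume f: "f \<in> lhom A (sub s) X"
    obtain G where G: "G \<in> lhom A (mid s') X"
      "\<forall>x\<in>carrier (sub s'). G (emb s' x) = compose (carrier (sub s')) f u' x"
      using e lhom_compose[OF D'(1) u' f] unfolding extends_def by blast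
    let ?H = "\<lambda>x\<in>carrier (mid s). compose (carrier (mid s)) G t x \<ominus>\<^bsub>X\<^esub> compose (carrier (mid s)) f g x"
    have "?H \<in> lhom A (mid s) X"
      by (rule lhom_sub[OF D(3) X lhom_compose[OF D(3) t G(1)] lhom_compose[OF D(3) g(1) f]])
    moreover have "?H (emb s x) = f x" if x: "x \<in> carrier (sub s)" for x
    proof -
      have ux: "u x \<in> carrier (sub s')" "u' (u x) \<in> carrier (sub s)"
        using lhom_closed[OF u x] lhom_closed[OF u'] by auto
      have "?H (emb s x) = G (t (emb s x)) \<ominus>\<^bsub>X\<^esub> f (g (emb s x))"
        using D(11)[OF x] by (simp add: compose_eq)
      also have "\<dots> = f (u' (u x)) \<ominus>\<^bsub>X\<^esub> (f (u' (u x)) \<ominus>\<^bsub>X\<^esub> f x)"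
        using x ux G(2) by (simp add: tu g' compose_eq lhom_minus[OF D(1) X f])
      also have "\<dots> = f x" using lhom_closed[OF f] ux x by simp
      finally show ?thesis .
    qed
    ultimately show "\<exists>G\<in>lhom A (mid s) X. \<forall>x\<in>carrier (sub s). G (emb s x) = f x" by blast
  qed
qed

text \<open>Schanuel's lemma in the form needed here: a and b are identities and their defect is
  zero, factored through the middle term by zero maps.\<close>

lemma extends_same_quo:
  assumes s: "proj_seq A s" and s': "proj_seq A s'" and X: "left_module A X" and q: "quo s = quo s'"
    and e: "extends A s' X"
  shows "extends A s X"
proof -
  note D = proj_seqD[OF s]
  interpret QG: abelian_group "quo s" by (rule left_module_abelian_group[OF D(4)])
  have i: "(\<lambda>x\<in>carrier (quo s). x) \<in> lhom A (quo s) (quo s')"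
    "(\<lambda>x\<in>carrier (quo s). x) \<in> lhom A (quo s') (quo s)"
    using lhom_id[OF D(4)] q by simp_all
  show ?thesis
    by (rule extends_transfer[OF s s' X i D(2) lhom_zero_map[OF D(4,3)] lhom_zero_map[OF D(3,4)] _ e])
      (simp add: left_module_zero_closed[OF D(3)])
qed

text \<open>Lifts of the identity make \<open>sub s\<close> and \<open>sub s'\<close> isomorphic up
  to maps through projectives, and \<open>extends_transfer\<close> applies one step further along;
  the defect on \<open>sub s\<close> factors through \<open>mid s\<close> by
  \<open>seq_mor_sub_factors\<close>.\<close>

lemma extends_second_syzygy:
  assumes s: "proj_seq A s" and s': "proj_seq A s'" and X: "left_module A X" and q: "quo s = quo s'"
    and r: "proj_seq A r" and r': "proj_seq A r'" and qr: "quo r = sub s" "quo r' = sub s'"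
    and e: "extends A r' X"
  shows "extends A r X"
proof -
  note D = proj_seqD[OF s]
  interpret QG: abelian_group "quo s" by (rule left_module_abelian_group[OF D(4)])
  have i: "(\<lambda>x\<in>carrier (quo s). x) \<in> lhom A (quo s) (quo s')"
    "(\<lambda>x\<in>carrier (quo s). x) \<in> lhom A (quo s') (quo s)"
    using lhom_id[OF D(4)] q by simp_all
  obtain u t where m: "seq_mor A s s' u t (\<lambda>x\<in>carrier (quo s). x)"
    using seq_mor_from_quo[OF s s' i(1)] by blast
  obtain u' t' where m': "seq_mor A s' s u' t' (\<lambda>x\<in>carrier (quo s). x)"
    using seq_mor_from_quo[OF s' s i(2)] by blast
  have u: "u \<in> lhom A (quo r) (quo r')" "u' \<in> lhom A (quo r') (quo r)"
    using m m' by (auto simp: seq_mor_def qr)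
  note md = seq_mor_minus[OF s s seq_mor_compose[OF s m m'] seq_mor_id[OF s]]
  have "\<exists>g\<in>lhom A (mid s) (sub s). \<forall>x\<in>carrier (sub s).
      (\<lambda>x\<in>carrier (sub s). compose (carrier (sub s)) u' u x \<ominus>\<^bsub>sub s\<^esub> (\<lambda>x\<in>carrier (sub s). x) x) x = g (emb s x)"
    by (rule seq_mor_sub_factors[OF s s md D(2) lhom_zero_map[OF D(4,3)] lhom_zero_map[OF D(3,4)]])
      (simp add: compose_eq left_module_zero_closed[OF D(3)])
  then obtain g where g: "g \<in> lhom A (mid s) (sub s)"
    "\<And>x. x \<in> carrier (sub s) \<Longrightarrow> u' (u x) \<ominus>\<^bsub>sub s\<^esub> x = g (emb s x)"
    by (auto simp: compose_eq)
  show ?thesis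
    by (rule extends_transfer[OF r r' X u D(2), of "emb s" g])
      (simp_all add: qr D(5) g e)
qed

section \<open>Projective resolutions and Ext\<close>

definition left_noetherian :: "('a, 'x) ring_scheme \<Rightarrow> bool" where
  "left_noetherian A \<longleftrightarrow>
     (\<forall>M :: 'a umod. \<forall>N. M \<in> fg_modules A \<longrightarrow> submodule N A M \<longrightarrow> submod M N \<in> fg_modules A)"

lemma left_noetherianD:
  fixes M :: "'a umod"
  shows "left_noetherian A \<Longrightarrow> M \<in> fg_modules A \<Longrightarrow> submodule N A M \<Longrightarrow> submod M N \<in> fg_modules A"
  by (simp add: left_noetherian_def)

lemma proj_modules_fg: "P \<in> proj_modules A \<Longrightarrow> P \<in> fg_modules A"
  by (simp add: proj_modules_def)

text \<open>Kernels stay finitely generated and keep the type \<open>'a umod\<close>, so covering by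
  projectives can be iterated. Only M may have another type, which is why its own cover is taken
  separately before the recursion.\<close>

lemma projective_resolution_exists:
  fixes M :: "('a, 'm) module"
  assumes A: "left_noetherian A" and M: "left_module A M" and fg: "finitely_generated A M"
  shows "\<exists>P d e. projective_resolution A M P d e"
proof -
  have ex: "\<exists>z. fst z \<in> proj_modules A \<and> snd z \<in> lhom A (fst z) K \<and> snd z ` carrier (fst z) = carrier K"
    if "K \<in> fg_modules A" for K :: "'a umod"
    using projective_surjection[OF fg_modulesD[OF that]] by (elim bexE) (metis fst_conv snd_conv)
  define cov where "cov K = (SOME z. fst z \<in> proj_modules A \<and> snd z \<in> lhom A (fst z) K \<and>
    snd z ` carrier (fst z) = carrier K)" for K :: "'a umod"
  have cov: "fst (cov K) \<in> proj_modules A" "snd (cov K) \<in> lhom A (fst (cov K)) K"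
    "snd (cov K) ` carrier (fst (cov K)) = carrier K" if "K \<in> fg_modules A" for K
    using someI_ex[OF ex[OF that]] unfolding cov_def[symmetric] by simp_all
  obtain P0 e where P0: "P0 \<in> proj_modules A" and e: "e \<in> lhom A P0 M" "e ` carrier P0 = carrier M"
    using projective_surjection[OF M fg] by blast
  \<comment> \<open>A state is a projective together with the submodule to be covered next; a step
    covers this submodule and records the kernel of the covering map.\<close>
  define nxt where "nxt = (\<lambda>(P :: 'a umod, N). let K = submod P N in (fst (cov K), a_kernel (fst (cov K)) K (snd (cov K))))"
  define st where "st n = (nxt ^^ n) (P0, a_kernel P0 M e)" for n
  define P where "P n = fst (st n)" for n
  define K where "K n = submod (P n) (snd (st n))" for n
  have st_Suc: "st (Suc n) = (fst (cov (K n)), a_kernel (fst (cov (K n))) (K n) (snd (cov (K n))))" for n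
    by (simp add: st_def nxt_def K_def P_def Let_def case_prod_beta)
  have inv: "P n \<in> proj_modules A \<and> submodule (snd (st n)) A (P n)" for n
  proof (induction n)
    case 0
    then show ?case
      using P0 submodule_kernel[OF fg_modulesD(1)[OF proj_modules_fg[OF P0]] M e(1)] by (simp add: P_def st_def)
  next
    case (Suc n)
    then have Kn: "K n \<in> fg_modules A"
      unfolding K_def using left_noetherianD[OF A proj_modules_fg] by blast
    show ?case
      using cov(1)[OF Kn] submodule_kernel[OF fg_modulesD(1)[OF proj_modules_fg[OF cov(1)[OF Kn]]] fg_modulesD(1)[OF Kn] cov(2)[OF Kn]]
      by (simp add: P_def st_Suc)
  qed
  have Pn: "P n \<in> proj_modules A" and Nn: "submodule (snd (st n)) A (P n)" for n using inv by auto
  have Kn: "K n \<in> fg_modules A" for n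
    unfolding K_def by (rule left_noetherianD[OF A proj_modules_fg[OF Pn] Nn])
  define d where "d n = snd (cov (K n))" for n
  have P_Suc: "P (Suc n) = fst (cov (K n))" for n by (simp add: P_def st_Suc)
  have d: "d n \<in> lhom A (P (Suc n)) (K n)" "d n ` carrier (P (Suc n)) = snd (st n)" for n
    using cov(2,3)[OF Kn[of n]] by (simp_all add: d_def P_Suc K_def)
  have dP: "d n \<in> lhom A (P (Suc n)) (P n)" for n
  proof (rule lhomI[OF lhom_extensional[OF d(1)]])
    fix x assume "x \<in> carrier (P (Suc n))"
    then have "d n x \<in> snd (st n)" using d(2) by blast
    then show "d n x \<in> carrier (P n)" using submodule_subset[OF Nn] by blast
  qed (use lhom_add[OF d(1)] lhom_smult[OF d(1)] in \<open>simp_all add: K_def\<close>)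
  have k: "a_kernel (P (Suc n)) (P n) (d n) = snd (st (Suc n))" for n
    by (simp add: st_Suc P_Suc d_def a_kernel_def' K_def)
  have "P 0 = P0" "snd (st 0) = a_kernel P0 M e" by (simp_all add: P_def st_def)
  then have "projective_resolution A M P d e"
    unfolding projective_resolution_def using Pn dP e d(2)[of 0] by (simp add: d(2) k)
  then show ?thesis by blast
qed

text \<open>The resolution is the one that \<open>Ext\<close> picks by choice. It depends on M
  alone, so one resolution serves all degrees; what remains of the quotient group is the comparison
  of cocycles with coboundaries.\<close>

lemma Ext_zero_via_resolution:
  assumes A: "left_noetherian A" and M: "left_module A M" and fg: "finitely_generated A M" and X: "left_module A X"
  shows "\<exists>P d e. projective_resolution A M P d e \<and>
    (\<forall>n. Ext_zero A (Suc n) M X \<longleftrightarrow> cocycles A P d (Suc n) X \<subseteq> coboundaries A P d (Suc n) X)"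
proof -
  interpret XG: abelian_group X by (rule left_module_abelian_group[OF X])
  have "\<exists>z. case z of (P, d, e) \<Rightarrow> projective_resolution A M P d e"
    using projective_resolution_exists[OF A M fg] by auto
  then have sm: "case (SOME (P, d, e). projective_resolution A M P d e) of (P, d, e) \<Rightarrow> projective_resolution A M P d e"
    by (rule someI_ex)
  obtain P d e where z: "(SOME (P, d, e). projective_resolution A M P d e) = (P, d, e)"
    by (rule prod_cases3)
  have res: "projective_resolution A M P d e" using sm unfolding z by (simp only: prod.case)
  have P: "P n \<in> proj_modules A" and d: "d n \<in> lhom A (P (Suc n)) (P n)" for n
    using res unfolding projective_resolution_def by simp_all
  note PM = fg_modulesD(1)[OF proj_modules_fg[OF P]]
  have "Ext_zero A (Suc n) M X \<longleftrightarrow> cocycles A P d (Suc n) X \<subseteq> coboundaries A P d (Suc n) X" for n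
  proof -
    let ?Z = "cocycles A P d (Suc n) X" and ?B = "coboundaries A P d (Suc n) X"
    define G where "G = (hom_group A (P (Suc n)) X)\<lparr>carrier := ?Z\<rparr>"
    have GZ: "carrier G = ?Z" by (simp add: G_def)
    have B: "?B = {compose (carrier (P (Suc n))) g (d n) |g. g \<in> lhom A (P n) X}"
      by (simp add: coboundaries_def)
    have op: "f \<otimes>\<^bsub>G\<^esub> g = (\<lambda>x\<in>carrier (P (Suc n)). f x \<oplus>\<^bsub>X\<^esub> g x)" for f g
      by (simp add: G_def hom_group_def)
    have zB: "(\<lambda>x\<in>carrier (P (Suc n)). \<zero>\<^bsub>X\<^esub>) \<in> ?B"
    proof -
      have "(\<lambda>x\<in>carrier (P (Suc n)). \<zero>\<^bsub>X\<^esub>) =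
          compose (carrier (P (Suc n))) (\<lambda>x\<in>carrier (P n). \<zero>\<^bsub>X\<^esub>) (d n)"
        by (rule extensionalityI[of _ "carrier (P (Suc n))"])
          (simp_all add: compose_eq lhom_closed[OF d] compose_extensional)
      then show ?thesis unfolding B using lhom_zero_map[OF PM X] by blast
    qed
    have Zh: "f \<in> lhom A (P (Suc n)) X" if "f \<in> ?Z" for f using that by (simp add: cocycles_def)
    have E1: "Ext_zero A (Suc n) M X \<longleftrightarrow> carrier (G Mod ?B) = {\<one>\<^bsub>G Mod ?B\<^esub>}"
      by (simp only: Ext_zero_def Ext_def z Let_def prod.case G_def)
    \<comment> \<open>Cosets are unfolded into explicit sets, so the comparison proceeds elementwise
      with the operation \<open>op\<close>.\<close>
    have E2: "carrier (G Mod ?B) = (\<Union>a\<in>?Z. {\<Union>h\<in>?B. {h \<otimes>\<^bsub>G\<^esub> a}})" "\<one>\<^bsub>G Mod ?B\<^esub> = ?B"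
      by (simp_all only: FactGroup_def RCOSETS_def r_coset_def partial_object.select_convs monoid.select_convs GZ)
    \<comment> \<open>The coset of a contains 0 + a, so if all cosets coincide with the coboundaries
      then a is one of them. Conversely, translating the coboundaries by a coboundary changes
      nothing.\<close>
    have E3: "(\<Union>a\<in>?Z. {\<Union>h\<in>?B. {h \<otimes>\<^bsub>G\<^esub> a}}) = {?B} \<longleftrightarrow> ?Z \<subseteq> ?B"
    proof
      assume eq: "(\<Union>a\<in>?Z. {\<Union>h\<in>?B. {h \<otimes>\<^bsub>G\<^esub> a}}) = {?B}"
      show "?Z \<subseteq> ?B"
      proof
        fix a assume a: "a \<in> ?Z"
        have "(\<Union>h\<in>?B. {h \<otimes>\<^bsub>G\<^esub> a}) \<in> (\<Union>a\<in>?Z. {\<Union>h\<in>?B. {h \<otimes>\<^bsub>G\<^esub> a}})"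
          by (rule UN_I[OF a singletonI])
        then have "(\<Union>h\<in>?B. {h \<otimes>\<^bsub>G\<^esub> a}) = ?B" unfolding eq by (rule singletonD)
        moreover have "(\<lambda>x\<in>carrier (P (Suc n)). \<zero>\<^bsub>X\<^esub>) \<otimes>\<^bsub>G\<^esub> a = a"
          unfolding op by (rule extensionalityI[of _ "carrier (P (Suc n))"])
            (use lhom_closed[OF Zh[OF a]] lhom_extensional[OF Zh[OF a]] in simp_all)
        ultimately show "a \<in> ?B" using UN_I[OF zB singletonI, of "\<lambda>h. h \<otimes>\<^bsub>G\<^esub> a"] by simp
      qed
    next
      assume sub: "?Z \<subseteq> ?B"
      have zZ: "(\<lambda>x\<in>carrier (P (Suc n)). \<zero>\<^bsub>X\<^esub>) \<in> ?Z"
        using lhom_zero_map[OF PM X] lhom_closed[OF d] by (simp add: cocycles_def)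
      have "(\<Union>h\<in>?B. {h \<otimes>\<^bsub>G\<^esub> a}) = ?B" if a: "a \<in> ?Z" for a
      proof -
        obtain g where g: "g \<in> lhom A (P n) X" and ag: "a = compose (carrier (P (Suc n))) g (d n)"
          using sub a unfolding B by blast
        show ?thesis
        proof (intro equalityI subsetI)
          fix f assume "f \<in> (\<Union>h\<in>?B. {h \<otimes>\<^bsub>G\<^esub> a})"
          then obtain h where "h \<in> ?B" and h: "f = h \<otimes>\<^bsub>G\<^esub> a" by (elim UN_E) simp
          then obtain k where k: "k \<in> lhom A (P n) X"
            and f: "f = compose (carrier (P (Suc n))) k (d n) \<otimes>\<^bsub>G\<^esub> a" unfolding B by blast
          have "f = compose (carrier (P (Suc n))) (\<lambda>x\<in>carrier (P n). k x \<oplus>\<^bsub>X\<^esub> g x) (d n)"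
            unfolding f op ag by (rule extensionalityI[of _ "carrier (P (Suc n))"])
              (simp_all add: compose_eq lhom_closed[OF d] compose_extensional)
          then show "f \<in> ?B" unfolding B using lhom_sum[OF PM X k g] by blast
        next
          fix f assume "f \<in> ?B"
          then obtain k where k: "k \<in> lhom A (P n) X"
            and f: "f = compose (carrier (P (Suc n))) k (d n)" unfolding B by blast
          let ?k = "\<lambda>x\<in>carrier (P n). k x \<ominus>\<^bsub>X\<^esub> g x"
          have "compose (carrier (P (Suc n))) ?k (d n) \<in> ?B"
            unfolding B using lhom_sub[OF PM X k g] by blast
          moreover have "f = compose (carrier (P (Suc n))) ?k (d n) \<otimes>\<^bsub>G\<^esub> a"
            unfolding f op ag by (rule extensionalityI[of _ "carrier (P (Suc n))"])
              (simp_all add: compose_eq lhom_closed[OF d] lhom_closed[OF k] lhom_closed[OF g] compose_extensional)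
          ultimately show "f \<in> (\<Union>h\<in>?B. {h \<otimes>\<^bsub>G\<^esub> a})" by (intro UN_I) simp_all
        qed
      qed
      then have "(\<Union>a\<in>?Z. {\<Union>h\<in>?B. {h \<otimes>\<^bsub>G\<^esub> a}}) = (\<Union>a\<in>?Z. {?B})" by (simp cong: SUP_cong_simp)
      also have "\<dots> = {?B}" using zZ by blast
      finally show "(\<Union>a\<in>?Z. {\<Union>h\<in>?B. {h \<otimes>\<^bsub>G\<^esub> a}}) = {?B}" .
    qed
    show ?thesis unfolding E1 E2 by (rule E3)
  qed
  then show ?thesis using res by blast
qed

text \<open>Maps out of \<open>mid r\<close> that vanish on \<open>sub r\<close> are maps out of \<open>sub s\<close>.\<close>

lemma extends_iff_spliced:
  assumes s: "proj_seq A s" and r: "proj_seq A r" and q: "quo r = sub s" and X: "left_module A X"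
    and d: "\<And>x. x \<in> carrier (mid r) \<Longrightarrow> d x = emb s (epi r x)"
  shows "extends A s X \<longleftrightarrow> {f \<in> lhom A (mid r) X. \<forall>x\<in>carrier (sub r). f (emb r x) = \<zero>\<^bsub>X\<^esub>} \<subseteq>
    {compose (carrier (mid r)) g d |g. g \<in> lhom A (mid s) X}"
proof -
  note D = proj_seqD[OF s] and R = proj_seqD[OF r]
  have epi: "epi r \<in> lhom A (mid r) (sub s)" "epi r ` carrier (mid r) = carrier (sub s)"
    using R(7,8) q by simp_all
  show ?thesis
  proof (intro iffI subsetI)
    fix f assume e: "extends A s X" and "f \<in> {f \<in> lhom A (mid r) X. \<forall>x\<in>carrier (sub r). f (emb r x) = \<zero>\<^bsub>X\<^esub>}"
    then have f: "f \<in> lhom A (mid r) X" "\<And>x. x \<in> carrier (sub r) \<Longrightarrow> f (emb r x) = \<zero>\<^bsub>X\<^esub>" by auto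
    obtain h where h: "h \<in> lhom A (sub s) X" "\<And>x. x \<in> carrier (mid r) \<Longrightarrow> h (epi r x) = f x"
      using proj_seq_factor_quo[OF r X f] unfolding q by blast
    obtain g where g: "g \<in> lhom A (mid s) X" "\<And>x. x \<in> carrier (sub s) \<Longrightarrow> g (emb s x) = h x"
      using e h(1) unfolding extends_def by blast
    have "f = compose (carrier (mid r)) g d"
      by (rule extensionalityI[of _ "carrier (mid r)"])
        (simp_all add: compose_eq lhom_extensional[OF f(1)] compose_extensional d g(2) lhom_closed[OF epi(1)] h(2))
    then show "f \<in> {compose (carrier (mid r)) g d |g. g \<in> lhom A (mid s) X}" using g(1) by blast
  next
    assume sub: "{f \<in> lhom A (mid r) X. \<forall>x\<in>carrier (sub r). f (emb r x) = \<zero>\<^bsub>X\<^esub>} \<subseteq>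
      {compose (carrier (mid r)) g d |g. g \<in> lhom A (mid s) X}"
    show "extends A s X" unfolding extends_def
    proof
      fix h assume h: "h \<in> lhom A (sub s) X"
      have "compose (carrier (mid r)) h (epi r) \<in>
          {f \<in> lhom A (mid r) X. \<forall>x\<in>carrier (sub r). f (emb r x) = \<zero>\<^bsub>X\<^esub>}"
        using lhom_compose[OF R(3) epi(1) h] lhom_zero[OF D(1) X h]
        by (simp add: compose_eq R(10,11) q)
      from subsetD[OF sub this] obtain g where g: "g \<in> lhom A (mid s) X"
        "compose (carrier (mid r)) h (epi r) = compose (carrier (mid r)) g d" by blast
      have "g (emb s y) = h y" if y: "y \<in> carrier (sub s)" for y
      proof -
        obtain x where x: "x \<in> carrier (mid r)" "y = epi r x"
          by (rule surj_imageE[OF epi(2) y])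
        then show ?thesis using fun_cong[OF g(2), of x] d by (simp add: compose_eq)
      qed
      with g(1) show "\<exists>G\<in>lhom A (mid s) X. \<forall>x\<in>carrier (sub s). G (emb s x) = h x" by blast
    qed
  qed
qed

text \<open>The chosen resolution is cut into short exact sequences \<open>s0\<close>,
  \<open>sq 0\<close>, \<open>sq 1\<close> and so on. Cocycles in degree n + 1 are the maps out of
  the middle term of \<open>sq n\<close> that vanish on its kernel, so
  \<open>extends_iff_spliced\<close> expresses Ext by \<open>s0\<close> in degree 1 and by
  \<open>sq 0\<close> in degree 2. These sequences are then exchanged for the given s and r.\<close>

lemma Ext_zero_iff_extends:
  assumes A: "left_noetherian A" and s: "proj_seq A s" and X: "left_module A X"
  shows Ext_zero_1_iff: "Ext_zero A 1 (quo s) X \<longleftrightarrow> extends A s X"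
    and Ext_zero_2_iff: "proj_seq A r \<Longrightarrow> quo r = sub s \<Longrightarrow> Ext_zero A 2 (quo s) X \<longleftrightarrow> extends A r X"
proof -
  note D = proj_seqD[OF s]
  have fg: "finitely_generated A (quo s)"
    by (rule finitely_generated_image[OF D(3,4,7,8) dual_basis_finitely_generated[OF D(2)]])
  obtain P d e where res: "projective_resolution A (quo s) P d e"
    and E: "\<And>n. Ext_zero A (Suc n) (quo s) X \<longleftrightarrow> cocycles A P d (Suc n) X \<subseteq> coboundaries A P d (Suc n) X"
    using Ext_zero_via_resolution[OF A D(4) fg X] by blast
  have P: "has_dual_basis A (P n)" and dh: "d n \<in> lhom A (P (Suc n)) (P n)"
    and ker: "a_kernel (P (Suc n)) (P n) (d n) = d (Suc n) ` carrier (P (Suc (Suc n)))" for n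
    using res unfolding projective_resolution_def by (simp_all add: proj_modules_iff)
  have eh: "e \<in> lhom A (P 0) (quo s)" "e ` carrier (P 0) = carrier (quo s)"
    and ker0: "a_kernel (P 0) (quo s) e = d 0 ` carrier (P (Suc 0))"
    using res unfolding projective_resolution_def by simp_all
  note PM = has_dual_basis_module[OF P]
  \<comment> \<open>The codomain of d n is cut down to its image, so that d n becomes onto and its
    kernel sequence begins with the next image.\<close>
  define im where "im n = submod (P n) (d n ` carrier (P (Suc n)))" for n
  have im: "submodule (d n ` carrier (P (Suc n))) A (P n)" for n
    by (rule submodule_image[OF PM PM dh])
  have dim: "d n \<in> lhom A (P (Suc n)) (im n)" for n
    by (rule lhomI[OF lhom_extensional[OF dh]]) (simp_all add: im_def lhom_add[OF dh] lhom_smult[OF dh])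
  define s0 where "s0 = kernel_seq (P 0) (quo s) e"
  define sq where "sq n = kernel_seq (P (Suc n)) (im n) (d n)" for n
  have s0: "proj_seq A s0" unfolding s0_def by (rule proj_seq_kernel_seq[OF P D(4) eh])
  have sq: "proj_seq A (sq n)" for n
    unfolding sq_def by (rule proj_seq_kernel_seq[OF P left_module_submod[OF PM im, folded im_def] dim])
      (simp add: im_def)
  have kq: "a_kernel (P (Suc n)) (im n) (d n) = d (Suc n) ` carrier (P (Suc (Suc n)))" for n
    using ker[of n] by (simp add: im_def a_kernel_def')
  have sub0: "sub s0 = im 0" by (simp add: s0_def ker0 im_def)
  have subq: "sub (sq n) = im (Suc n)" for n by (simp add: sq_def kq im_def[of "Suc n"])
  have Zq: "cocycles A P d (Suc n) X =
      {f \<in> lhom A (mid (sq n)) X. \<forall>x\<in>carrier (sub (sq n)). f (emb (sq n) x) = \<zero>\<^bsub>X\<^esub>}" for n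
    by (simp add: cocycles_def sq_def kq)
  have Bq: "coboundaries A P d (Suc n) X = {compose (carrier (mid (sq n))) g (d n) |g. g \<in> lhom A (P n) X}" for n
    by (simp add: coboundaries_def sq_def)
  have e0: "Ext_zero A (Suc 0) (quo s) X \<longleftrightarrow> extends A s0 X"
  proof -
    have q: "quo (sq 0) = sub s0" by (simp add: sub0) (simp add: sq_def)
    have "extends A s0 X \<longleftrightarrow> cocycles A P d (Suc 0) X \<subseteq> coboundaries A P d (Suc 0) X"
      unfolding Zq Bq
      using extends_iff_spliced[OF s0 sq q X, of "d 0"] by (simp add: s0_def sq_def ker0)
    then show ?thesis by (simp only: E)
  qed
  have e1: "Ext_zero A (Suc (Suc 0)) (quo s) X \<longleftrightarrow> extends A (sq 0) X"
  proof -
    have q: "quo (sq (Suc 0)) = sub (sq 0)" by (simp add: subq) (simp add: sq_def)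
    have "extends A (sq 0) X \<longleftrightarrow> cocycles A P d (Suc (Suc 0)) X \<subseteq> coboundaries A P d (Suc (Suc 0)) X"
      unfolding Zq Bq
      using extends_iff_spliced[OF sq sq q X, of "d (Suc 0)"] by (simp add: sq_def kq)
    then show ?thesis by (simp only: E)
  qed
  have q0: "quo s0 = quo s" by (simp add: s0_def)
  show "Ext_zero A 1 (quo s) X \<longleftrightarrow> extends A s X"
    using e0 extends_same_quo[OF s s0 X q0[symmetric]] extends_same_quo[OF s0 s X q0] by auto
  assume r: "proj_seq A r" and qr: "quo r = sub s"
  have q: "quo (sq 0) = sub s0" by (simp add: sub0) (simp add: sq_def)
  show "Ext_zero A 2 (quo s) X \<longleftrightarrow> extends A r X"
    using e1 extends_second_syzygy[OF s s0 X q0[symmetric] r sq qr q] extends_second_syzygy[OF s0 s X q0 sq r q qr]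
    by (auto simp: numeral_2_eq_2)
qed

section \<open>The stable category\<close>

lemma stable_relI:
  assumes "f \<in> lhom A M N" "g \<in> lhom A M N" "V \<in> proj_modules A" "u \<in> lhom A M V" "v \<in> lhom A V N"
    "\<And>x. x \<in> carrier M \<Longrightarrow> f x \<ominus>\<^bsub>N\<^esub> g x = v (u x)"
  shows "(f, g) \<in> stable_rel A M N"
  using assms unfolding stable_rel_def by blast

lemma stable_relE:
  assumes "(f, g) \<in> stable_rel A M N"
  obtains V u v where "f \<in> lhom A M N" "g \<in> lhom A M N" "V \<in> proj_modules A" "u \<in> lhom A M V" "v \<in> lhom A V N"
    "\<And>x. x \<in> carrier M \<Longrightarrow> f x \<ominus>\<^bsub>N\<^esub> g x = v (u x)"
  using assms unfolding stable_rel_def by blast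

text \<open>Any surjection from a projective module onto \<open>N\<close> detects all stably trivial maps into \<open>N\<close>;
  this makes additivity of the relation visible without forming direct sums.\<close>

lemma stable_rel_iff_cover:
  assumes M: "left_module A M" and N: "left_module A N" and V: "V \<in> proj_modules A"
    and p: "p \<in> lhom A V N" "p ` carrier V = carrier N"
  shows "(f, g) \<in> stable_rel A M N \<longleftrightarrow> f \<in> lhom A M N \<and> g \<in> lhom A M N \<and>
    (\<exists>u\<in>lhom A M V. \<forall>x\<in>carrier M. f x \<ominus>\<^bsub>N\<^esub> g x = p (u x))" (is "?L \<longleftrightarrow> ?R")
proof
  assume ?L
  then obtain W u v where f: "f \<in> lhom A M N" "g \<in> lhom A M N" and W: "W \<in> proj_modules A"
    and u: "u \<in> lhom A M W" and v: "v \<in> lhom A W N"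
    and e: "\<And>x. x \<in> carrier M \<Longrightarrow> f x \<ominus>\<^bsub>N\<^esub> g x = v (u x)" by (rule stable_relE) (rule that)
  obtain l where l: "l \<in> lhom A W V" "\<And>x. x \<in> carrier W \<Longrightarrow> p (l x) = v x"
    using dual_basis_lift[OF W[unfolded proj_modules_iff] _ N p v]
      fg_modulesD(1)[OF proj_modules_fg[OF V]] by blast
  have "\<forall>x\<in>carrier M. f x \<ominus>\<^bsub>N\<^esub> g x = p (compose (carrier M) l u x)"
    using e l(2) lhom_closed[OF u] by (simp add: compose_eq)
  then show ?R using f lhom_compose[OF M u l(1)] by blast
next
  assume ?R
  then show ?L using stable_relI[OF _ _ V _ p(1)] by blast
qed

lemma equiv_stable_rel:
  fixes M N :: "'a umod"
  assumes M: "M \<in> fg_modules A" and N: "N \<in> fg_modules A"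
  shows "equiv (lhom A M N) (stable_rel A M N)"
proof -
  note MM = fg_modulesD(1)[OF M] and NM = fg_modulesD(1)[OF N]
  obtain V p where V: "V \<in> proj_modules A" and p: "p \<in> lhom A V N" "p ` carrier V = carrier N"
    using projective_surjection[OF fg_modulesD[OF N]] by blast
  note VM = fg_modulesD(1)[OF proj_modules_fg[OF V]]
  note iff = stable_rel_iff_cover[OF MM NM V p]
  interpret NG: abelian_group N by (rule left_module_abelian_group[OF NM])
  interpret VG: abelian_group V by (rule left_module_abelian_group[OF VM])
  show ?thesis
  proof (rule equivI)
    show "stable_rel A M N \<subseteq> lhom A M N \<times> lhom A M N" by (auto simp: stable_rel_def)
    show "refl_on (lhom A M N) (stable_rel A M N)"
      unfolding refl_on_def
    proof
      fix f assume f: "f \<in> lhom A M N"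
      have "\<forall>x\<in>carrier M. f x \<ominus>\<^bsub>N\<^esub> f x = p ((\<lambda>x\<in>carrier M. \<zero>\<^bsub>V\<^esub>) x)"
        using lhom_closed[OF f] lhom_zero[OF VM NM p(1)] by simp
      then show "(f, f) \<in> stable_rel A M N" unfolding iff using f lhom_zero_map[OF MM VM] by blast
    qed
    show "sym (stable_rel A M N)"
    proof (rule symI)
      fix f g assume "(f, g) \<in> stable_rel A M N"
      then obtain u where f: "f \<in> lhom A M N" and g: "g \<in> lhom A M N" and u: "u \<in> lhom A M V"
        and e: "\<And>x. x \<in> carrier M \<Longrightarrow> f x \<ominus>\<^bsub>N\<^esub> g x = p (u x)" unfolding iff by blast
      let ?w = "\<lambda>x\<in>carrier M. (\<lambda>x\<in>carrier M. \<zero>\<^bsub>V\<^esub>) x \<ominus>\<^bsub>V\<^esub> u x"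
      have "g x \<ominus>\<^bsub>N\<^esub> f x = p (?w x)" if x: "x \<in> carrier M" for x
      proof -
        have "g x \<ominus>\<^bsub>N\<^esub> f x = \<zero>\<^bsub>N\<^esub> \<ominus>\<^bsub>N\<^esub> (f x \<ominus>\<^bsub>N\<^esub> g x)"
          using lhom_closed[OF f x] lhom_closed[OF g x] by (simp add: a_minus_def NG.minus_add NG.a_ac)
        then show ?thesis using x lhom_closed[OF u x]
          by (simp add: e lhom_minus[OF VM NM p(1)] lhom_zero[OF VM NM p(1)])
      qed
      then show "(g, f) \<in> stable_rel A M N"
        unfolding iff using f g lhom_sub[OF MM VM lhom_zero_map[OF MM VM] u] by blast
    qed
    show "trans (stable_rel A M N)"
    proof (rule transI)
      fix f g h assume "(f, g) \<in> stable_rel A M N" "(g, h) \<in> stable_rel A M N"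
      then obtain u w where f: "f \<in> lhom A M N" and g: "g \<in> lhom A M N" and h: "h \<in> lhom A M N"
        and u: "u \<in> lhom A M V" and w: "w \<in> lhom A M V"
        and e: "\<And>x. x \<in> carrier M \<Longrightarrow> f x \<ominus>\<^bsub>N\<^esub> g x = p (u x)"
        and e': "\<And>x. x \<in> carrier M \<Longrightarrow> g x \<ominus>\<^bsub>N\<^esub> h x = p (w x)" unfolding iff by blast
      have "f x \<ominus>\<^bsub>N\<^esub> h x = p ((\<lambda>x\<in>carrier M. u x \<oplus>\<^bsub>V\<^esub> w x) x)" if x: "x \<in> carrier M" for x
      proof -
        have "f x \<ominus>\<^bsub>N\<^esub> h x = (f x \<ominus>\<^bsub>N\<^esub> g x) \<oplus>\<^bsub>N\<^esub> (g x \<ominus>\<^bsub>N\<^esub> h x)"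
          using lhom_closed[OF f x] lhom_closed[OF g x] lhom_closed[OF h x]
          by (simp add: a_minus_def NG.a_assoc NG.r_neg1)
        then show ?thesis using x lhom_closed[OF u x] lhom_closed[OF w x] by (simp add: e e' lhom_add[OF p(1)])
      qed
      then show "(f, h) \<in> stable_rel A M N" unfolding iff using f h lhom_sum[OF MM VM u w] by blast
    qed
  qed
qed

text \<open>The two arguments are changed one after the other: g (f - f') and (g - g') f' both
  factor through projectives.\<close>

lemma stable_rel_compose:
  fixes L M N :: "'a umod"
  assumes L: "L \<in> fg_modules A" and M: "M \<in> fg_modules A" and N: "N \<in> fg_modules A"
    and f: "(f, f') \<in> stable_rel A L M" and g: "(g, g') \<in> stable_rel A M N"
  shows "(compose (carrier L) g f, compose (carrier L) g' f') \<in> stable_rel A L N"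
proof -
  note LM = fg_modulesD(1)[OF L] and MM = fg_modulesD(1)[OF M] and NM = fg_modulesD(1)[OF N]
  obtain V u v where fh: "f \<in> lhom A L M" "f' \<in> lhom A L M" and V: "V \<in> proj_modules A"
    and u: "u \<in> lhom A L V" and v: "v \<in> lhom A V M"
    and e: "\<And>x. x \<in> carrier L \<Longrightarrow> f x \<ominus>\<^bsub>M\<^esub> f' x = v (u x)" by (rule stable_relE[OF f]) (rule that)
  obtain W u' v' where gh: "g \<in> lhom A M N" "g' \<in> lhom A M N" and W: "W \<in> proj_modules A"
    and u': "u' \<in> lhom A M W" and v': "v' \<in> lhom A W N"
    and e': "\<And>x. x \<in> carrier M \<Longrightarrow> g x \<ominus>\<^bsub>N\<^esub> g' x = v' (u' x)" by (rule stable_relE[OF g]) (rule that)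
  note VM = fg_modulesD(1)[OF proj_modules_fg[OF V]]
  have "(compose (carrier L) g f, compose (carrier L) g f') \<in> stable_rel A L N"
    by (rule stable_relI[OF lhom_compose[OF LM fh(1) gh(1)] lhom_compose[OF LM fh(2) gh(1)] V u
          lhom_compose[OF VM v gh(1)]])
      (simp add: compose_eq lhom_closed[OF u] e[symmetric] lhom_minus[OF MM NM gh(1)]
        lhom_closed[OF fh(1)] lhom_closed[OF fh(2)])
  moreover have "(compose (carrier L) g f', compose (carrier L) g' f') \<in> stable_rel A L N"
    by (rule stable_relI[OF lhom_compose[OF LM fh(2) gh(1)] lhom_compose[OF LM fh(2) gh(2)] W
          lhom_compose[OF LM fh(2) u'] v'])
      (simp add: compose_eq e' lhom_closed[OF fh(2)])
  ultimately show ?thesis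
    using equiv_stable_rel[OF L N] by (blast elim: equivE dest: transD)
qed

lemma stable_class_eq_iff:
  fixes M N :: "'a umod"
  assumes "M \<in> fg_modules A" "N \<in> fg_modules A" "f \<in> lhom A M N" "g \<in> lhom A M N"
  shows "stable_class A M N f = stable_class A M N g \<longleftrightarrow> (f, g) \<in> stable_rel A M N"
  by (rule eq_equiv_class_iff[OF equiv_stable_rel[OF assms(1,2)] assms(3,4)])

lemma stable_rel_hom: "(f, g) \<in> stable_rel A M N \<Longrightarrow> f \<in> lhom A M N"
  "(f, g) \<in> stable_rel A M N \<Longrightarrow> g \<in> lhom A M N"
  by (auto simp: stable_rel_def)

lemma stable_cat_simps:
  "Ob (stable_cat A) = fg_modules A" "Arr (stable_cat A) M N = lhom A M N // stable_rel A M N"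
  "Ident (stable_cat A) M = stable_class A M M (\<lambda>x\<in>carrier M. x)"
  by (simp_all add: stable_cat_def)

lemma full_subcat_simps [simp]:
  "Ob (full_subcat C S) = Ob C \<inter> S" "Arr (full_subcat C S) = Arr C"
  "Ident (full_subcat C S) = Ident C" "Comp (full_subcat C S) = Comp C"
  by (simp_all add: full_subcat_def)

text \<open>Evaluates the unions by which \<open>Syz\<close> and \<open>Agemo\<close> act on
  classes: the family is inhabited and all its members agree.\<close>

lemma Union_classes:
  assumes "\<Phi> h" "\<And>k. \<Phi> k \<Longrightarrow> cl k = cl h"
  shows "\<Union>{cl k |k. \<Phi> k} = cl h"
  using assms by blast

text \<open>The same evaluation for the double union in the composition of
  \<open>stable_cat\<close>.\<close>

lemma Union_constant_family:
  assumes "g \<in> G" "f \<in> F" "\<And>g' f'. g' \<in> G \<Longrightarrow> f' \<in> F \<Longrightarrow> cl g' f' = c"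
  shows "(\<Union>g'\<in>G. \<Union>f'\<in>F. cl g' f') = c"
proof -
  have "(\<Union>g'\<in>G. \<Union>f'\<in>F. cl g' f') = (\<Union>g'\<in>G. \<Union>f'\<in>F. c)"
    by (intro SUP_cong refl assms(3))
  then show ?thesis using assms(1,2) by auto
qed

lemma stable_comp:
  fixes L M N :: "'a umod"
  assumes L: "L \<in> fg_modules A" and M: "M \<in> fg_modules A" and N: "N \<in> fg_modules A"
    and f: "f \<in> lhom A L M" and g: "g \<in> lhom A M N"
  shows "Comp (stable_cat A) L M N (stable_class A M N g) (stable_class A L M f) =
    stable_class A L N (compose (carrier L) g f)"
proof -
  have ff: "(f, f) \<in> stable_rel A L M" and gg: "(g, g) \<in> stable_rel A M N"
    using equiv_stable_rel[OF L M] equiv_stable_rel[OF M N] f g by (auto simp: equiv_def refl_on_def)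
  have "stable_class A L N (compose (carrier L) g' f') = stable_class A L N (compose (carrier L) g f)"
    if "g' \<in> stable_class A M N g" "f' \<in> stable_class A L M f" for g' f'
  proof -
    have "(compose (carrier L) g f, compose (carrier L) g' f') \<in> stable_rel A L N"
      using that by (intro stable_rel_compose[OF L M N]) auto
    then show ?thesis by (rule equiv_class_eq[OF equiv_stable_rel[OF L N], symmetric])
  qed
  note cl = this
  have m: "g \<in> stable_class A M N g" "f \<in> stable_class A L M f" using ff gg by auto
  have "(\<Union>g'\<in>stable_class A M N g. \<Union>f'\<in>stable_class A L M f.
      stable_class A L N (compose (carrier L) g' f')) = stable_class A L N (compose (carrier L) g f)"
    by (rule Union_constant_family[OF m cl])
  then show ?thesis by (simp add: stable_cat_def)
qed

lemma is_category_stable: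
  fixes A :: "('a, 'x) ring_scheme"
  shows "is_category (full_subcat (stable_cat A) S)"
proof -
  have id: "(\<lambda>x\<in>carrier M. x) \<in> lhom A M M" if "M \<in> fg_modules A" for M :: "'a umod"
    by (rule lhom_id[OF fg_modulesD(1)[OF that]])
  have unit: "compose (carrier M) f (\<lambda>x\<in>carrier M. x) = f" "compose (carrier M) (\<lambda>x\<in>carrier N. x) f = f"
    if "f \<in> lhom A M N" for f and M N :: "'a umod"
    by (rule extensionalityI[of _ "carrier M"];
        simp add: compose_eq compose_extensional lhom_extensional[OF that] lhom_closed[OF that])+
  have assoc: "compose (carrier W) (compose (carrier X) h g) f = compose (carrier W) h (compose (carrier W) g f)"
    if "f \<in> lhom A W X" for f g h and W X :: "'a umod"
    by (rule extensionalityI[of _ "carrier W"])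
      (simp_all add: compose_eq compose_extensional lhom_closed[OF that])
  note lc = lhom_compose[OF fg_modulesD(1)]
  show ?thesis
    unfolding is_category_def full_subcat_simps stable_cat_simps
  proof (intro conjI ballI)
    fix X assume "X \<in> fg_modules A \<inter> S"
    then show "stable_class A X X (\<lambda>x\<in>carrier X. x) \<in> lhom A X X // stable_rel A X X"
      by (intro quotientI id) auto
  next
    fix X Y Z F G assume "X \<in> fg_modules A \<inter> S" "Y \<in> fg_modules A \<inter> S" "Z \<in> fg_modules A \<inter> S"
      and FG: "F \<in> lhom A X Y // stable_rel A X Y" "G \<in> lhom A Y Z // stable_rel A Y Z"
    then have o: "X \<in> fg_modules A" "Y \<in> fg_modules A" "Z \<in> fg_modules A" by auto
    obtain f where f: "F = stable_class A X Y f" "f \<in> lhom A X Y" using FG(1) by (rule quotientE)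
    obtain g where g: "G = stable_class A Y Z g" "g \<in> lhom A Y Z" using FG(2) by (rule quotientE)
    show "Comp (stable_cat A) X Y Z G F \<in> lhom A X Z // stable_rel A X Z"
      unfolding f(1) g(1) stable_comp[OF o f(2) g(2)] by (rule quotientI[OF lc[OF o(1) f(2) g(2)]])
  next
    fix X Y F assume "X \<in> fg_modules A \<inter> S" "Y \<in> fg_modules A \<inter> S"
      and F: "F \<in> lhom A X Y // stable_rel A X Y"
    then have o: "X \<in> fg_modules A" "Y \<in> fg_modules A" by auto
    obtain f where f: "F = stable_class A X Y f" "f \<in> lhom A X Y" using F by (rule quotientE)
    show "Comp (stable_cat A) X X Y F (stable_class A X X (\<lambda>x\<in>carrier X. x)) = F"
      unfolding f(1) stable_comp[OF o(1,1,2) id[OF o(1)] f(2)] by (simp only: unit(1)[OF f(2)])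
    show "Comp (stable_cat A) X Y Y (stable_class A Y Y (\<lambda>x\<in>carrier Y. x)) F = F"
      unfolding f(1) stable_comp[OF o(1,2,2) f(2) id[OF o(2)]] by (simp only: unit(2)[OF f(2)])
  next
    fix W X Y Z F G H
    assume "W \<in> fg_modules A \<inter> S" "X \<in> fg_modules A \<inter> S" "Y \<in> fg_modules A \<inter> S" "Z \<in> fg_modules A \<inter> S"
      and FG: "F \<in> lhom A W X // stable_rel A W X" "G \<in> lhom A X Y // stable_rel A X Y"
        "H \<in> lhom A Y Z // stable_rel A Y Z"
    then have o: "W \<in> fg_modules A" "X \<in> fg_modules A" "Y \<in> fg_modules A" "Z \<in> fg_modules A" by auto
    obtain f where f: "F = stable_class A W X f" "f \<in> lhom A W X" using FG(1) by (rule quotientE)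
    obtain g where g: "G = stable_class A X Y g" "g \<in> lhom A X Y" using FG(2) by (rule quotientE)
    obtain h where h: "H = stable_class A Y Z h" "h \<in> lhom A Y Z" using FG(3) by (rule quotientE)
    show "Comp (stable_cat A) W X Z (Comp (stable_cat A) X Y Z H G) F =
        Comp (stable_cat A) W Y Z H (Comp (stable_cat A) W X Y G F)"
      unfolding f(1) g(1) h(1) stable_comp[OF o(2,3,4) g(2) h(2)] stable_comp[OF o(1,2,3) f(2) g(2)]
        stable_comp[OF o(1,2,4) f(2) lc[OF o(2) g(2) h(2)]]
        stable_comp[OF o(1,3,4) lc[OF o(1) f(2) g(2)] h(2)]
      by (simp only: assoc[OF f(2)])
  qed
qed


section \<open>Syzygies and cosyzygies on the stable category\<close>

definition approx_seq :: "('a, 'x) ring_scheme \<Rightarrow> ('a, 'k, 'p, 'c) seq \<Rightarrow> bool" where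
  "approx_seq A s \<longleftrightarrow> proj_seq A s \<and> extends A s (regular A)"

text \<open>Middle terms are projective and vanish in the stable category, so the map between them
  is quantified away.\<close>

definition stable_mor ::
    "('a, 'x) ring_scheme \<Rightarrow> ('a, 'k, 'p, 'c) seq \<Rightarrow> ('a, 'l, 'q, 'd) seq \<Rightarrow> ('k \<Rightarrow> 'l) \<Rightarrow> ('c \<Rightarrow> 'd) \<Rightarrow> bool" where
  "stable_mor A s s' u h \<longleftrightarrow> (\<exists>t. seq_mor A s s' u t h)"

type_synonym 'a useq = "('a, 'a univ, 'a univ, 'a univ) seq"

text \<open>The difference of the two morphisms is again a morphism of sequences. If one of its ends
  factors through a projective, then so does the other: h - h' through \<open>epi s'\<close>, by the
  approximation property of s, and u - u' through \<open>emb s\<close>, by lifting. This makes the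
  passage between the two ends well defined and injective on stable classes.\<close>

lemma stable_mor_rel_iff:
  fixes s s' :: "'a useq"
  assumes s: "approx_seq A s" and s': "approx_seq A s'"
    and m: "stable_mor A s s' u h" and m': "stable_mor A s s' u' h'"
  shows "(u, u') \<in> stable_rel A (sub s) (sub s') \<longleftrightarrow> (h, h') \<in> stable_rel A (quo s) (quo s')"
proof -
  have S: "proj_seq A s" "extends A s (regular A)" "proj_seq A s'"
    using s s' by (simp_all add: approx_seq_def)
  note D = proj_seqD[OF S(1)] and D' = proj_seqD[OF S(3)]
  obtain t t' where t: "seq_mor A s s' u t h" "seq_mor A s s' u' t' h'"
    using m m' unfolding stable_mor_def by blast
  have hom: "u \<in> lhom A (sub s) (sub s')" "u' \<in> lhom A (sub s) (sub s')"
    "h \<in> lhom A (quo s) (quo s')" "h' \<in> lhom A (quo s) (quo s')"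
    using t by (simp_all add: seq_mor_def)
  note md = seq_mor_minus[OF S(1,3) t]
  show ?thesis
  proof
    assume "(u, u') \<in> stable_rel A (sub s) (sub s')"
    then obtain V v w where V: "V \<in> proj_modules A" and v: "v \<in> lhom A (sub s) V" and w: "w \<in> lhom A V (sub s')"
      and e: "\<And>x. x \<in> carrier (sub s) \<Longrightarrow> u x \<ominus>\<^bsub>sub s'\<^esub> u' x = w (v x)" by (rule stable_relE) (rule that)
    have "\<exists>g\<in>lhom A (quo s) (mid s'). \<forall>x\<in>carrier (quo s).
        (\<lambda>x\<in>carrier (quo s). h x \<ominus>\<^bsub>quo s'\<^esub> h' x) x = epi s' (g x)"
      by (rule seq_mor_quo_factors[OF S md V[unfolded proj_modules_iff] v w]) (simp add: e)
    then obtain g where g: "g \<in> lhom A (quo s) (mid s')"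
      "\<And>x. x \<in> carrier (quo s) \<Longrightarrow> h x \<ominus>\<^bsub>quo s'\<^esub> h' x = epi s' (g x)" by auto
    show "(h, h') \<in> stable_rel A (quo s) (quo s')"
      by (rule stable_relI[OF hom(3,4) D'(2)[folded proj_modules_iff] g(1) D'(7) g(2)])
  next
    assume "(h, h') \<in> stable_rel A (quo s) (quo s')"
    then obtain V v w where V: "V \<in> proj_modules A" and v: "v \<in> lhom A (quo s) V" and w: "w \<in> lhom A V (quo s')"
      and e: "\<And>x. x \<in> carrier (quo s) \<Longrightarrow> h x \<ominus>\<^bsub>quo s'\<^esub> h' x = w (v x)" by (rule stable_relE) (rule that)
    have "\<exists>g\<in>lhom A (mid s) (sub s'). \<forall>x\<in>carrier (sub s).
        (\<lambda>x\<in>carrier (sub s). u x \<ominus>\<^bsub>sub s'\<^esub> u' x) x = g (emb s x)"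
      by (rule seq_mor_sub_factors[OF S(1,3) md V[unfolded proj_modules_iff] v w]) (simp add: e)
    then obtain g where g: "g \<in> lhom A (mid s) (sub s')"
      "\<And>x. x \<in> carrier (sub s) \<Longrightarrow> u x \<ominus>\<^bsub>sub s'\<^esub> u' x = g (emb s x)" by auto
    show "(u, u') \<in> stable_rel A (sub s) (sub s')"
      by (rule stable_relI[OF hom(1,2) D(2)[folded proj_modules_iff] D(5) g])
  qed
qed

lemma stable_mor_from_sub:
  assumes "approx_seq A s" "approx_seq A s'" "u \<in> lhom A (sub s) (sub s')"
  obtains h where "stable_mor A s s' u h"
  using seq_mor_from_sub[of A s s' u] assms unfolding approx_seq_def stable_mor_def by blast

lemma stable_mor_from_quo:
  assumes "approx_seq A s" "approx_seq A s'" "h \<in> lhom A (quo s) (quo s')"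
  obtains u where "stable_mor A s s' u h"
  using seq_mor_from_quo[of A s s' h] assms unfolding approx_seq_def stable_mor_def by blast

lemma stable_mor_id:
  "approx_seq A s \<Longrightarrow> stable_mor A s s (\<lambda>x\<in>carrier (sub s). x) (\<lambda>x\<in>carrier (quo s). x)"
  using seq_mor_id[of A s] unfolding approx_seq_def stable_mor_def by blast

lemma stable_mor_compose:
  "approx_seq A s \<Longrightarrow> stable_mor A s s' u h \<Longrightarrow> stable_mor A s' s'' u' h' \<Longrightarrow>
    stable_mor A s s'' (compose (carrier (sub s)) u' u) (compose (carrier (quo s)) h' h)"
  using seq_mor_compose[of A s s' u _ h s'' u' _ h'] unfolding approx_seq_def stable_mor_def by blast

lemma stable_mor_hom:
  "stable_mor A s s' u h \<Longrightarrow> u \<in> lhom A (sub s) (sub s')"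
  "stable_mor A s s' u h \<Longrightarrow> h \<in> lhom A (quo s) (quo s')"
  by (auto simp: stable_mor_def seq_mor_def)

section \<open>The action of \<open>Syz\<close> and \<open>Agemo\<close> on stable morphisms\<close>

lemma projective_coversD:
  assumes "projective_covers A P p" "M \<in> fg_modules A"
  shows "P M \<in> proj_modules A" "p M \<in> lhom A (P M) M" "p M ` carrier (P M) = carrier M"
  using assms by (auto simp: projective_covers_def projective_cover_def)

lemma proj_seq_cover:
  assumes "projective_covers A P p" "M \<in> fg_modules A"
  shows "proj_seq A (kernel_seq (P M) M (p M))"
  by (rule proj_seq_kernel_seq[OF projective_coversD(1)[OF assms, unfolded proj_modules_iff]
        fg_modulesD(1)[OF assms(2)] projective_coversD(2,3)[OF assms]])

lemma Syz_on_ob: "on_ob (Syz A P p) M = sub (kernel_seq (P M) M (p M))"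
  by (simp add: Syz_def Let_def)

text \<open>The union in \<open>Syz\<close> runs over all representatives and all lifts. Each choice
  yields a morphism of kernel sequences, and \<open>stable_mor_rel_iff\<close> shows that all of
  them have the same class at the kernel end.\<close>

lemma Syz_on_arr:
  fixes A :: "('a, 'x) ring_scheme" and M N :: "'a umod" and P :: "'a umod \<Rightarrow> 'a umod"
    and p :: "'a umod \<Rightarrow> 'a univ \<Rightarrow> 'a univ"
  defines "s \<equiv> \<lambda>M. kernel_seq (P M) M (p M)"
  assumes cov: "projective_covers A P p" and M: "M \<in> fg_modules A" and N: "N \<in> fg_modules A"
    and sM: "approx_seq A (s M)" "approx_seq A (s N)" "sub (s M) \<in> fg_modules A" "sub (s N) \<in> fg_modules A"
    and m: "stable_mor A (s M) (s N) u f"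
  shows "on_arr (Syz A P p) M N (stable_class A M N f) = stable_class A (sub (s M)) (sub (s N)) u"
proof -
  let ?\<Phi> = "\<lambda>h. \<exists>f'\<in>stable_class A M N f. \<exists>t\<in>lhom A (P M) (P N).
    (\<forall>x\<in>carrier (P M). p N (t x) = f' (p M x)) \<and> h = restrict t (carrier (sub (s M)))"
  have f: "f \<in> lhom A M N" using stable_mor_hom(2)[OF m] by (simp add: s_def)
  have u: "u \<in> lhom A (sub (s M)) (sub (s N))" by (rule stable_mor_hom(1)[OF m])
  have sMN: "proj_seq A (s M)" "proj_seq A (s N)" unfolding s_def by (rule proj_seq_cover[OF cov M] proj_seq_cover[OF cov N])+
  have arr: "on_arr (Syz A P p) M N (stable_class A M N f) =
      \<Union>{stable_class A (sub (s M)) (sub (s N)) h |h. ?\<Phi> h}"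
    by (simp add: Syz_def Let_def s_def)
  \<comment> \<open>In a kernel sequence the embedding is the inclusion, so the map on kernels is
    literally the restriction of t.\<close>
  have lift: "h = u'" if sm: "seq_mor A (s M) (s N) u' t f'" and h: "h = restrict t (carrier (sub (s M)))" for h u' t f'
  proof -
    have u': "u' \<in> lhom A (sub (s M)) (sub (s N))"
      and tu: "\<And>x. x \<in> carrier (sub (s M)) \<Longrightarrow> t (emb (s M) x) = emb (s N) (u' x)"
      using sm by (auto simp: seq_mor_def)
    have "t x = u' x" if "x \<in> carrier (sub (s M))" for x
      using tu[OF that] that lhom_closed[OF u' that] by (simp add: s_def)
    then show ?thesis unfolding h
      by (intro extensionalityI[of _ "carrier (sub (s M))"] lhom_extensional[OF u']) simp_all
  qed
  show ?thesis unfolding arr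
  proof (rule Union_classes)
    obtain t where t: "seq_mor A (s M) (s N) u t f" using m by (auto simp: stable_mor_def)
    have "f \<in> stable_class A M N f"
      using equiv_stable_rel[OF M N] f by (auto simp: equiv_def refl_on_def)
    moreover have "t \<in> lhom A (P M) (P N)" "\<forall>x\<in>carrier (P M). p N (t x) = f (p M x)"
      using t by (auto simp: seq_mor_def s_def)
    ultimately show "?\<Phi> u" using lift[OF t refl] by blast
  next
    fix h assume "?\<Phi> h"
    then obtain f' t where f': "f' \<in> stable_class A M N f" and t: "t \<in> lhom A (P M) (P N)"
      and e: "\<And>x. x \<in> carrier (P M) \<Longrightarrow> p N (t x) = f' (p M x)"
      and h: "h = restrict t (carrier (sub (s M)))" by blast
    have ff': "(f, f') \<in> stable_rel A M N" using f' by simp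
    have "f' \<in> lhom A (quo (s M)) (quo (s N))" "t \<in> lhom A (mid (s M)) (mid (s N))"
      "\<forall>x\<in>carrier (mid (s M)). f' (epi (s M) x) = epi (s N) (t x)"
      using stable_rel_hom(2)[OF ff'] t e by (simp_all add: s_def)
    then obtain u' where u': "seq_mor A (s M) (s N) u' t f'"
      using seq_mor_from_lift[OF sMN] by blast
    then have m': "stable_mor A (s M) (s N) h f'" unfolding lift[OF u' h] stable_mor_def by blast
    have "(u, h) \<in> stable_rel A (sub (s M)) (sub (s N))"
      using stable_mor_rel_iff[OF sM(1,2) m m'] ff' by (simp add: s_def)
    then show "stable_class A (sub (s M)) (sub (s N)) h = stable_class A (sub (s M)) (sub (s N)) u"
      by (rule equiv_class_eq[OF equiv_stable_rel[OF sM(3,4)], symmetric])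
  qed
qed

definition cokernel_seq ::
    "('a, 'k) module \<Rightarrow> ('k \<Rightarrow> 'p) \<Rightarrow> ('a, 'p) module \<Rightarrow> ('p \<Rightarrow> 'c) \<Rightarrow> ('a, 'c) module \<Rightarrow> ('a, 'k, 'p, 'c) seq" where
  "cokernel_seq M e Q q C = \<lparr>sub = M, emb = e, mid = Q, epi = q, quo = C\<rparr>"

lemma cokernel_seq_simps [simp]:
  "sub (cokernel_seq M e Q q C) = M" "emb (cokernel_seq M e Q q C) = e"
  "mid (cokernel_seq M e Q q C) = Q" "epi (cokernel_seq M e Q q C) = q" "quo (cokernel_seq M e Q q C) = C"
  by (simp_all add: cokernel_seq_def)

lemma regular_copy:
  assumes "ring A"
  obtains G a b where "G \<in> proj_modules A" "a \<in> lhom A (regular A) G" "b \<in> lhom A G (regular A)"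
    "\<And>x. x \<in> carrier A \<Longrightarrow> b (a x) = x"
proof -
  note R = has_dual_basis_regular[OF assms]
  note RM = has_dual_basis_module[OF R]
  obtain G a b where G: "G \<in> fg_modules A" and a: "a \<in> lhom A (regular A) G" and b: "b \<in> lhom A G (regular A)"
    and ba: "\<And>x. x \<in> carrier (regular A) \<Longrightarrow> b (a x) = x" and ab: "\<And>x. x \<in> carrier G \<Longrightarrow> a (b x) = x"
    by (rule fg_module_copy[OF RM dual_basis_finitely_generated[OF R]]) (rule that)
  have "has_dual_basis A G" by (rule has_dual_basis_retract[OF R fg_modulesD(1)[OF G] a b]) (rule ab)
  then have "G \<in> proj_modules A" by (simp only: proj_modules_iff)
  from that[OF this a b] ba show ?thesis by simp
qed

text \<open>An approximation promises factorisations only for targets on \<open>'a univ\<close>. A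
  functional is therefore moved into a projective copy of \<open>regular A\<close>, factored there,
  and moved back.\<close>

lemma left_proj_approx_regular:
  assumes f: "left_proj_approx A M Q f" and M: "left_module A M" and g: "g \<in> lhom A M (regular A)"
  shows "\<exists>G\<in>lhom A Q (regular A). \<forall>x\<in>carrier M. G (f x) = g x"
proof -
  have Q: "Q \<in> proj_modules A" and fh: "f \<in> lhom A M Q"
    and fac: "\<And>Q' g. Q' \<in> proj_modules A \<Longrightarrow> g \<in> lhom A M Q' \<Longrightarrow> \<exists>h\<in>lhom A Q Q'. \<forall>x\<in>carrier M. g x = h (f x)"
    using f by (auto simp: left_proj_approx_def)
  note QM = fg_modulesD(1)[OF proj_modules_fg[OF Q]]
  obtain L a b where L: "L \<in> proj_modules A" and a: "a \<in> lhom A (regular A) L" and b: "b \<in> lhom A L (regular A)"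
    and ba: "\<And>x. x \<in> carrier A \<Longrightarrow> b (a x) = x" by (rule regular_copy[OF left_module_ring[OF M]]) (rule that)
  obtain h where h: "h \<in> lhom A Q L" "\<forall>x\<in>carrier M. compose (carrier M) a g x = h (f x)"
    using fac[OF L lhom_compose[OF M g a]] by blast
  have "\<forall>x\<in>carrier M. compose (carrier Q) b h (f x) = g x"
  proof
    fix x assume x: "x \<in> carrier M"
    then have "h (f x) = a (g x)" using h(2) by (simp add: compose_eq)
    then show "compose (carrier Q) b h (f x) = g x"
      using ba lhom_closed[OF g x] lhom_closed[OF fh x] by (simp add: compose_eq)
  qed
  then show ?thesis using lhom_compose[OF QM h(1) b] by blast
qed

lemma minimal_approximationsD:
  assumes "minimal_approximations A Q e C q" "M \<in> fg_modules A"
  shows "left_proj_approx A M (Q M) (e M)" "Q M \<in> proj_modules A" "e M \<in> lhom A M (Q M)"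
    "C M \<in> fg_modules A" "q M \<in> lhom A (Q M) (C M)" "q M ` carrier (Q M) = carrier (C M)"
    "a_kernel (Q M) (C M) (q M) = e M ` carrier M"
  using assms by (auto simp: minimal_approximations_def minimal_left_proj_approx_def is_cokernel_def left_proj_approx_def)

lemma approx_seq_approximation:
  assumes ap: "minimal_approximations A Q e C q" and M: "M \<in> fg_modules A" and inj: "inj_on (e M) (carrier M)"
  shows "approx_seq A (cokernel_seq M (e M) (Q M) (q M) (C M))"
proof -
  note D = minimal_approximationsD[OF ap M]
  have "proj_seq A (cokernel_seq M (e M) (Q M) (q M) (C M))"
    unfolding proj_seq_def
    using D fg_modulesD(1)[OF M] fg_modulesD(1)[OF D(4)] inj by (simp add: proj_modules_iff)
  then show ?thesis
    using left_proj_approx_regular[OF D(1) fg_modulesD(1)[OF M]] by (simp add: approx_seq_def extends_def)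
qed

lemma Agemo_on_ob: "on_ob (Agemo A Q e C q) M = C M"
  by (simp add: Agemo_def)

lemma Agemo_on_arr:
  fixes A :: "('a, 'x) ring_scheme" and M N :: "'a umod" and Q C :: "'a umod \<Rightarrow> 'a umod"
    and e q :: "'a umod \<Rightarrow> 'a univ \<Rightarrow> 'a univ"
  defines "s \<equiv> \<lambda>M. cokernel_seq M (e M) (Q M) (q M) (C M)"
  assumes ap: "minimal_approximations A Q e C q" and M: "M \<in> fg_modules A" and N: "N \<in> fg_modules A"
    and sM: "approx_seq A (s M)" "approx_seq A (s N)"
    and m: "stable_mor A (s M) (s N) f h"
  shows "on_arr (Agemo A Q e C q) M N (stable_class A M N f) = stable_class A (C M) (C N) h"
proof -
  let ?\<Phi> = "\<lambda>h. h \<in> lhom A (C M) (C N) \<and> (\<exists>f'\<in>stable_class A M N f. \<exists>t\<in>lhom A (Q M) (Q N).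
    (\<forall>x\<in>carrier M. t (e M x) = e N (f' x)) \<and> (\<forall>y\<in>carrier (Q M). h (q M y) = q N (t y)))"
  have f: "f \<in> lhom A M N" using stable_mor_hom(1)[OF m] by (simp add: s_def)
  have mor: "?\<Phi> h'" if "f' \<in> stable_class A M N f" "stable_mor A (s M) (s N) f' h'" for f' h'
    using that unfolding stable_mor_def seq_mor_def by (auto simp: s_def)
  have arr: "on_arr (Agemo A Q e C q) M N (stable_class A M N f) = \<Union>{stable_class A (C M) (C N) h |h. ?\<Phi> h}"
    by (simp add: Agemo_def)
  show ?thesis unfolding arr
  proof (rule Union_classes)
    have "f \<in> stable_class A M N f"
      using equiv_stable_rel[OF M N] f by (auto simp: equiv_def refl_on_def)
    then show "?\<Phi> h" using m by (rule mor)
  next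
    fix k assume "?\<Phi> k"
    then obtain f' t where f': "f' \<in> stable_class A M N f" and k: "k \<in> lhom A (C M) (C N)"
      and t: "t \<in> lhom A (Q M) (Q N)" "\<And>x. x \<in> carrier M \<Longrightarrow> t (e M x) = e N (f' x)"
        "\<And>y. y \<in> carrier (Q M) \<Longrightarrow> k (q M y) = q N (t y)" by blast
    have ff': "(f, f') \<in> stable_rel A M N" using f' by simp
    have "seq_mor A (s M) (s N) f' t k"
      unfolding seq_mor_def using stable_rel_hom(2)[OF ff'] k t by (simp add: s_def)
    then have m': "stable_mor A (s M) (s N) f' k" unfolding stable_mor_def by blast
    have "(h, k) \<in> stable_rel A (C M) (C N)"
      using stable_mor_rel_iff[OF sM m m'] ff' by (simp add: s_def)
    then show "stable_class A (C M) (C N) k = stable_class A (C M) (C N) h"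
      by (rule equiv_class_eq[OF equiv_stable_rel[OF minimal_approximationsD(4)[OF ap M] minimal_approximationsD(4)[OF ap N]], symmetric])
  qed
qed

text \<open>The unit at \<open>M\<close> completes the identity of \<open>quo (s M)\<close> to a morphism of sequences, the counit at
  \<open>Z\<close> completes the identity of \<open>sub (r Z)\<close>; every identity to be checked holds at the other end of
  the sequences and is carried over by \<open>stable_mor_rel_iff\<close>.\<close>

lemma quasi_inverse_equivalencesI:
  fixes A :: "('a, 'x) ring_scheme" and S S' :: "'a umod set"
    and F G :: "'a stable_endofunctor" and s r :: "'a umod \<Rightarrow> 'a useq"
  assumes S: "S \<subseteq> fg_modules A" and S': "S' \<subseteq> fg_modules A"
    and s: "\<And>M. M \<in> S \<Longrightarrow> approx_seq A (s M)" "\<And>M. M \<in> S \<Longrightarrow> sub (s M) = M"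
    and r: "\<And>Z. Z \<in> S' \<Longrightarrow> approx_seq A (r Z)" "\<And>Z. Z \<in> S' \<Longrightarrow> quo (r Z) = Z"
    and F: "\<And>M. M \<in> S \<Longrightarrow> on_ob F M = quo (s M)" "\<And>M. M \<in> S \<Longrightarrow> quo (s M) \<in> S'"
      "\<And>M N f h. M \<in> S \<Longrightarrow> N \<in> S \<Longrightarrow> stable_mor A (s M) (s N) f h \<Longrightarrow>
        on_arr F M N (stable_class A M N f) = stable_class A (quo (s M)) (quo (s N)) h"
    and G: "\<And>Z. Z \<in> S' \<Longrightarrow> on_ob G Z = sub (r Z)" "\<And>Z. Z \<in> S' \<Longrightarrow> sub (r Z) \<in> S"
      "\<And>Y Z f h. Y \<in> S' \<Longrightarrow> Z \<in> S' \<Longrightarrow> stable_mor A (r Y) (r Z) f h \<Longrightarrow>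
        on_arr G Y Z (stable_class A Y Z h) = stable_class A (sub (r Y)) (sub (r Z)) f"
  shows "quasi_inverse_equivalences (full_subcat (stable_cat A) S) (full_subcat (stable_cat A) S') F G"
proof -
  let ?C = "full_subcat (stable_cat A) S" and ?D = "full_subcat (stable_cat A) S'"
  have Sf: "M \<in> S \<Longrightarrow> M \<in> fg_modules A" and S'f: "M \<in> S' \<Longrightarrow> M \<in> fg_modules A" for M using S S' by auto
  have Ob: "Ob ?C = S" "Ob ?D = S'" using S S' by (auto simp: stable_cat_simps)
  have id: "(\<lambda>x\<in>carrier M. x) \<in> lhom A M M" if "M \<in> fg_modules A" for M :: "'a umod"
    by (rule lhom_id[OF fg_modulesD(1)[OF that]])
  have Farr: "\<exists>f h. f \<in> lhom A M N \<and> T = stable_class A M N f \<and> stable_mor A (s M) (s N) f h"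
    if MN: "M \<in> S" "N \<in> S" and T: "T \<in> lhom A M N // stable_rel A M N" for M N T
  proof -
    obtain f where f: "T = stable_class A M N f" "f \<in> lhom A M N" using T by (rule quotientE)
    obtain h where "stable_mor A (s M) (s N) f h"
      using stable_mor_from_sub[OF s(1)[OF MN(1)] s(1)[OF MN(2)], of f] s(2) f(2) MN by auto
    then show ?thesis using f by blast
  qed
  have Garr: "\<exists>f h. h \<in> lhom A M N \<and> T = stable_class A M N h \<and> stable_mor A (r M) (r N) f h"
    if MN: "M \<in> S'" "N \<in> S'" and T: "T \<in> lhom A M N // stable_rel A M N" for M N T
  proof -
    obtain h where h: "T = stable_class A M N h" "h \<in> lhom A M N" using T by (rule quotientE)
    obtain f where "stable_mor A (r M) (r N) f h"
      using stable_mor_from_quo[OF r(1)[OF MN(1)] r(1)[OF MN(2)], of h] r(2) h(2) MN by auto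
    then show ?thesis using h by blast
  qed
  have funF: "is_functor ?C ?D F"
    unfolding is_functor_def full_subcat_simps(2-4) stable_cat_simps(2,3) Ob
  proof (intro conjI ballI is_category_stable)
    fix M assume M: "M \<in> S"
    then show "on_ob F M \<in> S'" by (simp add: F)
    have "stable_mor A (s M) (s M) (\<lambda>x\<in>carrier M. x) (\<lambda>x\<in>carrier (quo (s M)). x)"
      using stable_mor_id[OF s(1)[OF M]] s(2)[OF M] by simp
    from F(3)[OF M M this] F(1)[OF M]
    show "on_arr F M M (stable_class A M M (\<lambda>x\<in>carrier M. x)) =
        stable_class A (on_ob F M) (on_ob F M) (\<lambda>x\<in>carrier (on_ob F M). x)" by simp
  next
    fix M N T assume MN: "M \<in> S" "N \<in> S" and T: "T \<in> lhom A M N // stable_rel A M N"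
    obtain f h where fh: "T = stable_class A M N f" "stable_mor A (s M) (s N) f h" using Farr[OF MN T] by blast
    show "on_arr F M N T \<in> lhom A (on_ob F M) (on_ob F N) // stable_rel A (on_ob F M) (on_ob F N)"
      unfolding fh(1) F(3)[OF MN fh(2)] F(1)[OF MN(1)] F(1)[OF MN(2)]
      by (rule quotientI[OF stable_mor_hom(2)[OF fh(2)]])
  next
    fix L M N T U assume o: "L \<in> S" "M \<in> S" "N \<in> S" and T: "T \<in> lhom A L M // stable_rel A L M"
      and U: "U \<in> lhom A M N // stable_rel A M N"
    obtain f h where fh: "f \<in> lhom A L M" "T = stable_class A L M f" "stable_mor A (s L) (s M) f h" using Farr[OF o(1,2) T] by blast
    obtain g k where gk: "g \<in> lhom A M N" "U = stable_class A M N g" "stable_mor A (s M) (s N) g k" using Farr[OF o(2,3) U] by blast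
    have c: "stable_mor A (s L) (s N) (compose (carrier L) g f) (compose (carrier (quo (s L))) k h)"
      using stable_mor_compose[OF s(1)[OF o(1)] fh(3) gk(3)] s(2)[OF o(1)] by simp
    show "on_arr F L N (Comp (stable_cat A) L M N U T) =
        Comp (stable_cat A) (on_ob F L) (on_ob F M) (on_ob F N) (on_arr F M N U) (on_arr F L M T)"
      unfolding fh(2) gk(2) F(1)[OF o(1)] F(1)[OF o(2)] F(1)[OF o(3)]
        stable_comp[OF Sf[OF o(1)] Sf[OF o(2)] Sf[OF o(3)] fh(1) gk(1)]
        F(3)[OF o(1,2) fh(3)] F(3)[OF o(2,3) gk(3)] F(3)[OF o(1,3) c]
      by (rule stable_comp[symmetric, OF S'f[OF F(2)[OF o(1)]] S'f[OF F(2)[OF o(2)]] S'f[OF F(2)[OF o(3)]]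
            stable_mor_hom(2)[OF fh(3)] stable_mor_hom(2)[OF gk(3)]])
  qed
  have funG: "is_functor ?D ?C G"
    unfolding is_functor_def full_subcat_simps(2-4) stable_cat_simps(2,3) Ob
  proof (intro conjI ballI is_category_stable)
    fix M assume M: "M \<in> S'"
    then show "on_ob G M \<in> S" by (simp add: G)
    have "stable_mor A (r M) (r M) (\<lambda>x\<in>carrier (sub (r M)). x) (\<lambda>x\<in>carrier M. x)"
      using stable_mor_id[OF r(1)[OF M]] r(2)[OF M] by simp
    from G(3)[OF M M this] G(1)[OF M]
    show "on_arr G M M (stable_class A M M (\<lambda>x\<in>carrier M. x)) =
        stable_class A (on_ob G M) (on_ob G M) (\<lambda>x\<in>carrier (on_ob G M). x)" by simp
  next
    fix M N T assume MN: "M \<in> S'" "N \<in> S'" and T: "T \<in> lhom A M N // stable_rel A M N"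
    obtain f h where fh: "T = stable_class A M N h" "stable_mor A (r M) (r N) f h" using Garr[OF MN T] by blast
    show "on_arr G M N T \<in> lhom A (on_ob G M) (on_ob G N) // stable_rel A (on_ob G M) (on_ob G N)"
      unfolding fh(1) G(3)[OF MN fh(2)] G(1)[OF MN(1)] G(1)[OF MN(2)]
      by (rule quotientI[OF stable_mor_hom(1)[OF fh(2)]])
  next
    fix L M N T U assume o: "L \<in> S'" "M \<in> S'" "N \<in> S'" and T: "T \<in> lhom A L M // stable_rel A L M"
      and U: "U \<in> lhom A M N // stable_rel A M N"
    obtain f h where fh: "h \<in> lhom A L M" "T = stable_class A L M h" "stable_mor A (r L) (r M) f h" using Garr[OF o(1,2) T] by blast
    obtain g k where gk: "k \<in> lhom A M N" "U = stable_class A M N k" "stable_mor A (r M) (r N) g k" using Garr[OF o(2,3) U] by blast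
    have c: "stable_mor A (r L) (r N) (compose (carrier (sub (r L))) g f) (compose (carrier L) k h)"
      using stable_mor_compose[OF r(1)[OF o(1)] fh(3) gk(3)] r(2)[OF o(1)] by simp
    show "on_arr G L N (Comp (stable_cat A) L M N U T) =
        Comp (stable_cat A) (on_ob G L) (on_ob G M) (on_ob G N) (on_arr G M N U) (on_arr G L M T)"
      unfolding fh(2) gk(2) G(1)[OF o(1)] G(1)[OF o(2)] G(1)[OF o(3)]
        stable_comp[OF S'f[OF o(1)] S'f[OF o(2)] S'f[OF o(3)] fh(1) gk(1)]
        G(3)[OF o(1,2) fh(3)] G(3)[OF o(2,3) gk(3)] G(3)[OF o(1,3) c]
      by (rule stable_comp[symmetric, OF Sf[OF G(2)[OF o(1)]] Sf[OF G(2)[OF o(2)]] Sf[OF G(2)[OF o(3)]]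
            stable_mor_hom(1)[OF fh(3)] stable_mor_hom(1)[OF gk(3)]])
  qed
  \<comment> \<open>Maps that are mutually inverse up to maps through projectives; unit and counit
    are both treated by this.\<close>
  have iso: "is_isomorphism (full_subcat (stable_cat A) T) M N (stable_class A M N f)"
    if "M \<in> fg_modules A" "N \<in> fg_modules A" "f \<in> lhom A M N" "g \<in> lhom A N M"
      "(compose (carrier M) g f, \<lambda>x\<in>carrier M. x) \<in> stable_rel A M M"
      "(compose (carrier N) f g, \<lambda>x\<in>carrier N. x) \<in> stable_rel A N N" for M N f g T
    unfolding is_isomorphism_def full_subcat_simps stable_cat_simps
    using that by (intro conjI bexI[of _ "stable_class A N M g"] quotientI)
      (simp_all add: stable_comp equiv_class_eq[OF equiv_stable_rel])
  have unit: "naturally_isomorphic ?C ?C id_functor (comp_functor G F)"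
  proof -
    have ex: "\<exists>u. stable_mor A (s M) (r (quo (s M))) u (\<lambda>x\<in>carrier (quo (s M)). x)" if M: "M \<in> S" for M
      using stable_mor_from_quo[OF s(1)[OF M] r(1)[OF F(2)[OF M]], of "\<lambda>x\<in>carrier (quo (s M)). x"]
        id[OF S'f[OF F(2)[OF M]]] r(2)[OF F(2)[OF M]] by auto
    define \<eta> where "\<eta> M = (SOME u. stable_mor A (s M) (r (quo (s M))) u (\<lambda>x\<in>carrier (quo (s M)). x))" for M
    have \<eta>: "stable_mor A (s M) (r (quo (s M))) (\<eta> M) (\<lambda>x\<in>carrier (quo (s M)). x)" if M: "M \<in> S" for M
      unfolding \<eta>_def by (rule someI_ex[OF ex[OF M]])
    have \<eta>h: "\<eta> M \<in> lhom A M (sub (r (quo (s M))))" if M: "M \<in> S" for M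
      using stable_mor_hom(1)[OF \<eta>[OF M]] s(2)[OF M] by simp
    show ?thesis
      unfolding naturally_isomorphic_def Ob
    proof (intro exI[of _ "\<lambda>M. stable_class A M (sub (r (quo (s M)))) (\<eta> M)"] conjI ballI)
      fix M assume M: "M \<in> S"
      let ?Z = "quo (s M)"
      note Z = F(2)[OF M]
      note idZ = id[OF S'f[OF Z]]
      \<comment> \<open>The inverse of the unit completes the same identity in the opposite
        direction; both composites then lie over an identity.\<close>
      obtain v where v: "stable_mor A (r ?Z) (s M) v (\<lambda>x\<in>carrier ?Z. x)"
        using stable_mor_from_quo[OF r(1)[OF Z] s(1)[OF M], of "\<lambda>x\<in>carrier ?Z. x"] idZ r(2)[OF Z] by auto
      have cid: "compose (carrier ?Z) (\<lambda>x\<in>carrier ?Z. x) (\<lambda>x\<in>carrier ?Z. x) = (\<lambda>x\<in>carrier ?Z. x)"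
        by (rule extensionalityI[of _ "carrier ?Z"]) (simp_all add: compose_eq compose_extensional)
      have rf: "((\<lambda>x\<in>carrier ?Z. x), (\<lambda>x\<in>carrier ?Z. x)) \<in> stable_rel A ?Z ?Z"
        using equiv_stable_rel[OF S'f[OF Z] S'f[OF Z]] idZ by (auto simp: equiv_def refl_on_def)
      have a1: "stable_mor A (s M) (s M) (compose (carrier M) v (\<eta> M)) (\<lambda>x\<in>carrier ?Z. x)"
        using stable_mor_compose[OF s(1)[OF M] \<eta>[OF M] v] s(2)[OF M] cid by simp
      have b1: "stable_mor A (s M) (s M) (\<lambda>x\<in>carrier M. x) (\<lambda>x\<in>carrier ?Z. x)"
        using stable_mor_id[OF s(1)[OF M]] s(2)[OF M] by simp
      have 1: "(compose (carrier M) v (\<eta> M), \<lambda>x\<in>carrier M. x) \<in> stable_rel A M M"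
        using stable_mor_rel_iff[OF s(1)[OF M] s(1)[OF M] a1 b1] s(2)[OF M] rf by simp
      have a2: "stable_mor A (r ?Z) (r ?Z) (compose (carrier (sub (r ?Z))) (\<eta> M) v) (\<lambda>x\<in>carrier ?Z. x)"
        using stable_mor_compose[OF r(1)[OF Z] v \<eta>[OF M]] r(2)[OF Z] cid by simp
      have b2: "stable_mor A (r ?Z) (r ?Z) (\<lambda>x\<in>carrier (sub (r ?Z)). x) (\<lambda>x\<in>carrier ?Z. x)"
        using stable_mor_id[OF r(1)[OF Z]] r(2)[OF Z] by simp
      have 2: "(compose (carrier (sub (r ?Z))) (\<eta> M) v, \<lambda>x\<in>carrier (sub (r ?Z)). x) \<in>
          stable_rel A (sub (r ?Z)) (sub (r ?Z))"
        using stable_mor_rel_iff[OF r(1)[OF Z] r(1)[OF Z] a2 b2] r(2)[OF Z] rf by simp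
      have vh: "v \<in> lhom A (sub (r ?Z)) M" using stable_mor_hom(1)[OF v] s(2)[OF M] by simp
      from iso[OF Sf[OF M] Sf[OF G(2)[OF Z]] \<eta>h[OF M] vh 1 2]
      show "is_isomorphism ?C (on_ob id_functor M) (on_ob (comp_functor G F) M) (stable_class A M (sub (r ?Z)) (\<eta> M))"
        by (simp add: id_functor_def comp_functor_def F(1)[OF M] G(1)[OF Z])
    next
      fix M N T assume o: "M \<in> S" "N \<in> S" and "T \<in> Arr ?C M N"
      then have T: "T \<in> lhom A M N // stable_rel A M N" by (simp add: stable_cat_simps)
      obtain f h where f: "f \<in> lhom A M N" and Tf: "T = stable_class A M N f" and fh: "stable_mor A (s M) (s N) f h"
        using Farr[OF o T] by blast
      let ?X = "quo (s M)" and ?Y = "quo (s N)"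
      note X = F(2)[OF o(1)] and Y = F(2)[OF o(2)]
      note h = stable_mor_hom(2)[OF fh]
      obtain k where k: "stable_mor A (r ?X) (r ?Y) k h"
        using stable_mor_from_quo[OF r(1)[OF X] r(1)[OF Y], of h] h r(2)[OF X] r(2)[OF Y] by auto
      have kh: "k \<in> lhom A (sub (r ?X)) (sub (r ?Y))" by (rule stable_mor_hom(1)[OF k])
      have c1: "compose (carrier ?X) (\<lambda>x\<in>carrier ?Y. x) h = h" and c2: "compose (carrier ?X) h (\<lambda>x\<in>carrier ?X. x) = h"
        by (rule extensionalityI[of _ "carrier ?X"];
          simp add: compose_eq compose_extensional lhom_extensional[OF h] lhom_closed[OF h])+
      have m1: "stable_mor A (s M) (r ?Y) (compose (carrier M) (\<eta> N) f) h"
        using stable_mor_compose[OF s(1)[OF o(1)] fh \<eta>[OF o(2)]] s(2)[OF o(1)] c1 by simp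
      have m2: "stable_mor A (s M) (r ?Y) (compose (carrier M) k (\<eta> M)) h"
        using stable_mor_compose[OF s(1)[OF o(1)] \<eta>[OF o(1)] k] s(2)[OF o(1)] c2 by simp
      have "(h, h) \<in> stable_rel A ?X ?Y"
        using equiv_stable_rel[OF S'f[OF X] S'f[OF Y]] h by (auto simp: equiv_def refl_on_def)
      then have "(compose (carrier M) (\<eta> N) f, compose (carrier M) k (\<eta> M)) \<in> stable_rel A M (sub (r ?Y))"
        using stable_mor_rel_iff[OF s(1)[OF o(1)] r(1)[OF Y] m1 m2] s(2)[OF o(1)] r(2)[OF Y] by simp
      note eq = equiv_class_eq[OF equiv_stable_rel[OF Sf[OF o(1)] Sf[OF G(2)[OF Y]]] this]
      have GF: "on_arr (comp_functor G F) M N T = stable_class A (sub (r ?X)) (sub (r ?Y)) k"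
        unfolding comp_functor_def Tf by (simp add: F(1)[OF o(1)] F(1)[OF o(2)] F(3)[OF o fh] G(3)[OF X Y k])
      show "Comp ?C (on_ob id_functor M) (on_ob id_functor N) (on_ob (comp_functor G F) N)
            (stable_class A N (sub (r ?Y)) (\<eta> N)) (on_arr id_functor M N T) =
          Comp ?C (on_ob id_functor M) (on_ob (comp_functor G F) M) (on_ob (comp_functor G F) N)
            (on_arr (comp_functor G F) M N T) (stable_class A M (sub (r ?X)) (\<eta> M))"
        unfolding GF
        by (simp add: id_functor_def comp_functor_def F(1)[OF o(1)] F(1)[OF o(2)] G(1)[OF X] G(1)[OF Y] Tf eq
            stable_comp[OF Sf[OF o(1)] Sf[OF o(2)] Sf[OF G(2)[OF Y]] f \<eta>h[OF o(2)]]
            stable_comp[OF Sf[OF o(1)] Sf[OF G(2)[OF X]] Sf[OF G(2)[OF Y]] \<eta>h[OF o(1)] kh])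
    qed
  qed
  have counit: "naturally_isomorphic ?D ?D (comp_functor F G) id_functor"
  proof -
    have ex: "\<exists>h. stable_mor A (s (sub (r Z))) (r Z) (\<lambda>x\<in>carrier (sub (r Z)). x) h" if Z: "Z \<in> S'" for Z
      using stable_mor_from_sub[OF s(1)[OF G(2)[OF Z]] r(1)[OF Z], of "\<lambda>x\<in>carrier (sub (r Z)). x"]
        id[OF Sf[OF G(2)[OF Z]]] s(2)[OF G(2)[OF Z]] by auto
    define \<epsilon> where "\<epsilon> Z = (SOME h. stable_mor A (s (sub (r Z))) (r Z) (\<lambda>x\<in>carrier (sub (r Z)). x) h)" for Z
    have \<epsilon>: "stable_mor A (s (sub (r Z))) (r Z) (\<lambda>x\<in>carrier (sub (r Z)). x) (\<epsilon> Z)" if Z: "Z \<in> S'" for Z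
      unfolding \<epsilon>_def by (rule someI_ex[OF ex[OF Z]])
    have \<epsilon>h: "\<epsilon> Z \<in> lhom A (quo (s (sub (r Z)))) Z" if Z: "Z \<in> S'" for Z
      using stable_mor_hom(2)[OF \<epsilon>[OF Z]] r(2)[OF Z] by simp
    show ?thesis
      unfolding naturally_isomorphic_def Ob
    proof (intro exI[of _ "\<lambda>Z. stable_class A (quo (s (sub (r Z)))) Z (\<epsilon> Z)"] conjI ballI)
      fix Z assume Z: "Z \<in> S'"
      let ?M = "sub (r Z)"
      note M = G(2)[OF Z]
      note idM = id[OF Sf[OF M]]
      \<comment> \<open>The inverse of the counit is obtained by completing the identity of the
        first term in the opposite direction.\<close>
      obtain v where v: "stable_mor A (r Z) (s ?M) (\<lambda>x\<in>carrier ?M. x) v"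
        using stable_mor_from_sub[OF r(1)[OF Z] s(1)[OF M], of "\<lambda>x\<in>carrier ?M. x"] idM s(2)[OF M] by auto
      have cid: "compose (carrier ?M) (\<lambda>x\<in>carrier ?M. x) (\<lambda>x\<in>carrier ?M. x) = (\<lambda>x\<in>carrier ?M. x)"
        by (rule extensionalityI[of _ "carrier ?M"]) (simp_all add: compose_eq compose_extensional)
      have rf: "((\<lambda>x\<in>carrier ?M. x), (\<lambda>x\<in>carrier ?M. x)) \<in> stable_rel A ?M ?M"
        using equiv_stable_rel[OF Sf[OF M] Sf[OF M]] idM by (auto simp: equiv_def refl_on_def)
      have a1: "stable_mor A (r Z) (r Z) (\<lambda>x\<in>carrier ?M. x) (compose (carrier Z) (\<epsilon> Z) v)"
        using stable_mor_compose[OF r(1)[OF Z] v \<epsilon>[OF Z]] r(2)[OF Z] cid by simp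
      have b1: "stable_mor A (r Z) (r Z) (\<lambda>x\<in>carrier ?M. x) (\<lambda>x\<in>carrier Z. x)"
        using stable_mor_id[OF r(1)[OF Z]] r(2)[OF Z] by simp
      have 1: "(compose (carrier Z) (\<epsilon> Z) v, \<lambda>x\<in>carrier Z. x) \<in> stable_rel A Z Z"
        using stable_mor_rel_iff[OF r(1)[OF Z] r(1)[OF Z] a1 b1] r(2)[OF Z] rf by simp
      have a2: "stable_mor A (s ?M) (s ?M) (\<lambda>x\<in>carrier ?M. x) (compose (carrier (quo (s ?M))) v (\<epsilon> Z))"
        using stable_mor_compose[OF s(1)[OF M] \<epsilon>[OF Z] v] s(2)[OF M] cid by simp
      have b2: "stable_mor A (s ?M) (s ?M) (\<lambda>x\<in>carrier ?M. x) (\<lambda>x\<in>carrier (quo (s ?M)). x)"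
        using stable_mor_id[OF s(1)[OF M]] s(2)[OF M] by simp
      have 2: "(compose (carrier (quo (s ?M))) v (\<epsilon> Z), \<lambda>x\<in>carrier (quo (s ?M)). x) \<in>
          stable_rel A (quo (s ?M)) (quo (s ?M))"
        using stable_mor_rel_iff[OF s(1)[OF M] s(1)[OF M] a2 b2] s(2)[OF M] rf by simp
      have vh: "v \<in> lhom A Z (quo (s ?M))" using stable_mor_hom(2)[OF v] r(2)[OF Z] by simp
      from iso[OF S'f[OF F(2)[OF M]] S'f[OF Z] \<epsilon>h[OF Z] vh 2 1]
      show "is_isomorphism ?D (on_ob (comp_functor F G) Z) (on_ob id_functor Z) (stable_class A (quo (s ?M)) Z (\<epsilon> Z))"
        by (simp add: id_functor_def comp_functor_def F(1)[OF M] G(1)[OF Z])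
    next
      fix X Y T assume o: "X \<in> S'" "Y \<in> S'" and "T \<in> Arr ?D X Y"
      then have T: "T \<in> lhom A X Y // stable_rel A X Y" by (simp add: stable_cat_simps)
      obtain f h where h: "h \<in> lhom A X Y" and Th: "T = stable_class A X Y h" and fh: "stable_mor A (r X) (r Y) f h"
        using Garr[OF o T] by blast
      let ?M = "sub (r X)" and ?N = "sub (r Y)"
      note M = G(2)[OF o(1)] and N = G(2)[OF o(2)]
      note f = stable_mor_hom(1)[OF fh]
      obtain k where k: "stable_mor A (s ?M) (s ?N) f k"
        using stable_mor_from_sub[OF s(1)[OF M] s(1)[OF N], of f] f s(2)[OF M] s(2)[OF N] by auto
      have kh: "k \<in> lhom A (quo (s ?M)) (quo (s ?N))" by (rule stable_mor_hom(2)[OF k])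
      have c1: "compose (carrier ?M) (\<lambda>x\<in>carrier ?N. x) f = f" and c2: "compose (carrier ?M) f (\<lambda>x\<in>carrier ?M. x) = f"
        by (rule extensionalityI[of _ "carrier ?M"];
          simp add: compose_eq compose_extensional lhom_extensional[OF f] lhom_closed[OF f])+
      have m1: "stable_mor A (s ?M) (r Y) f (compose (carrier (quo (s ?M))) (\<epsilon> Y) k)"
        using stable_mor_compose[OF s(1)[OF M] k \<epsilon>[OF o(2)]] s(2)[OF M] c1 by simp
      have m2: "stable_mor A (s ?M) (r Y) f (compose (carrier (quo (s ?M))) h (\<epsilon> X))"
        using stable_mor_compose[OF s(1)[OF M] \<epsilon>[OF o(1)] fh] s(2)[OF M] c2 by simp
      have "(f, f) \<in> stable_rel A ?M ?N"
        using equiv_stable_rel[OF Sf[OF M] Sf[OF N]] f by (auto simp: equiv_def refl_on_def)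
      then have "(compose (carrier (quo (s ?M))) (\<epsilon> Y) k, compose (carrier (quo (s ?M))) h (\<epsilon> X)) \<in>
          stable_rel A (quo (s ?M)) Y"
        using stable_mor_rel_iff[OF s(1)[OF M] r(1)[OF o(2)] m1 m2] s(2)[OF M] r(2)[OF o(2)] by simp
      note eq = equiv_class_eq[OF equiv_stable_rel[OF S'f[OF F(2)[OF M]] S'f[OF o(2)]] this]
      have FG: "on_arr (comp_functor F G) X Y T = stable_class A (quo (s ?M)) (quo (s ?N)) k"
        unfolding comp_functor_def Th by (simp add: G(1)[OF o(1)] G(1)[OF o(2)] G(3)[OF o fh] F(3)[OF M N k])
      show "Comp ?D (on_ob (comp_functor F G) X) (on_ob (comp_functor F G) Y) (on_ob id_functor Y)
            (stable_class A (quo (s ?N)) Y (\<epsilon> Y)) (on_arr (comp_functor F G) X Y T) =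
          Comp ?D (on_ob (comp_functor F G) X) (on_ob id_functor X) (on_ob id_functor Y)
            (on_arr id_functor X Y T) (stable_class A (quo (s ?M)) X (\<epsilon> X))"
        unfolding FG
        by (simp add: id_functor_def comp_functor_def F(1)[OF M] F(1)[OF N] G(1)[OF o(1)] G(1)[OF o(2)] Th eq
            stable_comp[OF S'f[OF F(2)[OF M]] S'f[OF F(2)[OF N]] S'f[OF o(2)] kh \<epsilon>h[OF o(2)]]
            stable_comp[OF S'f[OF F(2)[OF M]] S'f[OF o(1)] S'f[OF o(2)] \<epsilon>h[OF o(1)] h])
    qed
  qed
  show ?thesis unfolding quasi_inverse_equivalences_def using funF funG unit counit by blast
qed

text \<open>Reduces each equivalence to statements about objects. \<open>inj\<close> and
  \<open>ext\<close> make the cokernel sequences over S and the kernel sequences over S'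
  approximation sequences; \<open>SC\<close> and \<open>S'Om\<close> say that the functors respect
  the two classes.\<close>

lemma quasi_inverse_Agemo_Syz:
  fixes A :: "('a, 'x) ring_scheme" and S S' :: "'a umod set"
  assumes cov: "projective_covers A P p" and ap: "minimal_approximations A Q e C q"
    and S: "S \<subseteq> fg_modules A" and S': "S' \<subseteq> fg_modules A"
    and SC: "\<And>M. M \<in> S \<Longrightarrow> C M \<in> S'"
    and S'Om: "\<And>Z. Z \<in> S' \<Longrightarrow> sub (kernel_seq (P Z) Z (p Z)) \<in> S"
    and inj: "\<And>M. M \<in> S \<Longrightarrow> inj_on (e M) (carrier M)"
    and ext: "\<And>Z. Z \<in> S' \<Longrightarrow> extends A (kernel_seq (P Z) Z (p Z)) (regular A)"
  shows "quasi_inverse_equivalences (full_subcat (stable_cat A) S) (full_subcat (stable_cat A) S')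
    (Agemo A Q e C q) (Syz A P p)"
proof -
  let ?s = "\<lambda>M. cokernel_seq M (e M) (Q M) (q M) (C M)" and ?r = "\<lambda>Z. kernel_seq (P Z) Z (p Z)"
  have Sf: "M \<in> S \<Longrightarrow> M \<in> fg_modules A" and S'f: "M \<in> S' \<Longrightarrow> M \<in> fg_modules A" for M using S S' by auto
  have s: "approx_seq A (?s M)" if "M \<in> S" for M
    by (rule approx_seq_approximation[OF ap Sf[OF that] inj[OF that]])
  have r: "approx_seq A (?r Z)" if "Z \<in> S'" for Z
    unfolding approx_seq_def using proj_seq_cover[OF cov S'f[OF that]] ext[OF that] by blast
  show ?thesis
  proof (rule quasi_inverse_equivalencesI[OF S S', of ?s ?r])
    fix M N f h assume "M \<in> S" "N \<in> S" "stable_mor A (?s M) (?s N) f h"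
    then show "on_arr (Agemo A Q e C q) M N (stable_class A M N f) = stable_class A (quo (?s M)) (quo (?s N)) h"
      using Agemo_on_arr[OF ap Sf Sf s s] by simp
  next
    fix Y Z f h assume "Y \<in> S'" "Z \<in> S'" "stable_mor A (?r Y) (?r Z) f h"
    then show "on_arr (Syz A P p) Y Z (stable_class A Y Z h) = stable_class A (sub (?r Y)) (sub (?r Z)) f"
      using Syz_on_arr[OF cov S'f S'f r r Sf[OF S'Om] Sf[OF S'Om]] by simp
  next
    fix Z assume "Z \<in> S'"
    then show "sub (?r Z) \<in> S" by (rule S'Om)
  qed (simp_all only: s r cokernel_seq_simps kernel_seq_simps(5) Agemo_on_ob Syz_on_ob SC)
qed

section \<open>Quotient modules\<close>

lemma quot_mod_facts:
  assumes M: "left_module A M" and N: "submodule N A M"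
  shows left_module_quot_mod: "left_module A (quot_mod M N)"
    and lhom_quot_proj: "(\<lambda>x\<in>carrier M. N +>\<^bsub>M\<^esub> x) \<in> lhom A M (quot_mod M N)"
    and quot_proj_surj: "(\<lambda>x\<in>carrier M. N +>\<^bsub>M\<^esub> x) ` carrier M = carrier (quot_mod M N)"
    and quot_proj_kernel: "a_kernel M (quot_mod M N) (\<lambda>x\<in>carrier M. N +>\<^bsub>M\<^esub> x) = N"
proof -
  interpret MG: abelian_group M using M by (rule left_module_abelian_group)
  interpret M: left_module A M by fact
  note sN = submodule_subset[OF N]
  have gN: "subgroup N (add_monoid M)" by (rule submodule.axioms(1)[OF N])
  interpret N: abelian_subgroup N M
    by (rule abelian_subgroupI3[OF additive_subgroup.intro[OF gN] MG.abelian_group_axioms])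
  let ?c = "\<lambda>x. N +>\<^bsub>M\<^esub> x" and ?Q = "quot_mod M N"
  have car: "carrier ?Q = ?c ` carrier M"
    unfolding quot_mod_def by (simp only: partial_object.select_convs A_RCOSETS_def') blast
  have zero: "\<zero>\<^bsub>?Q\<^esub> = N" by (simp add: quot_mod_def)
  have c0: "?c \<zero>\<^bsub>M\<^esub> = N" by (rule MG.a_coset_add_zero[OF sN])
  have add: "?c x \<oplus>\<^bsub>?Q\<^esub> ?c y = ?c (x \<oplus>\<^bsub>M\<^esub> y)" if "x \<in> carrier M" "y \<in> carrier M" for x y
    using N.a_rcos_sum[OF that] by (simp add: quot_mod_def)
  have sm: "a \<odot>\<^bsub>?Q\<^esub> ?c y = ?c (a \<odot>\<^bsub>M\<^esub> y)" if a: "a \<in> carrier A" and y: "y \<in> carrier M" for a y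
  proof -
    \<comment> \<open>Members of one coset differ by some n in N, and a times n lies in N again. So
      the union defining scalar multiplication is a union of equal cosets.\<close>
    have eq: "?c (a \<odot>\<^bsub>M\<^esub> x) = ?c (a \<odot>\<^bsub>M\<^esub> y)" if x: "x \<in> ?c y" for x
    proof -
      obtain n where n: "n \<in> N" "x = n \<oplus>\<^bsub>M\<^esub> y" using x unfolding a_r_coset_def' by blast
      then have "a \<odot>\<^bsub>M\<^esub> x = a \<odot>\<^bsub>M\<^esub> n \<oplus>\<^bsub>M\<^esub> a \<odot>\<^bsub>M\<^esub> y" using a y sN by (auto simp: M.smult_r_distr)
      then have "a \<odot>\<^bsub>M\<^esub> x \<in> ?c (a \<odot>\<^bsub>M\<^esub> y)"
        using MG.a_rcosI[OF submodule_smult[OF N a n(1)] sN M.smult_closed[OF a y]] by simp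
      from MG.a_repr_independence[OF this M.smult_closed[OF a y] gN] show ?thesis by simp
    qed
    have y': "y \<in> ?c y" using MG.a_rcosI[OF N.zero_closed sN y] y by simp
    have "(\<Union>x\<in>?c y. ?c (a \<odot>\<^bsub>M\<^esub> x)) = (\<Union>x\<in>?c y. ?c (a \<odot>\<^bsub>M\<^esub> y))" by (intro SUP_cong refl eq)
    also have "\<dots> = ?c (a \<odot>\<^bsub>M\<^esub> y)" using y' by auto
    finally show ?thesis by (simp add: quot_mod_def)
  qed
  have rep: "\<exists>x\<in>carrier M. X = ?c x" if "X \<in> carrier ?Q" for X using that unfolding car by blast
  have cin: "?c x \<in> carrier ?Q" if "x \<in> carrier M" for x using that unfolding car by blast
  have ab: "abelian_group ?Q"
  proof (rule abelian_groupI)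
    fix X Y assume "X \<in> carrier ?Q" "Y \<in> carrier ?Q"
    then obtain x y where xy: "x \<in> carrier M" "X = ?c x" "y \<in> carrier M" "Y = ?c y" using rep by metis
    show "X \<oplus>\<^bsub>?Q\<^esub> Y \<in> carrier ?Q" using xy by (simp add: add cin)
    show "X \<oplus>\<^bsub>?Q\<^esub> Y = Y \<oplus>\<^bsub>?Q\<^esub> X" using xy by (simp add: add MG.a_comm)
  next
    fix X Y Z assume "X \<in> carrier ?Q" "Y \<in> carrier ?Q" "Z \<in> carrier ?Q"
    then obtain x y z where xy: "x \<in> carrier M" "X = ?c x" "y \<in> carrier M" "Y = ?c y" "z \<in> carrier M" "Z = ?c z"
      using rep by metis
    show "X \<oplus>\<^bsub>?Q\<^esub> Y \<oplus>\<^bsub>?Q\<^esub> Z = X \<oplus>\<^bsub>?Q\<^esub> (Y \<oplus>\<^bsub>?Q\<^esub> Z)" using xy by (simp add: add MG.a_assoc)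
  next
    show "\<zero>\<^bsub>?Q\<^esub> \<in> carrier ?Q" using cin[OF MG.zero_closed] by (simp add: zero c0)
  next
    fix X assume "X \<in> carrier ?Q"
    then obtain x where x: "x \<in> carrier M" "X = ?c x" using rep by metis
    have "\<zero>\<^bsub>?Q\<^esub> \<oplus>\<^bsub>?Q\<^esub> X = ?c \<zero>\<^bsub>M\<^esub> \<oplus>\<^bsub>?Q\<^esub> ?c x" by (simp only: zero c0 x)
    also have "\<dots> = X" using x by (simp only: add MG.zero_closed MG.l_zero)
    finally show "\<zero>\<^bsub>?Q\<^esub> \<oplus>\<^bsub>?Q\<^esub> X = X" .
    have "?c (\<ominus>\<^bsub>M\<^esub> x) \<oplus>\<^bsub>?Q\<^esub> X = \<zero>\<^bsub>?Q\<^esub>" using x by (simp add: add MG.l_neg zero c0)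
    then show "\<exists>Y\<in>carrier ?Q. Y \<oplus>\<^bsub>?Q\<^esub> X = \<zero>\<^bsub>?Q\<^esub>" using cin[OF MG.a_inv_closed[OF x(1)]] by blast
  qed
  show L: "left_module A ?Q"
  proof (rule left_module.intro[OF left_module_ring[OF M] ab], rule left_module_axioms.intro)
    fix a X assume a: "a \<in> carrier A" and "X \<in> carrier ?Q"
    then obtain x where x: "x \<in> carrier M" "X = ?c x" using rep by metis
    show "a \<odot>\<^bsub>?Q\<^esub> X \<in> carrier ?Q" using x a by (simp add: sm cin)
  next
    fix a b X assume a: "a \<in> carrier A" "b \<in> carrier A" and "X \<in> carrier ?Q"
    then obtain x where x: "x \<in> carrier M" "X = ?c x" using rep by metis
    show "(a \<oplus>\<^bsub>A\<^esub> b) \<odot>\<^bsub>?Q\<^esub> X = a \<odot>\<^bsub>?Q\<^esub> X \<oplus>\<^bsub>?Q\<^esub> b \<odot>\<^bsub>?Q\<^esub> X"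
      using x a by (simp add: sm add M.smult_l_distr)
    show "(a \<otimes>\<^bsub>A\<^esub> b) \<odot>\<^bsub>?Q\<^esub> X = a \<odot>\<^bsub>?Q\<^esub> (b \<odot>\<^bsub>?Q\<^esub> X)"
      using x a by (simp add: sm M.smult_assoc)
  next
    fix a X Y assume a: "a \<in> carrier A" and "X \<in> carrier ?Q" "Y \<in> carrier ?Q"
    then obtain x y where xy: "x \<in> carrier M" "X = ?c x" "y \<in> carrier M" "Y = ?c y" using rep by metis
    show "a \<odot>\<^bsub>?Q\<^esub> (X \<oplus>\<^bsub>?Q\<^esub> Y) = a \<odot>\<^bsub>?Q\<^esub> X \<oplus>\<^bsub>?Q\<^esub> a \<odot>\<^bsub>?Q\<^esub> Y"
      using xy a by (simp add: sm add M.smult_r_distr)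
  next
    fix X assume "X \<in> carrier ?Q"
    then obtain x where x: "x \<in> carrier M" "X = ?c x" using rep by metis
    show "\<one>\<^bsub>A\<^esub> \<odot>\<^bsub>?Q\<^esub> X = X" using x by (simp add: sm)
  qed
  show "(\<lambda>x\<in>carrier M. ?c x) \<in> lhom A M ?Q"
    by (rule lhom_restrictI[OF M]) (simp_all add: cin add sm)
  show "(\<lambda>x\<in>carrier M. ?c x) ` carrier M = carrier ?Q" unfolding car by simp
  have "?c x = N \<longleftrightarrow> x \<in> N" if "x \<in> carrier M" for x
    using MG.a_coset_join1[OF _ that gN] MG.a_coset_join2[OF that gN] by blast
  then show "a_kernel M ?Q (\<lambda>x\<in>carrier M. ?c x) = N"
    using sN by (auto simp: a_kernel_def' zero)
qed


section \<open>Duals over the opposite ring\<close>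

lemma opp_simps [simp]:
  "carrier (opp A) = carrier A" "\<one>\<^bsub>opp A\<^esub> = \<one>\<^bsub>A\<^esub>" "\<zero>\<^bsub>opp A\<^esub> = \<zero>\<^bsub>A\<^esub>"
  "x \<oplus>\<^bsub>opp A\<^esub> y = x \<oplus>\<^bsub>A\<^esub> y" "x \<otimes>\<^bsub>opp A\<^esub> y = y \<otimes>\<^bsub>A\<^esub> x"
  by (simp_all add: opp_def)

lemma ring_opp:
  assumes "ring A"
  shows "ring (opp A)"
proof -
  interpret ring A by fact
  show ?thesis
  proof (rule ringI)
    show "abelian_group (opp A)"
    proof (rule abelian_groupI)
      fix x assume "x \<in> carrier (opp A)"
      then show "\<exists>y\<in>carrier (opp A). y \<oplus>\<^bsub>opp A\<^esub> x = \<zero>\<^bsub>opp A\<^esub>"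
        by (intro bexI[of _ "\<ominus>\<^bsub>A\<^esub> x"]) (simp_all add: l_neg)
    qed (simp_all add: a_ac)
    show "monoid (opp A)" by (rule monoidI) (simp_all add: m_assoc)
  qed (simp_all add: l_distr r_distr)
qed

lemma star_simps [simp]:
  "carrier (star A M) = lhom A M (regular A)" "\<zero>\<^bsub>star A M\<^esub> = (\<lambda>x\<in>carrier M. \<zero>\<^bsub>A\<^esub>)"
  "\<phi> \<oplus>\<^bsub>star A M\<^esub> \<psi> = (\<lambda>x\<in>carrier M. \<phi> x \<oplus>\<^bsub>A\<^esub> \<psi> x)"
  "a \<odot>\<^bsub>star A M\<^esub> \<phi> = (\<lambda>x\<in>carrier M. \<phi> x \<otimes>\<^bsub>A\<^esub> a)"
  by (simp_all add: star_def)

lemma left_module_star: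
  assumes M: "left_module A M"
  shows "left_module (opp A) (star A M)"
proof -
  note A = left_module_ring[OF M]
  interpret ring A by fact
  note R = left_module_regular[OF A]
  have c: "\<phi> x \<in> carrier A" if "\<phi> \<in> lhom A M (regular A)" "x \<in> carrier M" for \<phi> x
    using lhom_closed[OF that] by simp
  have ac: "(\<lambda>x\<in>carrier M. \<phi> x \<oplus>\<^bsub>A\<^esub> \<psi> x) \<in> lhom A M (regular A)"
    if "\<phi> \<in> lhom A M (regular A)" "\<psi> \<in> lhom A M (regular A)" for \<phi> \<psi>
    using lhom_sum[OF M R that] by simp
  have sc: "(\<lambda>x\<in>carrier M. \<phi> x \<otimes>\<^bsub>A\<^esub> a) \<in> lhom A M (regular A)"
    if "\<phi> \<in> lhom A M (regular A)" "a \<in> carrier A" for \<phi> a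
    by (rule lhom_restrictI[OF M])
      (use that c lhom_add[OF that(1)] lhom_smult[OF that(1)] in \<open>simp_all add: l_distr m_assoc\<close>)
  have zc: "(\<lambda>x\<in>carrier M. \<zero>\<^bsub>A\<^esub>) \<in> lhom A M (regular A)"
    using lhom_zero_map[OF M R] by simp
  have ab: "abelian_group (star A M)"
  proof (rule abelian_groupI)
    fix \<phi> assume p: "\<phi> \<in> carrier (star A M)"
    \<comment> \<open>The negative of \<phi> is written as \<phi> times -1, so that
      \<open>sc\<close> gives its linearity.\<close>
    let ?n = "\<lambda>x\<in>carrier M. \<phi> x \<otimes>\<^bsub>A\<^esub> (\<ominus>\<^bsub>A\<^esub> \<one>\<^bsub>A\<^esub>)"
    have "?n \<oplus>\<^bsub>star A M\<^esub> \<phi> = \<zero>\<^bsub>star A M\<^esub>"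
      unfolding star_simps by (rule restrict_ext) (use p c in \<open>simp add: r_minus l_neg\<close>)
    then show "\<exists>\<psi>\<in>carrier (star A M). \<psi> \<oplus>\<^bsub>star A M\<^esub> \<phi> = \<zero>\<^bsub>star A M\<^esub>"
      using sc[of \<phi> "\<ominus>\<^bsub>A\<^esub> \<one>\<^bsub>A\<^esub>"] p by (intro bexI[of _ ?n]) simp_all
  next
    fix \<phi> \<psi> \<chi> assume p: "\<phi> \<in> carrier (star A M)" "\<psi> \<in> carrier (star A M)" "\<chi> \<in> carrier (star A M)"
    show "\<phi> \<oplus>\<^bsub>star A M\<^esub> \<psi> \<oplus>\<^bsub>star A M\<^esub> \<chi> = \<phi> \<oplus>\<^bsub>star A M\<^esub> (\<psi> \<oplus>\<^bsub>star A M\<^esub> \<chi>)"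
      unfolding star_simps by (rule restrict_ext) (use p c in \<open>simp add: a_assoc\<close>)
  next
    fix \<phi> \<psi> assume p: "\<phi> \<in> carrier (star A M)" "\<psi> \<in> carrier (star A M)"
    show "\<phi> \<oplus>\<^bsub>star A M\<^esub> \<psi> = \<psi> \<oplus>\<^bsub>star A M\<^esub> \<phi>"
      unfolding star_simps by (rule restrict_ext) (use p c in \<open>simp add: a_comm\<close>)
  next
    fix \<phi> assume p: "\<phi> \<in> carrier (star A M)"
    show "\<zero>\<^bsub>star A M\<^esub> \<oplus>\<^bsub>star A M\<^esub> \<phi> = \<phi>"
      unfolding star_simps by (rule extensionalityI[of _ "carrier M"])
        (use p c lhom_extensional in simp_all)
  qed (use ac zc in simp_all)
  show ?thesis
  proof (rule left_module.intro[OF ring_opp[OF A] ab], rule left_module_axioms.intro)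
    fix a b \<phi> assume p: "a \<in> carrier (opp A)" "b \<in> carrier (opp A)" "\<phi> \<in> carrier (star A M)"
    show "(a \<oplus>\<^bsub>opp A\<^esub> b) \<odot>\<^bsub>star A M\<^esub> \<phi> = a \<odot>\<^bsub>star A M\<^esub> \<phi> \<oplus>\<^bsub>star A M\<^esub> b \<odot>\<^bsub>star A M\<^esub> \<phi>"
      unfolding star_simps by (rule restrict_ext) (use p c in \<open>simp add: r_distr\<close>)
    show "(a \<otimes>\<^bsub>opp A\<^esub> b) \<odot>\<^bsub>star A M\<^esub> \<phi> = a \<odot>\<^bsub>star A M\<^esub> (b \<odot>\<^bsub>star A M\<^esub> \<phi>)"
      unfolding star_simps by (rule restrict_ext) (use p c in \<open>simp add: m_assoc\<close>)
  next
    fix a \<phi> \<psi> assume p: "a \<in> carrier (opp A)" "\<phi> \<in> carrier (star A M)" "\<psi> \<in> carrier (star A M)"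
    show "a \<odot>\<^bsub>star A M\<^esub> (\<phi> \<oplus>\<^bsub>star A M\<^esub> \<psi>) = a \<odot>\<^bsub>star A M\<^esub> \<phi> \<oplus>\<^bsub>star A M\<^esub> a \<odot>\<^bsub>star A M\<^esub> \<psi>"
      unfolding star_simps by (rule restrict_ext) (use p c in \<open>simp add: l_distr\<close>)
  next
    fix \<phi> assume p: "\<phi> \<in> carrier (star A M)"
    show "\<one>\<^bsub>opp A\<^esub> \<odot>\<^bsub>star A M\<^esub> \<phi> = \<phi>"
      unfolding star_simps opp_simps by (rule extensionalityI[of _ "carrier M"])
        (use p c lhom_extensional in simp_all)
  qed (use sc in simp)
qed

section \<open>Dual maps, evaluations and duals of projectives\<close>

definition star_map ::
    "('a, 'x) ring_scheme \<Rightarrow> ('a, 'm) module \<Rightarrow> ('a, 'n) module \<Rightarrow> ('m \<Rightarrow> 'n) \<Rightarrow> ('n \<Rightarrow> 'a) \<Rightarrow> 'm \<Rightarrow> 'a" where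
  "star_map A M N f = (\<lambda>\<phi>\<in>lhom A N (regular A). compose (carrier M) \<phi> f)"

lemma star_map_apply: "\<phi> \<in> lhom A N (regular A) \<Longrightarrow> star_map A M N f \<phi> = compose (carrier M) \<phi> f"
  by (simp add: star_map_def)

lemma lhom_star_map:
  assumes M: "left_module A M" and N: "left_module A N" and f: "f \<in> lhom A M N"
  shows "star_map A M N f \<in> lhom (opp A) (star A N) (star A M)"
proof -
  have "(\<lambda>\<phi>\<in>carrier (star A N). compose (carrier M) \<phi> f) \<in> lhom (opp A) (star A N) (star A M)"
  proof (rule lhom_restrictI[OF left_module_star[OF N]])
    fix \<phi> assume "\<phi> \<in> carrier (star A N)"
    then show "compose (carrier M) \<phi> f \<in> carrier (star A M)" using lhom_compose[OF M f] by simp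
  qed (simp_all add: compose_def lhom_closed[OF f] cong: restrict_cong)
  then show ?thesis by (simp add: star_map_def)
qed

definition evaluation ::
    "('a, 'x) ring_scheme \<Rightarrow> ('a, 'm) module \<Rightarrow> 'm \<Rightarrow> ('m \<Rightarrow> 'a) \<Rightarrow> 'a" where
  "evaluation A M x = (\<lambda>\<phi>\<in>lhom A M (regular A). \<phi> x)"

lemma lhom_evaluation:
  assumes M: "left_module A M" and x: "x \<in> carrier M"
  shows "evaluation A M x \<in> lhom (opp A) (star A M) (regular (opp A))"
proof -
  have "(\<lambda>\<phi>\<in>carrier (star A M). \<phi> x) \<in> lhom (opp A) (star A M) (regular (opp A))"
  proof (rule lhom_restrictI[OF left_module_star[OF M]])
    fix \<phi> assume "\<phi> \<in> carrier (star A M)"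
    then show "\<phi> x \<in> carrier (regular (opp A))" using lhom_closed[of \<phi> A M "regular A" x] x by simp
  qed (simp_all add: x)
  then show ?thesis by (simp add: evaluation_def)
qed

lemma evaluation_apply [simp]: "\<phi> \<in> lhom A M (regular A) \<Longrightarrow> evaluation A M x \<phi> = \<phi> x"
  by (simp add: evaluation_def)

text \<open>A ring and its opposite have the same additive structure, and \<open>finsum\<close>
  depends on nothing else. This lets the expansions over A and over \<open>opp A\<close> be
  compared.\<close>

lemma finsum_regular_opp: "finsum (regular (opp A)) f I = finsum (regular A) f I"
  by (simp add: finsum_def regular_def opp_def)

text \<open>Generators and functionals exchange roles: applying \<psi> to the expansion of y gives
  \<psi> y as the sum of the products \<phi> i y * \<psi> (x i), which writes \<psi> as a
  combination of the \<phi> i whose coefficients are evaluations at the x i.\<close>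

lemma dual_basis_star:
  assumes b: "dual_basis A P n x \<phi>"
  shows "dual_basis (opp A) (star A P) n \<phi> (\<lambda>i. evaluation A P (x i))"
proof -
  have P: "left_module A P" and x: "\<And>i. i < n \<Longrightarrow> x i \<in> carrier P"
    and \<phi>: "\<And>i. i < n \<Longrightarrow> \<phi> i \<in> lhom A P (regular A)"
    using b by (auto simp: dual_basis_def)
  note A = left_module_ring[OF P]
  note S = left_module_star[OF P] and R = left_module_regular[OF A]
  note R' = left_module_regular[OF ring_opp[OF A]]
  interpret SG: abelian_group "star A P" by (rule left_module_abelian_group[OF S])
  interpret RG: abelian_group "regular A" by (rule left_module_abelian_group[OF R])
  interpret RG': abelian_group "regular (opp A)" by (rule left_module_abelian_group[OF R'])
  show ?thesis unfolding dual_basis_def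
  proof (intro conjI allI impI ballI S)
    fix \<psi> assume "\<psi> \<in> carrier (star A P)"
    then have \<psi>: "\<psi> \<in> lhom A P (regular A)" by simp
    let ?g = "\<lambda>i. evaluation A P (x i) \<psi> \<odot>\<^bsub>star A P\<^esub> \<phi> i"
    have xc: "evaluation A P (x i) \<psi> \<in> carrier (opp A)" if "i < n" for i
      using lhom_closed[OF \<psi> x[OF that]] \<psi> by simp
    have g: "?g i \<in> carrier (star A P)" if "i < n" for i
      by (rule left_module.smult_closed[OF S xc[OF that]]) (simp add: \<phi>[OF that])
    have fs: "finsum (star A P) ?g {..<n} \<in> carrier (star A P)"
      by (rule SG.finsum_closed) (use g in auto)
    have "\<psi> y = finsum (star A P) ?g {..<n} y" if y: "y \<in> carrier P" for y
    proof -
      have yc: "\<phi> i y \<in> carrier A" "\<psi> (x i) \<in> carrier A" if "i < n" for i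
        using lhom_closed[OF \<phi>[OF that] y] lhom_closed[OF \<psi> x[OF that]] by simp_all
      \<comment> \<open>The sum is a function; evaluation at y is linear over \<open>opp A\<close>
        and so may be moved inside.\<close>
      have "finsum (star A P) ?g {..<n} y = evaluation A P y (finsum (star A P) ?g {..<n})"
        using fs by simp
      also have "\<dots> = finsum (regular (opp A)) (\<lambda>i. evaluation A P y (?g i)) {..<n}"
        by (rule lhom_finsum[OF S R' lhom_evaluation[OF P y]]) (use g in auto)
      also have "\<dots> = finsum (regular (opp A)) (\<lambda>i. \<phi> i y \<odot>\<^bsub>regular A\<^esub> \<psi> (x i)) {..<n}"
      proof (rule RG'.finsum_cong')
        fix i assume i: "i \<in> {..<n}"
        then show "evaluation A P y (?g i) = \<phi> i y \<odot>\<^bsub>regular A\<^esub> \<psi> (x i)"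
          using g[of i] y \<psi> by simp
      qed (use yc ring.ring_simprules(5)[OF A] in auto)
      also have "\<dots> = \<psi> y"
        unfolding finsum_regular_opp by (rule lhom_dual_basis_expand[OF b R \<psi> y, symmetric])
      finally show ?thesis by simp
    qed
    then show "\<psi> = finsum (star A P) ?g {..<n}"
      using fs by (intro lhom_eqI[OF \<psi>]) (simp_all only: star_simps(1))
  next
    fix i assume "i < n"
    then show "\<phi> i \<in> carrier (star A P)" "evaluation A P (x i) \<in> lhom (opp A) (star A P) (regular (opp A))"
      using \<phi> lhom_evaluation[OF P x] by simp_all
  qed
qed

lemma has_dual_basis_star: "has_dual_basis A P \<Longrightarrow> has_dual_basis (opp A) (star A P)"
  unfolding has_dual_basis_def using dual_basis_star by blast

text \<open>The expansion of \<psi> in the dual of the basis turns \<alpha> \<psi> into \<psi>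
  applied to the sum of the \<alpha> (\<phi> i) x i, which is therefore the required
  element.\<close>

lemma dual_basis_reflexive:
  assumes P: "has_dual_basis A P" and \<alpha>: "\<alpha> \<in> lhom (opp A) (star A P) (regular (opp A))"
  obtains x where "x \<in> carrier P" "\<And>\<psi>. \<psi> \<in> lhom A P (regular A) \<Longrightarrow> \<alpha> \<psi> = \<psi> x"
proof -
  obtain n x \<phi> where b: "dual_basis A P n x \<phi>" using P by (auto simp: has_dual_basis_def)
  have P: "left_module A P" and x: "\<And>i. i < n \<Longrightarrow> x i \<in> carrier P"
    and \<phi>: "\<And>i. i < n \<Longrightarrow> \<phi> i \<in> lhom A P (regular A)"
    using b by (auto simp: dual_basis_def)
  note A = left_module_ring[OF P]
  note R = left_module_regular[OF A] and R' = left_module_regular[OF ring_opp[OF A]]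
  interpret PG: abelian_group P by (rule left_module_abelian_group[OF P])
  interpret RG: abelian_group "regular A" by (rule left_module_abelian_group[OF R])
  have ac: "\<alpha> (\<phi> i) \<in> carrier A" if "i < n" for i
    using lhom_closed[OF \<alpha>, of "\<phi> i"] \<phi>[OF that] by simp
  let ?x = "finsum P (\<lambda>i. \<alpha> (\<phi> i) \<odot>\<^bsub>P\<^esub> x i) {..<n}"
  have xc: "\<alpha> (\<phi> i) \<odot>\<^bsub>P\<^esub> x i \<in> carrier P" if "i < n" for i
    by (rule left_module.smult_closed[OF P ac[OF that] x[OF that]])
  have "?x \<in> carrier P" by (rule PG.finsum_closed) (use xc in auto)
  moreover have "\<alpha> \<psi> = \<psi> ?x" if \<psi>: "\<psi> \<in> lhom A P (regular A)" for \<psi>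
  proof -
    have "\<alpha> \<psi> = finsum (regular (opp A)) (\<lambda>i. evaluation A P (x i) \<psi> \<odot>\<^bsub>regular (opp A)\<^esub> \<alpha> (\<phi> i)) {..<n}"
      by (rule lhom_dual_basis_expand[OF dual_basis_star[OF b] R' \<alpha>]) (simp add: \<psi>)
    also have "\<dots> = finsum (regular A) (\<lambda>i. \<psi> (\<alpha> (\<phi> i) \<odot>\<^bsub>P\<^esub> x i)) {..<n}"
      unfolding finsum_regular_opp
    proof (rule RG.finsum_cong')
      fix i assume "i \<in> {..<n}"
      then show "evaluation A P (x i) \<psi> \<odot>\<^bsub>regular (opp A)\<^esub> \<alpha> (\<phi> i) = \<psi> (\<alpha> (\<phi> i) \<odot>\<^bsub>P\<^esub> x i)"
        using \<psi> lhom_smult[OF \<psi> ac x] by simp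
    qed (use lhom_closed[OF \<psi> xc] in auto)
    also have "\<dots> = \<psi> ?x" by (rule lhom_finsum[OF P R \<psi>, symmetric]) (use xc in auto)
    finally show ?thesis .
  qed
  ultimately show ?thesis by (rule that)
qed

section \<open>Torsionless and reflexive modules\<close>

text \<open>Injectivity of the canonical map M -> M**, expressed without forming the bidual.\<close>

definition torsionless :: "('a, 'x) ring_scheme \<Rightarrow> ('a, 'm) module \<Rightarrow> bool" where
  "torsionless A M \<longleftrightarrow>
     (\<forall>x\<in>carrier M. (\<forall>\<phi>\<in>lhom A M (regular A). \<phi> x = \<zero>\<^bsub>A\<^esub>) \<longrightarrow> x = \<zero>\<^bsub>M\<^esub>)"

text \<open>Surjectivity of the canonical map M -> M**.\<close>

definition bidual_surjective :: "('a, 'x) ring_scheme \<Rightarrow> ('a, 'm) module \<Rightarrow> bool" where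
  "bidual_surjective A M \<longleftrightarrow> (\<forall>\<alpha>\<in>lhom (opp A) (star A M) (regular (opp A)).
     \<exists>x\<in>carrier M. \<forall>\<phi>\<in>lhom A M (regular A). \<alpha> \<phi> = \<phi> x)"

lemma torsionlessD:
  assumes "torsionless A M" "x \<in> carrier M" "\<And>\<phi>. \<phi> \<in> lhom A M (regular A) \<Longrightarrow> \<phi> x = \<zero>\<^bsub>A\<^esub>"
  shows "x = \<zero>\<^bsub>M\<^esub>"
  using assms by (auto simp: torsionless_def)

lemma torsionless_dual_basis:
  assumes "has_dual_basis A P"
  shows "torsionless A P"
  unfolding torsionless_def
proof (intro ballI impI)
  fix y assume y: "y \<in> carrier P" and z: "\<forall>\<phi>\<in>lhom A P (regular A). \<phi> y = \<zero>\<^bsub>A\<^esub>"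
  obtain n x \<phi> where b: "dual_basis A P n x \<phi>" using assms by (auto simp: has_dual_basis_def)
  have P: "left_module A P" and x: "\<And>i. i < n \<Longrightarrow> x i \<in> carrier P"
    and \<phi>: "\<And>i. i < n \<Longrightarrow> \<phi> i \<in> lhom A P (regular A)"
    and e: "y = finsum P (\<lambda>i. \<phi> i y \<odot>\<^bsub>P\<^esub> x i) {..<n}"
    using b y by (auto simp: dual_basis_def)
  interpret PG: abelian_group P by (rule left_module_abelian_group[OF P])
  have "\<phi> i y \<odot>\<^bsub>P\<^esub> x i = \<zero>\<^bsub>P\<^esub>" if "i < n" for i
    using bspec[OF z \<phi>[OF that]] left_module.smult_l_null[OF P x[OF that]] by simp
  then have "finsum P (\<lambda>i. \<phi> i y \<odot>\<^bsub>P\<^esub> x i) {..<n} = finsum P (\<lambda>i. \<zero>\<^bsub>P\<^esub>) {..<n}"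
    by (intro PG.finsum_cong') simp_all
  also have "\<dots> = \<zero>\<^bsub>P\<^esub>" by (rule PG.finsum_zero)
  finally show "y = \<zero>\<^bsub>P\<^esub>" using e by metis
qed

lemma torsionless_submodule:
  assumes K: "left_module A K" and P: "left_module A P" and i: "i \<in> lhom A K P" "inj_on i (carrier K)"
    and t: "torsionless A P"
  shows "torsionless A K"
  unfolding torsionless_def
proof (intro ballI impI)
  fix x assume x: "x \<in> carrier K" and z: "\<forall>\<phi>\<in>lhom A K (regular A). \<phi> x = \<zero>\<^bsub>A\<^esub>"
  have "i x = \<zero>\<^bsub>P\<^esub>"
  proof (rule torsionlessD[OF t lhom_closed[OF i(1) x]])
    fix \<phi> assume "\<phi> \<in> lhom A P (regular A)"
    then show "\<phi> (i x) = \<zero>\<^bsub>A\<^esub>" using z lhom_compose[OF K i(1)] x by (metis compose_eq)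
  qed
  then show "x = \<zero>\<^bsub>K\<^esub>" using i(2) x unfolding lhom_inj_on_iff[OF K P i(1)] by blast
qed

lemma torsionless_sub: "proj_seq A s \<Longrightarrow> torsionless A (sub s)"
  using torsionless_submodule[OF proj_seqD(1,3,5,6)] torsionless_dual_basis[OF proj_seqD(2)] by blast

text \<open>All functionals on M factor through f, so they cannot separate more points than f does.
  Conversely an injective f embeds M into a projective, which is torsionless.\<close>

lemma torsionless_iff_approximation_inj:
  assumes M: "M \<in> fg_modules A" and f: "left_proj_approx A M Q f"
  shows "torsionless A M \<longleftrightarrow> inj_on f (carrier M)"
proof -
  note MM = fg_modulesD(1)[OF M]
  have Q: "Q \<in> proj_modules A" and fh: "f \<in> lhom A M Q" using f by (auto simp: left_proj_approx_def)
  note QB = Q[unfolded proj_modules_iff]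
  note QM = has_dual_basis_module[OF QB]
  note R = left_module_regular[OF left_module_ring[OF MM]]
  show ?thesis
  proof
    assume t: "torsionless A M"
    show "inj_on f (carrier M)" unfolding lhom_inj_on_iff[OF MM QM fh]
    proof (intro ballI impI)
      fix x assume x: "x \<in> carrier M" and z: "f x = \<zero>\<^bsub>Q\<^esub>"
      show "x = \<zero>\<^bsub>M\<^esub>"
      proof (rule torsionlessD[OF t x])
        fix \<phi> assume "\<phi> \<in> lhom A M (regular A)"
        then obtain G where "G \<in> lhom A Q (regular A)" "\<forall>x\<in>carrier M. G (f x) = \<phi> x"
          using left_proj_approx_regular[OF f MM] by blast
        then show "\<phi> x = \<zero>\<^bsub>A\<^esub>" using x z lhom_zero[OF QM R] by (metis regular_simps(2))
      qed
    qed
  qed (rule torsionless_submodule[OF MM QM fh _ torsionless_dual_basis[OF QB]])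
qed

text \<open>Restriction mid* -> sub* is onto, so sub** embeds into mid**, which is mid. Its image
  consists of the x at which every functional vanishing on sub vanishes; such functionals come from
  quo, so the condition says that all functionals on quo kill \<open>epi s x\<close>. This image is
  sub exactly if zero is the only such value.\<close>

lemma bidual_surjective_iff_torsionless_quo:
  assumes s: "approx_seq A s"
  shows "bidual_surjective A (sub s) \<longleftrightarrow> torsionless A (quo s)"
proof -
  have ps: "proj_seq A s" and ex: "extends A s (regular A)" using s by (auto simp: approx_seq_def)
  note D = proj_seqD[OF ps]
  note A = left_module_ring[OF D(1)]
  note R = left_module_regular[OF A] and R' = left_module_regular[OF ring_opp[OF A]]
  let ?i = "star_map A (sub s) (mid s) (emb s)"
  have ih: "?i \<in> lhom (opp A) (star A (mid s)) (star A (sub s))" by (rule lhom_star_map[OF D(1,3,5)])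
  note Sm = left_module_star[OF D(3)] and Ss = left_module_star[OF D(1)]
  have lift: "\<exists>G\<in>lhom A (mid s) (regular A). ?i G = \<phi> \<and> (\<forall>x\<in>carrier (sub s). G (emb s x) = \<phi> x)"
    if p: "\<phi> \<in> lhom A (sub s) (regular A)" for \<phi>
  proof -
    obtain G where G: "G \<in> lhom A (mid s) (regular A)" "\<And>x. x \<in> carrier (sub s) \<Longrightarrow> G (emb s x) = \<phi> x"
      using ex p unfolding extends_def by blast
    have "?i G = \<phi>" unfolding star_map_apply[OF G(1)]
      by (rule lhom_eqI[OF lhom_compose[OF D(1,5) G(1)] p]) (simp add: compose_eq G(2))
    with G show ?thesis by blast
  qed
  show ?thesis
  proof
    assume t: "torsionless A (quo s)"
    show "bidual_surjective A (sub s)" unfolding bidual_surjective_def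
    proof
      fix \<alpha> assume a: "\<alpha> \<in> lhom (opp A) (star A (sub s)) (regular (opp A))"
      \<comment> \<open>Composed with the restriction map, \<alpha> is a functional on the dual of a
        projective, hence evaluation at some x.\<close>
      obtain x where x: "x \<in> carrier (mid s)"
        and xe: "\<And>\<psi>. \<psi> \<in> lhom A (mid s) (regular A) \<Longrightarrow> compose (carrier (star A (mid s))) \<alpha> ?i \<psi> = \<psi> x"
        by (rule dual_basis_reflexive[OF D(2) lhom_compose[OF Sm ih a]]) (rule that)
      have xe: "\<alpha> (?i \<psi>) = \<psi> x" if "\<psi> \<in> lhom A (mid s) (regular A)" for \<psi>
        using xe[OF that] that by (simp add: compose_eq)
      have "epi s x = \<zero>\<^bsub>quo s\<^esub>"
      proof (rule torsionlessD[OF t D(12)[OF x]])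
        fix \<psi> assume p: "\<psi> \<in> lhom A (quo s) (regular A)"
        have pe: "compose (carrier (mid s)) \<psi> (epi s) \<in> lhom A (mid s) (regular A)"
          by (rule lhom_compose[OF D(3,7) p])
        have "?i (compose (carrier (mid s)) \<psi> (epi s)) = \<zero>\<^bsub>star A (sub s)\<^esub>"
          unfolding star_map_apply[OF pe] star_simps
          by (rule lhom_eqI[OF lhom_compose[OF D(1,5) pe] lhom_zero_map[OF D(1) R, unfolded regular_simps]])
            (use lhom_zero[OF D(4) R p] in \<open>simp add: compose_eq D(10,11)\<close>)
        then show "\<psi> (epi s x) = \<zero>\<^bsub>A\<^esub>"
          using xe[OF pe] x lhom_zero[OF Ss R' a] by (simp add: compose_eq)
      qed
      then have "x \<in> emb s ` carrier (sub s)" using D(9)[OF x] by blast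
      then obtain m where m: "m \<in> carrier (sub s)" "x = emb s m" by blast
      have "\<alpha> \<phi> = \<phi> m" if "\<phi> \<in> lhom A (sub s) (regular A)" for \<phi>
        using lift[OF that] xe m by metis
      with m(1) show "\<exists>x\<in>carrier (sub s). \<forall>\<phi>\<in>lhom A (sub s) (regular A). \<alpha> \<phi> = \<phi> x" by blast
    qed
  next
    assume b: "bidual_surjective A (sub s)"
    show "torsionless A (quo s)" unfolding torsionless_def
    proof (intro ballI impI)
      fix c assume c: "c \<in> carrier (quo s)" and z: "\<forall>\<psi>\<in>lhom A (quo s) (regular A). \<psi> c = \<zero>\<^bsub>A\<^esub>"
      obtain x where x: "x \<in> carrier (mid s)" "c = epi s x" by (rule surj_imageE[OF D(8) c])
      have "?i ` carrier (star A (mid s)) = carrier (star A (sub s))"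
      proof
        show "?i ` carrier (star A (mid s)) \<subseteq> carrier (star A (sub s))" using lhom_closed[OF ih] by blast
        show "carrier (star A (sub s)) \<subseteq> ?i ` carrier (star A (mid s))"
        proof
          fix \<phi> assume "\<phi> \<in> carrier (star A (sub s))"
          then obtain G where "G \<in> lhom A (mid s) (regular A)" "?i G = \<phi>" using lift[of \<phi>] by auto
          then show "\<phi> \<in> ?i ` carrier (star A (mid s))" by (intro image_eqI[of _ _ G]) simp_all
        qed
      qed
      \<comment> \<open>Evaluation at x descends to the dual of \<open>sub s\<close>: a functional
        that vanishes on \<open>sub s\<close> comes from \<open>quo s\<close>, where all functionals
        kill c.\<close>
      moreover have "evaluation A (mid s) x G = \<zero>\<^bsub>regular (opp A)\<^esub>"
        if "G \<in> carrier (star A (mid s))" "?i G = \<zero>\<^bsub>star A (sub s)\<^esub>" for G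
      proof -
        have G: "G \<in> lhom A (mid s) (regular A)" using that by simp
        have "G (emb s y) = \<zero>\<^bsub>regular A\<^esub>" if y: "y \<in> carrier (sub s)" for y
          using fun_cong[OF \<open>?i G = \<zero>\<^bsub>star A (sub s)\<^esub>\<close>, of y] y unfolding star_map_apply[OF G]
          by (simp add: compose_eq)
        then obtain \<psi> where "\<psi> \<in> lhom A (quo s) (regular A)" "\<forall>x\<in>carrier (mid s). \<psi> (epi s x) = G x"
          using proj_seq_factor_quo[OF ps R G] by blast
        then have "G x = \<zero>\<^bsub>A\<^esub>" using z x by metis
        then show ?thesis using G by simp
      qed
      ultimately obtain \<alpha> where a: "\<alpha> \<in> lhom (opp A) (star A (sub s)) (regular (opp A))"
        "\<forall>G\<in>carrier (star A (mid s)). \<alpha> (?i G) = evaluation A (mid s) x G"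
        using lhom_factor[OF Sm Ss R' ih _ lhom_evaluation[OF D(3) x(1)]] by blast
      obtain m where m: "m \<in> carrier (sub s)" "\<And>\<phi>. \<phi> \<in> lhom A (sub s) (regular A) \<Longrightarrow> \<alpha> \<phi> = \<phi> m"
        using b a(1) unfolding bidual_surjective_def by blast
      have em: "emb s m \<in> carrier (mid s)" by (rule D(11)[OF m(1)])
      interpret mG: abelian_group "mid s" by (rule left_module_abelian_group[OF D(3)])
      interpret RG: abelian_group "regular A" by (rule left_module_abelian_group[OF R])
      \<comment> \<open>The two elements agree under all functionals, and functionals separate the
        points of a projective.\<close>
      have "x \<ominus>\<^bsub>mid s\<^esub> emb s m = \<zero>\<^bsub>mid s\<^esub>"
      proof (rule torsionlessD[OF torsionless_dual_basis[OF D(2)]])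
        fix G assume G: "G \<in> lhom A (mid s) (regular A)"
        have iG: "?i G \<in> lhom A (sub s) (regular A)" using lhom_closed[OF ih, of G] G by simp
        have "G x = \<alpha> (?i G)" using a(2) G by simp
        also have "\<dots> = ?i G m" by (rule m(2)[OF iG])
        also have "\<dots> = G (emb s m)" using m(1) by (simp add: star_map_apply[OF G] compose_eq)
        finally have "G x \<ominus>\<^bsub>regular A\<^esub> G (emb s m) = \<zero>\<^bsub>regular A\<^esub>"
          using lhom_closed[OF G em] by simp
        then show "G (x \<ominus>\<^bsub>mid s\<^esub> emb s m) = \<zero>\<^bsub>A\<^esub>"
          by (simp add: lhom_minus[OF D(3) R G x(1) em])
      qed (use x em in simp)
      then have "x = emb s m" using mG.minus_eq_zero_iff[OF x(1) em] by simp
      then show "c = \<zero>\<^bsub>quo s\<^esub>" using D(10)[OF m(1)] x(2) by simp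
    qed
  qed
qed

text \<open>Dualising P1 -> P0 -> M -> 0 gives the exact sequence 0 -> M* -> P0* -> P1* -> Tr M ->
  0, the start of a resolution of Tr M. Functionals on P0* and P1* are evaluations, so the extension
  properties of its two halves become statements about elements of P0, P1 and M. These are the two
  ends of the exact sequence 0 -> Ext^1(Tr M, A) -> M -> M** -> Ext^2(Tr M, A) -> 0.\<close>

lemma Tr_Ext_conditions:
  fixes A :: "('a, 'x) ring_scheme" and M P0 P1 :: "'a umod"
  defines "\<Delta> \<equiv> star_map A P1 P0"
  assumes A': "left_noetherian (opp A)" and M: "left_module A M"
    and P0: "has_dual_basis A P0" and p0: "p0 \<in> lhom A P0 M" "p0 ` carrier P0 = carrier M"
    and P1: "has_dual_basis A P1" and p1: "p1 \<in> lhom A P1 P0" "p1 ` carrier P1 = a_kernel P0 M p0"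
  shows "Ext_zero (opp A) 1 (quot_mod (star A P1) (\<Delta> p1 ` carrier (star A P0))) (regular (opp A)) \<longleftrightarrow> torsionless A M"
    and "Ext_zero (opp A) 2 (quot_mod (star A P1) (\<Delta> p1 ` carrier (star A P0))) (regular (opp A)) \<longleftrightarrow> bidual_surjective A M"
proof -
  note PM0 = has_dual_basis_module[OF P0] and PM1 = has_dual_basis_module[OF P1]
  note A = left_module_ring[OF M]
  note R = left_module_regular[OF A] and R' = left_module_regular[OF ring_opp[OF A]]
  note S0 = left_module_star[OF PM0] and S1 = left_module_star[OF PM1] and SM = left_module_star[OF M]
  let ?d = "\<Delta> p1" and ?e = "star_map A P0 M p0"
  have d: "?d \<in> lhom (opp A) (star A P0) (star A P1)" unfolding \<Delta>_def by (rule lhom_star_map[OF PM1 PM0 p1(1)])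
  have e: "?e \<in> lhom (opp A) (star A M) (star A P0)" by (rule lhom_star_map[OF PM0 M p0(1)])
  have d_app: "?d \<phi> y = \<phi> (p1 y)" if "\<phi> \<in> lhom A P0 (regular A)" "y \<in> carrier P1" for \<phi> y
    unfolding \<Delta>_def using that by (simp add: star_map_apply compose_eq)
  have e_app: "?e \<phi> y = \<phi> (p0 y)" if "\<phi> \<in> lhom A M (regular A)" "y \<in> carrier P0" for \<phi> y
    using that by (simp add: star_map_apply compose_eq)
  let ?I = "?d ` carrier (star A P0)"
  have I: "submodule ?I (opp A) (star A P1)" by (rule submodule_image[OF S0 S1 d])
  let ?T = "quot_mod (star A P1) ?I"
  let ?\<pi> = "\<lambda>x\<in>carrier (star A P1). ?I +>\<^bsub>star A P1\<^esub> x"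
  note Q = quot_mod_facts[OF S1 I]
  \<comment> \<open>The right half of the dual sequence: the image of P0* in P1*, and Tr M.\<close>
  define s where "s = kernel_seq (star A P1) ?T ?\<pi>"
  have s: "proj_seq (opp A) s" unfolding s_def by (rule proj_seq_kernel_seq[OF has_dual_basis_star[OF P1] Q(1-3)])
  have sub_s: "sub s = submod (star A P1) ?I" by (simp only: s_def kernel_seq_simps Q(4))
  have emb_s: "emb s x = x" if "x \<in> ?I" for x
    unfolding s_def by (rule kernel_seq_simps(2)) (simp only: Q(4) that)
  have mid_s: "mid s = star A P1" and quo_s: "quo s = ?T" by (simp_all add: s_def)
  have IM: "left_module (opp A) (submod (star A P1) ?I)" by (rule left_module_submod[OF S1 I])
  have dI: "?d \<in> lhom (opp A) (star A P0) (submod (star A P1) ?I)"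
    by (rule lhomI[OF lhom_extensional[OF d]]) (simp_all only: submod_simps lhom_add[OF d] lhom_smult[OF d] opp_simps imageI)
  \<comment> \<open>The left half: M*, then P0*, then the same image. Splicing r and s makes r the
    sequence that tests Ext^2.\<close>
  define r where "r = \<lparr>sub = star A M, emb = ?e, mid = star A P0, epi = ?d, quo = submod (star A P1) ?I\<rparr>"
  \<comment> \<open>Exactness at P0*: a functional on P0 that vanishes on the image of p1 factors
    through M.\<close>
  have kill: "\<exists>\<psi>\<in>lhom A M (regular A). ?e \<psi> = \<phi>"
    if p: "\<phi> \<in> lhom A P0 (regular A)" and z: "?d \<phi> = \<zero>\<^bsub>star A P1\<^esub>" for \<phi>
  proof -
    have "\<phi> x = \<zero>\<^bsub>regular A\<^esub>" if x: "x \<in> carrier P0" "p0 x = \<zero>\<^bsub>M\<^esub>" for x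
    proof -
      have "x \<in> a_kernel P0 M p0" using x by (simp add: in_a_kernel_iff)
      then obtain y where y: "y \<in> carrier P1" "x = p1 y" using p1(2) by (metis imageE)
      then show ?thesis using fun_cong[OF z, of y] d_app[OF p y(1)] by simp
    qed
    then obtain \<psi> where ps: "\<psi> \<in> lhom A M (regular A)" "\<forall>x\<in>carrier P0. \<psi> (p0 x) = \<phi> x"
      using lhom_factor[OF PM0 M R p0 p] by blast
    have "?e \<psi> = \<phi>" using lhom_closed[OF e, of \<psi>] ps
      by (intro lhom_eqI[OF _ p, of "?e \<psi>"]) (simp_all add: e_app)
    with ps(1) show ?thesis by blast
  qed
  have de: "?d (?e \<psi>) = \<zero>\<^bsub>star A P1\<^esub>" if p: "\<psi> \<in> lhom A M (regular A)" for \<psi>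
  proof -
    have ep: "?e \<psi> \<in> lhom A P0 (regular A)" using lhom_closed[OF e, of \<psi>] p by simp
    have "?d (?e \<psi>) y = \<zero>\<^bsub>A\<^esub>" if y: "y \<in> carrier P1" for y
    proof -
      have "p1 y \<in> a_kernel P0 M p0" using p1(2) y by blast
      then show ?thesis using d_app[OF ep y] e_app[OF p] lhom_zero[OF M R p] by (simp add: in_a_kernel_iff)
    qed
    then show ?thesis unfolding star_simps using lhom_closed[OF d, of "?e \<psi>"] ep
      by (intro lhom_eqI[OF _ lhom_zero_map[OF PM1 R, unfolded regular_simps]]) simp_all
  qed
  have r: "proj_seq (opp A) r"
    unfolding proj_seq_def r_def seq.simps
  proof (intro conjI SM has_dual_basis_star[OF P0] IM e dI)
    show "inj_on ?e (carrier (star A M))"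
    proof (rule inj_onI)
      fix \<phi> \<psi> assume pp: "\<phi> \<in> carrier (star A M)" "\<psi> \<in> carrier (star A M)" "?e \<phi> = ?e \<psi>"
      then have p: "\<phi> \<in> lhom A M (regular A)" "\<psi> \<in> lhom A M (regular A)" by simp_all
      show "\<phi> = \<psi>"
      proof (rule lhom_eqI[OF p])
        fix m assume m: "m \<in> carrier M"
        obtain x where x: "x \<in> carrier P0" "m = p0 x" by (rule surj_imageE[OF p0(2) m])
        then show "\<phi> m = \<psi> m" using pp(3) e_app[OF p(1) x(1)] e_app[OF p(2) x(1)] by simp
      qed
    qed
    show "?d ` carrier (star A P0) = carrier (submod (star A P1) ?I)" by (simp only: submod_simps)
    show "a_kernel (star A P0) (submod (star A P1) ?I) ?d = ?e ` carrier (star A M)"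
    proof (intro equalityI subsetI)
      fix \<phi> assume "\<phi> \<in> a_kernel (star A P0) (submod (star A P1) ?I) ?d"
      then have "\<phi> \<in> lhom A P0 (regular A)" "?d \<phi> = \<zero>\<^bsub>star A P1\<^esub>"
        by (simp_all only: in_a_kernel_iff submod_simps star_simps(1))
      from kill[OF this] show "\<phi> \<in> ?e ` carrier (star A M)" by auto
    next
      fix \<phi> assume "\<phi> \<in> ?e ` carrier (star A M)"
      then obtain \<psi> where ps: "\<psi> \<in> lhom A M (regular A)" "\<phi> = ?e \<psi>" by auto
      then show "\<phi> \<in> a_kernel (star A P0) (submod (star A P1) ?I) ?d"
        unfolding in_a_kernel_iff submod_simps using de[OF ps(1)] lhom_closed[OF e, of \<psi>] by simp
    qed
  qed
  have rs: "quo r = sub s" by (simp only: sub_s) (simp add: r_def)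
  have r_simps: "sub r = star A M" "mid r = star A P0" "emb r = ?e" by (simp_all add: r_def)
  note t0 = torsionless_dual_basis[OF P0]
  interpret G0: abelian_group P0 by (rule left_module_abelian_group[OF PM0])
  interpret RG: abelian_group "regular A" by (rule left_module_abelian_group[OF R])
  have sep: "x = y" if "x \<in> carrier P0" "y \<in> carrier P0" "\<And>\<phi>. \<phi> \<in> lhom A P0 (regular A) \<Longrightarrow> \<phi> x = \<phi> y" for x y
  proof -
    have "x \<ominus>\<^bsub>P0\<^esub> y = \<zero>\<^bsub>P0\<^esub>"
    proof (rule torsionlessD[OF t0])
      fix \<phi> assume p: "\<phi> \<in> lhom A P0 (regular A)"
      have "\<phi> x \<ominus>\<^bsub>regular A\<^esub> \<phi> y = \<zero>\<^bsub>regular A\<^esub>"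
        unfolding that(3)[OF p] by (rule RG.minus_self[OF lhom_closed[OF p that(2)]])
      then show "\<phi> (x \<ominus>\<^bsub>P0\<^esub> y) = \<zero>\<^bsub>A\<^esub>" by (simp add: lhom_minus[OF PM0 R p that(1,2)])
    qed (use that in simp)
    then show ?thesis using G0.minus_eq_zero_iff that by simp
  qed
  have "extends (opp A) r (regular (opp A)) \<longleftrightarrow> bidual_surjective A M"
  proof
    assume ex: "extends (opp A) r (regular (opp A))"
    show "bidual_surjective A M" unfolding bidual_surjective_def
    proof
      fix \<alpha> assume "\<alpha> \<in> lhom (opp A) (star A M) (regular (opp A))"
      then obtain G where G: "G \<in> lhom (opp A) (star A P0) (regular (opp A))"
        "\<And>\<phi>. \<phi> \<in> carrier (star A M) \<Longrightarrow> G (?e \<phi>) = \<alpha> \<phi>"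
        using ex unfolding extends_def r_simps by blast
      obtain x where x: "x \<in> carrier P0" "\<And>\<psi>. \<psi> \<in> lhom A P0 (regular A) \<Longrightarrow> G \<psi> = \<psi> x"
        by (rule dual_basis_reflexive[OF P0 G(1)]) (rule that)
      have "\<alpha> \<phi> = \<phi> (p0 x)" if p: "\<phi> \<in> lhom A M (regular A)" for \<phi>
        using G(2)[of \<phi>] x(2)[of "?e \<phi>"] lhom_closed[OF e, of \<phi>] e_app[OF p x(1)] p by simp
      then show "\<exists>x\<in>carrier M. \<forall>\<phi>\<in>lhom A M (regular A). \<alpha> \<phi> = \<phi> x" using lhom_closed[OF p0(1) x(1)] by blast
    qed
  next
    assume b: "bidual_surjective A M"
    show "extends (opp A) r (regular (opp A))" unfolding extends_def r_simps
    proof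
      fix \<alpha> assume "\<alpha> \<in> lhom (opp A) (star A M) (regular (opp A))"
      then obtain m where m: "m \<in> carrier M" "\<And>\<phi>. \<phi> \<in> lhom A M (regular A) \<Longrightarrow> \<alpha> \<phi> = \<phi> m"
        using b unfolding bidual_surjective_def by blast
      obtain x where x: "x \<in> carrier P0" "m = p0 x" by (rule surj_imageE[OF p0(2) m(1)])
      have "evaluation A P0 x (?e \<phi>) = \<alpha> \<phi>" if "\<phi> \<in> carrier (star A M)" for \<phi>
        using that m(2)[of \<phi>] lhom_closed[OF e that] e_app[of \<phi> x] x by simp
      then show "\<exists>G\<in>lhom (opp A) (star A P0) (regular (opp A)). \<forall>x\<in>carrier (star A M). G (?e x) = \<alpha> x"
        using lhom_evaluation[OF PM0 x(1)] by blast
    qed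
  qed
  then show "Ext_zero (opp A) 2 ?T (regular (opp A)) \<longleftrightarrow> bidual_surjective A M"
    using Ext_zero_2_iff[OF A' s R' r rs] by (simp only: quo_s)
  have "extends (opp A) s (regular (opp A)) \<longleftrightarrow> torsionless A M"
  proof
    assume ex: "extends (opp A) s (regular (opp A))"
    show "torsionless A M" unfolding torsionless_def
    proof (intro ballI impI)
      fix m assume m: "m \<in> carrier M" and z: "\<forall>\<phi>\<in>lhom A M (regular A). \<phi> m = \<zero>\<^bsub>A\<^esub>"
      obtain x where x: "x \<in> carrier P0" "m = p0 x" by (rule surj_imageE[OF p0(2) m])
      \<comment> \<open>Evaluation at x descends to the image of P0*: a functional that becomes zero
        on P1 comes from M, where every functional kills m.\<close>
      have k: "evaluation A P0 x \<phi> = \<zero>\<^bsub>regular (opp A)\<^esub>"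
        if p: "\<phi> \<in> carrier (star A P0)" and dz: "?d \<phi> = \<zero>\<^bsub>submod (star A P1) ?I\<^esub>" for \<phi>
      proof -
        have "\<phi> \<in> lhom A P0 (regular A)" "?d \<phi> = \<zero>\<^bsub>star A P1\<^esub>" using p dz by (simp_all only: submod_simps star_simps(1))
        from kill[OF this] obtain \<psi> where ps: "\<psi> \<in> lhom A M (regular A)" "?e \<psi> = \<phi>" by blast
        have "\<phi> x = \<zero>\<^bsub>A\<^esub>" using e_app[OF ps(1) x(1)] ps z x(2) by simp
        then show ?thesis using p by simp
      qed
      obtain g where g: "g \<in> lhom (opp A) (submod (star A P1) ?I) (regular (opp A))"
        "\<And>\<phi>. \<phi> \<in> carrier (star A P0) \<Longrightarrow> g (?d \<phi>) = evaluation A P0 x \<phi>"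
        using lhom_factor[OF S0 IM R' dI _ lhom_evaluation[OF PM0 x(1)] k] by (auto simp only: submod_simps)
      obtain G where G: "G \<in> lhom (opp A) (star A P1) (regular (opp A))"
        "\<And>y. y \<in> ?I \<Longrightarrow> G (emb s y) = g y"
        using ex g(1) unfolding extends_def mid_s sub_s submod_simps by blast
      \<comment> \<open>The extension to P1* is evaluation at some y. Comparing the two on the image
        of P0* gives x = p1 y, so m is zero.\<close>
      obtain y where y: "y \<in> carrier P1" "\<And>\<psi>. \<psi> \<in> lhom A P1 (regular A) \<Longrightarrow> G \<psi> = \<psi> y"
        by (rule dual_basis_reflexive[OF P1 G(1)]) (rule that)
      have "x = p1 y"
      proof (rule sep[OF x(1) lhom_closed[OF p1(1) y(1)]])
        fix \<phi> assume p: "\<phi> \<in> lhom A P0 (regular A)"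
        have dp: "?d \<phi> \<in> ?I" using p by simp
        have "\<phi> x = g (?d \<phi>)" using g(2)[of \<phi>] p by simp
        also have "\<dots> = G (?d \<phi>)" using G(2)[OF dp] emb_s[OF dp] by simp
        also have "\<dots> = ?d \<phi> y" by (rule y(2)) (use lhom_closed[OF d, of \<phi>] p in simp)
        also have "\<dots> = \<phi> (p1 y)" by (rule d_app[OF p y(1)])
        finally show "\<phi> x = \<phi> (p1 y)" .
      qed
      then have "x \<in> a_kernel P0 M p0" using p1(2) y(1) by blast
      then show "m = \<zero>\<^bsub>M\<^esub>" using x(2) by (simp add: in_a_kernel_iff)
    qed
  next
    assume t: "torsionless A M"
    show "extends (opp A) s (regular (opp A))" unfolding extends_def mid_s sub_s submod_simps
    proof
      fix g assume g: "g \<in> lhom (opp A) (submod (star A P1) ?I) (regular (opp A))"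
      obtain x where x: "x \<in> carrier P0"
        and xe: "\<And>\<psi>. \<psi> \<in> lhom A P0 (regular A) \<Longrightarrow> compose (carrier (star A P0)) g ?d \<psi> = \<psi> x"
        by (rule dual_basis_reflexive[OF P0 lhom_compose[OF S0 dI g]]) (rule that)
      have xe: "g (?d \<psi>) = \<psi> x" if "\<psi> \<in> lhom A P0 (regular A)" for \<psi>
        using xe[OF that] that by (simp add: compose_eq)
      have "p0 x = \<zero>\<^bsub>M\<^esub>"
      proof (rule torsionlessD[OF t lhom_closed[OF p0(1) x]])
        fix \<psi> assume p: "\<psi> \<in> lhom A M (regular A)"
        have ep: "?e \<psi> \<in> lhom A P0 (regular A)" using lhom_closed[OF e, of \<psi>] p by simp
        have "\<psi> (p0 x) = g \<zero>\<^bsub>star A P1\<^esub>" using xe[OF ep] e_app[OF p x] de[OF p] by simp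
        then show "\<psi> (p0 x) = \<zero>\<^bsub>A\<^esub>" using lhom_zero[OF IM R' g] by simp
      qed
      then have "x \<in> a_kernel P0 M p0" using x by (simp add: in_a_kernel_iff)
      then obtain y where y: "y \<in> carrier P1" "x = p1 y" using p1(2) by (metis imageE)
      have "evaluation A P1 y (emb s \<chi>) = g \<chi>" if c: "\<chi> \<in> ?I" for \<chi>
      proof -
        obtain \<phi> where p: "\<phi> \<in> lhom A P0 (regular A)" "\<chi> = ?d \<phi>" using c by auto
        have "\<chi> \<in> lhom A P1 (regular A)" using lhom_closed[OF d, of \<phi>] p by simp
        then show ?thesis using emb_s[OF c] d_app[OF p(1) y(1)] xe[OF p(1)] y(2) p(2) by simp
      qed
      then show "\<exists>G\<in>lhom (opp A) (star A P1) (regular (opp A)). \<forall>x\<in>?I. G (emb s x) = g x"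
        using lhom_evaluation[OF PM1 y(1)] by blast
    qed
  qed
  then show "Ext_zero (opp A) 1 ?T (regular (opp A)) \<longleftrightarrow> torsionless A M"
    using Ext_zero_1_iff[OF A' s R'] by (simp only: quo_s)
qed

text \<open>The given covers provide some minimal presentation, the kernel being finitely generated
  since A is noetherian. Hence the one chosen inside \<open>Tr\<close> is a presentation as well,
  and \<open>Tr_Ext_conditions\<close> applies to it.\<close>

lemma reflexive_modules_iff:
  fixes M :: "'a umod"
  assumes A: "left_noetherian A" and A': "left_noetherian (opp A)" and cov: "projective_covers A P p"
  shows "M \<in> reflexive_modules A \<longleftrightarrow> M \<in> fg_modules A \<and> torsionless A M \<and> bidual_surjective A M"
proof (cases "M \<in> fg_modules A")
  case M: True
  note MM = fg_modulesD(1)[OF M]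
  let ?K = "submod (P M) (a_kernel (P M) M (p M))"
  have c: "projective_cover A M (P M) (p M)" using cov M by (simp add: projective_covers_def)
  have PM: "P M \<in> proj_modules A" using c by (simp add: projective_cover_def)
  have "?K \<in> fg_modules A"
    by (rule left_noetherianD[OF A proj_modules_fg[OF PM] submodule_kernel[OF fg_modulesD(1)[OF proj_modules_fg[OF PM]] MM]])
      (use c in \<open>simp add: projective_cover_def\<close>)
  then have "projective_cover A ?K (P ?K) (p ?K)" using cov by (simp add: projective_covers_def)
  then have "\<exists>z. case z of (P1, P0, p1, p0) \<Rightarrow> minimal_presentation A M P1 P0 p1 p0"
    using c by (intro exI[of _ "(P ?K, P M, p ?K, p M)"]) (simp add: minimal_presentation_def)
  then have sm: "case (SOME (P1, P0, p1, p0). minimal_presentation A M P1 P0 p1 p0) of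
      (P1, P0, p1, p0) \<Rightarrow> minimal_presentation A M P1 P0 p1 p0" by (rule someI_ex)
  obtain P1 P0 p1 p0 where z: "(SOME (P1, P0, p1, p0). minimal_presentation A M P1 P0 p1 p0) = (P1, P0, p1, p0)"
    by (rule prod_cases4)
  have mp: "minimal_presentation A M P1 P0 p1 p0" using sm unfolding z by (simp only: prod.case)
  have P0: "has_dual_basis A P0" and p0: "p0 \<in> lhom A P0 M" "p0 ` carrier P0 = carrier M"
    and P1: "has_dual_basis A P1" and p1: "p1 \<in> lhom A P1 (submod P0 (a_kernel P0 M p0))"
    and p1s: "p1 ` carrier P1 = a_kernel P0 M p0"
    using mp unfolding minimal_presentation_def projective_cover_def by (simp_all add: proj_modules_iff)
  have p1': "p1 \<in> lhom A P1 P0"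
  proof (rule lhomI[OF lhom_extensional[OF p1]])
    fix x assume "x \<in> carrier P1"
    then have "p1 x \<in> a_kernel P0 M p0" using p1s by blast
    then show "p1 x \<in> carrier P0" by (simp add: in_a_kernel_iff)
  qed (use lhom_add[OF p1] lhom_smult[OF p1] in simp_all)
  have "Tr A M = quot_mod (star A P1) (star_map A P1 P0 p1 ` carrier (star A P0))"
    unfolding Tr_def z Let_def prod.case star_map_def by (simp cong: image_cong)
  then show ?thesis
    using Tr_Ext_conditions[OF A' MM P0 p0 P1 p1' p1s] M by (simp add: reflexive_modules_def)
qed (simp add: reflexive_modules_def)

section \<open>Vanishing of \<open>Ext\<close> against syzygies and cosyzygies\<close>

lemma dsum_simps [simp]:
  "carrier (dsum M N) = carrier M \<times> carrier N" "\<zero>\<^bsub>dsum M N\<^esub> = (\<zero>\<^bsub>M\<^esub>, \<zero>\<^bsub>N\<^esub>)"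
  "(x, y) \<oplus>\<^bsub>dsum M N\<^esub> (x', y') = (x \<oplus>\<^bsub>M\<^esub> x', y \<oplus>\<^bsub>N\<^esub> y')"
  "a \<odot>\<^bsub>dsum M N\<^esub> (x, y) = (a \<odot>\<^bsub>M\<^esub> x, a \<odot>\<^bsub>N\<^esub> y)"
  by (simp_all add: dsum_def)

lemma left_module_dsum:
  assumes M: "left_module A M" and N: "left_module A N"
  shows "left_module A (dsum M N)"
proof -
  interpret MG: abelian_group M using M by (rule left_module_abelian_group)
  interpret NG: abelian_group N using N by (rule left_module_abelian_group)
  interpret M: left_module A M by fact
  interpret N: left_module A N by fact
  have ab: "abelian_group (dsum M N)"
  proof (rule abelian_groupI)
    fix x assume "x \<in> carrier (dsum M N)"
    then obtain u v where "x = (u, v)" "u \<in> carrier M" "v \<in> carrier N" by auto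
    then show "\<exists>y\<in>carrier (dsum M N). y \<oplus>\<^bsub>dsum M N\<^esub> x = \<zero>\<^bsub>dsum M N\<^esub>"
      by (intro bexI[of _ "(\<ominus>\<^bsub>M\<^esub> u, \<ominus>\<^bsub>N\<^esub> v)"]) (simp_all add: MG.l_neg NG.l_neg)
  qed (auto simp: MG.a_ac NG.a_ac)
  show ?thesis
    by (rule left_module.intro[OF left_module_ring[OF M] ab], rule left_module_axioms.intro)
      (auto simp: M.smult_l_distr M.smult_r_distr M.smult_assoc N.smult_l_distr N.smult_r_distr N.smult_assoc)
qed

lemma extends_dsum_iff:
  assumes s: "proj_seq A s" and X: "left_module A X" and Y: "left_module A Y"
  shows "extends A s (dsum X Y) \<longleftrightarrow> extends A s X \<and> extends A s Y"
proof -
  note D = proj_seqD[OF s]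
  note XY = left_module_dsum[OF X Y]
  have fst_h: "(\<lambda>z\<in>carrier (dsum X Y). fst z) \<in> lhom A (dsum X Y) X"
    by (rule lhom_restrictI[OF XY]) auto
  have snd_h: "(\<lambda>z\<in>carrier (dsum X Y). snd z) \<in> lhom A (dsum X Y) Y"
    by (rule lhom_restrictI[OF XY]) auto
  show ?thesis
  proof (intro iffI conjI)
    assume e: "extends A s (dsum X Y)"
    show "extends A s X" unfolding extends_def
    proof
      fix f assume f: "f \<in> lhom A (sub s) X"
      have "(\<lambda>m\<in>carrier (sub s). (f m, (\<lambda>x\<in>carrier (sub s). \<zero>\<^bsub>Y\<^esub>) m)) \<in> lhom A (sub s) (dsum X Y)"
        by (rule lhom_restrictI[OF D(1)])
          (use abelian_group.axioms(1)[OF left_module_abelian_group[OF Y]] in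
            \<open>simp_all add: lhom_closed[OF f] lhom_add[OF f] lhom_smult[OF f] left_module_zero_closed[OF Y]
              left_module_add_closed[OF D(1)] left_module.smult_closed[OF D(1)]
              abelian_monoid.l_zero left_module.smult_r_null[OF Y]\<close>)
      then obtain G where G: "G \<in> lhom A (mid s) (dsum X Y)"
        "\<And>x. x \<in> carrier (sub s) \<Longrightarrow> G (emb s x) = (\<lambda>m\<in>carrier (sub s). (f m, (\<lambda>x\<in>carrier (sub s). \<zero>\<^bsub>Y\<^esub>) m)) x"
        using e unfolding extends_def by blast
      have "\<forall>x\<in>carrier (sub s). compose (carrier (mid s)) (\<lambda>z\<in>carrier (dsum X Y). fst z) G (emb s x) = f x"
        using D(11) by (simp add: compose_eq G(2) lhom_closed[OF f] left_module_zero_closed[OF Y])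
      then show "\<exists>G\<in>lhom A (mid s) X. \<forall>x\<in>carrier (sub s). G (emb s x) = f x"
        using lhom_compose[OF D(3) G(1) fst_h] by blast
    qed
    show "extends A s Y" unfolding extends_def
    proof
      fix f assume f: "f \<in> lhom A (sub s) Y"
      have "(\<lambda>m\<in>carrier (sub s). ((\<lambda>x\<in>carrier (sub s). \<zero>\<^bsub>X\<^esub>) m, f m)) \<in> lhom A (sub s) (dsum X Y)"
        by (rule lhom_restrictI[OF D(1)])
          (use abelian_group.axioms(1)[OF left_module_abelian_group[OF X]] in
            \<open>simp_all add: lhom_closed[OF f] lhom_add[OF f] lhom_smult[OF f] left_module_zero_closed[OF X]
              left_module_add_closed[OF D(1)] left_module.smult_closed[OF D(1)]
              abelian_monoid.l_zero left_module.smult_r_null[OF X]\<close>)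
      then obtain G where G: "G \<in> lhom A (mid s) (dsum X Y)"
        "\<And>x. x \<in> carrier (sub s) \<Longrightarrow> G (emb s x) = (\<lambda>m\<in>carrier (sub s). ((\<lambda>x\<in>carrier (sub s). \<zero>\<^bsub>X\<^esub>) m, f m)) x"
        using e unfolding extends_def by blast
      have "\<forall>x\<in>carrier (sub s). compose (carrier (mid s)) (\<lambda>z\<in>carrier (dsum X Y). snd z) G (emb s x) = f x"
        using D(11) by (simp add: compose_eq G(2) lhom_closed[OF f] left_module_zero_closed[OF X])
      then show "\<exists>G\<in>lhom A (mid s) Y. \<forall>x\<in>carrier (sub s). G (emb s x) = f x"
        using lhom_compose[OF D(3) G(1) snd_h] by blast
    qed
  next
    assume e: "extends A s X \<and> extends A s Y"
    show "extends A s (dsum X Y)" unfolding extends_def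
    proof
      fix f assume f: "f \<in> lhom A (sub s) (dsum X Y)"
      obtain G where G: "G \<in> lhom A (mid s) X"
        "\<And>x. x \<in> carrier (sub s) \<Longrightarrow> G (emb s x) = compose (carrier (sub s)) (\<lambda>z\<in>carrier (dsum X Y). fst z) f x"
        using e lhom_compose[OF D(1) f fst_h] unfolding extends_def by blast
      obtain H where H: "H \<in> lhom A (mid s) Y"
        "\<And>x. x \<in> carrier (sub s) \<Longrightarrow> H (emb s x) = compose (carrier (sub s)) (\<lambda>z\<in>carrier (dsum X Y). snd z) f x"
        using e lhom_compose[OF D(1) f snd_h] unfolding extends_def by blast
      have "(\<lambda>m\<in>carrier (mid s). (G m, H m)) \<in> lhom A (mid s) (dsum X Y)"
        by (rule lhom_restrictI[OF D(3)])
          (simp_all add: lhom_closed[OF G(1)] lhom_closed[OF H(1)] lhom_add[OF G(1)] lhom_add[OF H(1)]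
            lhom_smult[OF G(1)] lhom_smult[OF H(1)])
      moreover have "\<forall>x\<in>carrier (sub s). (\<lambda>m\<in>carrier (mid s). (G m, H m)) (emb s x) = f x"
        using G(2) H(2) lhom_closed[OF f] D(11) by (simp add: compose_eq del: dsum_simps)
      ultimately show "\<exists>G\<in>lhom A (mid s) (dsum X Y). \<forall>x\<in>carrier (sub s). G (emb s x) = f x" by blast
    qed
  qed
qed

text \<open>\<open>extends\<close> over the kernel of p says that every map f from
  \<open>quo s\<close> to D lifts to P. If so, a z with f z nonzero is seen by a map into a
  projective and hence by a functional. Conversely a torsionless \<open>quo s\<close> embeds into a
  projective Q; f extends to Q by injectivity and then lifts to P by projectivity. The injective
  cogenerator enters through \<open>cog\<close> and \<open>inj\<close>, since D does not have the
  carrier type of \<open>inj_modules\<close>.\<close>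

lemma extends_syzygy_iff_torsionless:
  fixes s :: "'a useq" and P :: "'a umod" and D :: "('a, 'd) module"
  assumes s: "approx_seq A s" and P: "has_dual_basis A P" and DM: "left_module A D"
    and p: "p \<in> lhom A P D" "p ` carrier P = carrier D"
    and cog: "\<And>z. z \<in> carrier (quo s) \<Longrightarrow> z \<noteq> \<zero>\<^bsub>quo s\<^esub> \<Longrightarrow> \<exists>f\<in>lhom A (quo s) D. f z \<noteq> \<zero>\<^bsub>D\<^esub>"
    and inj: "\<And>Q i f. Q \<in> fg_modules A \<Longrightarrow> i \<in> lhom A (quo s) Q \<Longrightarrow> inj_on i (carrier (quo s)) \<Longrightarrow>
      f \<in> lhom A (quo s) D \<Longrightarrow> \<exists>h\<in>lhom A Q D. \<forall>x\<in>carrier (quo s). h (i x) = f x"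
    and ap: "left_proj_approx A (quo s) Q e" and fg: "quo s \<in> fg_modules A"
  shows "extends A s (submod P (a_kernel P D p)) \<longleftrightarrow> torsionless A (quo s)"
proof -
  have ps: "proj_seq A s" and ex: "extends A s (regular A)" using s by (auto simp: approx_seq_def)
  note S = proj_seqD[OF ps]
  note PM = has_dual_basis_module[OF P]
  let ?K = "submod P (a_kernel P D p)"
  have Ks: "submodule (a_kernel P D p) A P" by (rule submodule_kernel[OF PM DM p(1)])
  have incl: "f \<in> lhom A M P" if "f \<in> lhom A M ?K" for f and M :: "('a, 'm) module"
  proof (rule lhomI[OF lhom_extensional[OF that]])
    fix x assume "x \<in> carrier M"
    then show "f x \<in> carrier P" using lhom_closed[OF that] submodule_subset[OF Ks] by auto
  qed (use lhom_add[OF that] lhom_smult[OF that] in simp_all)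
  have pK: "p (f x) = \<zero>\<^bsub>D\<^esub>" if "f \<in> lhom A M ?K" "x \<in> carrier M" for f x and M :: "('a, 'm) module"
    using lhom_closed[OF that] by (simp add: in_a_kernel_iff)
  have intoK: "f \<in> lhom A M ?K" if "f \<in> lhom A M P" "\<And>x. x \<in> carrier M \<Longrightarrow> p (f x) = \<zero>\<^bsub>D\<^esub>"
    for f and M :: "('a, 'm) module"
    by (rule lhomI[OF lhom_extensional[OF that(1)]])
      (use that(2) lhom_closed[OF that(1)] lhom_add[OF that(1)] lhom_smult[OF that(1)] in \<open>simp_all add: in_a_kernel_iff\<close>)
  interpret PG: abelian_group P by (rule left_module_abelian_group[OF PM])
  interpret DG: abelian_group D by (rule left_module_abelian_group[OF DM])
  show ?thesis
  proof
    assume eK: "extends A s ?K"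
    \<comment> \<open>Lift f epi to a map t on \<open>mid s\<close>. On \<open>sub s\<close> it
      takes values in the kernel of p; subtracting an extension of this restriction lets t descend
      to \<open>quo s\<close>.\<close>
    have fac: "\<exists>h\<in>lhom A (quo s) P. \<forall>z\<in>carrier (quo s). p (h z) = f z" if f: "f \<in> lhom A (quo s) D" for f
    proof -
      note fe = lhom_compose[OF S(3,7) f]
      obtain t where t: "t \<in> lhom A (mid s) P"
        "\<forall>x\<in>carrier (mid s). p (t x) = compose (carrier (mid s)) f (epi s) x"
        using dual_basis_lift[OF S(2) PM DM p fe] by blast
      have te: "compose (carrier (sub s)) t (emb s) \<in> lhom A (sub s) ?K"
      proof (rule intoK[OF lhom_compose[OF S(1,5) t(1)]])
        fix x assume x: "x \<in> carrier (sub s)"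
        then show "p (compose (carrier (sub s)) t (emb s) x) = \<zero>\<^bsub>D\<^esub>"
          using t(2) S(10,11)[OF x] lhom_zero[OF S(4) DM f] by (simp add: compose_eq)
      qed
      obtain G where G: "G \<in> lhom A (mid s) ?K"
        "\<forall>x\<in>carrier (sub s). G (emb s x) = compose (carrier (sub s)) t (emb s) x"
        using eK te unfolding extends_def by blast
      let ?d = "\<lambda>x\<in>carrier (mid s). t x \<ominus>\<^bsub>P\<^esub> G x"
      have "\<exists>h\<in>lhom A (quo s) P. \<forall>x\<in>carrier (mid s). h (epi s x) = ?d x"
      proof (rule proj_seq_factor_quo[OF ps PM lhom_sub[OF S(3) PM t(1) incl[OF G(1)]]])
        fix x assume x: "x \<in> carrier (sub s)"
        then have "G (emb s x) = t (emb s x)" using G(2) by (simp add: compose_eq)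
        then show "?d (emb s x) = \<zero>\<^bsub>P\<^esub>" using S(11)[OF x] lhom_closed[OF t(1) S(11)[OF x]] by simp
      qed
      then obtain h where h: "h \<in> lhom A (quo s) P" "\<And>x. x \<in> carrier (mid s) \<Longrightarrow> h (epi s x) = ?d x" by blast
      have "p (h z) = f z" if z: "z \<in> carrier (quo s)" for z
      proof -
        obtain x where x: "x \<in> carrier (mid s)" "z = epi s x" by (rule surj_imageE[OF S(8) z])
        have "p (h z) = p (t x) \<ominus>\<^bsub>D\<^esub> p (G x)"
          using x h(2) by (simp add: lhom_minus[OF PM DM p(1)] lhom_closed[OF t(1)] lhom_closed[OF incl[OF G(1)]])
        then show ?thesis using x t(2) pK[OF G(1) x(1)] lhom_closed[OF f z] by (simp add: compose_eq)
      qed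
      with h(1) show ?thesis by blast
    qed
    show "torsionless A (quo s)" unfolding torsionless_def
    proof (intro ballI impI, rule ccontr)
      fix z assume z: "z \<in> carrier (quo s)" and v: "\<forall>\<phi>\<in>lhom A (quo s) (regular A). \<phi> z = \<zero>\<^bsub>A\<^esub>"
        and nz: "z \<noteq> \<zero>\<^bsub>quo s\<^esub>"
      obtain f where f: "f \<in> lhom A (quo s) D" "f z \<noteq> \<zero>\<^bsub>D\<^esub>" using cog[OF z nz] by blast
      obtain h where h: "h \<in> lhom A (quo s) P" "\<forall>z\<in>carrier (quo s). p (h z) = f z" using fac[OF f(1)] by blast
      have "h z = \<zero>\<^bsub>P\<^esub>"
      proof (rule torsionlessD[OF torsionless_dual_basis[OF P] lhom_closed[OF h(1) z]])
        fix \<phi> assume "\<phi> \<in> lhom A P (regular A)"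
        then show "\<phi> (h z) = \<zero>\<^bsub>A\<^esub>" using bspec[OF v lhom_compose[OF S(4) h(1)]] z by (simp add: compose_eq)
      qed
      then have "f z = \<zero>\<^bsub>D\<^esub>" using h(2) z lhom_zero[OF PM DM p(1)] by metis
      then show False using f(2) by simp
    qed
  next
    assume t: "torsionless A (quo s)"
    have Q: "Q \<in> proj_modules A" and eh: "e \<in> lhom A (quo s) Q" using ap by (auto simp: left_proj_approx_def)
    note QB = Q[unfolded proj_modules_iff]
    have ei: "inj_on e (carrier (quo s))" using t torsionless_iff_approximation_inj[OF fg ap] by blast
    have eP: "extends A s P" by (rule extends_dual_basis[OF ps ex P])
    show "extends A s ?K" unfolding extends_def
    proof
      fix g assume g: "g \<in> lhom A (sub s) ?K"
      obtain G where G: "G \<in> lhom A (mid s) P" "\<And>x. x \<in> carrier (sub s) \<Longrightarrow> G (emb s x) = g x"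
        using bspec[OF eP[unfolded extends_def] incl[OF g]] by blast
      note pG = lhom_compose[OF S(3) G(1) p(1)]
      have "\<exists>f\<in>lhom A (quo s) D. \<forall>x\<in>carrier (mid s). f (epi s x) = compose (carrier (mid s)) p G x"
        by (rule proj_seq_factor_quo[OF ps DM pG]) (simp add: compose_eq S(11) G(2) pK[OF g])
      then obtain f where f: "f \<in> lhom A (quo s) D"
        "\<forall>x\<in>carrier (mid s). f (epi s x) = compose (carrier (mid s)) p G x" by blast
      have fp: "f (epi s x) = p (G x)" if "x \<in> carrier (mid s)" for x using f(2) that by (simp add: compose_eq)
      obtain f1 where f1: "f1 \<in> lhom A Q D" "\<And>z. z \<in> carrier (quo s) \<Longrightarrow> f1 (e z) = f z"
        using inj[OF proj_modules_fg[OF Q] eh ei f(1)] by blast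
      obtain f2 where f2: "f2 \<in> lhom A Q P" "\<And>y. y \<in> carrier Q \<Longrightarrow> p (f2 y) = f1 y"
        using dual_basis_lift[OF QB PM DM p f1(1)] by blast
      \<comment> \<open>A map through \<open>quo s\<close> and Q with the same composite to D as G.
        Subtracting it moves G into the kernel of p and changes nothing on
        \<open>sub s\<close>.\<close>
      let ?w = "compose (carrier (mid s)) (compose (carrier (quo s)) f2 e) (epi s)"
      have w: "?w \<in> lhom A (mid s) P" by (rule lhom_compose[OF S(3,7) lhom_compose[OF S(4) eh f2(1)]])
      have pw: "p (?w x) = p (G x)" if x: "x \<in> carrier (mid s)" for x
        using x S(12)[OF x] by (simp add: compose_eq f2(2) lhom_closed[OF eh] f1(2) fp)
      let ?H = "\<lambda>x\<in>carrier (mid s). G x \<ominus>\<^bsub>P\<^esub> ?w x"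
      have "?H \<in> lhom A (mid s) ?K"
      proof (rule intoK[OF lhom_sub[OF S(3) PM G(1) w]])
        fix x assume x: "x \<in> carrier (mid s)"
        have "p (?H x) = p (G x) \<ominus>\<^bsub>D\<^esub> p (?w x)"
          using x by (simp add: lhom_minus[OF PM DM p(1)] lhom_closed[OF G(1)] lhom_closed[OF w])
        then show "p (?H x) = \<zero>\<^bsub>D\<^esub>" using pw[OF x] lhom_closed[OF p(1) lhom_closed[OF G(1) x]] by simp
      qed
      moreover have "?H (emb s x) = g x" if x: "x \<in> carrier (sub s)" for x
      proof -
        have "?w (emb s x) = \<zero>\<^bsub>P\<^esub>"
          using x S(10,11)[OF x] left_module_zero_closed[OF S(4)] lhom_zero[OF S(4) PM lhom_compose[OF S(4) eh f2(1)]]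
          by (simp add: compose_eq[of "emb s x"])
        then show ?thesis using S(11)[OF x] G(2)[OF x] lhom_closed[OF incl[OF g] x] by simp
      qed
      ultimately show "\<exists>G\<in>lhom A (mid s) ?K. \<forall>x\<in>carrier (sub s). G (emb s x) = g x" by blast
    qed
  qed
qed

text \<open>Both sides test Ext^2(quo s, X): the left one by shifting along the injective I, the
  right one along the projective \<open>mid s\<close>. The proof is the comparison of the two
  shifts, written out with maps.\<close>

lemma extends_cosyzygy_iff:
  fixes s r :: "'a useq" and X :: "('a, 'n) module"
  assumes s: "proj_seq A s" and r: "proj_seq A r" and qr: "quo r = sub s"
    and I: "I \<in> inj_modules A" and j: "j \<in> lhom A X I" "inj_on j (carrier X)" and X: "left_module A X"
    and fg: "sub s \<in> fg_modules A" "sub r \<in> fg_modules A"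
  shows "extends A s (quot_mod I (j ` carrier X)) \<longleftrightarrow> extends A r X"
proof -
  note S = proj_seqD[OF s] and D = proj_seqD[OF r]
  have If: "I \<in> fg_modules A" using I by (simp add: inj_modules_def)
  note IM = fg_modulesD(1)[OF If]
  have inj: "\<exists>h\<in>lhom A N I. \<forall>x\<in>carrier M. h (g x) = f x"
    if "M \<in> fg_modules A" "N \<in> fg_modules A" "g \<in> lhom A M N" "f \<in> lhom A M I" "inj_on g (carrier M)" for M N g f
    using I that by (simp add: inj_modules_def)
  have mid_fg: "mid s \<in> fg_modules A" "mid r \<in> fg_modules A"
    by (rule proj_modules_fg[OF S(2)[folded proj_modules_iff]], rule proj_modules_fg[OF D(2)[folded proj_modules_iff]])
  have N: "submodule (j ` carrier X) A I" by (rule submodule_image[OF X IM j(1)])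
  let ?L = "quot_mod I (j ` carrier X)"
  define \<pi> where "\<pi> = (\<lambda>x\<in>carrier I. (j ` carrier X) +>\<^bsub>I\<^esub> x)"
  have LM: "left_module A ?L" and \<pi>: "\<pi> \<in> lhom A I ?L" "\<pi> ` carrier I = carrier ?L"
    and ker: "a_kernel I ?L \<pi> = j ` carrier X"
    unfolding \<pi>_def by (fact quot_mod_facts[OF IM N])+
  have ker: "\<pi> x = \<zero>\<^bsub>?L\<^esub> \<longleftrightarrow> x \<in> j ` carrier X" if "x \<in> carrier I" for x
    using in_a_kernel_iff[of x I ?L \<pi>, unfolded ker] that by simp
  have epi: "epi r \<in> lhom A (mid r) (sub s)" "epi r ` carrier (mid r) = carrier (sub s)" using D(7,8) qr by simp_all
  interpret IG: abelian_group I by (rule left_module_abelian_group[OF IM])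
  interpret LG: abelian_group ?L by (rule left_module_abelian_group[OF LM])
  show ?thesis
  proof
    assume e: "extends A r X"
    show "extends A s ?L" unfolding extends_def
    proof
      fix g assume g: "g \<in> lhom A (sub s) ?L"
      obtain l where l: "l \<in> lhom A (mid r) I"
        "\<forall>x\<in>carrier (mid r). \<pi> (l x) = compose (carrier (mid r)) g (epi r) x"
        using dual_basis_lift[OF D(2) IM LM \<pi> lhom_compose[OF D(3) epi(1) g]] by blast
      have pl: "\<pi> (l x) = g (epi r x)" if "x \<in> carrier (mid r)" for x using l(2) that by (simp add: compose_eq)
      have "\<exists>m\<in>lhom A (sub r) X. \<forall>x\<in>carrier (sub r). j (m x) = compose (carrier (sub r)) l (emb r) x"
      proof (rule lhom_corestrict[OF X IM D(1) j lhom_compose[OF D(1,5) l(1)]])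
        fix x assume x: "x \<in> carrier (sub r)"
        have "\<pi> (l (emb r x)) = \<zero>\<^bsub>?L\<^esub>"
          using pl[OF D(11)[OF x]] D(10)[OF x] lhom_zero[OF S(1) LM g] by (simp add: qr)
        then show "compose (carrier (sub r)) l (emb r) x \<in> j ` carrier X"
          using ker[OF lhom_closed[OF l(1) D(11)[OF x]]] x by (simp add: compose_eq)
      qed
      then obtain m where m: "m \<in> lhom A (sub r) X"
        "\<forall>x\<in>carrier (sub r). j (m x) = compose (carrier (sub r)) l (emb r) x" by blast
      have jm': "j (m x) = l (emb r x)" if "x \<in> carrier (sub r)" for x using m(2) that by (simp add: compose_eq)
      obtain m' where m': "m' \<in> lhom A (mid r) X" "\<And>x. x \<in> carrier (sub r) \<Longrightarrow> m' (emb r x) = m x"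
        using bspec[OF e[unfolded extends_def] m(1)] by blast
      let ?jm = "compose (carrier (mid r)) j m'"
      have jm: "?jm \<in> lhom A (mid r) I" by (rule lhom_compose[OF D(3) m'(1) j(1)])
      \<comment> \<open>Subtracting the extended map into X makes l vanish on \<open>sub r\<close>;
        the result descends to a lift of g into I, which extends over \<open>mid s\<close> because I
        is injective.\<close>
      let ?d = "\<lambda>x\<in>carrier (mid r). l x \<ominus>\<^bsub>I\<^esub> ?jm x"
      have "\<exists>h\<in>lhom A (quo r) I. \<forall>x\<in>carrier (mid r). h (epi r x) = ?d x"
      proof (rule proj_seq_factor_quo[OF r IM lhom_sub[OF D(3) IM l(1) jm]])
        fix x assume x: "x \<in> carrier (sub r)"
        then show "?d (emb r x) = \<zero>\<^bsub>I\<^esub>"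
          using D(11)[OF x] lhom_closed[OF l(1) D(11)[OF x]] by (simp add: compose_eq m'(2) jm')
      qed
      then obtain h where h: "h \<in> lhom A (sub s) I" "\<And>x. x \<in> carrier (mid r) \<Longrightarrow> h (epi r x) = ?d x"
        unfolding qr by blast
      have ph: "\<pi> (h y) = g y" if y: "y \<in> carrier (sub s)" for y
      proof -
        obtain x where x: "x \<in> carrier (mid r)" "y = epi r x" by (rule surj_imageE[OF epi(2) y])
        have "\<pi> (?jm x) = \<zero>\<^bsub>?L\<^esub>"
          using ker[OF lhom_closed[OF jm x(1)]] x(1) lhom_closed[OF m'(1) x(1)] by (simp add: compose_eq)
        then have "\<pi> (h y) = \<pi> (l x) \<ominus>\<^bsub>?L\<^esub> \<zero>\<^bsub>?L\<^esub>"
          using x h(2)[OF x(1)] by (simp add: lhom_minus[OF IM LM \<pi>(1)] lhom_closed[OF l(1)] lhom_closed[OF jm])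
        then show ?thesis using pl[OF x(1)] x lhom_closed[OF g y] by simp
      qed
      obtain h' where h': "h' \<in> lhom A (mid s) I" "\<forall>x\<in>carrier (sub s). h' (emb s x) = h x"
        using inj[OF fg(1) mid_fg(1) S(5) h(1) S(6)] by blast
      have "\<forall>x\<in>carrier (sub s). compose (carrier (mid s)) \<pi> h' (emb s x) = g x"
        using h'(2) ph S(11) by (simp add: compose_eq)
      then show "\<exists>G\<in>lhom A (mid s) ?L. \<forall>x\<in>carrier (sub s). G (emb s x) = g x"
        using lhom_compose[OF S(3) h'(1) \<pi>(1)] by blast
    qed
  next
    assume e: "extends A s ?L"
    show "extends A r X" unfolding extends_def
    proof
      fix m assume m: "m \<in> lhom A (sub r) X"
      obtain l where l: "l \<in> lhom A (mid r) I"
        "\<forall>x\<in>carrier (sub r). l (emb r x) = compose (carrier (sub r)) j m x"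
        using inj[OF fg(2) mid_fg(2) D(5) lhom_compose[OF D(1) m j(1)] D(6)] by blast
      have lm: "l (emb r x) = j (m x)" if "x \<in> carrier (sub r)" for x using l(2) that by (simp add: compose_eq)
      have "\<exists>g\<in>lhom A (quo r) ?L. \<forall>x\<in>carrier (mid r). g (epi r x) = compose (carrier (mid r)) \<pi> l x"
      proof (rule proj_seq_factor_quo[OF r LM lhom_compose[OF D(3) l(1) \<pi>(1)]])
        fix x assume x: "x \<in> carrier (sub r)"
        then show "compose (carrier (mid r)) \<pi> l (emb r x) = \<zero>\<^bsub>?L\<^esub>"
          using D(11)[OF x] lm[OF x] ker[OF lhom_closed[OF j(1) lhom_closed[OF m x]]] lhom_closed[OF m x]
          by (simp add: compose_eq)
      qed
      then obtain g where g: "g \<in> lhom A (sub s) ?L"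
        "\<forall>x\<in>carrier (mid r). g (epi r x) = compose (carrier (mid r)) \<pi> l x" unfolding qr by blast
      have gp: "g (epi r x) = \<pi> (l x)" if "x \<in> carrier (mid r)" for x using g(2) that by (simp add: compose_eq)
      obtain G where G: "G \<in> lhom A (mid s) ?L" "\<And>x. x \<in> carrier (sub s) \<Longrightarrow> G (emb s x) = g x"
        using bspec[OF e[unfolded extends_def] g(1)] by blast
      obtain k where k: "k \<in> lhom A (mid s) I" "\<And>x. x \<in> carrier (mid s) \<Longrightarrow> \<pi> (k x) = G x"
        using dual_basis_lift[OF S(2) IM LM \<pi> G(1)] by blast
      \<comment> \<open>G was lifted to I over the projective \<open>mid s\<close>. Pulled back to
        \<open>mid r\<close>, this lift agrees with l modulo X and is zero on \<open>sub r\<close>,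
        so the difference is the desired extension of m.\<close>
      let ?k = "compose (carrier (mid r)) (compose (carrier (sub s)) k (emb s)) (epi r)"
      have ke: "compose (carrier (sub s)) k (emb s) \<in> lhom A (sub s) I" by (rule lhom_compose[OF S(1,5) k(1)])
      have kh: "?k \<in> lhom A (mid r) I" by (rule lhom_compose[OF D(3) epi(1) ke])
      let ?d = "\<lambda>x\<in>carrier (mid r). l x \<ominus>\<^bsub>I\<^esub> ?k x"
      have dh: "?d \<in> lhom A (mid r) I" by (rule lhom_sub[OF D(3) IM l(1) kh])
      have "\<exists>h\<in>lhom A (mid r) X. \<forall>x\<in>carrier (mid r). j (h x) = ?d x"
      proof (rule lhom_corestrict[OF X IM D(3) j dh])
        fix x assume x: "x \<in> carrier (mid r)"
        have ex: "epi r x \<in> carrier (sub s)" by (rule lhom_closed[OF epi(1) x])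
        have "\<pi> (?k x) = \<pi> (l x)" using x ex S(11)[OF ex] by (simp add: compose_eq k(2) G(2) gp)
        then have "\<pi> (?d x) = \<zero>\<^bsub>?L\<^esub>"
          using x lhom_closed[OF \<pi>(1) lhom_closed[OF l(1) x]]
          by (simp add: lhom_minus[OF IM LM \<pi>(1)] lhom_closed[OF l(1)] lhom_closed[OF kh])
        then show "?d x \<in> j ` carrier X" using ker[OF lhom_closed[OF dh x]] by blast
      qed
      then obtain h where h: "h \<in> lhom A (mid r) X" "\<And>x. x \<in> carrier (mid r) \<Longrightarrow> j (h x) = ?d x" by blast
      have "h (emb r x) = m x" if x: "x \<in> carrier (sub r)" for x
      proof (rule inj_onD[OF j(2) _ lhom_closed[OF h(1) D(11)[OF x]] lhom_closed[OF m x]])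
        have "?k (emb r x) = \<zero>\<^bsub>I\<^esub>"
          using D(11)[OF x] D(10)[OF x] lhom_zero[OF S(1) IM ke] by (simp add: compose_eq[of "emb r x"] qr)
        then show "j (h (emb r x)) = j (m x)"
          using h(2)[OF D(11)[OF x]] D(11)[OF x] lm[OF x] lhom_closed[OF j(1) lhom_closed[OF m x]] by simp
      qed
      with h(1) show "\<exists>G\<in>lhom A (mid r) X. \<forall>x\<in>carrier (sub r). G (emb r x) = m x" by blast
    qed
  qed
qed

section \<open>Artinian commutative rings are noetherian\<close>

lemma (in cring) ideal_criterion:
  assumes "I \<subseteq> carrier R" "\<zero> \<in> I" "\<And>x y. x \<in> I \<Longrightarrow> y \<in> I \<Longrightarrow> x \<oplus> y \<in> I"
    and sm: "\<And>r x. r \<in> carrier R \<Longrightarrow> x \<in> I \<Longrightarrow> r \<otimes> x \<in> I"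
  shows "ideal I R"
proof (rule idealI[OF ring_axioms])
  show "subgroup I (add_monoid R)"
  proof (rule subgroup.intro)
    fix x assume x: "x \<in> I"
    then have "\<ominus> x = (\<ominus> \<one>) \<otimes> x" using assms(1) by (auto simp: l_minus)
    then show "inv\<^bsub>add_monoid R\<^esub> x \<in> I" using sm[of "\<ominus> \<one>" x] x by (simp add: a_inv_def)
  qed (use assms in auto)
next
  fix a x assume "a \<in> I" "x \<in> carrier R"
  then show "x \<otimes> a \<in> I" "a \<otimes> x \<in> I" using sm[of x a] assms(1) m_comm[of a x] by auto
qed

lemma idealD:
  assumes "ideal I R"
  shows ideal_subset: "I \<subseteq> carrier R" and ideal_zero: "\<zero>\<^bsub>R\<^esub> \<in> I"
    and ideal_add: "x \<in> I \<Longrightarrow> y \<in> I \<Longrightarrow> x \<oplus>\<^bsub>R\<^esub> y \<in> I"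
    and ideal_mult: "r \<in> carrier R \<Longrightarrow> x \<in> I \<Longrightarrow> r \<otimes>\<^bsub>R\<^esub> x \<in> I"
    and ideal_neg: "x \<in> I \<Longrightarrow> \<ominus>\<^bsub>R\<^esub> x \<in> I"
proof -
  interpret ideal I R by fact
  show "I \<subseteq> carrier R" by (rule a_subset)
  show "\<zero>\<^bsub>R\<^esub> \<in> I" by (rule additive_subgroup.zero_closed[OF is_additive_subgroup])
  show "x \<in> I \<Longrightarrow> y \<in> I \<Longrightarrow> x \<oplus>\<^bsub>R\<^esub> y \<in> I" by (rule additive_subgroup.a_closed[OF is_additive_subgroup])
  show "r \<in> carrier R \<Longrightarrow> x \<in> I \<Longrightarrow> r \<otimes>\<^bsub>R\<^esub> x \<in> I" by (rule I_l_closed)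
  show "x \<in> I \<Longrightarrow> \<ominus>\<^bsub>R\<^esub> x \<in> I" by (rule additive_subgroup.a_inv_closed[OF is_additive_subgroup])
qed

text \<open>Otherwise repeated choice of a strictly smaller member gives a descending sequence of
  ideals that never stops.\<close>

lemma artinian_minimal:
  assumes art: "artinian R" and S: "I\<^sub>0 \<in> S" "\<And>I. I \<in> S \<Longrightarrow> ideal I R"
  shows "\<exists>I\<in>S. \<forall>J\<in>S. J \<subseteq> I \<longrightarrow> J = I"
proof (rule ccontr)
  assume n: "\<not> (\<exists>I\<in>S. \<forall>J\<in>S. J \<subseteq> I \<longrightarrow> J = I)"
  then have "\<forall>I\<in>S. \<exists>J. J \<in> S \<and> J \<subset> I" by blast
  from bchoice[OF this] obtain g where "\<forall>I\<in>S. g I \<in> S \<and> g I \<subset> I" ..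
  note g = bspec[OF this]
  define f where "f n = (g ^^ n) I\<^sub>0" for n
  have fS: "f n \<in> S" for n by (induction n) (simp_all add: f_def S(1) g)
  have f_Suc: "f (Suc n) \<subset> f n" for n using g[OF fS[of n]] by (simp add: f_def)
  have "ideal (f n) R \<and> f (Suc n) \<subseteq> f n" for n
    using S(2)[OF fS] psubset_imp_subset[OF f_Suc] by (rule conjI)
  then have "\<forall>n. ideal (f n) R \<and> f (Suc n) \<subseteq> f n" ..
  from mp[OF spec[OF art[unfolded artinian_def], of f] this] obtain m where m: "\<forall>n\<ge>m. f n = f m" ..
  have "f (Suc m) = f m" by (rule m[rule_format]) simp
  then show False using f_Suc[of m] by simp
qed

definition fg_ideal :: "('r, 'x) ring_scheme \<Rightarrow> 'r set \<Rightarrow> bool" where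
  "fg_ideal R I \<longleftrightarrow> (\<exists>S. finite S \<and> S \<subseteq> I \<and> (\<forall>J. ideal J R \<longrightarrow> S \<subseteq> J \<longrightarrow> I \<subseteq> J))"

text \<open>Zorn's lemma, used twice: with x = 1 it produces maximal ideals, and over the zero ideal
  the hyperplane in \<open>artinian_fg_ideal\<close>.\<close>

lemma (in cring) ideal_avoiding:
  assumes I: "ideal I R" and x: "x \<notin> I"
  obtains V where "ideal V R" "I \<subseteq> V" "x \<notin> V" "\<And>W. ideal W R \<Longrightarrow> V \<subseteq> W \<Longrightarrow> x \<notin> W \<Longrightarrow> W = V"
proof -
  let ?S = "{V. ideal V R \<and> I \<subseteq> V \<and> x \<notin> V}"
  have "\<exists>V\<in>?S. \<forall>W\<in>?S. V \<subseteq> W \<longrightarrow> W = V"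
  proof (rule subset_Zorn_nonempty)
    show "?S \<noteq> {}" using I x by blast
    fix C assume C: "C \<noteq> {}" "subset.chain ?S C"
    have id: "ideal V R" "I \<subseteq> V" "x \<notin> V" if "V \<in> C" for V using C(2) that by (auto simp: subset.chain_def)
    have lin: "V \<subseteq> W \<or> W \<subseteq> V" if "V \<in> C" "W \<in> C" for V W
      using C(2) that by (auto simp: subset.chain_def)
    have "ideal (\<Union>C) R"
    proof (rule ideal_criterion)
      show "\<Union>C \<subseteq> carrier R" using id(1) ideal_subset by blast
      obtain V where "V \<in> C" using C(1) by blast
      then show "\<zero> \<in> \<Union>C" using id(1) ideal_zero by blast
    next
      fix y z assume "y \<in> \<Union>C" "z \<in> \<Union>C"
      then obtain V W where VW: "V \<in> C" "y \<in> V" "W \<in> C" "z \<in> W" by blast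
      then consider "z \<in> V" | "y \<in> W" using lin by blast
      then show "y \<oplus> z \<in> \<Union>C" using VW ideal_add[OF id(1)] by cases blast+
    next
      fix r y assume "r \<in> carrier R" "y \<in> \<Union>C"
      then show "r \<otimes> y \<in> \<Union>C" using ideal_mult[OF id(1)] by blast
    qed
    then show "\<Union>C \<in> ?S" using id(2,3) C(1) by blast
  qed
  then obtain V where "V \<in> ?S" "\<forall>W\<in>?S. V \<subseteq> W \<longrightarrow> W = V" by (elim bexE)
  then show ?thesis by (intro that[of V]) auto
qed

lemma (in cring) ideal_translate:
  assumes "ideal I R" "r \<in> carrier R"
  shows "ideal ((\<otimes>) r ` I) R"
proof (rule ideal_criterion)
  note c = subsetD[OF ideal_subset[OF assms(1)]]
  show "(\<otimes>) r ` I \<subseteq> carrier R" using c assms(2) by blast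
  show "\<zero> \<in> (\<otimes>) r ` I" using ideal_zero[OF assms(1)] assms(2) by (intro image_eqI[of _ _ "\<zero>"]) simp_all
  fix x y assume "x \<in> (\<otimes>) r ` I" "y \<in> (\<otimes>) r ` I"
  then obtain u v where uv: "u \<in> I" "v \<in> I" "x = r \<otimes> u" "y = r \<otimes> v" by blast
  then show "x \<oplus> y \<in> (\<otimes>) r ` I"
    using ideal_add[OF assms(1) uv(1,2)] c assms(2) by (intro image_eqI[of _ _ "u \<oplus> v"]) (simp_all add: r_distr)
next
  note c = subsetD[OF ideal_subset[OF assms(1)]]
  fix s x assume s: "s \<in> carrier R" and "x \<in> (\<otimes>) r ` I"
  then obtain u where u: "u \<in> I" "x = r \<otimes> u" by blast
  then show "s \<otimes> x \<in> (\<otimes>) r ` I"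
    using ideal_mult[OF assms(1) s u(1)] c s assms(2) by (intro image_eqI[of _ _ "s \<otimes> u"]) (simp_all add: m_lcomm)
qed

lemma (in cring) ideal_inter:
  assumes "ideal I R" "ideal J R"
  shows "ideal (I \<inter> J) R"
  by (rule ideal_criterion) (use idealD[OF assms(1)] idealD[OF assms(2)] in auto)

lemma (in cring) ideal_sum_principal:
  assumes V: "ideal V R" and y: "y \<in> carrier R"
  shows "ideal {v \<oplus> r \<otimes> y |v r. v \<in> V \<and> r \<in> carrier R} R" (is "ideal ?W R")
proof (rule ideal_criterion)
  note c = subsetD[OF ideal_subset[OF V]]
  show "?W \<subseteq> carrier R" using c y by auto
  show "\<zero> \<in> ?W" using ideal_zero[OF V] y by (intro CollectI exI[of _ "\<zero>"]) simp
  fix a b assume "a \<in> ?W" "b \<in> ?W"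
  then obtain v r v' r' where vr: "v \<in> V" "r \<in> carrier R" "v' \<in> V" "r' \<in> carrier R"
    "a = v \<oplus> r \<otimes> y" "b = v' \<oplus> r' \<otimes> y" by blast
  have "a \<oplus> b = (v \<oplus> v') \<oplus> (r \<oplus> r') \<otimes> y" using vr c y by (simp add: l_distr a_ac)
  then show "a \<oplus> b \<in> ?W" using ideal_add[OF V vr(1,3)] a_closed[OF vr(2,4)] by blast
next
  note c = subsetD[OF ideal_subset[OF V]]
  fix s a assume s: "s \<in> carrier R" and "a \<in> ?W"
  then obtain v r where vr: "v \<in> V" "r \<in> carrier R" "a = v \<oplus> r \<otimes> y" by blast
  have "s \<otimes> a = s \<otimes> v \<oplus> (s \<otimes> r) \<otimes> y" using vr c y s by (simp add: r_distr m_assoc)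
  then show "s \<otimes> a \<in> ?W" using ideal_mult[OF V s vr(1)] m_closed[OF s vr(2)] by blast
qed

text \<open>A minimal ideal \<open>I\<close> among those containing an ideal that is not finitely generated would be a
  vector space over the residue field of its annihilator, all of whose proper subspaces are finitely
  generated; a hyperplane, which exists by Zorn's lemma, then contradicts this.\<close>

lemma (in cring) artinian_fg_ideal:
  assumes art: "artinian R" and I0: "ideal I\<^sub>0 R"
  shows "fg_ideal R I\<^sub>0"
proof (rule ccontr)
  assume nf: "\<not> fg_ideal R I\<^sub>0"
  define S where "S = {I. ideal I R \<and> (\<exists>N. ideal N R \<and> N \<subseteq> I \<and> \<not> fg_ideal R N)}"
  have "I\<^sub>0 \<in> S" using nf I0 unfolding S_def by blast
  then have "\<exists>I\<in>S. \<forall>J\<in>S. J \<subseteq> I \<longrightarrow> J = I"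
    by (rule artinian_minimal[OF art]) (simp add: S_def)
  then obtain I where IS: "I \<in> S" and Imin: "\<And>J. J \<in> S \<Longrightarrow> J \<subseteq> I \<Longrightarrow> J = I" by blast
  have I: "ideal I R" using IS by (simp add: S_def)
  note c = subsetD[OF ideal_subset[OF I]]
  have proper: "fg_ideal R N" if "ideal N R" "N \<subseteq> I" "N \<noteq> I" for N
  proof (rule ccontr)
    assume "\<not> fg_ideal R N"
    then have "N \<in> S" using that(1) unfolding S_def by blast
    then show False using Imin that(2,3) by blast
  qed
  then have nI: "\<not> fg_ideal R I" using IS unfolding S_def by blast
  \<comment> \<open>Otherwise the kernel and the image of multiplication by r on I are both proper
    ideals inside I, hence finitely generated. Generators of the kernel together with preimages of
    generators of the image would then generate I.\<close>
  have dich: "(\<otimes>) r ` I = I \<or> (\<forall>x\<in>I. r \<otimes> x = \<zero>)" if r: "r \<in> carrier R" for r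
  proof (rule ccontr)
    assume n: "\<not> ((\<otimes>) r ` I = I \<or> (\<forall>x\<in>I. r \<otimes> x = \<zero>))"
    let ?K = "{x \<in> I. r \<otimes> x = \<zero>}"
    have K: "ideal ?K R"
    proof (rule ideal_criterion)
      fix s x assume "s \<in> carrier R" "x \<in> ?K"
      then show "s \<otimes> x \<in> ?K" using ideal_mult[OF I] c r m_lcomm[of r s x] by auto
    qed (use idealD[OF I] c r in \<open>auto simp: r_distr\<close>)
    have rI: "(\<otimes>) r ` I \<subseteq> I" using ideal_mult[OF I r] by blast
    obtain U where U: "finite U" "U \<subseteq> ?K" "\<And>J. ideal J R \<Longrightarrow> U \<subseteq> J \<Longrightarrow> ?K \<subseteq> J"
      using proper[OF K] n unfolding fg_ideal_def by blast
    obtain T where T: "finite T" "T \<subseteq> (\<otimes>) r ` I" "\<And>J. ideal J R \<Longrightarrow> T \<subseteq> J \<Longrightarrow> (\<otimes>) r ` I \<subseteq> J"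
      using proper[OF ideal_translate[OF I r] rI] n unfolding fg_ideal_def by blast
    obtain T' where T': "T' \<subseteq> I" "finite T'" "T = (\<otimes>) r ` T'"
      using finite_subset_image[OF T(1,2)] by blast
    have "I \<subseteq> J" if J: "ideal J R" "U \<union> T' \<subseteq> J" for J
    proof
      fix x assume x: "x \<in> I"
      have "T \<subseteq> (\<otimes>) r ` (J \<inter> I)" using T'(1,3) J(2) by blast
      then have "(\<otimes>) r ` I \<subseteq> (\<otimes>) r ` (J \<inter> I)"
        by (rule T(3)[OF ideal_translate[OF ideal_inter[OF J(1) I] r]])
      then obtain y where y: "y \<in> J" "y \<in> I" "r \<otimes> x = r \<otimes> y" using x by blast
      have "r \<otimes> (x \<ominus> y) = \<zero>" using y x c r by (simp add: r_minus r_distr a_minus_def r_neg)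
      moreover have "x \<ominus> y \<in> I" using ideal_add[OF I x ideal_neg[OF I y(2)]] by (simp add: a_minus_def)
      ultimately have "x \<ominus> y \<in> J" using U(3)[OF J(1)] J(2) by blast
      from ideal_add[OF J(1) this y(1)] show "x \<in> J" using x y c by simp
    qed
    then have "fg_ideal R I" unfolding fg_ideal_def using U(1,2) T'(1,2)
      by (intro exI[of _ "U \<union> T'"]) blast
    then show False using nI by blast
  qed
  obtain x where x: "x \<in> I" "x \<noteq> \<zero>"
  proof (rule ccontr)
    assume "\<not> thesis"
    then have "I \<subseteq> {\<zero>}" using that by blast
    then have "fg_ideal R I" unfolding fg_ideal_def using ideal_zero by (intro exI[of _ "{}"]) blast
    then show False using nI by blast
  qed
  have zi: "ideal {\<zero>} R" by (rule zeroideal)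
  obtain V where V: "ideal V R" "x \<notin> V" "\<And>W. ideal W R \<Longrightarrow> V \<subseteq> W \<Longrightarrow> x \<notin> W \<Longrightarrow> W = V"
    using ideal_avoiding[OF zi, of x] x(2) by blast
  note cV = subsetD[OF ideal_subset[OF V(1)]]
  \<comment> \<open>The descending chain condition replaces the passage to the residue field: a
    minimal principal ideal among those of elements acting onto I will provide inverses.\<close>
  define \<A> where "\<A> = {(\<otimes>) a ` carrier R |a. a \<in> carrier R \<and> (\<otimes>) a ` I = I}"
  have "(\<otimes>) \<one> ` I = (\<lambda>x. x) ` I" by (rule image_cong) (use c in simp_all)
  then have "(\<otimes>) \<one> ` I = I" by simp
  then have oneA: "(\<otimes>) \<one> ` carrier R \<in> \<A>" unfolding \<A>_def by blast
  have "\<exists>A\<in>\<A>. \<forall>J\<in>\<A>. J \<subseteq> A \<longrightarrow> J = A"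
    by (rule artinian_minimal[OF art oneA]) (auto simp: \<A>_def intro: ideal_translate[OF oneideal])
  then obtain A where A: "A \<in> \<A>" and Amin: "\<And>J. J \<in> \<A> \<Longrightarrow> J \<subseteq> A \<Longrightarrow> J = A" by blast
  obtain a where a: "a \<in> carrier R" "(\<otimes>) a ` I = I" "A = (\<otimes>) a ` carrier R" using A unfolding \<A>_def by blast
  \<comment> \<open>By minimality a and a r generate the same ideal, so a = a r s. Every y in I has
    the form a z, and therefore s r y = y.\<close>
  have inv: "\<exists>s\<in>carrier R. \<forall>y\<in>I. s \<otimes> (r \<otimes> y) = y" if r: "r \<in> carrier R" "(\<otimes>) r ` I = I" for r
  proof -
    have "(\<otimes>) (a \<otimes> r) ` I = (\<otimes>) a ` ((\<otimes>) r ` I)"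
      unfolding image_image by (rule image_cong) (use a(1) r(1) c in \<open>simp_all add: m_assoc\<close>)
    then have "(\<otimes>) (a \<otimes> r) ` I = I" unfolding r(2) a(2) .
    then have "(\<otimes>) (a \<otimes> r) ` carrier R \<in> \<A>" unfolding \<A>_def using m_closed[OF a(1) r(1)] by blast
    moreover have "(\<otimes>) (a \<otimes> r) ` carrier R \<subseteq> A" unfolding a(3) using a(1) r(1) by (auto simp: m_assoc)
    ultimately have "(\<otimes>) (a \<otimes> r) ` carrier R = A" by (rule Amin)
    moreover have "a \<in> A" unfolding a(3) using a(1) by (intro image_eqI[of _ _ "\<one>"]) simp_all
    ultimately obtain s where s: "s \<in> carrier R" "a = a \<otimes> r \<otimes> s" by blast
    have "s \<otimes> (r \<otimes> y) = y" if y: "y \<in> I" for y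
    proof -
      obtain z where z: "z \<in> I" "y = a \<otimes> z" using y a(2) by blast
      have "s \<otimes> (r \<otimes> y) = (a \<otimes> r \<otimes> s) \<otimes> z" using z c s(1) r(1) a(1) by (simp add: m_ac)
      then show ?thesis using s(2) z(2) by simp
    qed
    with s(1) show ?thesis by blast
  qed
  have "V \<inter> I \<noteq> I" using x V(2) by blast
  then obtain U where U: "finite U" "U \<subseteq> V \<inter> I" "\<And>J. ideal J R \<Longrightarrow> U \<subseteq> J \<Longrightarrow> V \<inter> I \<subseteq> J"
    using proper[OF ideal_inter[OF V(1) I]] unfolding fg_ideal_def by blast
  \<comment> \<open>Generators of the hyperplane V \<inter> I together with x generate I: for y
    outside V, maximality gives x = v + r y with v in V \<inter> I, and r is invertible on
    I.\<close>
  have "I \<subseteq> J" if J: "ideal J R" "insert x U \<subseteq> J" for J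
  proof
    fix y assume y: "y \<in> I"
    show "y \<in> J"
    proof (cases "y \<in> V")
      case True
      then show ?thesis using U(3)[OF J(1)] J(2) y by blast
    next
      case False
      let ?W = "{v \<oplus> r \<otimes> y |v r. v \<in> V \<and> r \<in> carrier R}"
      have "V \<subseteq> ?W"
      proof
        fix v assume "v \<in> V"
        then show "v \<in> ?W" using cV c[OF y] by (intro CollectI exI[of _ v] exI[of _ "\<zero>"]) simp
      qed
      moreover have "y \<in> ?W"
        using ideal_zero[OF V(1)] c[OF y] by (intro CollectI exI[of _ "\<zero>"] exI[of _ "\<one>"]) simp
      ultimately have "x \<in> ?W" using V(3)[OF ideal_sum_principal[OF V(1) c[OF y]]] False by blast
      then obtain v r where v: "v \<in> V" and r: "r \<in> carrier R" and xe: "x = v \<oplus> r \<otimes> y" by blast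
      have "r \<otimes> y \<noteq> \<zero>" using xe V(2) v cV by auto
      then have "(\<otimes>) r ` I = I" using dich[OF r] y by blast
      then obtain s where s: "s \<in> carrier R" "s \<otimes> (r \<otimes> y) = y" using inv[OF r] y by blast
      have ry: "r \<otimes> y \<in> I" by (rule ideal_mult[OF I r y])
      have ve: "v = x \<ominus> r \<otimes> y" using xe cV[OF v] c[OF ry] by (simp add: a_minus_def a_assoc r_neg)
      have "v \<in> I" unfolding ve a_minus_def by (rule ideal_add[OF I x(1) ideal_neg[OF I ry]])
      then have vJ: "v \<in> J" using U(3)[OF J(1)] J(2) v by blast
      have xJ: "x \<in> J" using J(2) by blast
      have "r \<otimes> y = x \<ominus> v" using xe cV[OF v] c[OF ry] by (simp add: a_minus_def a_ac r_neg1 r_neg2)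
      then have "r \<otimes> y \<in> J" using ideal_add[OF J(1) xJ ideal_neg[OF J(1) vJ]] by (simp add: a_minus_def)
      then show ?thesis using ideal_mult[OF J(1) s(1)] s(2) by metis
    qed
  qed
  then have "fg_ideal R I" unfolding fg_ideal_def using U(1,2) x(1)
    by (intro exI[of _ "insert x U"]) blast
  then show False using nI by blast
qed

section \<open>Artin algebras are noetherian\<close>

text \<open>Generators are tested against submodules of the ambient M, so that N can vary in an
  induction without changing the module.\<close>

definition submodule_fg :: "('r, 'x) ring_scheme \<Rightarrow> ('r, 'm) module \<Rightarrow> 'm set \<Rightarrow> bool" where
  "submodule_fg R M N \<longleftrightarrow> (\<exists>T. finite T \<and> T \<subseteq> N \<and> (\<forall>U. submodule U R M \<longrightarrow> T \<subseteq> U \<longrightarrow> N \<subseteq> U))"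

text \<open>The intersection with \<open>carrier M\<close> keeps the span inside the module also
  when no submodule contains S.\<close>

definition module_span :: "('r, 'x) ring_scheme \<Rightarrow> ('r, 'm) module \<Rightarrow> 'm set \<Rightarrow> 'm set" where
  "module_span R M S = carrier M \<inter> \<Inter>{U. submodule U R M \<and> S \<subseteq> U}"

lemma submodule_inter:
  assumes "left_module A M" "submodule U A M" "submodule V A M"
  shows "submodule (U \<inter> V) A M"
  by (rule left_module.submodule_criterion[OF assms(1)])
    (simp_all add: submodule_zero[OF assms(2)] submodule_zero[OF assms(3)] submodule_add[OF assms(2)]
      submodule_add[OF assms(3)] submodule_smult[OF assms(2)] submodule_smult[OF assms(3)]
      le_infI1 submodule_subset[OF assms(2)])

lemma in_module_span_iff:
  "x \<in> module_span R M S \<longleftrightarrow> x \<in> carrier M \<and> (\<forall>U. submodule U R M \<longrightarrow> S \<subseteq> U \<longrightarrow> x \<in> U)"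
  by (auto simp: module_span_def)

lemma submodule_span:
  assumes M: "left_module R M"
  shows "submodule (module_span R M S) R M"
  by (rule left_module.submodule_criterion[OF M])
    (simp_all add: in_module_span_iff subset_iff left_module_zero_closed[OF M] submodule_zero
      left_module_add_closed[OF M] submodule_add left_module.smult_closed[OF M] submodule_smult)

lemma span_least: "submodule U R M \<Longrightarrow> S \<subseteq> U \<Longrightarrow> module_span R M S \<subseteq> U"
  by (auto simp: module_span_def)

lemma span_superset: "S \<subseteq> carrier M \<Longrightarrow> S \<subseteq> module_span R M S"
  by (auto simp: module_span_def)

lemma submodule_adjoin:
  assumes M: "left_module R M" and W: "submodule W R M" and x: "x \<in> carrier M"
  shows "submodule {y \<oplus>\<^bsub>M\<^esub> r \<odot>\<^bsub>M\<^esub> x |y r. y \<in> W \<and> r \<in> carrier R} R M" (is "submodule ?E R M")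
proof -
  interpret R: ring R by (rule left_module_ring[OF M])
  interpret MG: abelian_group M by (rule left_module_abelian_group[OF M])
  interpret M: left_module R M by fact
  note c = subsetD[OF submodule_subset[OF W]]
  show ?thesis
  proof (rule M.submodule_criterion)
    show "?E \<subseteq> carrier M" using c x by auto
    show "\<zero>\<^bsub>M\<^esub> \<in> ?E"
      using submodule_zero[OF W] x by (intro CollectI exI[of _ "\<zero>\<^bsub>M\<^esub>"] exI[of _ "\<zero>\<^bsub>R\<^esub>"]) (simp add: M.smult_l_null)
  next
    fix a b assume "a \<in> ?E" "b \<in> ?E"
    then obtain y r y' r' where e: "y \<in> W" "r \<in> carrier R" "y' \<in> W" "r' \<in> carrier R"
      "a = y \<oplus>\<^bsub>M\<^esub> r \<odot>\<^bsub>M\<^esub> x" "b = y' \<oplus>\<^bsub>M\<^esub> r' \<odot>\<^bsub>M\<^esub> x" by blast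
    have "a \<oplus>\<^bsub>M\<^esub> b = (y \<oplus>\<^bsub>M\<^esub> y') \<oplus>\<^bsub>M\<^esub> (r \<oplus>\<^bsub>R\<^esub> r') \<odot>\<^bsub>M\<^esub> x"
      using e c x by (simp add: M.smult_l_distr MG.a_ac)
    then show "a \<oplus>\<^bsub>M\<^esub> b \<in> ?E" using submodule_add[OF W e(1,3)] R.a_closed[OF e(2,4)] by blast
  next
    fix s a assume s: "s \<in> carrier R" and "a \<in> ?E"
    then obtain y r where e: "y \<in> W" "r \<in> carrier R" "a = y \<oplus>\<^bsub>M\<^esub> r \<odot>\<^bsub>M\<^esub> x" by blast
    have "s \<odot>\<^bsub>M\<^esub> a = s \<odot>\<^bsub>M\<^esub> y \<oplus>\<^bsub>M\<^esub> (s \<otimes>\<^bsub>R\<^esub> r) \<odot>\<^bsub>M\<^esub> x"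
      using e c x s by (simp add: M.smult_r_distr M.smult_assoc)
    then show "s \<odot>\<^bsub>M\<^esub> a \<in> ?E" using submodule_smult[OF W s e(1)] R.m_closed[OF s e(2)] by blast
  qed
qed

text \<open>Induction on the generators: N is controlled by its intersection with the span of the
  earlier generators and by the ideal of coefficients at the new generator x.\<close>

lemma noetherian_span:
  assumes R: "cring R" and fgR: "\<And>I. ideal I R \<Longrightarrow> fg_ideal R I" and M: "left_module R M"
    and S: "finite S" "S \<subseteq> carrier M" and N: "submodule N R M" "N \<subseteq> module_span R M S"
  shows "submodule_fg R M N"
  using S N
proof (induction S arbitrary: N rule: finite_induct)
  case empty
  have "N \<subseteq> U" if "submodule U R M" for U using span_least[OF that, of "{}"] empty.prems(3) by simp
  then show ?case unfolding submodule_fg_def by (intro exI[of _ "{}"]) simp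
next
  case (insert x S)
  interpret R: cring R by fact
  interpret MG: abelian_group M by (rule left_module_abelian_group[OF M])
  interpret M: left_module R M by fact
  let ?W = "module_span R M S"
  have x: "x \<in> carrier M" and Sc: "S \<subseteq> carrier M" using insert.prems(1) by auto
  have W: "submodule ?W R M" by (rule submodule_span[OF M])
  note cW = subsetD[OF submodule_subset[OF W]]
  \<comment> \<open>The coefficients that x can have in elements of V, modulo the span of the
    earlier generators.\<close>
  define coef where "coef V = {r \<in> carrier R. \<exists>y\<in>?W. y \<oplus>\<^bsub>M\<^esub> r \<odot>\<^bsub>M\<^esub> x \<in> V}" for V
  have coef: "ideal (coef V) R" if V: "submodule V R M" for V
  proof (rule R.ideal_criterion)
    show "coef V \<subseteq> carrier R" by (auto simp: coef_def)
    show "\<zero>\<^bsub>R\<^esub> \<in> coef V" unfolding coef_def using submodule_zero[OF V] submodule_zero[OF W] x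
      by (intro CollectI conjI bexI[of _ "\<zero>\<^bsub>M\<^esub>"]) (simp_all add: M.smult_l_null)
  next
    fix r s assume "r \<in> coef V" "s \<in> coef V"
    then obtain y z where e: "r \<in> carrier R" "y \<in> ?W" "y \<oplus>\<^bsub>M\<^esub> r \<odot>\<^bsub>M\<^esub> x \<in> V"
      "s \<in> carrier R" "z \<in> ?W" "z \<oplus>\<^bsub>M\<^esub> s \<odot>\<^bsub>M\<^esub> x \<in> V" unfolding coef_def by blast
    have "(y \<oplus>\<^bsub>M\<^esub> z) \<oplus>\<^bsub>M\<^esub> (r \<oplus>\<^bsub>R\<^esub> s) \<odot>\<^bsub>M\<^esub> x = (y \<oplus>\<^bsub>M\<^esub> r \<odot>\<^bsub>M\<^esub> x) \<oplus>\<^bsub>M\<^esub> (z \<oplus>\<^bsub>M\<^esub> s \<odot>\<^bsub>M\<^esub> x)"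
      using e cW x by (simp add: M.smult_l_distr MG.a_ac)
    also have "\<dots> \<in> V" by (rule submodule_add[OF V e(3,6)])
    finally show "r \<oplus>\<^bsub>R\<^esub> s \<in> coef V"
      unfolding coef_def using submodule_add[OF W e(2,5)] R.a_closed[OF e(1,4)] by blast
  next
    fix t r assume t: "t \<in> carrier R" and "r \<in> coef V"
    then obtain y where e: "r \<in> carrier R" "y \<in> ?W" "y \<oplus>\<^bsub>M\<^esub> r \<odot>\<^bsub>M\<^esub> x \<in> V" unfolding coef_def by blast
    have "t \<odot>\<^bsub>M\<^esub> y \<oplus>\<^bsub>M\<^esub> (t \<otimes>\<^bsub>R\<^esub> r) \<odot>\<^bsub>M\<^esub> x = t \<odot>\<^bsub>M\<^esub> (y \<oplus>\<^bsub>M\<^esub> r \<odot>\<^bsub>M\<^esub> x)"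
      using e cW x t by (simp add: M.smult_r_distr M.smult_assoc)
    also have "\<dots> \<in> V" by (rule submodule_smult[OF V t e(3)])
    finally show "t \<otimes>\<^bsub>R\<^esub> r \<in> coef V"
      unfolding coef_def using submodule_smult[OF W t e(2)] R.m_closed[OF t e(1)] by blast
  qed
  let ?E = "{y \<oplus>\<^bsub>M\<^esub> r \<odot>\<^bsub>M\<^esub> x |y r. y \<in> ?W \<and> r \<in> carrier R}"
  have "insert x S \<subseteq> ?E"
  proof
    fix s assume "s \<in> insert x S"
    then consider "s = x" | "s \<in> S" by blast
    then show "s \<in> ?E"
    proof cases
      case 1
      then show ?thesis using x submodule_zero[OF W]
        by (intro CollectI exI[of _ "\<zero>\<^bsub>M\<^esub>"] exI[of _ "\<one>\<^bsub>R\<^esub>"]) simp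
    next
      case 2
      then have "s \<in> ?W" using span_superset[OF Sc] by blast
      then show ?thesis using x cW
        by (intro CollectI exI[of _ s] exI[of _ "\<zero>\<^bsub>R\<^esub>"]) (simp add: M.smult_l_null)
    qed
  qed
  then have NE: "N \<subseteq> ?E"
    using insert.prems(3) span_least[OF submodule_adjoin[OF M W x]] by (meson order_trans)
  obtain C where C: "finite C" "C \<subseteq> coef N" "\<And>I. ideal I R \<Longrightarrow> C \<subseteq> I \<Longrightarrow> coef N \<subseteq> I"
    using fgR[OF coef[OF insert.prems(2)]] unfolding fg_ideal_def by blast
  have "\<forall>r\<in>C. \<exists>n. n \<in> N \<and> (\<exists>y\<in>?W. n = y \<oplus>\<^bsub>M\<^esub> r \<odot>\<^bsub>M\<^esub> x)" using C(2) unfolding coef_def by blast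
  from bchoice[OF this] obtain n where n: "\<forall>r\<in>C. n r \<in> N \<and> (\<exists>y\<in>?W. n r = y \<oplus>\<^bsub>M\<^esub> r \<odot>\<^bsub>M\<^esub> x)" ..
  obtain T where T: "finite T" "T \<subseteq> N \<inter> ?W"
    "\<forall>U. submodule U R M \<longrightarrow> T \<subseteq> U \<longrightarrow> N \<inter> ?W \<subseteq> U"
    using insert.IH[OF Sc submodule_inter[OF M insert.prems(2) W]] unfolding submodule_fg_def by blast
  have "N \<subseteq> U" if U: "submodule U R M" "n ` C \<union> T \<subseteq> U" for U
  proof
    fix m assume m: "m \<in> N"
    \<comment> \<open>m is corrected by an element of N \<inter> U with the same coefficient r; the
      difference lies in the intersection of N with the span of S, which U contains.\<close>
    have NU: "submodule (N \<inter> U) R M" by (rule submodule_inter[OF M insert.prems(2) U(1)])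
    obtain y r where y: "y \<in> ?W" "r \<in> carrier R" "m = y \<oplus>\<^bsub>M\<^esub> r \<odot>\<^bsub>M\<^esub> x" using NE m by blast
    have "C \<subseteq> coef (N \<inter> U)"
    proof
      fix r assume r: "r \<in> C"
      then obtain y where "y \<in> ?W" "n r = y \<oplus>\<^bsub>M\<^esub> r \<odot>\<^bsub>M\<^esub> x" using n by blast
      moreover have "n r \<in> N \<inter> U" using n r U(2) by blast
      moreover have "r \<in> carrier R" using r C(2) by (auto simp: coef_def)
      ultimately show "r \<in> coef (N \<inter> U)" unfolding coef_def by auto
    qed
    then have "coef N \<subseteq> coef (N \<inter> U)" by (rule C(3)[OF coef[OF NU]])
    moreover have "r \<in> coef N" unfolding coef_def using y m by blast
    ultimately obtain z where z: "z \<in> ?W" "z \<oplus>\<^bsub>M\<^esub> r \<odot>\<^bsub>M\<^esub> x \<in> N" "z \<oplus>\<^bsub>M\<^esub> r \<odot>\<^bsub>M\<^esub> x \<in> U"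
      unfolding coef_def by blast
    have eq: "m = (y \<ominus>\<^bsub>M\<^esub> z) \<oplus>\<^bsub>M\<^esub> (z \<oplus>\<^bsub>M\<^esub> r \<odot>\<^bsub>M\<^esub> x)"
      using y z cW x by (simp add: a_minus_def MG.a_assoc MG.r_neg1)
    have yz: "y \<ominus>\<^bsub>M\<^esub> z = m \<oplus>\<^bsub>M\<^esub> \<ominus>\<^bsub>M\<^esub> (z \<oplus>\<^bsub>M\<^esub> r \<odot>\<^bsub>M\<^esub> x)"
      using y z(1) cW[OF y(1)] cW[OF z(1)] x by (simp add: a_minus_def MG.minus_add MG.a_ac MG.r_neg1 MG.r_neg2 MG.r_neg)
    have "y \<ominus>\<^bsub>M\<^esub> z \<in> N"
      unfolding yz by (rule submodule_add[OF insert.prems(2) m submodule_neg[OF insert.prems(2) z(2)]])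
    moreover have "y \<ominus>\<^bsub>M\<^esub> z \<in> ?W"
      unfolding a_minus_def by (rule submodule_add[OF W y(1) submodule_neg[OF W z(1)]])
    moreover have "N \<inter> ?W \<subseteq> U" using T(3) U by blast
    ultimately have "y \<ominus>\<^bsub>M\<^esub> z \<in> U" by blast
    then show "m \<in> U" by (subst eq) (rule submodule_add[OF U(1) _ z(3)])
  qed
  moreover have "finite (n ` C \<union> T)" "n ` C \<union> T \<subseteq> N" using C(1) T(1,2) n by auto
  ultimately show ?case unfolding submodule_fg_def by (intro exI[of _ "n ` C \<union> T"]) simp
qed

section \<open>Artin algebras over their base ring\<close>

lemma artin_algebraD:
  assumes "artin_algebra R A"
  shows "cring R" "artinian R" "ring A" "left_module R A" "finitely_generated R A"
    "\<And>r x y. r \<in> carrier R \<Longrightarrow> x \<in> carrier A \<Longrightarrow> y \<in> carrier A \<Longrightarrow>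
      (r \<odot>\<^bsub>A\<^esub> x) \<otimes>\<^bsub>A\<^esub> y = r \<odot>\<^bsub>A\<^esub> (x \<otimes>\<^bsub>A\<^esub> y)"
    "\<And>r x y. r \<in> carrier R \<Longrightarrow> x \<in> carrier A \<Longrightarrow> y \<in> carrier A \<Longrightarrow>
      x \<otimes>\<^bsub>A\<^esub> (r \<odot>\<^bsub>A\<^esub> y) = r \<odot>\<^bsub>A\<^esub> (x \<otimes>\<^bsub>A\<^esub> y)"
proof -
  show R: "cring R" and "artinian R" "ring A" "finitely_generated R A"
    and "\<And>r x y. r \<in> carrier R \<Longrightarrow> x \<in> carrier A \<Longrightarrow> y \<in> carrier A \<Longrightarrow>
      (r \<odot>\<^bsub>A\<^esub> x) \<otimes>\<^bsub>A\<^esub> y = r \<odot>\<^bsub>A\<^esub> (x \<otimes>\<^bsub>A\<^esub> y)"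
    and "\<And>r x y. r \<in> carrier R \<Longrightarrow> x \<in> carrier A \<Longrightarrow> y \<in> carrier A \<Longrightarrow>
      x \<otimes>\<^bsub>A\<^esub> (r \<odot>\<^bsub>A\<^esub> y) = r \<odot>\<^bsub>A\<^esub> (x \<otimes>\<^bsub>A\<^esub> y)"
    using assms by (simp_all add: artin_algebra_def)
  interpret module R A using assms by (simp add: artin_algebra_def)
  show "left_module R A"
    by (rule left_module.intro[OF cring.axioms(1)[OF R] abelian_group_axioms], rule left_module_axioms.intro)
      (simp_all add: smult_l_distr smult_r_distr smult_assoc1)
qed

text \<open>The transpose is a module over the opposite algebra, so resolutions are needed on that
  side as well.\<close>

lemma artin_algebra_opp:
  fixes A :: "('r, 'a) module"
  assumes "artin_algebra R A"
  shows "artin_algebra R (opp A)"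
proof -
  note D = artin_algebraD[OF assms]
  interpret R: cring R by (rule D(1))
  have op: "carrier (opp A) = carrier A" "smult (opp A) = smult A" by (simp_all add: opp_def)
  interpret module R A using assms by (simp add: artin_algebra_def)
  have m: "module R (opp A)"
    by (rule moduleI[OF D(1) abelian_group.intro])
      (use ring_opp[OF D(3)] in \<open>simp_all add: op smult_l_distr smult_r_distr smult_assoc1 ring_def abelian_group_def\<close>)
  have "submodule N R (opp A) \<longleftrightarrow> submodule N R A" for N
    by (simp add: submodule_def submodule_axioms_def opp_def)
  then have "finitely_generated R (opp A)" using D(5) by (simp add: finitely_generated_def op)
  then show ?thesis unfolding artin_algebra_def using D(1,2) ring_opp[OF D(3)] m D(6,7) by (simp add: op)
qed

definition restrict_scalars :: "('r, 'a) module \<Rightarrow> ('a, 'm) module \<Rightarrow> ('r, 'm) module" where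
  "restrict_scalars A M = \<lparr>carrier = carrier M, mult = undefined, one = undefined,
     zero = \<zero>\<^bsub>M\<^esub>, add = (\<oplus>\<^bsub>M\<^esub>), smult = (\<lambda>r x. (r \<odot>\<^bsub>A\<^esub> \<one>\<^bsub>A\<^esub>) \<odot>\<^bsub>M\<^esub> x)\<rparr>"

lemma restrict_scalars_simps [simp]:
  "carrier (restrict_scalars A M) = carrier M" "\<zero>\<^bsub>restrict_scalars A M\<^esub> = \<zero>\<^bsub>M\<^esub>"
  "x \<oplus>\<^bsub>restrict_scalars A M\<^esub> y = x \<oplus>\<^bsub>M\<^esub> y"
  "r \<odot>\<^bsub>restrict_scalars A M\<^esub> x = (r \<odot>\<^bsub>A\<^esub> \<one>\<^bsub>A\<^esub>) \<odot>\<^bsub>M\<^esub> x"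
  by (simp_all add: restrict_scalars_def)

lemma restrict_scalars_facts:
  assumes art: "artin_algebra R A" and M: "left_module A M"
  shows left_module_restrict_scalars: "left_module R (restrict_scalars A M)"
    and submodule_restrict_scalars: "submodule N A M \<Longrightarrow> submodule N R (restrict_scalars A M)"
    and finitely_generated_restrict_scalars:
      "finitely_generated A M \<Longrightarrow> finitely_generated R (restrict_scalars A M)"
proof -
  note D = artin_algebraD[OF art]
  interpret R: cring R by (rule D(1))
  interpret A: ring A by (rule D(3))
  interpret RA: left_module R A by (rule D(4))
  interpret MG: abelian_group M by (rule left_module_abelian_group[OF M])
  interpret M: left_module A M by fact
  let ?N = "restrict_scalars A M"
  have rc: "r \<odot>\<^bsub>A\<^esub> \<one>\<^bsub>A\<^esub> \<in> carrier A" if "r \<in> carrier R" for r by (rule RA.smult_closed[OF that A.one_closed])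
  have rmul: "(r \<odot>\<^bsub>A\<^esub> \<one>\<^bsub>A\<^esub>) \<otimes>\<^bsub>A\<^esub> a = r \<odot>\<^bsub>A\<^esub> a" if "r \<in> carrier R" "a \<in> carrier A" for r a
    using D(6)[OF that(1) A.one_closed that(2)] that by simp
  have ab: "abelian_group ?N"
  proof (rule abelian_groupI)
    fix x assume "x \<in> carrier ?N"
    then show "\<exists>y\<in>carrier ?N. y \<oplus>\<^bsub>?N\<^esub> x = \<zero>\<^bsub>?N\<^esub>"
      by (intro bexI[of _ "\<ominus>\<^bsub>M\<^esub> x"]) (simp_all add: MG.l_neg)
  qed (simp_all add: MG.a_ac)
  show L: "left_module R ?N"
  proof (rule left_module.intro[OF R.ring_axioms ab], rule left_module_axioms.intro)
    fix r s x assume rs: "r \<in> carrier R" "s \<in> carrier R" and x: "x \<in> carrier ?N"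
    show "(r \<oplus>\<^bsub>R\<^esub> s) \<odot>\<^bsub>?N\<^esub> x = r \<odot>\<^bsub>?N\<^esub> x \<oplus>\<^bsub>?N\<^esub> s \<odot>\<^bsub>?N\<^esub> x"
      using rs x rc by (simp add: RA.smult_l_distr M.smult_l_distr)
    have "(r \<otimes>\<^bsub>R\<^esub> s) \<odot>\<^bsub>A\<^esub> \<one>\<^bsub>A\<^esub> = (r \<odot>\<^bsub>A\<^esub> \<one>\<^bsub>A\<^esub>) \<otimes>\<^bsub>A\<^esub> (s \<odot>\<^bsub>A\<^esub> \<one>\<^bsub>A\<^esub>)"
      using rs rc by (simp add: RA.smult_assoc rmul)
    then show "(r \<otimes>\<^bsub>R\<^esub> s) \<odot>\<^bsub>?N\<^esub> x = r \<odot>\<^bsub>?N\<^esub> (s \<odot>\<^bsub>?N\<^esub> x)"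
      using rs x rc by (simp add: M.smult_assoc)
  qed (use rc in \<open>simp_all add: M.smult_r_distr\<close>)
  show sub: "submodule N R ?N" if N: "submodule N A M" for N
    by (rule left_module.submodule_criterion[OF L])
      (use submodule_subset[OF N] submodule_zero[OF N] submodule_add[OF N] submodule_smult[OF N] rc in auto)
  show "finitely_generated R ?N" if fg: "finitely_generated A M"
  proof -
    obtain S where S: "finite S" "S \<subseteq> carrier M"
      and gen: "\<And>T. submodule T A M \<Longrightarrow> S \<subseteq> T \<Longrightarrow> T = carrier M"
      using fg unfolding finitely_generated_def by (elim exE conjE) simp
    obtain B where B: "finite B" "B \<subseteq> carrier A"
      and genB: "\<And>T. submodule T R A \<Longrightarrow> B \<subseteq> T \<Longrightarrow> T = carrier A"
      using D(5) unfolding finitely_generated_def by (elim exE conjE) simp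
    \<comment> \<open>Products of generators of A over R with generators of M over A.\<close>
    let ?G = "(\<lambda>(b, s). b \<odot>\<^bsub>M\<^esub> s) ` (B \<times> S)"
    have "U = carrier ?N" if U: "submodule U R ?N" "?G \<subseteq> U" for U
    proof -
      have 1: "a \<odot>\<^bsub>M\<^esub> s \<in> U" if s: "s \<in> S" and a: "a \<in> carrier A" for a s
      proof -
        have sc: "s \<in> carrier M" using s S(2) by blast
        have "submodule {a \<in> carrier A. a \<odot>\<^bsub>M\<^esub> s \<in> U} R A"
        proof (rule RA.submodule_criterion)
          show "\<zero>\<^bsub>A\<^esub> \<in> {a \<in> carrier A. a \<odot>\<^bsub>M\<^esub> s \<in> U}"
            using submodule_zero[OF U(1)] sc by (simp add: M.smult_l_null)
        next
          fix a b assume "a \<in> {a \<in> carrier A. a \<odot>\<^bsub>M\<^esub> s \<in> U}" "b \<in> {a \<in> carrier A. a \<odot>\<^bsub>M\<^esub> s \<in> U}"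
          then show "a \<oplus>\<^bsub>A\<^esub> b \<in> {a \<in> carrier A. a \<odot>\<^bsub>M\<^esub> s \<in> U}"
            using submodule_add[OF U(1), of "a \<odot>\<^bsub>M\<^esub> s" "b \<odot>\<^bsub>M\<^esub> s"] sc by (simp add: M.smult_l_distr)
        next
          fix r a assume r: "r \<in> carrier R" and a: "a \<in> {a \<in> carrier A. a \<odot>\<^bsub>M\<^esub> s \<in> U}"
          then have "(r \<odot>\<^bsub>A\<^esub> a) \<odot>\<^bsub>M\<^esub> s = (r \<odot>\<^bsub>A\<^esub> \<one>\<^bsub>A\<^esub>) \<odot>\<^bsub>M\<^esub> (a \<odot>\<^bsub>M\<^esub> s)"
            using sc rc[OF r] by (simp add: M.smult_assoc[symmetric] rmul)
          then show "r \<odot>\<^bsub>A\<^esub> a \<in> {a \<in> carrier A. a \<odot>\<^bsub>M\<^esub> s \<in> U}"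
            using submodule_smult[OF U(1) r, of "a \<odot>\<^bsub>M\<^esub> s"] a RA.smult_closed[OF r, of a] by simp
        qed auto
        moreover have "B \<subseteq> {a \<in> carrier A. a \<odot>\<^bsub>M\<^esub> s \<in> U}" using B(2) U(2) s by auto
        ultimately show ?thesis using genB a by blast
      qed
      have Uc: "U \<subseteq> carrier M" using submodule_subset[OF U(1)] by simp
      \<comment> \<open>U is only an R-submodule. The elements all of whose multiples lie in U form
        an A-submodule, and by the first step it contains S.\<close>
      have "submodule {x \<in> carrier M. \<forall>a\<in>carrier A. a \<odot>\<^bsub>M\<^esub> x \<in> U} A M"
      proof (rule M.submodule_criterion)
        show "\<zero>\<^bsub>M\<^esub> \<in> {x \<in> carrier M. \<forall>a\<in>carrier A. a \<odot>\<^bsub>M\<^esub> x \<in> U}"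
          using submodule_zero[OF U(1)] by (simp add: M.smult_r_null)
      next
        fix x y assume "x \<in> {x \<in> carrier M. \<forall>a\<in>carrier A. a \<odot>\<^bsub>M\<^esub> x \<in> U}" "y \<in> {x \<in> carrier M. \<forall>a\<in>carrier A. a \<odot>\<^bsub>M\<^esub> x \<in> U}"
        then show "x \<oplus>\<^bsub>M\<^esub> y \<in> {x \<in> carrier M. \<forall>a\<in>carrier A. a \<odot>\<^bsub>M\<^esub> x \<in> U}"
          using submodule_add[OF U(1)] by (simp add: M.smult_r_distr)
      next
        fix b x assume "b \<in> carrier A" "x \<in> {x \<in> carrier M. \<forall>a\<in>carrier A. a \<odot>\<^bsub>M\<^esub> x \<in> U}"
        then show "b \<odot>\<^bsub>M\<^esub> x \<in> {x \<in> carrier M. \<forall>a\<in>carrier A. a \<odot>\<^bsub>M\<^esub> x \<in> U}"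
          by (simp add: M.smult_assoc[symmetric])
      qed auto
      moreover have "S \<subseteq> {x \<in> carrier M. \<forall>a\<in>carrier A. a \<odot>\<^bsub>M\<^esub> x \<in> U}" using 1 S(2) by auto
      ultimately have "{x \<in> carrier M. \<forall>a\<in>carrier A. a \<odot>\<^bsub>M\<^esub> x \<in> U} = carrier M" by (rule gen)
      then have "\<one>\<^bsub>A\<^esub> \<odot>\<^bsub>M\<^esub> x \<in> U" if "x \<in> carrier M" for x using that A.one_closed by blast
      then have "carrier M \<subseteq> U" by (simp add: subset_iff)
      then show ?thesis using Uc by simp
    qed
    moreover have "finite ?G" "?G \<subseteq> carrier ?N" using B S by auto
    ultimately show ?thesis unfolding finitely_generated_def by (intro exI[of _ ?G]) blast
  qed
qed

text \<open>Over R, the module M is finitely generated and ideals are finitely generated, so N has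
  finitely many generators over R. They generate N over A too, since A-submodules are
  R-submodules.\<close>

lemma artin_algebra_left_noetherian:
  assumes art: "artin_algebra R A"
  shows "left_noetherian A"
  unfolding left_noetherian_def
proof (intro allI impI)
  fix M :: "'b umod" and N assume M: "M \<in> fg_modules A" and N: "submodule N A M"
  note D = artin_algebraD[OF art]
  note MM = fg_modulesD(1)[OF M]
  let ?M = "restrict_scalars A M"
  note RM = left_module_restrict_scalars[OF art MM]
  obtain S where S: "finite S" "S \<subseteq> carrier ?M"
    and gen: "\<And>T. submodule T R ?M \<Longrightarrow> S \<subseteq> T \<Longrightarrow> T = carrier ?M"
    using finitely_generated_restrict_scalars[OF art MM fg_modulesD(2)[OF M]]
    unfolding finitely_generated_def by (elim exE conjE) simp
  have "module_span R ?M S = carrier ?M"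
    by (rule gen[OF submodule_span[OF RM] span_superset[OF S(2)]])
  then have sp: "N \<subseteq> module_span R ?M S" using submodule_subset[OF N] by simp
  have "submodule_fg R ?M N"
    by (rule noetherian_span[OF D(1) _ RM S submodule_restrict_scalars[OF art MM N] sp])
      (rule cring.artinian_fg_ideal[OF D(1,2)])
  then obtain T where T: "finite T" "T \<subseteq> N" "\<forall>U. submodule U R ?M \<longrightarrow> T \<subseteq> U \<longrightarrow> N \<subseteq> U"
    unfolding submodule_fg_def by blast
  note NM = left_module_submod[OF MM N]
  have "U = carrier (submod M N)" if U: "submodule U A (submod M N)" "T \<subseteq> U" for U
  proof -
    have sU: "U \<subseteq> N" using submodule_subset[OF U(1)] by simp
    have "submodule U A M"
      by (rule left_module.submodule_criterion[OF MM])
        (use sU submodule_subset[OF N] submodule_zero[OF U(1)] submodule_add[OF U(1)] submodule_smult[OF U(1)] in auto)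
    then have "N \<subseteq> U" using T(3) U(2) submodule_restrict_scalars[OF art MM] by blast
    then show ?thesis using sU by simp
  qed
  then have "finitely_generated A (submod M N)"
    unfolding finitely_generated_def using T(1,2) by (intro exI[of _ T]) simp
  then show "submod M N \<in> fg_modules A" using NM by (simp add: fg_modules_def)
qed

section \<open>The injective cogenerator \<open>D\<Lambda>\<close>\<close>

text \<open>\<open>inj_modules\<close> tests only modules on \<open>'r univ\<close>; X and Y are
  replaced by copies there, and the extension is carried back.\<close>

lemma inj_modules_extend:
  fixes J :: "'r umod" and X :: "('r, 'm) module" and Y :: "('r, 'n) module"
  assumes J: "J \<in> inj_modules R" and X: "left_module R X" "finitely_generated R X"
    and Y: "left_module R Y" "finitely_generated R Y"
    and i: "i \<in> lhom R X Y" "inj_on i (carrier X)" and f: "f \<in> lhom R X J"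
  shows "\<exists>h\<in>lhom R Y J. \<forall>x\<in>carrier X. h (i x) = f x"
proof -
  obtain X' a b where X': "X' \<in> fg_modules R" and a: "a \<in> lhom R X X'" and b: "b \<in> lhom R X' X"
    and ba: "\<And>x. x \<in> carrier X \<Longrightarrow> b (a x) = x" and ab: "\<And>x. x \<in> carrier X' \<Longrightarrow> a (b x) = x"
    by (rule fg_module_copy[OF X]) (rule that)
  obtain Y' c d where Y': "Y' \<in> fg_modules R" and c: "c \<in> lhom R Y Y'" and d: "d \<in> lhom R Y' Y"
    and dc: "\<And>y. y \<in> carrier Y \<Longrightarrow> d (c y) = y" and cd: "\<And>y. y \<in> carrier Y' \<Longrightarrow> c (d y) = y"
    by (rule fg_module_copy[OF Y]) (rule that)
  note XM' = fg_modulesD(1)[OF X']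
  let ?g = "compose (carrier X') c (compose (carrier X') i b)"
  have g: "?g \<in> lhom R X' Y'" by (rule lhom_compose[OF XM' lhom_compose[OF XM' b i(1)] c])
  have "inj_on ?g (carrier X')"
  proof (rule inj_onI)
    fix x y assume xy: "x \<in> carrier X'" "y \<in> carrier X'" "?g x = ?g y"
    then have "d (c (i (b x))) = d (c (i (b y)))" by (simp add: compose_eq)
    then have "i (b x) = i (b y)" using dc lhom_closed[OF i(1)] lhom_closed[OF b] xy by simp
    then have "b x = b y" using inj_onD[OF i(2)] lhom_closed[OF b] xy by blast
    then show "x = y" using ab xy by metis
  qed
  then obtain h where h: "h \<in> lhom R Y' J" "\<forall>x\<in>carrier X'. h (?g x) = compose (carrier X') f b x"
    using J X' Y' g lhom_compose[OF XM' b f] unfolding inj_modules_def by blast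
  have "compose (carrier Y) h c (i x) = f x" if x: "x \<in> carrier X" for x
    using bspec[OF h(2) lhom_closed[OF a x]] lhom_closed[OF a x] lhom_closed[OF i(1) x] x
    by (simp add: compose_eq ba)
  then show ?thesis using lhom_compose[OF Y(1) c h(1)] by blast
qed

lemma (in cring) exists_maximalideal:
  assumes I: "ideal I R" and one: "\<one> \<notin> I"
  obtains V where "maximalideal V R" "I \<subseteq> V"
proof -
  obtain V where V: "ideal V R" "I \<subseteq> V" "\<one> \<notin> V"
    "\<And>W. ideal W R \<Longrightarrow> V \<subseteq> W \<Longrightarrow> \<one> \<notin> W \<Longrightarrow> W = V"
    by (rule ideal_avoiding[OF I one]) (rule that)
  have "maximalideal V R"
  proof (rule maximalidealI[OF V(1)])
    show "carrier R \<noteq> V" using V(3) one_closed by blast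
    fix W assume W: "ideal W R" "V \<subseteq> W" "W \<subseteq> carrier R"
    show "W = V \<or> W = carrier R" using V(4)[OF W(1,2)] ideal.one_imp_carrier[OF W(1)] by blast
  qed
  then show ?thesis using V(2) by (rule that)
qed

text \<open>The residue field of \<open>V\<close> embeds into \<open>R / rad R\<close> by \<open>1 \<mapsto> y\<close>.\<close>

lemma (in cring) artinian_radical_socle:
  assumes art: "artinian R" and V: "maximalideal V R"
  obtains y where "y \<in> carrier R" "\<And>n. maximalideal n R \<Longrightarrow> n \<noteq> V \<Longrightarrow> y \<in> n" "y \<notin> V"
proof -
  interpret V: maximalideal V R by fact
  interpret Vp: primeideal V R by (rule maximalideal_prime[OF V])
  \<comment> \<open>K is taken minimal among the ideals not inside V. For another maximal ideal n, a
    product of an element of n and one of K, both outside V, shows that the intersection of n and K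
    is not inside V, so it is K.\<close>
  let ?S = "{K. ideal K R \<and> \<not> K \<subseteq> V}"
  have "\<not> carrier R \<subseteq> V" using V.I_notcarr V.a_subset by blast
  then have "carrier R \<in> ?S" using oneideal by blast
  then have "\<exists>K\<in>?S. \<forall>L\<in>?S. L \<subseteq> K \<longrightarrow> L = K"
    by (rule artinian_minimal[OF art]) simp
  then obtain K where K: "ideal K R" "\<not> K \<subseteq> V" and min: "\<And>L. ideal L R \<Longrightarrow> \<not> L \<subseteq> V \<Longrightarrow> L \<subseteq> K \<Longrightarrow> L = K"
    by blast
  obtain y where y: "y \<in> K" "y \<notin> V" using K(2) by blast
  have "y \<in> n" if n: "maximalideal n R" "n \<noteq> V" for n
  proof -
    interpret n: maximalideal n R by fact
    have "\<not> n \<subseteq> V"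
    proof
      assume "n \<subseteq> V"
      then have "V = n \<or> V = carrier R" by (rule n.I_maximal[OF V.ideal_axioms _ V.a_subset])
      then show False using n(2) V.I_notcarr by blast
    qed
    then obtain b where b: "b \<in> n" "b \<notin> V" by blast
    have bc: "b \<in> carrier R" "y \<in> carrier R" using b n.a_subset y ideal_subset[OF K(1)] by auto
    have "b \<otimes> y \<in> K" by (rule ideal_mult[OF K(1) bc(1) y(1)])
    moreover have "b \<otimes> y \<in> n" using n.I_r_closed[OF b(1) bc(2)] .
    moreover have "b \<otimes> y \<notin> V" using Vp.I_prime[OF bc] b(2) y(2) by blast
    ultimately have "\<not> n \<inter> K \<subseteq> V" by blast
    then have "n \<inter> K = K" using min[OF ideal_inter[OF n.ideal_axioms K(1)]] by blast
    then show ?thesis using y(1) by blast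
  qed
  moreover have "y \<in> carrier R" using y ideal_subset[OF K(1)] by blast
  ultimately show ?thesis using that y(2) by blast
qed

text \<open>The annihilator of x lies in a maximal ideal V, and the residue field of V embeds into R
  / rad R by \<open>artinian_radical_socle\<close>. This gives a map from the submodule generated by
  x to R / rad R, and on into J, that is nonzero at x; injectivity of J extends it to X.\<close>

lemma dualizing_module_cogenerates:
  fixes R :: "'r ring" and J :: "'r umod" and X :: "('r, 'm) module"
  assumes R: "cring R" and art: "artinian R" and J: "dualizing_module R J"
    and X: "left_module R X" "finitely_generated R X" and x: "x \<in> carrier X" "x \<noteq> \<zero>\<^bsub>X\<^esub>"
  shows "\<exists>f\<in>lhom R X J. f x \<noteq> \<zero>\<^bsub>J\<^esub>"
proof -
  interpret R: cring R by fact
  interpret XG: abelian_group X by (rule left_module_abelian_group[OF X(1)])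
  interpret X: left_module R X by fact
  let ?rad = "jacobson_radical R" and ?R = "regular R"
  note RM = left_module_regular[OF R.ring_axioms]
  have rad: "submodule ?rad R ?R"
  proof (rule left_module.submodule_criterion[OF RM])
    have id: "ideal I R" if "maximalideal I R" for I using that by (rule maximalideal.axioms(1))
    show "?rad \<subseteq> carrier ?R" by (simp add: jacobson_radical_def)
    show "\<zero>\<^bsub>?R\<^esub> \<in> ?rad" by (simp add: jacobson_radical_def ideal_zero[OF id])
    show "a \<oplus>\<^bsub>?R\<^esub> b \<in> ?rad" if "a \<in> ?rad" "b \<in> ?rad" for a b
      using that by (simp add: jacobson_radical_def ideal_add[OF id])
    show "a \<odot>\<^bsub>?R\<^esub> b \<in> ?rad" if "a \<in> carrier R" "b \<in> ?rad" for a b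
      using that by (simp add: jacobson_radical_def ideal_mult[OF id])
  qed
  let ?Q = "quot_mod ?R ?rad"
  define \<pi> where "\<pi> = (\<lambda>r\<in>carrier ?R. ?rad +>\<^bsub>?R\<^esub> r)"
  have QM: "left_module R ?Q" by (rule left_module_quot_mod[OF RM rad])
  have \<pi>: "\<pi> \<in> lhom R ?R ?Q" unfolding \<pi>_def by (rule lhom_quot_proj[OF RM rad])
  have "a_kernel ?R ?Q \<pi> = ?rad" unfolding \<pi>_def by (rule quot_proj_kernel[OF RM rad])
  then have ker: "\<pi> r = \<zero>\<^bsub>?Q\<^esub> \<longleftrightarrow> r \<in> ?rad" if "r \<in> carrier R" for r
    using in_a_kernel_iff[of r ?R ?Q \<pi>] that by simp
  obtain j where J': "J \<in> inj_modules R" and j: "j \<in> lhom R ?Q J" "inj_on j (carrier ?Q)"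
    using J unfolding dualizing_module_def injective_envelope_def by blast
  have JM: "left_module R J" using J' by (simp add: inj_modules_def fg_modules_def)
  define p where "p = (\<lambda>r\<in>carrier ?R. r \<odot>\<^bsub>X\<^esub> x)"
  have p: "p \<in> lhom R ?R X"
    unfolding p_def by (rule lhom_restrictI[OF RM]) (use x in \<open>simp_all add: X.smult_l_distr X.smult_assoc\<close>)
  let ?C = "submod X (p ` carrier ?R)"
  have Cs: "submodule (p ` carrier ?R) R X" by (rule submodule_image[OF RM X(1) p])
  have CM: "left_module R ?C" by (rule left_module_submod[OF X(1) Cs])
  have pC: "p \<in> lhom R ?R ?C"
    by (rule lhomI[OF lhom_extensional[OF p]]) (simp_all only: submod_simps lhom_add[OF p] lhom_smult[OF p] imageI)
  have pCs: "p ` carrier ?R = carrier ?C" by (simp only: submod_simps)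
  have Cfg: "finitely_generated R ?C"
    by (rule finitely_generated_image[OF RM CM pC pCs dual_basis_finitely_generated[OF has_dual_basis_regular[OF R.ring_axioms]]])
  let ?ann = "{r \<in> carrier R. r \<odot>\<^bsub>X\<^esub> x = \<zero>\<^bsub>X\<^esub>}"
  have "ideal ?ann R"
    by (rule R.ideal_criterion)
      (use x in \<open>simp_all add: subset_iff X.smult_l_null X.smult_l_distr X.smult_assoc X.smult_r_null\<close>)
  moreover have "\<one>\<^bsub>R\<^esub> \<notin> ?ann" using x by simp
  ultimately obtain V where V: "maximalideal V R" "?ann \<subseteq> V" by (rule R.exists_maximalideal)
  obtain y where y: "y \<in> carrier R" "\<And>n. maximalideal n R \<Longrightarrow> n \<noteq> V \<Longrightarrow> y \<in> n" "y \<notin> V"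
    by (rule R.artinian_radical_socle[OF art V(1)]) (rule that)
  have Vy: "r \<otimes>\<^bsub>R\<^esub> y \<in> ?rad" if r: "r \<in> V" for r
  proof -
    interpret V: maximalideal V R by (rule V(1))
    have rc: "r \<in> carrier R" using r V.a_subset by blast
    have "r \<otimes>\<^bsub>R\<^esub> y \<in> n" if n: "maximalideal n R" for n
    proof (cases "n = V")
      case True
      then show ?thesis using V.I_r_closed[OF r y(1)] by simp
    next
      case False
      then show ?thesis by (intro ideal_mult[OF maximalideal.axioms(1)[OF n] rc] y(2)[OF n])
    qed
    then show ?thesis using rc y(1) by (simp add: jacobson_radical_def)
  qed
  \<comment> \<open>Multiplication by y followed by the projection to R / rad R kills V, which
    contains the annihilator of x; hence it factors through the submodule generated by x.\<close>
  define m where "m = (\<lambda>r\<in>carrier ?R. r \<otimes>\<^bsub>R\<^esub> y)"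
  have m: "m \<in> lhom R ?R ?R"
    unfolding m_def by (rule lhom_restrictI[OF RM]) (use y(1) in \<open>simp_all add: R.l_distr R.m_assoc\<close>)
  let ?f = "compose (carrier ?R) \<pi> m"
  have f: "?f \<in> lhom R ?R ?Q" by (rule lhom_compose[OF RM m \<pi>])
  have "\<exists>h\<in>lhom R ?C ?Q. \<forall>r\<in>carrier ?R. h (p r) = ?f r"
  proof (rule lhom_factor[OF RM CM QM pC pCs f])
    fix r assume r: "r \<in> carrier ?R" and "p r = \<zero>\<^bsub>?C\<^esub>"
    then have "r \<in> V" using V(2) by (auto simp: p_def)
    then show "?f r = \<zero>\<^bsub>?Q\<^esub>" using r Vy ker y(1) by (simp add: compose_eq m_def)
  qed
  then obtain h where h: "h \<in> lhom R ?C ?Q" "\<forall>r\<in>carrier ?R. h (p r) = ?f r" by blast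
  have p1: "p \<one>\<^bsub>R\<^esub> = x" using x by (simp add: p_def)
  have xC: "x \<in> carrier ?C" using imageI[of "\<one>\<^bsub>R\<^esub>" "carrier ?R" p] p1 by simp
  have "h x = \<pi> y" using bspec[OF h(2), of "\<one>\<^bsub>R\<^esub>"] y(1) by (simp add: p1 compose_eq m_def)
  moreover have "y \<notin> ?rad" using y(3) V(1) by (auto simp: jacobson_radical_def)
  ultimately have hx: "h x \<noteq> \<zero>\<^bsub>?Q\<^esub>" using ker[OF y(1)] by simp
  obtain g where g: "g \<in> lhom R X J"
    "\<forall>z\<in>carrier ?C. g ((\<lambda>z\<in>p ` carrier ?R. z) z) = compose (carrier ?C) j h z"
    using inj_modules_extend[OF J' CM Cfg X lhom_submod_incl[OF X(1) Cs] _ lhom_compose[OF CM h(1) j(1)]]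
    by (auto simp: inj_on_def)
  have "g x = j (h x)" using bspec[OF g(2) xC] xC by (simp add: compose_eq)
  moreover have "j (h x) \<noteq> \<zero>\<^bsub>J\<^esub>"
    using hx lhom_closed[OF h(1) xC] j(2) unfolding lhom_inj_on_iff[OF QM JM j(1)] by blast
  ultimately show ?thesis using g(1) by metis
qed

section \<open>The dual of the regular module as an injective cogenerator\<close>

context
  fixes R :: "'r ring" and A :: "('r, 'a) module" and J :: "'r umod"
  assumes art: "artin_algebra R A" and dJ: "dualizing_module R J"
begin

lemma dualizing_left_module: "left_module R J"
  using dJ by (auto simp: dualizing_module_def injective_envelope_def inj_modules_def fg_modules_def)

lemma dual_regular_simps:
  "carrier (dual_regular R J A) = lhom R A J"
  "\<zero>\<^bsub>dual_regular R J A\<^esub> = (\<lambda>x\<in>carrier A. \<zero>\<^bsub>J\<^esub>)"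
  "\<phi> \<oplus>\<^bsub>dual_regular R J A\<^esub> \<psi> = (\<lambda>x\<in>carrier A. \<phi> x \<oplus>\<^bsub>J\<^esub> \<psi> x)"
  "a \<odot>\<^bsub>dual_regular R J A\<^esub> \<phi> = (\<lambda>x\<in>carrier A. \<phi> (x \<otimes>\<^bsub>A\<^esub> a))"
proof -
  note D = artin_algebraD[OF art]
  interpret A: ring A by (rule D(3))
  \<comment> \<open>Over the opposite ring, r acts by right multiplication with r 1; bilinearity of
    the product identifies this with the action of r on A.\<close>
  have "x \<otimes>\<^bsub>A\<^esub> (r \<odot>\<^bsub>A\<^esub> \<one>\<^bsub>A\<^esub>) = r \<odot>\<^bsub>A\<^esub> x" if "r \<in> carrier R" "x \<in> carrier A" for r x
    using D(7)[OF that A.one_closed] that by simp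
  moreover have "smult (opp A) = smult A" by (simp add: opp_def)
  ultimately show "carrier (dual_regular R J A) = lhom R A J"
    by (simp add: dual_regular_def dual_def lhom_def)
qed (simp_all add: dual_regular_def dual_def)

lemma left_module_dual_regular: "left_module A (dual_regular R J A)"
proof -
  note D = artin_algebraD[OF art]
  interpret A: ring A by (rule D(3))
  note JM = dualizing_left_module and RA = D(4)
  interpret J: abelian_group J by (rule left_module_abelian_group[OF JM])
  let ?D = "dual_regular R J A"
  note c = lhom_closed[of _ R A J]
  have ab: "abelian_group ?D"
  proof (rule abelian_groupI)
    fix \<phi> \<psi> assume "\<phi> \<in> carrier ?D" "\<psi> \<in> carrier ?D"
    then have p: "\<phi> \<in> lhom R A J" "\<psi> \<in> lhom R A J" by (simp_all add: dual_regular_simps)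
    show "\<phi> \<oplus>\<^bsub>?D\<^esub> \<psi> \<in> carrier ?D" unfolding dual_regular_simps by (rule lhom_sum[OF RA JM p])
    show "\<phi> \<oplus>\<^bsub>?D\<^esub> \<psi> = \<psi> \<oplus>\<^bsub>?D\<^esub> \<phi>"
      unfolding dual_regular_simps by (rule restrict_ext) (use p c in \<open>simp add: J.a_comm\<close>)
  next
    show "\<zero>\<^bsub>?D\<^esub> \<in> carrier ?D" unfolding dual_regular_simps by (rule lhom_zero_map[OF RA JM])
  next
    fix \<phi> \<psi> \<chi> assume "\<phi> \<in> carrier ?D" "\<psi> \<in> carrier ?D" "\<chi> \<in> carrier ?D"
    then have p: "\<phi> \<in> lhom R A J" "\<psi> \<in> lhom R A J" "\<chi> \<in> lhom R A J" by (simp_all add: dual_regular_simps)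
    show "\<phi> \<oplus>\<^bsub>?D\<^esub> \<psi> \<oplus>\<^bsub>?D\<^esub> \<chi> = \<phi> \<oplus>\<^bsub>?D\<^esub> (\<psi> \<oplus>\<^bsub>?D\<^esub> \<chi>)"
      unfolding dual_regular_simps by (rule restrict_ext) (use p c in \<open>simp add: J.a_assoc\<close>)
  next
    fix \<phi> assume "\<phi> \<in> carrier ?D"
    then have p: "\<phi> \<in> lhom R A J" by (simp add: dual_regular_simps)
    show "\<zero>\<^bsub>?D\<^esub> \<oplus>\<^bsub>?D\<^esub> \<phi> = \<phi>" unfolding dual_regular_simps
      by (rule extensionalityI[of _ "carrier A"]) (use p c lhom_extensional[OF p] in simp_all)
    let ?n = "\<lambda>x\<in>carrier A. (\<lambda>x\<in>carrier A. \<zero>\<^bsub>J\<^esub>) x \<ominus>\<^bsub>J\<^esub> \<phi> x"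
    have "?n \<oplus>\<^bsub>?D\<^esub> \<phi> = \<zero>\<^bsub>?D\<^esub>"
      unfolding dual_regular_simps by (rule restrict_ext) (use p c in simp)
    then show "\<exists>\<psi>\<in>carrier ?D. \<psi> \<oplus>\<^bsub>?D\<^esub> \<phi> = \<zero>\<^bsub>?D\<^esub>"
      using lhom_sub[OF RA JM lhom_zero_map[OF RA JM] p] by (intro bexI[of _ ?n]) (simp_all only: dual_regular_simps(1))
  qed
  show ?thesis
  proof (rule left_module.intro[OF D(3) ab], rule left_module_axioms.intro)
    fix a \<phi> assume a: "a \<in> carrier A" and "\<phi> \<in> carrier ?D"
    then have p: "\<phi> \<in> lhom R A J" by (simp add: dual_regular_simps)
    show "a \<odot>\<^bsub>?D\<^esub> \<phi> \<in> carrier ?D"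
      unfolding dual_regular_simps
      by (rule lhom_restrictI[OF RA])
        (use a p c in \<open>simp_all add: A.l_distr lhom_add[OF p] D(6) lhom_smult[OF p]\<close>)
  next
    fix a b \<phi> assume a: "a \<in> carrier A" "b \<in> carrier A" and "\<phi> \<in> carrier ?D"
    then have p: "\<phi> \<in> lhom R A J" by (simp add: dual_regular_simps)
    show "(a \<oplus>\<^bsub>A\<^esub> b) \<odot>\<^bsub>?D\<^esub> \<phi> = a \<odot>\<^bsub>?D\<^esub> \<phi> \<oplus>\<^bsub>?D\<^esub> b \<odot>\<^bsub>?D\<^esub> \<phi>"
      unfolding dual_regular_simps by (rule restrict_ext) (use a in \<open>simp add: A.r_distr lhom_add[OF p]\<close>)
    show "(a \<otimes>\<^bsub>A\<^esub> b) \<odot>\<^bsub>?D\<^esub> \<phi> = a \<odot>\<^bsub>?D\<^esub> (b \<odot>\<^bsub>?D\<^esub> \<phi>)"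
      unfolding dual_regular_simps by (rule restrict_ext) (use a in \<open>simp add: A.m_assoc\<close>)
  next
    fix a \<phi> \<psi> assume a: "a \<in> carrier A" and "\<phi> \<in> carrier ?D" "\<psi> \<in> carrier ?D"
    show "a \<odot>\<^bsub>?D\<^esub> (\<phi> \<oplus>\<^bsub>?D\<^esub> \<psi>) = a \<odot>\<^bsub>?D\<^esub> \<phi> \<oplus>\<^bsub>?D\<^esub> a \<odot>\<^bsub>?D\<^esub> \<psi>"
      unfolding dual_regular_simps by (rule restrict_ext) (use a in simp)
  next
    fix \<phi> assume "\<phi> \<in> carrier ?D"
    then have p: "\<phi> \<in> lhom R A J" by (simp add: dual_regular_simps)
    show "\<one>\<^bsub>A\<^esub> \<odot>\<^bsub>?D\<^esub> \<phi> = \<phi>" unfolding dual_regular_simps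
      by (rule extensionalityI[of _ "carrier A"]) (use lhom_extensional[OF p] in simp_all)
  qed
qed

text \<open>One direction of the adjunction Hom_R(M, J) = Hom_A(M, Hom_R(A, J)), by which
  injectivity and cogeneration pass from J over R to the dual over A.\<close>

lemma lhom_dual_regularI:
  assumes M: "left_module A M" and g: "g \<in> lhom R (restrict_scalars A M) J"
  shows "(\<lambda>z\<in>carrier M. \<lambda>x\<in>carrier A. g (x \<odot>\<^bsub>M\<^esub> z)) \<in> lhom A M (dual_regular R J A)"
proof (rule lhom_restrictI[OF M])
  note D = artin_algebraD[OF art]
  interpret A: ring A by (rule D(3))
  interpret RA: left_module R A by (rule D(4))
  interpret M: left_module A M by fact
  have gc: "g z \<in> carrier J" if "z \<in> carrier M" for z using lhom_closed[OF g] that by simp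
  have ga: "g (x \<oplus>\<^bsub>M\<^esub> y) = g x \<oplus>\<^bsub>J\<^esub> g y" if "x \<in> carrier M" "y \<in> carrier M" for x y
    using lhom_add[OF g] that by simp
  have gs: "g ((r \<odot>\<^bsub>A\<^esub> \<one>\<^bsub>A\<^esub>) \<odot>\<^bsub>M\<^esub> x) = r \<odot>\<^bsub>J\<^esub> g x" if "r \<in> carrier R" "x \<in> carrier M" for r x
    using lhom_smult[OF g] that by simp
  have rm: "r \<odot>\<^bsub>A\<^esub> x = (r \<odot>\<^bsub>A\<^esub> \<one>\<^bsub>A\<^esub>) \<otimes>\<^bsub>A\<^esub> x" if "r \<in> carrier R" "x \<in> carrier A" for r x
    using D(6)[OF that(1) A.one_closed that(2)] that by simp
  fix z assume z: "z \<in> carrier M"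
  show "(\<lambda>x\<in>carrier A. g (x \<odot>\<^bsub>M\<^esub> z)) \<in> carrier (dual_regular R J A)"
    unfolding dual_regular_simps
  proof (rule lhom_restrictI[OF D(4)])
    fix r x assume r: "r \<in> carrier R" and x: "x \<in> carrier A"
    have rc: "r \<odot>\<^bsub>A\<^esub> \<one>\<^bsub>A\<^esub> \<in> carrier A" by (rule RA.smult_closed[OF r A.one_closed])
    show "g ((r \<odot>\<^bsub>A\<^esub> x) \<odot>\<^bsub>M\<^esub> z) = r \<odot>\<^bsub>J\<^esub> g (x \<odot>\<^bsub>M\<^esub> z)"
      unfolding rm[OF r x] using rc x z r by (simp only: M.smult_assoc gs M.smult_closed)
  qed (use z in \<open>simp_all add: gc ga M.smult_l_distr\<close>)
  show "(\<lambda>x\<in>carrier A. g (x \<odot>\<^bsub>M\<^esub> (z \<oplus>\<^bsub>M\<^esub> y))) =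
      (\<lambda>x\<in>carrier A. g (x \<odot>\<^bsub>M\<^esub> z)) \<oplus>\<^bsub>dual_regular R J A\<^esub> (\<lambda>x\<in>carrier A. g (x \<odot>\<^bsub>M\<^esub> y))" if "y \<in> carrier M" for y
    unfolding dual_regular_simps by (rule restrict_ext) (use z that in \<open>simp add: M.smult_r_distr ga\<close>)
  show "(\<lambda>x\<in>carrier A. g (x \<odot>\<^bsub>M\<^esub> (a \<odot>\<^bsub>M\<^esub> z))) = a \<odot>\<^bsub>dual_regular R J A\<^esub> (\<lambda>x\<in>carrier A. g (x \<odot>\<^bsub>M\<^esub> z))"
    if "a \<in> carrier A" for a
    unfolding dual_regular_simps by (rule restrict_ext) (use z that in \<open>simp add: M.smult_assoc\<close>)
qed

text \<open>The map adjoint to an R-linear g with g z nonzero sends z to a functional whose value at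
  1 is g z.\<close>

lemma dual_regular_cogenerates:
  assumes Z: "left_module A Z" "finitely_generated A Z" and z: "z \<in> carrier Z" "z \<noteq> \<zero>\<^bsub>Z\<^esub>"
  shows "\<exists>f\<in>lhom A Z (dual_regular R J A). f z \<noteq> \<zero>\<^bsub>dual_regular R J A\<^esub>"
proof -
  note D = artin_algebraD[OF art]
  interpret A: ring A by (rule D(3))
  have "z \<in> carrier (restrict_scalars A Z)" "z \<noteq> \<zero>\<^bsub>restrict_scalars A Z\<^esub>" using z by simp_all
  then obtain g where g: "g \<in> lhom R (restrict_scalars A Z) J" "g z \<noteq> \<zero>\<^bsub>J\<^esub>"
    using dualizing_module_cogenerates[OF D(1,2) dJ left_module_restrict_scalars[OF art Z(1)]
      finitely_generated_restrict_scalars[OF art Z]] by blast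
  let ?F = "\<lambda>z\<in>carrier Z. \<lambda>x\<in>carrier A. g (x \<odot>\<^bsub>Z\<^esub> z)"
  have "?F z \<noteq> \<zero>\<^bsub>dual_regular R J A\<^esub>"
  proof
    assume "?F z = \<zero>\<^bsub>dual_regular R J A\<^esub>"
    from fun_cong[OF this, of "\<one>\<^bsub>A\<^esub>"] show False
      using z g(2) left_module.smult_one[OF Z(1)] by (simp add: dual_regular_simps)
  qed
  with lhom_dual_regularI[OF Z(1) g(1)] show ?thesis by blast
qed

text \<open>Under the adjunction f becomes an R-linear map into J, which extends over Q because J is
  injective; the adjoint of the extension extends f.\<close>

lemma dual_regular_extends:
  assumes Z: "left_module A Z" "finitely_generated A Z" and Q: "left_module A Q" "finitely_generated A Q"
    and i: "i \<in> lhom A Z Q" "inj_on i (carrier Z)" and f: "f \<in> lhom A Z (dual_regular R J A)"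
  shows "\<exists>h\<in>lhom A Q (dual_regular R J A). \<forall>z\<in>carrier Z. h (i z) = f z"
proof -
  note D = artin_algebraD[OF art]
  interpret A: ring A by (rule D(3))
  interpret RA: left_module R A by (rule D(4))
  interpret Z: left_module A Z by (rule Z(1))
  have fh: "f z \<in> lhom R A J" if "z \<in> carrier Z" for z
    using lhom_closed[OF f that] by (simp add: dual_regular_simps)
  have rc: "r \<odot>\<^bsub>A\<^esub> \<one>\<^bsub>A\<^esub> \<in> carrier A" if "r \<in> carrier R" for r by (rule RA.smult_closed[OF that A.one_closed])
  have fsm: "f (a \<odot>\<^bsub>Z\<^esub> z) x = f z (x \<otimes>\<^bsub>A\<^esub> a)" if "a \<in> carrier A" "z \<in> carrier Z" "x \<in> carrier A" for a z x
    using lhom_smult[OF f that(1,2)] that(3) by (simp add: dual_regular_simps)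
  \<comment> \<open>The other direction of the adjunction is evaluation at 1; linearity over A
    recovers f z x as the value at 1 for x z.\<close>
  define g where "g = (\<lambda>z\<in>carrier (restrict_scalars A Z). f z \<one>\<^bsub>A\<^esub>)"
  have g: "g \<in> lhom R (restrict_scalars A Z) J"
    unfolding g_def
  proof (rule lhom_restrictI[OF left_module_restrict_scalars[OF art Z(1)]])
    fix z assume "z \<in> carrier (restrict_scalars A Z)"
    then show "f z \<one>\<^bsub>A\<^esub> \<in> carrier J" using lhom_closed[OF fh A.one_closed] by simp
  next
    fix y z assume "y \<in> carrier (restrict_scalars A Z)" "z \<in> carrier (restrict_scalars A Z)"
    then show "f (y \<oplus>\<^bsub>restrict_scalars A Z\<^esub> z) \<one>\<^bsub>A\<^esub> = f y \<one>\<^bsub>A\<^esub> \<oplus>\<^bsub>J\<^esub> f z \<one>\<^bsub>A\<^esub>"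
      using lhom_add[OF f] by (simp add: dual_regular_simps)
  next
    fix r z assume r: "r \<in> carrier R" and "z \<in> carrier (restrict_scalars A Z)"
    then have z: "z \<in> carrier Z" by simp
    have "f ((r \<odot>\<^bsub>A\<^esub> \<one>\<^bsub>A\<^esub>) \<odot>\<^bsub>Z\<^esub> z) \<one>\<^bsub>A\<^esub> = f z (r \<odot>\<^bsub>A\<^esub> \<one>\<^bsub>A\<^esub>)"
      using fsm[OF rc[OF r] z A.one_closed] rc[OF r] by simp
    also have "\<dots> = r \<odot>\<^bsub>J\<^esub> f z \<one>\<^bsub>A\<^esub>" by (rule lhom_smult[OF fh[OF z] r A.one_closed])
    finally show "f (r \<odot>\<^bsub>restrict_scalars A Z\<^esub> z) \<one>\<^bsub>A\<^esub> = r \<odot>\<^bsub>J\<^esub> f z \<one>\<^bsub>A\<^esub>" by simp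
  qed
  have iR: "i \<in> lhom R (restrict_scalars A Z) (restrict_scalars A Q)"
    by (rule lhomI) (use lhom_extensional[OF i(1)] lhom_closed[OF i(1)] lhom_add[OF i(1)] lhom_smult[OF i(1) rc] in simp_all)
  have J: "J \<in> inj_modules R" using dJ by (auto simp: dualizing_module_def injective_envelope_def)
  have "inj_on i (carrier (restrict_scalars A Z))" using i(2) by simp
  then obtain k where k: "k \<in> lhom R (restrict_scalars A Q) J"
    "\<forall>z\<in>carrier (restrict_scalars A Z). k (i z) = g z"
    using inj_modules_extend[OF J left_module_restrict_scalars[OF art Z(1)] finitely_generated_restrict_scalars[OF art Z]
      left_module_restrict_scalars[OF art Q(1)] finitely_generated_restrict_scalars[OF art Q] iR _ g] by blast
  let ?F = "\<lambda>z\<in>carrier Q. \<lambda>x\<in>carrier A. k (x \<odot>\<^bsub>Q\<^esub> z)"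
  have "?F (i z) = f z" if z: "z \<in> carrier Z" for z
  proof (rule extensionalityI[of _ "carrier A"])
    fix x assume x: "x \<in> carrier A"
    have "?F (i z) x = k (i (x \<odot>\<^bsub>Z\<^esub> z))"
      using x z lhom_closed[OF i(1) z] lhom_smult[OF i(1) x z] by simp
    also have "\<dots> = f (x \<odot>\<^bsub>Z\<^esub> z) \<one>\<^bsub>A\<^esub>" using k(2) x z by (simp add: g_def)
    also have "\<dots> = f z x" using fsm[OF x z A.one_closed] x by simp
    finally show "?F (i z) x = f z x" .
  qed (use lhom_closed[OF i(1) z] lhom_extensional[OF fh[OF z]] in simp_all)
  then show ?thesis using lhom_dual_regularI[OF Q(1) k(1)] by blast
qed

end

section \<open>The two equivalences\<close>

lemma perp1_iff:
  assumes A: "left_noetherian A" and X: "left_module A X" and s: "proj_seq A s" and Z: "quo s = Z" "Z \<in> fg_modules A"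
  shows "Z \<in> perp1 A X \<longleftrightarrow> extends A s X"
  using Ext_zero_1_iff[OF A s X] Z by (simp add: perp1_def)

text \<open>Any sequence ending in Z may serve as s: membership of Z is tested by the cover sequence
  in one direction of the equivalence and by the approximation sequence in the other.\<close>

lemma perp1_syzygy_iff:
  fixes R :: "'r ring" and A :: "('r, 'a) module" and J :: "'r umod" and s :: "'a useq"
  assumes art: "artin_algebra R A" and J: "dualizing_module R J"
    and P0: "projective_cover A (dual_regular R J A) P\<^sub>0 p\<^sub>0"
    and ap: "minimal_approximations A Q e C q"
    and s: "proj_seq A s" and Z: "quo s = Z" "Z \<in> fg_modules A"
  shows "Z \<in> perp1 A (dsum (regular A) (submod P\<^sub>0 (a_kernel P\<^sub>0 (dual_regular R J A) p\<^sub>0))) \<longleftrightarrow>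
    extends A s (regular A) \<and> torsionless A Z"
proof -
  let ?D = "dual_regular R J A"
  have P: "P\<^sub>0 \<in> proj_modules A" and p: "p\<^sub>0 \<in> lhom A P\<^sub>0 ?D" "p\<^sub>0 ` carrier P\<^sub>0 = carrier ?D"
    using P0 by (auto simp: projective_cover_def)
  note PB = P[unfolded proj_modules_iff]
  note PM = has_dual_basis_module[OF PB]
  note DM = left_module_dual_regular[OF art J]
  note RM = left_module_regular[OF artin_algebraD(3)[OF art]]
  let ?K = "submod P\<^sub>0 (a_kernel P\<^sub>0 ?D p\<^sub>0)"
  have KM: "left_module A ?K" by (rule left_module_submod[OF PM submodule_kernel[OF PM DM p(1)]])
  note Zfg = fg_modulesD[OF Z(2)]
  have K: "extends A s ?K \<longleftrightarrow> torsionless A Z" if e: "extends A s (regular A)"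
  proof -
    have "extends A s ?K \<longleftrightarrow> torsionless A (quo s)"
    proof (rule extends_syzygy_iff_torsionless[OF _ PB DM p])
      show "approx_seq A s" using s e by (simp add: approx_seq_def)
      show "left_proj_approx A (quo s) (Q Z) (e Z)"
        using minimal_approximationsD(1)[OF ap Z(2)] Z(1) by simp
      show "quo s \<in> fg_modules A" using Z by simp
      show "\<exists>f\<in>lhom A (quo s) ?D. f z \<noteq> \<zero>\<^bsub>?D\<^esub>" if "z \<in> carrier (quo s)" "z \<noteq> \<zero>\<^bsub>quo s\<^esub>" for z
        using dual_regular_cogenerates[OF art J Zfg] that Z(1) by simp
      show "\<exists>h\<in>lhom A Q' ?D. \<forall>x\<in>carrier (quo s). h (i x) = f x"
        if "Q' \<in> fg_modules A" "i \<in> lhom A (quo s) Q'" "inj_on i (carrier (quo s))" "f \<in> lhom A (quo s) ?D" for Q' i f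
        using dual_regular_extends[OF art J Zfg fg_modulesD[OF that(1)]] that Z(1) by simp
    qed
    then show ?thesis using Z(1) by simp
  qed
  have "Z \<in> perp1 A (dsum (regular A) ?K) \<longleftrightarrow> extends A s (regular A) \<and> extends A s ?K"
    using perp1_iff[OF artin_algebra_left_noetherian[OF art] left_module_dsum[OF RM KM] s Z]
      extends_dsum_iff[OF s RM KM] by simp
  then show ?thesis using K by blast
qed

lemma perp1_cosyzygy_iff:
  fixes s r :: "'a useq"
  assumes art: "artin_algebra R A" and I: "injective_envelope A (regular A) I j"
    and s: "proj_seq A s" and Z: "quo s = Z" "Z \<in> fg_modules A"
    and r: "proj_seq A r" "quo r = sub s" and fg: "sub s \<in> fg_modules A" "sub r \<in> fg_modules A"
  shows "Z \<in> perp1 A (dsum (regular A) (quot_mod I (j ` carrier A))) \<longleftrightarrow>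
    extends A s (regular A) \<and> extends A r (regular A)"
proof -
  have I': "I \<in> inj_modules A" and j: "j \<in> lhom A (regular A) I" "inj_on j (carrier (regular A))"
    using I by (auto simp: injective_envelope_def)
  have IM: "left_module A I" using I' by (simp add: inj_modules_def fg_modules_def)
  note RM = left_module_regular[OF artin_algebraD(3)[OF art]]
  let ?L = "quot_mod I (j ` carrier A)"
  have LM: "left_module A ?L"
    using left_module_quot_mod[OF IM submodule_image[OF RM IM j(1)]] by simp
  have "Z \<in> perp1 A (dsum (regular A) ?L) \<longleftrightarrow> extends A s (regular A) \<and> extends A s ?L"
    using perp1_iff[OF artin_algebra_left_noetherian[OF art] left_module_dsum[OF RM LM] s Z]
      extends_dsum_iff[OF s RM LM] by simp
  moreover have "extends A s ?L \<longleftrightarrow> extends A r (regular A)"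
    using extends_cosyzygy_iff[OF s r I' j RM fg] by simp
  ultimately show ?thesis by simp
qed


theorem proposition3p6:
  fixes R :: "'r ring" and \<Lambda> :: "('r, 'a) module"
    and J :: "'r umod"
    and P\<^sub>0 :: "'a umod" and p\<^sub>0 :: "'a univ \<Rightarrow> 'a \<Rightarrow> 'r univ"
    and I\<^sub>0 :: "'a umod" and j\<^sub>0 :: "'a \<Rightarrow> 'a univ"
    and P :: "'a umod \<Rightarrow> 'a umod" and p :: "'a umod \<Rightarrow> 'a univ \<Rightarrow> 'a univ"
    and Q :: "'a umod \<Rightarrow> 'a umod" and e :: "'a umod \<Rightarrow> 'a univ \<Rightarrow> 'a univ"
    and C :: "'a umod \<Rightarrow> 'a umod" and q :: "'a umod \<Rightarrow> 'a univ \<Rightarrow> 'a univ"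
  assumes "artin_algebra R \<Lambda>"
    and "dualizing_module R J"
    and "projective_cover \<Lambda> (dual_regular R J \<Lambda>) P\<^sub>0 p\<^sub>0"
    and "injective_envelope \<Lambda> (regular \<Lambda>) I\<^sub>0 j\<^sub>0"
    and "projective_covers \<Lambda> P p"
    and "minimal_approximations \<Lambda> Q e C q"
  shows
    "let K\<^sub>1 = submod P\<^sub>0 (a_kernel P\<^sub>0 (dual_regular R J \<Lambda>) p\<^sub>0);
         L = quot_mod I\<^sub>0 (j\<^sub>0 ` carrier \<Lambda>);
         \<R> = full_subcat (stable_cat \<Lambda>) (reflexive_modules \<Lambda>);
         \<Y> = full_subcat (stable_cat \<Lambda>) (perp1 \<Lambda> (dsum (regular \<Lambda>) K\<^sub>1));
         \<W> = full_subcat (stable_cat \<Lambda>) (perp1 \<Lambda> (dsum (regular \<Lambda>) L));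
         Omega = Syz \<Lambda> P p;
         Mho = Agemo \<Lambda> Q e C q
     in quasi_inverse_equivalences \<R> \<Y> Mho Omega \<and>
        quasi_inverse_equivalences \<Y> \<W> Mho Omega"
proof -
  let ?K = "submod P\<^sub>0 (a_kernel P\<^sub>0 (dual_regular R J \<Lambda>) p\<^sub>0)"
  let ?L = "quot_mod I\<^sub>0 (j\<^sub>0 ` carrier \<Lambda>)"
  let ?R = "reflexive_modules \<Lambda>"
  let ?Y = "perp1 \<Lambda> (dsum (regular \<Lambda>) ?K)" and ?W = "perp1 \<Lambda> (dsum (regular \<Lambda>) ?L)"
  let ?k = "\<lambda>Z. kernel_seq (P Z) Z (p Z)"
  let ?c = "\<lambda>M. cokernel_seq M (e M) (Q M) (q M) (C M)"
  note art = assms(1) and cov = assms(5) and ap = assms(6)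
  note N = artin_algebra_left_noetherian[OF art]
  note N' = artin_algebra_left_noetherian[OF artin_algebra_opp[OF art]]
  note k = proj_seq_cover[OF cov] and Cfg = minimal_approximationsD(4)[OF ap]
  have Om_fg: "sub (?k Z) \<in> fg_modules \<Lambda>" if "Z \<in> fg_modules \<Lambda>" for Z
  proof -
    note pc = projective_coversD[OF cov that]
    show ?thesis
      using left_noetherianD[OF N proj_modules_fg[OF pc(1)]
        submodule_kernel[OF fg_modulesD(1)[OF proj_modules_fg[OF pc(1)]] fg_modulesD(1)[OF that] pc(2)]]
      by simp
  qed
  have R: "M \<in> ?R \<longleftrightarrow> M \<in> fg_modules \<Lambda> \<and> torsionless \<Lambda> M \<and> bidual_surjective \<Lambda> M" for M
    by (rule reflexive_modules_iff[OF N N' cov])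
  \<comment> \<open>The sequence s is left free on purpose: for Z it will be the cover sequence, and
    for C M the approximation sequence of M.\<close>
  have Y: "Z \<in> ?Y \<longleftrightarrow> extends \<Lambda> s (regular \<Lambda>) \<and> torsionless \<Lambda> Z"
    if "proj_seq \<Lambda> s" "quo s = Z" "Z \<in> fg_modules \<Lambda>" for s :: "'a useq" and Z
    by (rule perp1_syzygy_iff[OF art assms(2,3) ap that])
  have W: "Z \<in> ?W \<longleftrightarrow> extends \<Lambda> s (regular \<Lambda>) \<and> extends \<Lambda> r (regular \<Lambda>)"
    if "proj_seq \<Lambda> s" "quo s = Z" "Z \<in> fg_modules \<Lambda>" "proj_seq \<Lambda> r" "quo r = sub s"
      "sub s \<in> fg_modules \<Lambda>" "sub r \<in> fg_modules \<Lambda>" for s r :: "'a useq" and Z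
    by (rule perp1_cosyzygy_iff[OF art assms(4) that])
  have fg: "?R \<subseteq> fg_modules \<Lambda>" "?Y \<subseteq> fg_modules \<Lambda>" "?W \<subseteq> fg_modules \<Lambda>"
    by (auto simp: reflexive_modules_def perp1_def)
  have c: "approx_seq \<Lambda> (?c M)" if "M \<in> fg_modules \<Lambda>" "torsionless \<Lambda> M" for M
    using approx_seq_approximation[OF ap that(1)] that(2)
      torsionless_iff_approximation_inj[OF that(1) minimal_approximationsD(1)[OF ap that(1)]] by simp
  have inj: "inj_on (e M) (carrier M)" if "M \<in> fg_modules \<Lambda>" "torsionless \<Lambda> M" for M
    using torsionless_iff_approximation_inj[OF that(1) minimal_approximationsD(1)[OF ap that(1)]] that(2) by simp
  have Yk: "Z \<in> fg_modules \<Lambda> \<and> extends \<Lambda> (?k Z) (regular \<Lambda>) \<and> torsionless \<Lambda> Z" if "Z \<in> ?Y" for Z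
    using Y[OF k, of Z] that fg(2) by auto
  have "quasi_inverse_equivalences (full_subcat (stable_cat \<Lambda>) ?R) (full_subcat (stable_cat \<Lambda>) ?Y)
      (Agemo \<Lambda> Q e C q) (Syz \<Lambda> P p)"
  proof (rule quasi_inverse_Agemo_Syz[OF cov ap fg(1,2)])
    fix M assume "M \<in> ?R"
    then have M: "M \<in> fg_modules \<Lambda>" "torsionless \<Lambda> M" "bidual_surjective \<Lambda> M" using R by auto
    note cM = c[OF M(1,2)]
    have "torsionless \<Lambda> (C M)" using bidual_surjective_iff_torsionless_quo[OF cM] M(3) by simp
    \<comment> \<open>Vanishing of Ext^1(C M, \<Lambda>) is built into the approximation sequence,
      which already extends functionals.\<close>
    then show "C M \<in> ?Y" using Y[of "?c M" "C M"] cM Cfg[OF M(1)] by (simp add: approx_seq_def)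
    show "inj_on (e M) (carrier M)" by (rule inj[OF M(1,2)])
  next
    fix Z assume "Z \<in> ?Y"
    then have Z: "Z \<in> fg_modules \<Lambda>" "extends \<Lambda> (?k Z) (regular \<Lambda>)" "torsionless \<Lambda> Z" using Yk by auto
    show "extends \<Lambda> (?k Z) (regular \<Lambda>)" by (rule Z(2))
    \<comment> \<open>Vanishing of Ext^1(Z, \<Lambda>) turns the cover sequence into an
      approximation sequence, so that torsionlessness of Z gives surjectivity onto the bidual for
      its syzygy.\<close>
    have "approx_seq \<Lambda> (?k Z)" using k[OF Z(1)] Z(2) by (simp add: approx_seq_def)
    then have "bidual_surjective \<Lambda> (sub (?k Z))"
      using bidual_surjective_iff_torsionless_quo[of \<Lambda> "?k Z"] Z(3) by simp
    then show "sub (?k Z) \<in> ?R" using R Om_fg[OF Z(1)] torsionless_sub[OF k[OF Z(1)]] by blast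
  qed
  moreover have "quasi_inverse_equivalences (full_subcat (stable_cat \<Lambda>) ?Y) (full_subcat (stable_cat \<Lambda>) ?W)
      (Agemo \<Lambda> Q e C q) (Syz \<Lambda> P p)"
  proof (rule quasi_inverse_Agemo_Syz[OF cov ap fg(2,3)])
    fix M assume "M \<in> ?Y"
    then have M: "M \<in> fg_modules \<Lambda>" "extends \<Lambda> (?k M) (regular \<Lambda>)" "torsionless \<Lambda> M" using Yk by auto
    show "inj_on (e M) (carrier M)" by (rule inj[OF M(1,3)])
    \<comment> \<open>In the approximation sequence the syzygy of C M is M itself, so the second
      condition is Ext^1(M, \<Lambda>) = 0, tested by the cover of M.\<close>
    show "C M \<in> ?W"
      using W[of "?c M" "C M" "?k M"] c[OF M(1,3)] Cfg[OF M(1)] k[OF M(1)] M(1,2) Om_fg[OF M(1)]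
      by (simp add: approx_seq_def)
  next
    fix Z assume Z': "Z \<in> ?W"
    then have Z: "Z \<in> fg_modules \<Lambda>" using fg(3) by blast
    let ?Om = "sub (?k Z)"
    note Om = Om_fg[OF Z]
    have ext: "extends \<Lambda> (?k Z) (regular \<Lambda>)" "extends \<Lambda> (?k ?Om) (regular \<Lambda>)"
      using W[OF k[OF Z] _ Z k[OF Om] _ Om Om_fg[OF Om]] Z' by simp_all
    show "extends \<Lambda> (?k Z) (regular \<Lambda>)" by (rule ext(1))
    \<comment> \<open>The syzygy is torsionless as a submodule of a projective; the other condition
      is the vanishing of Ext^1 on the syzygy, contained in Z lying in ?W.\<close>
    show "?Om \<in> ?Y"
      using Y[OF k[OF Om] _ Om] ext(2) torsionless_sub[OF k[OF Z]] by simp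
  qed
  ultimately show ?thesis unfolding Let_def by (rule conjI)
qed

end
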